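(* Let $k$ be an algebraically closed field of characteristic zero, let $m,n\ge 1$, and let $E\in GL(m,k)$ and $F\in GL(n,k)$. The Hopf algebras $\mathcal B(E)$ and $\mathcal B(F)$ are isomorphic if and only if $m=n$ and there exists $M\in GL(m,k)$ such that $F={}^tM\,E\,M$.
   Context: ${}^tx$ denotes the transpose of a matrix $x$ (with $({}^tx)_{ij}=x_{ji}$). For $E\in GL(m,k)$, $\mathcal B(E)$ is the universal $k$-algebra with generators $a_{ij}$, $1\le i,j\le m$, and relations $E^{-1}\,{}^ta\,E\,a=I=a\,E^{-1}\,{}^ta\,E$, where $a=(a_{ij})$ and $I$ is the identity matrix. It is a Hopf algebra with $\Delta(a_{ij})=\sum_{l} a_{il}\otimes a_{lj}$, $\varepsilon(a_{ij})=\delta_{ij}$, and $S(a)=E^{-1}\,{}^ta\,E$. *)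

theory Defs
  imports
    "HOL-Algebra.QuotRing"
    "HOL-Algebra.Module"
    "HOL-Library.Poly_Mapping"
    "HOL-Computational_Algebra.Polynomial"
    "Jordan_Normal_Form.Matrix"
    "Jordan_Normal_Form.Gauss_Jordan_Elimination"
begin

hide_const (open) Multiset.mult  (* otherwise it shadows the record field *)

text \<open>
  The ground field is a type \<open>'k\<close> of class \<open>field\<close>. An associative unital (in general
  noncommutative) \<open>'k\<close>-algebra is a record of type \<open>('k, 'b) module\<close>, whose ring part carries the
  multiplication. The locale \<^locale>\<open>algebra\<close> of the library is not used because it requires a
  commutative multiplication.
\<close>

section \<open>Monoid algebras and quotients\<close>

definition pm_scale :: "'k::field \<Rightarrow> ('x \<Rightarrow>\<^sub>0 'k) \<Rightarrow> ('x \<Rightarrow>\<^sub>0 'k)" where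
  "pm_scale c p = Poly_Mapping.map ((*) c) p"

definition monoid_alg :: "('x, 'z) monoid_scheme \<Rightarrow> ('k::field, 'x \<Rightarrow>\<^sub>0 'k) module" where
  "monoid_alg G =
    \<lparr>carrier = {p. Poly_Mapping.keys p \<subseteq> carrier G},
     mult = (\<lambda>p q. \<Sum>x\<in>Poly_Mapping.keys p. \<Sum>y\<in>Poly_Mapping.keys q.
       Poly_Mapping.single (x \<otimes>\<^bsub>G\<^esub> y) (Poly_Mapping.lookup p x * Poly_Mapping.lookup q y)),
     one = Poly_Mapping.single \<one>\<^bsub>G\<^esub> 1,
     zero = 0,
     add = (+),
     smult = pm_scale\<rparr>"

definition quot_alg ::
  "('k, 'b, 'z) module_scheme \<Rightarrow> 'b set \<Rightarrow> ('k, 'b set) module" where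
  "quot_alg A I = ring.extend (A Quot I)
    (module.fields (\<lambda>c X. the_elem ((\<lambda>x. I +>\<^bsub>A\<^esub> (c \<odot>\<^bsub>A\<^esub> x)) ` X)))"

definition lin_ext ::
  "('k, 'b, 'z) module_scheme \<Rightarrow> ('x \<Rightarrow> 'b) \<Rightarrow> ('x \<Rightarrow>\<^sub>0 'k::field) \<Rightarrow> 'b" where
  "lin_ext A \<phi> p = (\<Oplus>\<^bsub>A\<^esub>x\<in>Poly_Mapping.keys p. Poly_Mapping.lookup p x \<odot>\<^bsub>A\<^esub> \<phi> x)"

section \<open>Free algebras\<close>

text \<open>Noncommutative polynomials in the variables \<open>X\<close>: the monoid algebra of the free monoid of
  words in \<open>X\<close>.\<close>

definition free_alg :: "'x set \<Rightarrow> ('k::field, 'x list \<Rightarrow>\<^sub>0 'k) module" where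
  "free_alg X = monoid_alg \<lparr>carrier = lists X, mult = (@), one = []\<rparr>"

definition free_gen :: "'x \<Rightarrow> ('x list \<Rightarrow>\<^sub>0 'k::field)" where
  "free_gen x = Poly_Mapping.single [x] 1"

text \<open>The algebra homomorphism from the free algebra to \<open>A\<close> that sends each variable \<open>x\<close> to
  \<open>\<phi> x\<close>.\<close>

definition free_lift ::
  "('k, 'b, 'z) module_scheme \<Rightarrow> ('x \<Rightarrow> 'b) \<Rightarrow> ('x list \<Rightarrow>\<^sub>0 'k::field) \<Rightarrow> 'b" where
  "free_lift A \<phi> = lin_ext A (\<lambda>w. foldr (\<lambda>x r. \<phi> x \<otimes>\<^bsub>A\<^esub> r) w \<one>\<^bsub>A\<^esub>)"

definition op_alg :: "('k, 'b) module \<Rightarrow> ('k, 'b) module" where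
  "op_alg A = A\<lparr>mult := (\<lambda>x y. y \<otimes>\<^bsub>A\<^esub> x)\<rparr>"

definition base_alg :: "('k::field, 'k) module" where
  "base_alg = \<lparr>carrier = UNIV, mult = (*), one = 1, zero = 0, add = (+), smult = (*)\<rparr>"

section \<open>Tensor products of algebras\<close>

text \<open>The free vector space on the set of pairs \<open>(x, y)\<close>, modulo the span of the bilinearity
  relations. The multiplication \<open>(x \<otimes> y) (x' \<otimes> y') = x x' \<otimes> y y'\<close> is inherited from the monoid
  algebra of the product of the multiplicative monoids; the span is an ideal of the latter.\<close>

definition tensor_pre ::
  "('k, 'a, 'z) module_scheme \<Rightarrow> ('k, 'b, 'w) module_scheme
    \<Rightarrow> ('k::field, ('a \<times> 'b) \<Rightarrow>\<^sub>0 'k) module" where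
  "tensor_pre A B = monoid_alg (A \<times>\<times> B)"

definition tensor_rels ::
  "('k, 'a, 'z) module_scheme \<Rightarrow> ('k, 'b, 'w) module_scheme
    \<Rightarrow> (('a \<times> 'b) \<Rightarrow>\<^sub>0 'k::field) set" where
  "tensor_rels A B =
    {Poly_Mapping.single (x \<oplus>\<^bsub>A\<^esub> x', y) 1
       - (Poly_Mapping.single (x, y) 1 + Poly_Mapping.single (x', y) 1)
     | x x' y. x \<in> carrier A \<and> x' \<in> carrier A \<and> y \<in> carrier B}
    \<union> {Poly_Mapping.single (x, y \<oplus>\<^bsub>B\<^esub> y') 1
       - (Poly_Mapping.single (x, y) 1 + Poly_Mapping.single (x, y') 1)
     | x y y'. x \<in> carrier A \<and> y \<in> carrier B \<and> y' \<in> carrier B}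
    \<union> {Poly_Mapping.single (c \<odot>\<^bsub>A\<^esub> x, y) 1 - Poly_Mapping.single (x, y) c
     | c x y. x \<in> carrier A \<and> y \<in> carrier B}
    \<union> {Poly_Mapping.single (x, c \<odot>\<^bsub>B\<^esub> y) 1 - Poly_Mapping.single (x, y) c
     | c x y. x \<in> carrier A \<and> y \<in> carrier B}"

definition tensor_null ::
  "('k, 'a, 'z) module_scheme \<Rightarrow> ('k, 'b, 'w) module_scheme
    \<Rightarrow> (('a \<times> 'b) \<Rightarrow>\<^sub>0 'k::field) set" where
  "tensor_null A B = module.span pm_scale (tensor_rels A B)"

definition tensor_alg ::
  "('k, 'a, 'z) module_scheme \<Rightarrow> ('k, 'b, 'w) module_scheme
    \<Rightarrow> ('k::field, (('a \<times> 'b) \<Rightarrow>\<^sub>0 'k) set) module" where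
  "tensor_alg A B = quot_alg (tensor_pre A B) (tensor_null A B)"

definition pure_tensor ::
  "('k, 'a, 'z) module_scheme \<Rightarrow> ('k, 'b, 'w) module_scheme
    \<Rightarrow> 'a \<Rightarrow> 'b \<Rightarrow> (('a \<times> 'b) \<Rightarrow>\<^sub>0 'k::field) set" where
  "pure_tensor A B x y =
    tensor_null A B +>\<^bsub>tensor_pre A B\<^esub> Poly_Mapping.single (x, y) 1"

text \<open>The map \<open>f \<otimes> g\<close> into the tensor product of \<open>A\<close> and \<open>B\<close>, for linear \<open>f\<close> and \<open>g\<close> with values
  in \<open>A\<close> and \<open>B\<close>. As in \<^theory>\<open>HOL-Algebra.QuotRing\<close>, maps out of a quotient are induced by
  \<open>\<lambda>X. the_elem (h ` X)\<close>, where \<open>h\<close> is constant on cosets.\<close>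

definition tensor_map ::
  "('k, 'c, 'z) module_scheme \<Rightarrow> ('k, 'd, 'w) module_scheme \<Rightarrow> ('a \<Rightarrow> 'c) \<Rightarrow> ('b \<Rightarrow> 'd)
    \<Rightarrow> (('a \<times> 'b) \<Rightarrow>\<^sub>0 'k::field) set \<Rightarrow> (('c \<times> 'd) \<Rightarrow>\<^sub>0 'k) set" where
  "tensor_map A B f g X =
    the_elem (lin_ext (tensor_alg A B) (\<lambda>(x, y). pure_tensor A B (f x) (g y)) ` X)"

section \<open>Hopf algebras and their isomorphisms\<close>

record (overloaded) ('k::zero, 'b) hopf = "('k, 'b) module" +
  comult :: "'b \<Rightarrow> (('b \<times> 'b) \<Rightarrow>\<^sub>0 'k) set"
  counit :: "'b \<Rightarrow> 'k"
  antipode :: "'b \<Rightarrow> 'b"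

definition hopf_iso ::
  "('k::field, 'a) hopf \<Rightarrow> ('k, 'b) hopf \<Rightarrow> ('a \<Rightarrow> 'b) set" where
  "hopf_iso A B = {f \<in> ring_iso A B.
    (\<forall>c. \<forall>x\<in>carrier A. f (c \<odot>\<^bsub>A\<^esub> x) = c \<odot>\<^bsub>B\<^esub> f x) \<and>
    (\<forall>x\<in>carrier A. comult B (f x) = tensor_map B B f f (comult A x)) \<and>
    (\<forall>x\<in>carrier A. counit B (f x) = counit A x) \<and>
    (\<forall>x\<in>carrier A. antipode B (f x) = f (antipode A x))}"

definition hopf_isomorphic ::
  "('k::field, 'a) hopf \<Rightarrow> ('k, 'b) hopf \<Rightarrow> bool" where
  "hopf_isomorphic A B \<longleftrightarrow> hopf_iso A B \<noteq> {}"

section \<open>The Hopf algebra of a nondegenerate bilinear form\<close>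

text \<open>The product of matrices with entries in an algebra given by a record; the library product
  \<open>(*)\<close> needs entries from a type of class \<open>semiring_0\<close>.\<close>

definition amat_mult :: "('b, 'z) ring_scheme \<Rightarrow> 'b mat \<Rightarrow> 'b mat \<Rightarrow> 'b mat" where
  "amat_mult A P Q = mat (dim_row P) (dim_col Q)
    (\<lambda>(i, j). \<Oplus>\<^bsub>A\<^esub>l\<in>{..<dim_col P}. P $$ (i, l) \<otimes>\<^bsub>A\<^esub> Q $$ (l, j))"

definition scalar_mat :: "('k, 'b, 'z) module_scheme \<Rightarrow> 'k mat \<Rightarrow> 'b mat" where
  "scalar_mat A E = map_mat (\<lambda>c. c \<odot>\<^bsub>A\<^esub> \<one>\<^bsub>A\<^esub>) E"

text \<open>The matrix \<open>E\<^sup>-\<^sup>1 \<cdot> a\<^sup>T \<cdot> E\<close> with entries in \<open>A\<close>. All definitions below are meant for invertible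
  \<open>E\<close> only.\<close>

definition bil_conj :: "('k::field, 'b) module \<Rightarrow> 'k mat \<Rightarrow> 'b mat \<Rightarrow> 'b mat" where
  "bil_conj A E a = amat_mult A (scalar_mat A (the (mat_inverse E)))
    (amat_mult A (transpose_mat a) (scalar_mat A E))"

text \<open>Generators are indexed by pairs \<open>(i, j)\<close> with \<open>i, j < m\<close>, where \<open>m\<close> is the size of \<open>E\<close>.\<close>

definition bil_free ::
  "'k mat \<Rightarrow> ('k::field, (nat \<times> nat) list \<Rightarrow>\<^sub>0 'k) module" where
  "bil_free E = free_alg ({..<dim_row E} \<times> {..<dim_row E})"

definition bil_free_mat :: "'k::field mat \<Rightarrow> ((nat \<times> nat) list \<Rightarrow>\<^sub>0 'k) mat" where
  "bil_free_mat E = mat (dim_row E) (dim_row E) free_gen"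

definition bil_rels :: "'k::field mat \<Rightarrow> ((nat \<times> nat) list \<Rightarrow>\<^sub>0 'k) set" where
  "bil_rels E =
    (let m = dim_row E; A = bil_free E; a = bil_free_mat E; b = bil_conj A E a;
         I = scalar_mat A (1\<^sub>m m)
     in {amat_mult A b a $$ (i, j) \<ominus>\<^bsub>A\<^esub> I $$ (i, j) | i j. i < m \<and> j < m}
        \<union> {amat_mult A a b $$ (i, j) \<ominus>\<^bsub>A\<^esub> I $$ (i, j) | i j. i < m \<and> j < m})"

text \<open>\<open>Idl\<close> generates a two-sided ideal, which is a subspace because the free algebra contains the
  scalars.\<close>

definition bil_ideal :: "'k::field mat \<Rightarrow> ((nat \<times> nat) list \<Rightarrow>\<^sub>0 'k) set" where
  "bil_ideal E = Idl\<^bsub>bil_free E\<^esub> (bil_rels E)"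

definition bil_alg ::
  "'k mat \<Rightarrow> ('k::field, ((nat \<times> nat) list \<Rightarrow>\<^sub>0 'k) set) module" where
  "bil_alg E = quot_alg (bil_free E) (bil_ideal E)"

definition bil_mat :: "'k::field mat \<Rightarrow> ((nat \<times> nat) list \<Rightarrow>\<^sub>0 'k) set mat" where
  "bil_mat E = map_mat (\<lambda>p. bil_ideal E +>\<^bsub>bil_free E\<^esub> p) (bil_free_mat E)"

text \<open>\<open>\<Delta>\<close> and \<open>\<epsilon>\<close> are the algebra homomorphisms, and \<open>S\<close> the algebra antihomomorphism, with the
  prescribed values on the generators.\<close>

definition bil_comult ::
  "'k mat \<Rightarrow> ((nat \<times> nat) list \<Rightarrow>\<^sub>0 'k::field) set
    \<Rightarrow> ((((nat \<times> nat) list \<Rightarrow>\<^sub>0 'k) set \<times> ((nat \<times> nat) list \<Rightarrow>\<^sub>0 'k) set) \<Rightarrow>\<^sub>0 'k) set" where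
  "bil_comult E X =
    (let B = bil_alg E; T = tensor_alg B B; a = bil_mat E
     in the_elem (free_lift T
       (\<lambda>(i, j). \<Oplus>\<^bsub>T\<^esub>l\<in>{..<dim_row E}. pure_tensor B B (a $$ (i, l)) (a $$ (l, j))) ` X))"

definition bil_counit :: "'k mat \<Rightarrow> ((nat \<times> nat) list \<Rightarrow>\<^sub>0 'k::field) set \<Rightarrow> 'k" where
  "bil_counit E X =
    the_elem (free_lift base_alg (\<lambda>(i, j). if i = j then 1 else 0) ` X)"

definition bil_antipode ::
  "'k mat \<Rightarrow> ((nat \<times> nat) list \<Rightarrow>\<^sub>0 'k::field) set \<Rightarrow> ((nat \<times> nat) list \<Rightarrow>\<^sub>0 'k) set" where
  "bil_antipode E X =
    (let B = bil_alg E
     in the_elem (free_lift (op_alg B) (\<lambda>ij. bil_conj B E (bil_mat E) $$ ij) ` X))"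

definition bil_hopf ::
  "'k mat \<Rightarrow> ('k::field, ((nat \<times> nat) list \<Rightarrow>\<^sub>0 'k) set) hopf" where
  "bil_hopf E = module.extend (bil_alg E)
    (hopf.fields (bil_comult E) (bil_counit E) (bil_antipode E))"

end

theory Submission
  imports Defs "Jordan_Normal_Form.Determinant"
begin

text \<open>
The algebra of a nondegenerate form \<open>E\<close> is generated by the entries of a generic matrix
\<open>a\<close> subject to \<open>a^T E a = E\<close> and \<open>a E^-1 a^T = E^-1\<close>.

If \<open>F = M^T E M\<close> and \<open>b\<close> is the generic matrix of the algebra of \<open>F\<close>, then \<open>M b M^-1\<close>
satisfies the relations of \<open>a\<close>. The universal property turns this matrix into a homomorphism, the
inverse of \<open>M\<close> gives the inverse homomorphism, and the Hopf structure is respected because it is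
on generators (\<open>bil_congruence.hopf_isomorphic\<close>).

For the converse let \<open>m, n \<ge> 2\<close> and let \<open>f\<close> be an isomorphism with inverse \<open>g\<close>. The sum
\<open>chi\<close> of the diagonal entries of \<open>a\<close> is cocommutative, its powers are linearly independent
(\<open>chi_independent\<close>), and every cocommutative element is a polynomial in it
(\<open>cocommutative_polynomial\<close>). Isomorphisms preserve cocommutativity, so \<open>f\<close> maps one such sum to a
polynomial \<open>R\<close> in the other and \<open>g\<close> goes back by a polynomial \<open>Q\<close>. As \<open>R\<close> and \<open>Q\<close> are inverse
under composition, \<open>R\<close> has degree 1 (\<open>f_chi\<close>). Convolution with a functional dual to a
generator recovers \<open>a_ij\<close> from \<open>chi\<close>; therefore every \<open>f(a_ij)\<close> is a combination of 1 and the
entries of \<open>b\<close> (\<open>functional_f_a\<close>). Compatibility of \<open>f\<close> with the comultiplications makes the coefficients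
of the entries of \<open>b\<close> behave like matrix units, and one column of them is a scalar matrix \<open>P\<close>
with a left inverse and \<open>f(a) P = P b\<close> (\<open>intertwiner\<close>). By symmetry \<open>m = n\<close>, and both \<open>P^T E P\<close> and
\<open>F\<close> are preserved by \<open>b\<close>. Their quotient commutes with \<open>b^T\<close>, hence is a scalar
(\<open>scalar_commutant\<close>), and a square root of this scalar rescales \<open>P\<close> to the matrix \<open>M\<close>.

The two facts about \<open>chi\<close> rest on a supply of functionals. Let \<open>s\<close> and \<open>t\<close> be functions on words of
length \<open>n\<close> that \<open>E\<close>, respectively \<open>E^-1\<close>, annihilates at every pair of neighbouring letters. There
is a functional on the algebra that vanishes on products of fewer than \<open>n\<close> and of exactly \<open>n + 1\<close>
generators and takes the value \<open>s(I) t(J)\<close> at the product of the \<open>a_ij\<close> with row indices \<open>I\<close> and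
column indices \<open>J\<close> (\<open>top_functional\<close>). To build it choose \<open>q\<close> with
\<open>q + 1/q = - tr (E^-1 E^T)\<close>. Operators \<open>x_i, x'_i\<close> on functions on words satisfy the relations of a
generic matrix with two columns between \<open>E\<close> and the form with matrix \<open>((0, 1), (-1/q, 0))\<close>, and
operators \<open>y_j, y'_j\<close> do the same for \<open>E^-1\<close>. Then
\<open>a_ij \<mapsto> x_i y_j z - q x'_i y'_j z^-1\<close> is compatible with all relations, and the functional is the
coefficient of \<open>z^n\<close>. That there are enough pairs \<open>s, t\<close> to detect \<open>chi^n\<close> is
\<open>pairing_nonzero\<close>.

A form of size 1 gives an algebra of dimension at most 2. There every element is a root of a nonzero
polynomial, which distinguishes it from the algebras of larger forms; and any two forms of size 1 are
congruent, because the field has square roots.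
\<close>

hide_const (open) Multiset.mult  (* it would shadow the record field of the same name *)

section \<open>Algebras over a field and their homomorphisms\<close>

locale kalg = ring A for A :: "('k::field, 'b, 'z) module_scheme" (structure) +
  assumes smult_closed [simp, intro]: "x \<in> carrier A \<Longrightarrow> c \<odot> x \<in> carrier A"
    and smult_l_distr: "x \<in> carrier A \<Longrightarrow> (c + d) \<odot> x = c \<odot> x \<oplus> d \<odot> x"
    and smult_r_distr: "x \<in> carrier A \<Longrightarrow> y \<in> carrier A \<Longrightarrow> c \<odot> (x \<oplus> y) = c \<odot> x \<oplus> c \<odot> y"
    and smult_assoc: "x \<in> carrier A \<Longrightarrow> (c * d) \<odot> x = c \<odot> (d \<odot> x)"
    and smult_one [simp]: "x \<in> carrier A \<Longrightarrow> 1 \<odot> x = x"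
    and smult_mult_l: "x \<in> carrier A \<Longrightarrow> y \<in> carrier A \<Longrightarrow> (c \<odot> x) \<otimes> y = c \<odot> (x \<otimes> y)"
    and smult_mult_r: "x \<in> carrier A \<Longrightarrow> y \<in> carrier A \<Longrightarrow> x \<otimes> (c \<odot> y) = c \<odot> (x \<otimes> y)"
begin

lemma smult_zero_l [simp]: "x \<in> carrier A \<Longrightarrow> 0 \<odot> x = \<zero>"
  using smult_l_distr[of x 0 0] by (metis add.l_cancel_one' smult_closed add_0)

lemma smult_zero_r [simp]: "c \<odot> \<zero> = \<zero>"
  using smult_r_distr[of \<zero> \<zero> c] by (metis add.l_cancel_one' smult_closed r_zero zero_closed)

lemma smult_minus_one: "x \<in> carrier A \<Longrightarrow> (-1) \<odot> x = \<ominus> x"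
  using smult_l_distr[of x "-1" 1] by (simp add: minus_equality)

lemma smult_a_inv: "x \<in> carrier A \<Longrightarrow> c \<odot> (\<ominus> x) = \<ominus> (c \<odot> x)"
  by (metis mult.commute smult_assoc smult_closed smult_minus_one)

lemma minus_zero_eq: "x \<in> carrier A \<Longrightarrow> y \<in> carrier A \<Longrightarrow> x \<ominus> y = \<zero> \<Longrightarrow> x = y"
  by (metis a_minus_def minus_equality minus_minus a_inv_closed)

lemma smult_finsum:
  assumes "f \<in> S \<rightarrow> carrier A"
  shows "c \<odot> (\<Oplus>i\<in>S. f i) = (\<Oplus>i\<in>S. c \<odot> f i)"
  using assms
proof (induction S rule: infinite_finite_induct)
  case (insert x F)
  then have "f \<in> F \<rightarrow> carrier A" "f x \<in> carrier A" by auto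
  with insert show ?case by (simp add: smult_r_distr finsum_closed Pi_def)
qed auto

lemma finsum_swap:
  assumes "finite S" "finite T" "\<And>i j. i \<in> S \<Longrightarrow> j \<in> T \<Longrightarrow> f i j \<in> carrier A"
  shows "(\<Oplus>i\<in>S. \<Oplus>j\<in>T. f i j) = (\<Oplus>j\<in>T. \<Oplus>i\<in>S. f i j)"
  using assms(1,3)
proof (induction S rule: finite_induct)
  case (insert x F)
  have "(\<Oplus>i\<in>insert x F. \<Oplus>j\<in>T. f i j) = (\<Oplus>j\<in>T. f x j) \<oplus> (\<Oplus>i\<in>F. \<Oplus>j\<in>T. f i j)"
    using insert by (subst finsum_insert) auto
  also have "\<dots> = (\<Oplus>j\<in>T. f x j) \<oplus> (\<Oplus>j\<in>T. \<Oplus>i\<in>F. f i j)" using insert by simp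
  also have "\<dots> = (\<Oplus>j\<in>T. f x j \<oplus> (\<Oplus>i\<in>F. f i j))"
    using insert by (subst finsum_addf) auto
  also have "\<dots> = (\<Oplus>j\<in>T. \<Oplus>i\<in>insert x F. f i j)"
    using insert by (intro finsum_cong') (auto simp: Pi_def)
  finally show ?case .
qed simp

lemma finsum_single:
  assumes "finite S" "k \<in> S" "f k \<in> carrier A" "\<And>i. i \<in> S \<Longrightarrow> i \<noteq> k \<Longrightarrow> f i = \<zero>"
  shows "(\<Oplus>i\<in>S. f i) = f k"
proof -
  have c: "f i \<in> carrier A" if "i \<in> S" for i using assms(3,4) that by (cases "i = k") auto
  have "(\<Oplus>i\<in>S. f i) = (\<Oplus>i\<in>S. if k = i then f i else \<zero>)"
  proof (intro finsum_cong')
    show "(\<lambda>i. if k = i then f i else \<zero>) \<in> S \<rightarrow> carrier A" using assms(3) by auto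
  qed (use assms(4) in auto)
  also have "\<dots> = f k" using assms c by (subst finsum_singleton) auto
  finally show ?thesis .
qed

end

definition lin_map ::
  "('k, 'a, 'z) module_scheme \<Rightarrow> ('k, 'b, 'w) module_scheme \<Rightarrow> ('a \<Rightarrow> 'b) \<Rightarrow> bool" where
  "lin_map A B f \<longleftrightarrow> (\<forall>x\<in>carrier A. f x \<in> carrier B) \<and>
    (\<forall>x\<in>carrier A. \<forall>y\<in>carrier A. f (x \<oplus>\<^bsub>A\<^esub> y) = f x \<oplus>\<^bsub>B\<^esub> f y) \<and>
    (\<forall>c. \<forall>x\<in>carrier A. f (c \<odot>\<^bsub>A\<^esub> x) = c \<odot>\<^bsub>B\<^esub> f x)"

definition alg_hom ::
  "('k, 'a, 'z) module_scheme \<Rightarrow> ('k, 'b, 'w) module_scheme \<Rightarrow> ('a \<Rightarrow> 'b) \<Rightarrow> bool" where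
  "alg_hom A B f \<longleftrightarrow> lin_map A B f \<and> f \<one>\<^bsub>A\<^esub> = \<one>\<^bsub>B\<^esub> \<and>
    (\<forall>x\<in>carrier A. \<forall>y\<in>carrier A. f (x \<otimes>\<^bsub>A\<^esub> y) = f x \<otimes>\<^bsub>B\<^esub> f y)"

lemma lin_mapD:
  assumes "lin_map A B f"
  shows "x \<in> carrier A \<Longrightarrow> f x \<in> carrier B"
    and "x \<in> carrier A \<Longrightarrow> y \<in> carrier A \<Longrightarrow> f (x \<oplus>\<^bsub>A\<^esub> y) = f x \<oplus>\<^bsub>B\<^esub> f y"
    and "x \<in> carrier A \<Longrightarrow> f (c \<odot>\<^bsub>A\<^esub> x) = c \<odot>\<^bsub>B\<^esub> f x"
  using assms by (auto simp: lin_map_def)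

lemma lin_mapI:
  assumes "\<And>x. x \<in> carrier A \<Longrightarrow> f x \<in> carrier B"
    and "\<And>x y. x \<in> carrier A \<Longrightarrow> y \<in> carrier A \<Longrightarrow> f (x \<oplus>\<^bsub>A\<^esub> y) = f x \<oplus>\<^bsub>B\<^esub> f y"
    and "\<And>c x. x \<in> carrier A \<Longrightarrow> f (c \<odot>\<^bsub>A\<^esub> x) = c \<odot>\<^bsub>B\<^esub> f x"
  shows "lin_map A B f"
  using assms by (auto simp: lin_map_def)

lemma alg_homD:
  assumes "alg_hom A B f"
  shows "lin_map A B f" and "f \<one>\<^bsub>A\<^esub> = \<one>\<^bsub>B\<^esub>"
    and "x \<in> carrier A \<Longrightarrow> y \<in> carrier A \<Longrightarrow> f (x \<otimes>\<^bsub>A\<^esub> y) = f x \<otimes>\<^bsub>B\<^esub> f y"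
    and "x \<in> carrier A \<Longrightarrow> f x \<in> carrier B"
  using assms by (auto simp: alg_hom_def lin_map_def)

lemma lin_map_zero:
  assumes "lin_map A B f" "kalg A" "kalg B"
  shows "f \<zero>\<^bsub>A\<^esub> = \<zero>\<^bsub>B\<^esub>"
proof -
  interpret A: kalg A by fact
  interpret B: kalg B by fact
  show ?thesis
    by (metis A.smult_zero_l A.zero_closed B.smult_zero_l assms(1) lin_mapD(1,3))
qed

lemma lin_map_minus:
  assumes "lin_map A B f" "kalg A" "kalg B" "x \<in> carrier A" "y \<in> carrier A"
  shows "f (x \<ominus>\<^bsub>A\<^esub> y) = f x \<ominus>\<^bsub>B\<^esub> f y"
proof -
  interpret A: kalg A by fact
  interpret B: kalg B by fact
  have "f (\<ominus>\<^bsub>A\<^esub> y) = \<ominus>\<^bsub>B\<^esub> f y"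
    using assms lin_mapD[OF assms(1)] by (metis A.smult_minus_one B.smult_minus_one)
  then show ?thesis using assms(4,5) lin_mapD(2)[OF assms(1), of x "\<ominus>\<^bsub>A\<^esub> y"]
    by (simp add: a_minus_def)
qed

lemma lin_map_finsum:
  assumes "lin_map A B f" "kalg A" "kalg B" "g \<in> S \<rightarrow> carrier A"
  shows "f (\<Oplus>\<^bsub>A\<^esub>i\<in>S. g i) = (\<Oplus>\<^bsub>B\<^esub>i\<in>S. f (g i))"
proof -
  interpret A: kalg A by fact
  interpret B: kalg B by fact
  show ?thesis using assms(4)
  proof (induction S rule: infinite_finite_induct)
    case (insert x F)
    then have "g \<in> F \<rightarrow> carrier A" "g x \<in> carrier A" by auto
    with insert show ?case
      by (simp add: lin_mapD[OF assms(1)] A.finsum_closed Pi_def)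
  qed (auto simp: lin_map_zero[OF assms(1-3)])
qed

lemma lin_map_comp:
  assumes "lin_map A B f" "lin_map B C g"
  shows "lin_map A C (\<lambda>x. g (f x))"
  using assms by (auto simp: lin_map_def)

lemma alg_hom_comp:
  assumes "alg_hom A B f" "alg_hom B C g"
  shows "alg_hom A C (\<lambda>x. g (f x))"
  using assms by (auto simp: alg_hom_def lin_map_def)

section \<open>The ground field as an algebra\<close>

lemma base_alg_simps [simp]:
  "carrier base_alg = UNIV" "x \<otimes>\<^bsub>base_alg\<^esub> y = x * y" "\<one>\<^bsub>base_alg\<^esub> = 1" "\<zero>\<^bsub>base_alg\<^esub> = 0"
  "x \<oplus>\<^bsub>base_alg\<^esub> y = x + y" "c \<odot>\<^bsub>base_alg\<^esub> x = c * x"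
  by (simp_all add: base_alg_def)

lemma kalg_base: "kalg (base_alg :: ('k::field, 'k) module)"
proof (intro kalg.intro kalg_axioms.intro)
  show "ring (base_alg :: ('k::field, 'k) module)"
  proof (rule ringI)
    show "abelian_group (base_alg :: ('k::field, 'k) module)"
    proof (rule abelian_groupI)
      fix x :: 'k assume "x \<in> carrier base_alg"
      show "\<exists>y\<in>carrier base_alg. y \<oplus>\<^bsub>base_alg\<^esub> x = \<zero>\<^bsub>base_alg\<^esub>"
        by (rule bexI[of _ "-x"]) auto
    qed (auto simp: algebra_simps)
    show "Group.monoid (base_alg :: ('k::field, 'k) module)"
      by (rule monoidI) (auto simp: algebra_simps)
  qed (auto simp: algebra_simps)
qed (auto simp: algebra_simps)

lemma finsum_base [simp]: "(\<Oplus>\<^bsub>base_alg\<^esub>i\<in>S. f i) = (\<Sum>i\<in>S. f i)"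
proof -
  interpret kalg base_alg by (rule kalg_base)
  show ?thesis by (induction S rule: infinite_finite_induct) auto
qed

section \<open>Finitely supported functions\<close>

lemma lookup_pm_scale [simp]:
  "Poly_Mapping.lookup (pm_scale c p) x = c * Poly_Mapping.lookup p x"
  by (simp add: pm_scale_def Poly_Mapping.map.rep_eq when_def)

lemma pm_scale_single [simp]: "pm_scale c (Poly_Mapping.single x d) = Poly_Mapping.single x (c * d)"
  by (rule poly_mapping_eqI) (auto simp: lookup_single when_def)

lemma pm_scale_0 [simp]: "pm_scale c 0 = 0"
  by (rule poly_mapping_eqI) simp

lemma keys_pm_scale: "Poly_Mapping.keys (pm_scale c p) \<subseteq> Poly_Mapping.keys p"
  by (auto simp: in_keys_iff)

lemma vector_space_pm_scale: "vector_space pm_scale"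
  by unfold_locales (auto intro!: poly_mapping_eqI simp: lookup_add algebra_simps)

lemma pm_scale_add: "pm_scale c (p + q) = pm_scale c p + pm_scale c q"
  by (auto intro!: poly_mapping_eqI simp: lookup_add algebra_simps)

lemma pm_sum_singles:
  fixes p :: "'x \<Rightarrow>\<^sub>0 'a::comm_monoid_add"
  assumes "finite S" "Poly_Mapping.keys p \<subseteq> S"
  shows "p = (\<Sum>x\<in>S. Poly_Mapping.single x (Poly_Mapping.lookup p x))"
proof (rule poly_mapping_eqI)
  fix k
  have "(\<Sum>x\<in>S. Poly_Mapping.lookup (Poly_Mapping.single x (Poly_Mapping.lookup p x)) k)
     = (\<Sum>x\<in>S. if k = x then Poly_Mapping.lookup p k else 0)"
    by (rule sum.cong) (auto simp: lookup_single when_def)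
  also have "\<dots> = (if k \<in> S then Poly_Mapping.lookup p k else 0)"
    using assms(1) by simp
  also have "\<dots> = Poly_Mapping.lookup p k"
    using assms(2) by (auto simp: in_keys_iff)
  finally show "Poly_Mapping.lookup p k =
      Poly_Mapping.lookup (\<Sum>x\<in>S. Poly_Mapping.single x (Poly_Mapping.lookup p x)) k"
    by (simp add: lookup_sum)
qed

text \<open>Induction over linear combinations; it reduces identities in monoid algebras to single elements.\<close>
lemma pm_induct [consumes 1, case_names zero single add]:
  fixes p :: "'x \<Rightarrow>\<^sub>0 'a::comm_monoid_add"
  assumes "Poly_Mapping.keys p \<subseteq> X"
    and "P 0"
    and "\<And>x c. x \<in> X \<Longrightarrow> P (Poly_Mapping.single x c)"
    and "\<And>p q. Poly_Mapping.keys p \<subseteq> X \<Longrightarrow> Poly_Mapping.keys q \<subseteq> X \<Longrightarrow> P p \<Longrightarrow> P q \<Longrightarrow> P (p + q)"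
  shows "P p"
proof -
  have "P (\<Sum>x\<in>S. Poly_Mapping.single x (Poly_Mapping.lookup p x)) \<and>
     Poly_Mapping.keys (\<Sum>x\<in>S. Poly_Mapping.single x (Poly_Mapping.lookup p x)) \<subseteq> X"
    if "finite S" "S \<subseteq> X" for S
    using that
  proof (induction S rule: finite_induct)
    case (insert x F)
    let ?s = "Poly_Mapping.single x (Poly_Mapping.lookup p x)"
    let ?t = "\<Sum>x\<in>F. Poly_Mapping.single x (Poly_Mapping.lookup p x)"
    have 1: "Poly_Mapping.keys ?s \<subseteq> X" using insert by auto
    have 2: "P ?t" "Poly_Mapping.keys ?t \<subseteq> X" using insert by auto
    have "P (?s + ?t)" using 1 2 insert.prems by (intro assms(4)) (auto intro: assms(3))
    moreover have "Poly_Mapping.keys (?s + ?t) \<subseteq> X"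
      using keys_add[of ?s ?t] 1 2 by blast
    ultimately show ?case using insert by simp
  qed (auto simp: assms(2))
  from this[of "Poly_Mapping.keys p"] show ?thesis
    using pm_sum_singles[of "Poly_Mapping.keys p" p] assms(1) by simp
qed

section \<open>Monoid algebras\<close>

lemma monoid_alg_simps:
  "carrier (monoid_alg G) = {p. Poly_Mapping.keys p \<subseteq> carrier G}"
  "\<one>\<^bsub>monoid_alg G\<^esub> = Poly_Mapping.single \<one>\<^bsub>G\<^esub> 1" "\<zero>\<^bsub>monoid_alg G\<^esub> = 0"
  "p \<oplus>\<^bsub>monoid_alg G\<^esub> q = p + q" "c \<odot>\<^bsub>monoid_alg G\<^esub> p = pm_scale c p"
  by (simp_all add: monoid_alg_def)

text \<open>The supports in the definition of the product depend on the factors. Summation over a common larger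
set makes both distributive laws and associativity a matter of rearranging sums.\<close>
lemma monoid_alg_mult_superset:
  assumes "finite S" "finite T" "Poly_Mapping.keys p \<subseteq> S" "Poly_Mapping.keys q \<subseteq> T"
  shows "p \<otimes>\<^bsub>monoid_alg G\<^esub> q = (\<Sum>x\<in>S. \<Sum>y\<in>T.
       Poly_Mapping.single (x \<otimes>\<^bsub>G\<^esub> y) (Poly_Mapping.lookup p x * Poly_Mapping.lookup q y))"
proof -
  have "p \<otimes>\<^bsub>monoid_alg G\<^esub> q = (\<Sum>x\<in>Poly_Mapping.keys p. \<Sum>y\<in>Poly_Mapping.keys q.
       Poly_Mapping.single (x \<otimes>\<^bsub>G\<^esub> y) (Poly_Mapping.lookup p x * Poly_Mapping.lookup q y))"
    by (simp add: monoid_alg_def)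
  also have "\<dots> = (\<Sum>x\<in>Poly_Mapping.keys p. \<Sum>y\<in>T.
       Poly_Mapping.single (x \<otimes>\<^bsub>G\<^esub> y) (Poly_Mapping.lookup p x * Poly_Mapping.lookup q y))"
    by (intro sum.cong sum.mono_neutral_left assms refl) (auto simp: in_keys_iff)
  also have "\<dots> = (\<Sum>x\<in>S. \<Sum>y\<in>T.
       Poly_Mapping.single (x \<otimes>\<^bsub>G\<^esub> y) (Poly_Mapping.lookup p x * Poly_Mapping.lookup q y))"
    by (intro sum.mono_neutral_left assms) (auto simp: in_keys_iff)
  finally show ?thesis .
qed

lemma monoid_alg_mult_single [simp]:
  "Poly_Mapping.single x c \<otimes>\<^bsub>monoid_alg G\<^esub> Poly_Mapping.single y d =
    Poly_Mapping.single (x \<otimes>\<^bsub>G\<^esub> y) (c * d)"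
  by (subst monoid_alg_mult_superset[of "{x}" "{y}"]) auto

lemma monoid_alg_mult_zero [simp]:
  "0 \<otimes>\<^bsub>monoid_alg G\<^esub> q = 0" "p \<otimes>\<^bsub>monoid_alg G\<^esub> 0 = 0"
  by (simp_all add: monoid_alg_def)

lemma monoid_alg_l_distr:
  "(p + p') \<otimes>\<^bsub>monoid_alg G\<^esub> q = p \<otimes>\<^bsub>monoid_alg G\<^esub> q + p' \<otimes>\<^bsub>monoid_alg G\<^esub> q"
proof -
  let ?S = "Poly_Mapping.keys p \<union> Poly_Mapping.keys p'" and ?T = "Poly_Mapping.keys q"
  have "Poly_Mapping.keys (p + p') \<subseteq> ?S" by (rule keys_add)
  then show ?thesis
    by (simp add: monoid_alg_mult_superset[of ?S ?T] lookup_add single_add algebra_simps sum.distrib)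
qed

lemma monoid_alg_r_distr:
  "p \<otimes>\<^bsub>monoid_alg G\<^esub> (q + q') = p \<otimes>\<^bsub>monoid_alg G\<^esub> q + p \<otimes>\<^bsub>monoid_alg G\<^esub> q'"
proof -
  let ?S = "Poly_Mapping.keys p" and ?T = "Poly_Mapping.keys q \<union> Poly_Mapping.keys q'"
  have "Poly_Mapping.keys (q + q') \<subseteq> ?T" by (rule keys_add)
  then show ?thesis
    by (simp add: monoid_alg_mult_superset[of ?S ?T] lookup_add single_add algebra_simps sum.distrib)
qed

lemma monoid_alg_scale_l:
  "pm_scale c p \<otimes>\<^bsub>monoid_alg G\<^esub> q = pm_scale c (p \<otimes>\<^bsub>monoid_alg G\<^esub> q)"
proof -
  have "Poly_Mapping.keys p \<subseteq> UNIV" by simp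
  then show ?thesis
  proof (induction p rule: pm_induct)
    case (single x d)
    have "Poly_Mapping.keys q \<subseteq> UNIV" by simp
    then show ?case
      by (induction q rule: pm_induct)
        (auto simp: monoid_alg_r_distr pm_scale_add mult.assoc)
  qed (simp_all add: pm_scale_add monoid_alg_l_distr)
qed

lemma monoid_alg_scale_r:
  "p \<otimes>\<^bsub>monoid_alg G\<^esub> pm_scale c q = pm_scale c (p \<otimes>\<^bsub>monoid_alg G\<^esub> q)"
proof -
  have "Poly_Mapping.keys p \<subseteq> UNIV" by simp
  then show ?thesis
  proof (induction p rule: pm_induct)
    case (single x d)
    have "Poly_Mapping.keys q \<subseteq> UNIV" by simp
    then show ?case
      by (induction q rule: pm_induct)
        (auto simp: monoid_alg_r_distr pm_scale_add mult.left_commute)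
  qed (simp_all add: pm_scale_add monoid_alg_l_distr)
qed

lemma monoid_alg_closed:
  assumes "Group.monoid G" "Poly_Mapping.keys p \<subseteq> carrier G" "Poly_Mapping.keys q \<subseteq> carrier G"
  shows "Poly_Mapping.keys (p \<otimes>\<^bsub>monoid_alg G\<^esub> q) \<subseteq> carrier G"
proof -
  interpret Group.monoid G by fact
  show ?thesis using assms(2)
  proof (induction p rule: pm_induct)
    case (single x d)
    show ?case using assms(3)
    proof (induction q rule: pm_induct)
      case (add p q)
      then show ?case unfolding monoid_alg_r_distr by (intro order_trans[OF keys_add] Un_least)
    qed (use single in auto)
  next
    case (add p p')
    then show ?case unfolding monoid_alg_l_distr by (intro order_trans[OF keys_add] Un_least)
  qed auto
qed

lemma monoid_alg_assoc:
  assumes "Group.monoid G" "Poly_Mapping.keys p \<subseteq> carrier G" "Poly_Mapping.keys q \<subseteq> carrier G"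
    "Poly_Mapping.keys r \<subseteq> carrier G"
  shows "(p \<otimes>\<^bsub>monoid_alg G\<^esub> q) \<otimes>\<^bsub>monoid_alg G\<^esub> r = p \<otimes>\<^bsub>monoid_alg G\<^esub> (q \<otimes>\<^bsub>monoid_alg G\<^esub> r)"
proof -
  interpret Group.monoid G by fact
  show ?thesis using assms(2)
  proof (induction p rule: pm_induct)
    case x: (single x d)
    show ?case using assms(3)
    proof (induction q rule: pm_induct)
      case y: (single y e)
      show ?case using assms(4)
        by (induction r rule: pm_induct)
          (use x y in \<open>auto simp: monoid_alg_r_distr m_assoc mult.assoc\<close>)
    qed (auto simp: monoid_alg_l_distr monoid_alg_r_distr)
  qed (auto simp: monoid_alg_l_distr)
qed

lemma kalg_monoid_alg:
  assumes "Group.monoid G"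
  shows "kalg (monoid_alg G :: ('k::field, _) module)"
proof -
  interpret Group.monoid G by fact
  let ?A = "monoid_alg G :: ('k::field, _) module"
  show ?thesis
  proof (intro kalg.intro kalg_axioms.intro)
    show "ring ?A"
    proof (rule ringI)
      show "abelian_group ?A"
      proof (rule abelian_groupI)
        fix x assume "x \<in> carrier ?A"
        then show "\<exists>y\<in>carrier ?A. y \<oplus>\<^bsub>?A\<^esub> x = \<zero>\<^bsub>?A\<^esub>"
          by (intro bexI[of _ "-x"]) (auto simp: monoid_alg_simps)
      next
        fix x y assume "x \<in> carrier ?A" "y \<in> carrier ?A"
        then show "x \<oplus>\<^bsub>?A\<^esub> y \<in> carrier ?A"
          using keys_add[of x y] by (auto simp: monoid_alg_simps)
      qed (auto simp: monoid_alg_simps algebra_simps)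
      show "Group.monoid ?A"
      proof (rule monoidI)
        fix x assume "x \<in> carrier ?A"
        then have k: "Poly_Mapping.keys x \<subseteq> carrier G" by (simp add: monoid_alg_simps)
        from k show "\<one>\<^bsub>?A\<^esub> \<otimes>\<^bsub>?A\<^esub> x = x"
          by (induction x rule: pm_induct) (auto simp: monoid_alg_simps monoid_alg_r_distr)
        from k show "x \<otimes>\<^bsub>?A\<^esub> \<one>\<^bsub>?A\<^esub> = x"
          by (induction x rule: pm_induct) (auto simp: monoid_alg_simps monoid_alg_l_distr)
      qed (use monoid_alg_closed[OF assms, THEN subsetD] monoid_alg_assoc[OF assms] in
          \<open>auto simp: monoid_alg_simps\<close>)
    qed (auto simp: monoid_alg_simps monoid_alg_l_distr monoid_alg_r_distr)
  next
    fix x c assume "x \<in> carrier ?A"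
    then show "c \<odot>\<^bsub>?A\<^esub> x \<in> carrier ?A"
      using keys_pm_scale[of c x] by (auto simp: monoid_alg_simps)
  qed (auto simp: monoid_alg_simps monoid_alg_scale_l monoid_alg_scale_r lookup_add algebra_simps
      intro!: poly_mapping_eqI)
qed

section \<open>Linear extension to a monoid algebra\<close>

context kalg begin

text \<open>As for products, a fixed summation range that contains the support makes additivity visible.\<close>
lemma lin_ext_superset:
  assumes "finite S" "Poly_Mapping.keys p \<subseteq> S" "\<phi> \<in> S \<rightarrow> carrier A"
  shows "lin_ext A \<phi> p = (\<Oplus>x\<in>S. Poly_Mapping.lookup p x \<odot> \<phi> x)"
  unfolding lin_ext_def
  using assms by (intro add.finprod_mono_neutral_cong_left) (auto simp: in_keys_iff Pi_iff)

lemma lin_ext_closed: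
  assumes "\<phi> \<in> X \<rightarrow> carrier A" "Poly_Mapping.keys p \<subseteq> X"
  shows "lin_ext A \<phi> p \<in> carrier A"
  unfolding lin_ext_def using assms by (intro finsum_closed) auto

lemma lin_ext_zero [simp]: "lin_ext A \<phi> 0 = \<zero>"
  by (simp add: lin_ext_def)

lemma lin_ext_single [simp]:
  "\<phi> x \<in> carrier A \<Longrightarrow> lin_ext A \<phi> (Poly_Mapping.single x c) = c \<odot> \<phi> x"
  by (subst lin_ext_superset[of "{x}"]) auto

lemma lin_ext_add:
  assumes "\<phi> \<in> X \<rightarrow> carrier A" "Poly_Mapping.keys p \<subseteq> X" "Poly_Mapping.keys q \<subseteq> X"
  shows "lin_ext A \<phi> (p + q) = lin_ext A \<phi> p \<oplus> lin_ext A \<phi> q"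
proof -
  let ?S = "Poly_Mapping.keys p \<union> Poly_Mapping.keys q"
  have *: "\<phi> \<in> ?S \<rightarrow> carrier A" using assms by auto
  have "Poly_Mapping.keys (p + q) \<subseteq> ?S" by (rule keys_add)
  then have "lin_ext A \<phi> (p + q) = (\<Oplus>x\<in>?S. Poly_Mapping.lookup (p + q) x \<odot> \<phi> x)"
    by (intro lin_ext_superset * ) auto
  also have "\<dots> = (\<Oplus>x\<in>?S. Poly_Mapping.lookup p x \<odot> \<phi> x \<oplus> Poly_Mapping.lookup q x \<odot> \<phi> x)"
    using * by (intro finsum_cong') (auto simp: lookup_add smult_l_distr Pi_iff)
  also have "\<dots> = lin_ext A \<phi> p \<oplus> lin_ext A \<phi> q"
    using * by (subst finsum_addf) (auto simp: lin_ext_superset[of ?S])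
  finally show ?thesis .
qed

lemma lin_ext_scale:
  assumes "\<phi> \<in> X \<rightarrow> carrier A" "Poly_Mapping.keys p \<subseteq> X"
  shows "lin_ext A \<phi> (pm_scale c p) = c \<odot> lin_ext A \<phi> p"
proof -
  let ?S = "Poly_Mapping.keys p"
  have *: "\<phi> \<in> ?S \<rightarrow> carrier A" using assms by auto
  have "lin_ext A \<phi> (pm_scale c p) = (\<Oplus>x\<in>?S. Poly_Mapping.lookup (pm_scale c p) x \<odot> \<phi> x)"
    by (intro lin_ext_superset * keys_pm_scale) auto
  also have "\<dots> = (\<Oplus>x\<in>?S. c \<odot> (Poly_Mapping.lookup p x \<odot> \<phi> x))"
    using * by (intro finsum_cong') (auto simp: smult_assoc Pi_iff)
  also have "\<dots> = c \<odot> lin_ext A \<phi> p"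
    using * unfolding lin_ext_def by (subst smult_finsum) auto
  finally show ?thesis .
qed

lemma lin_ext_lin_map:
  assumes "\<phi> \<in> carrier G \<rightarrow> carrier A"
  shows "lin_map (monoid_alg G) A (lin_ext A \<phi>)"
  using lin_ext_closed[OF assms] lin_ext_add[OF assms] lin_ext_scale[OF assms]
  by (auto simp: lin_map_def monoid_alg_simps)

lemma lin_ext_alg_hom:
  assumes "Group.monoid G" "\<phi> \<in> carrier G \<rightarrow> carrier A" "\<phi> \<one>\<^bsub>G\<^esub> = \<one>"
    "\<And>x y. x \<in> carrier G \<Longrightarrow> y \<in> carrier G \<Longrightarrow> \<phi> (x \<otimes>\<^bsub>G\<^esub> y) = \<phi> x \<otimes> \<phi> y"
  shows "alg_hom (monoid_alg G) A (lin_ext A \<phi>)"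
proof -
  interpret G: Group.monoid G by fact
  have *: "lin_ext A \<phi> (p \<otimes>\<^bsub>monoid_alg G\<^esub> q) = lin_ext A \<phi> p \<otimes> lin_ext A \<phi> q"
    if "Poly_Mapping.keys p \<subseteq> carrier G" and q: "Poly_Mapping.keys q \<subseteq> carrier G" for p q
    using that(1)
  proof (induction p rule: pm_induct)
    case zero
    then show ?case using lin_ext_closed[OF assms(2) q] by simp
  next
    case (single x c)
    show ?case using q
    proof (induction q rule: pm_induct)
      case zero
      then show ?case using single lin_ext_closed[OF assms(2), of "Poly_Mapping.single x c"] by simp
    next
      case s: (single y d)
      then show ?case using single assms(2) funcset_mem[OF assms(2)]
        by (simp add: assms(4) smult_mult_l smult_mult_r smult_assoc[symmetric] mult.commute)
    next
      case (add p q)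
      have "Poly_Mapping.keys (Poly_Mapping.single x c \<otimes>\<^bsub>monoid_alg G\<^esub> p) \<subseteq> carrier G"
        "Poly_Mapping.keys (Poly_Mapping.single x c \<otimes>\<^bsub>monoid_alg G\<^esub> q) \<subseteq> carrier G"
        using add single by (intro monoid_alg_closed[OF assms(1)]; simp)+
      then show ?case using add single assms(2) funcset_mem[OF assms(2)]
        by (simp add: monoid_alg_r_distr lin_ext_add[OF assms(2)] lin_ext_closed[OF assms(2)] r_distr)
    qed
  next
    case (add p p')
    have "Poly_Mapping.keys (p \<otimes>\<^bsub>monoid_alg G\<^esub> q) \<subseteq> carrier G"
        "Poly_Mapping.keys (p' \<otimes>\<^bsub>monoid_alg G\<^esub> q) \<subseteq> carrier G"
      using add q by (intro monoid_alg_closed[OF assms(1)]; simp)+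
    then show ?case using add q
      by (simp add: monoid_alg_l_distr lin_ext_add[OF assms(2)] lin_ext_closed[OF assms(2)] l_distr)
  qed
  show ?thesis
    unfolding alg_hom_def using lin_ext_lin_map[OF assms(2)] assms(3) *
    by (auto simp: monoid_alg_simps)
qed

end

section \<open>Quotient algebras\<close>

lemma quot_alg_simps:
  "carrier (quot_alg A I) = carrier (A Quot I)" "mult (quot_alg A I) = mult (A Quot I)"
  "one (quot_alg A I) = one (A Quot I)" "zero (quot_alg A I) = zero (A Quot I)"
  "add (quot_alg A I) = add (A Quot I)"
  "smult (quot_alg A I) = (\<lambda>c X. the_elem ((\<lambda>x. I +>\<^bsub>A\<^esub> (c \<odot>\<^bsub>A\<^esub> x)) ` X))"
  by (simp_all add: quot_alg_def ring.extend_def module.fields_def)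

text \<open>The ring axioms refer only to the ring fields, so they pass from the quotient ring to the quotient
algebra, which carries a scalar multiplication in addition.\<close>
lemma ring_cong:
  assumes "ring R" "carrier S = carrier R" "mult S = mult R" "one S = one R" "zero S = zero R"
    "add S = add R"
  shows "ring S"
proof -
  interpret R: ring R by fact
  show ?thesis
  proof (rule ringI)
    show "abelian_group S"
    proof (rule abelian_groupI)
      fix x assume "x \<in> carrier S"
      then show "\<exists>y\<in>carrier S. y \<oplus>\<^bsub>S\<^esub> x = \<zero>\<^bsub>S\<^esub>"
        using assms R.l_neg R.a_inv_closed by metis
    qed (use assms in \<open>simp_all add: R.a_ac\<close>)
    show "Group.monoid S"
      by (rule monoidI) (use assms in \<open>simp_all add: R.m_assoc\<close>)
  qed (use assms in \<open>simp_all add: R.l_distr R.r_distr\<close>)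
qed

locale kalg_ideal = kalg A + ideal I A for A :: "('k::field, 'b, 'z) module_scheme" (structure) and I
begin

lemma smult_ideal: "x \<in> I \<Longrightarrow> c \<odot> x \<in> I"
proof -
  assume x: "x \<in> I"
  then have xc: "x \<in> carrier A" using a_subset by auto
  have "c \<odot> x = (c \<odot> \<one>) \<otimes> x" using xc by (simp add: smult_mult_l)
  then show ?thesis using x xc by (simp add: I_l_closed)
qed

lemma coset_eq_iff:
  "x \<in> carrier A \<Longrightarrow> y \<in> carrier A \<Longrightarrow> I +> x = I +> y \<longleftrightarrow> x \<ominus> y \<in> I"
  by (metis a_rcos_module_minus a_rcos_self a_repr_independence' local.ring_axioms)

text \<open>A function that is constant on a coset can be evaluated on the coset as a set of representatives;
this is how scalar multiplication and induced maps on the quotient are defined.\<close>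
lemma the_elem_coset:
  assumes "x \<in> carrier A" "\<And>y. y \<in> carrier A \<Longrightarrow> y \<ominus> x \<in> I \<Longrightarrow> h y = h x"
  shows "the_elem (h ` (I +> x)) = h x"
proof -
  have "h ` (I +> x) = {h x}"
  proof
    show "h ` (I +> x) \<subseteq> {h x}"
    proof
      fix z assume "z \<in> h ` (I +> x)"
      then obtain y where y: "y \<in> I +> x" "z = h y" by auto
      have "y \<in> carrier A" using y a_r_coset_subset_G[OF a_subset assms(1)] by auto
      moreover have "y \<ominus> x \<in> I" using y assms(1) a_rcos_module_minus calculation local.ring_axioms by blast
      ultimately show "z \<in> {h x}" using assms y by auto
    qed
    show "{h x} \<subseteq> h ` (I +> x)" using a_rcos_self[OF assms(1)] by auto
  qed
  then show ?thesis by simp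
qed

lemma quot_smult: "x \<in> carrier A \<Longrightarrow> c \<odot>\<^bsub>quot_alg A I\<^esub> (I +> x) = I +> (c \<odot> x)"
  unfolding quot_alg_simps
proof (rule the_elem_coset)
  fix y assume x: "x \<in> carrier A" "y \<in> carrier A" "y \<ominus> x \<in> I"
  have "c \<odot> y \<ominus> c \<odot> x = c \<odot> (y \<ominus> x)"
    using x by (simp add: a_minus_def smult_r_distr smult_a_inv)
  then show "I +> c \<odot> y = I +> c \<odot> x" using x smult_ideal by (simp add: coset_eq_iff)
qed

lemma quot_carrier: "carrier (quot_alg A I) = (\<lambda>x. I +> x) ` carrier A"
  by (auto simp: quot_alg_simps FactRing_def A_RCOSETS_def')

lemma quot_ops:
  "x \<in> carrier A \<Longrightarrow> y \<in> carrier A \<Longrightarrow> (I +> x) \<otimes>\<^bsub>quot_alg A I\<^esub> (I +> y) = I +> (x \<otimes> y)"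
  "x \<in> carrier A \<Longrightarrow> y \<in> carrier A \<Longrightarrow> (I +> x) \<oplus>\<^bsub>quot_alg A I\<^esub> (I +> y) = I +> (x \<oplus> y)"
  "\<one>\<^bsub>quot_alg A I\<^esub> = I +> \<one>"
  by (auto simp: quot_alg_simps FactRing_def rcoset_mult_add a_rcos_sum)

lemma quot_kalg: "kalg (quot_alg A I)"
proof (intro kalg.intro kalg_axioms.intro)
  show "ring (quot_alg A I)"
    by (rule ring_cong[OF quotient_is_ring]) (simp_all add: quot_alg_simps)
qed (auto simp: quot_carrier quot_ops quot_smult smult_l_distr smult_r_distr smult_assoc
    smult_mult_l smult_mult_r)

lemma quot_hom: "alg_hom A (quot_alg A I) (\<lambda>x. I +> x)"
  by (auto simp: alg_hom_def lin_map_def quot_carrier quot_ops quot_smult)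

lemma quot_lift_lin:
  assumes "kalg B" "lin_map A B h" "\<And>x. x \<in> I \<Longrightarrow> h x = \<zero>\<^bsub>B\<^esub>"
  shows "\<And>x. x \<in> carrier A \<Longrightarrow> the_elem (h ` (I +> x)) = h x"
    and "lin_map (quot_alg A I) B (\<lambda>X. the_elem (h ` X))"
proof -
  interpret B: kalg B by fact
  show *: "the_elem (h ` (I +> x)) = h x" if "x \<in> carrier A" for x
  proof (rule the_elem_coset[OF that])
    fix y assume y: "y \<in> carrier A" "y \<ominus> x \<in> I"
    then have "h y \<ominus>\<^bsub>B\<^esub> h x = \<zero>\<^bsub>B\<^esub>"
      using lin_map_minus[OF assms(2) kalg_axioms assms(1) y(1) that] assms(3) by simp
    then show "h y = h x"
      using y that lin_mapD(1)[OF assms(2)] B.minus_zero_eq by simp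
  qed
  show "lin_map (quot_alg A I) B (\<lambda>X. the_elem (h ` X))"
    by (rule lin_mapI) (auto simp: quot_carrier quot_ops quot_smult * lin_mapD[OF assms(2)])
qed

lemma quot_lift_hom:
  assumes "kalg B" "alg_hom A B h" "\<And>x. x \<in> I \<Longrightarrow> h x = \<zero>\<^bsub>B\<^esub>"
  shows "alg_hom (quot_alg A I) B (\<lambda>X. the_elem (h ` X))"
  using quot_lift_lin[OF assms(1) alg_homD(1)[OF assms(2)] assms(3)]
  unfolding alg_hom_def by (auto simp: quot_carrier quot_ops alg_homD[OF assms(2)])

end

section \<open>Free algebras\<close>

lemma word_monoid: "Group.monoid \<lparr>carrier = lists X, mult = (@), one = []\<rparr>"
  by (rule monoidI) auto

lemma kalg_free_alg: "kalg (free_alg X :: ('k::field, _) module)"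
  unfolding free_alg_def by (rule kalg_monoid_alg[OF word_monoid])

lemma free_alg_carrier: "carrier (free_alg X) = {p. Poly_Mapping.keys p \<subseteq> lists X}"
  by (simp add: free_alg_def monoid_alg_simps)

lemma free_alg_simps:
  "\<one>\<^bsub>free_alg X\<^esub> = Poly_Mapping.single [] 1" "\<zero>\<^bsub>free_alg X\<^esub> = 0"
  "p \<oplus>\<^bsub>free_alg X\<^esub> q = p + q" "c \<odot>\<^bsub>free_alg X\<^esub> p = pm_scale c p"
  "Poly_Mapping.single u a \<otimes>\<^bsub>free_alg X\<^esub> Poly_Mapping.single v b = Poly_Mapping.single (u @ v) (a * b)"
  by (simp_all add: free_alg_def monoid_alg_simps)

lemma free_gen_closed: "x \<in> X \<Longrightarrow> free_gen x \<in> carrier (free_alg X)"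
  by (auto simp: free_alg_carrier free_gen_def)

context kalg begin

definition word_prod :: "('x \<Rightarrow> 'b) \<Rightarrow> 'x list \<Rightarrow> 'b" where
  "word_prod \<phi> w = foldr (\<lambda>x r. \<phi> x \<otimes> r) w \<one>"

lemma word_prod_simps [simp]:
  "word_prod \<phi> [] = \<one>" "word_prod \<phi> (x # w) = \<phi> x \<otimes> word_prod \<phi> w"
  by (simp_all add: word_prod_def)

lemma word_prod_closed: "\<phi> \<in> X \<rightarrow> carrier A \<Longrightarrow> w \<in> lists X \<Longrightarrow> word_prod \<phi> w \<in> carrier A"
  by (induction w) auto

lemma word_prod_append:
  "\<phi> \<in> X \<rightarrow> carrier A \<Longrightarrow> u \<in> lists X \<Longrightarrow> v \<in> lists X \<Longrightarrow>
    word_prod \<phi> (u @ v) = word_prod \<phi> u \<otimes> word_prod \<phi> v"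
proof (induction u)
  case (Cons x u)
  then show ?case using word_prod_closed[of \<phi> X]
    by (simp add: Pi_iff m_assoc)
qed (simp add: word_prod_closed)

lemma free_lift_eq: "free_lift A \<phi> = lin_ext A (word_prod \<phi>)"
  by (simp add: free_lift_def word_prod_def[abs_def])

lemma free_lift_hom:
  assumes "\<phi> \<in> X \<rightarrow> carrier A"
  shows "alg_hom (free_alg X) A (free_lift A \<phi>)"
  unfolding free_alg_def free_lift_eq
proof (rule lin_ext_alg_hom[OF word_monoid])
  show "word_prod \<phi> \<in> carrier \<lparr>carrier = lists X, mult = (@), one = []\<rparr> \<rightarrow> carrier A"
    using word_prod_closed[OF assms] by simp
qed (use word_prod_append[OF assms] in auto)

lemma free_lift_single:
  "\<phi> \<in> X \<rightarrow> carrier A \<Longrightarrow> w \<in> lists X \<Longrightarrow>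
    free_lift A \<phi> (Poly_Mapping.single w c) = c \<odot> word_prod \<phi> w"
  using word_prod_closed[of \<phi> X w] by (simp add: free_lift_eq)

lemma free_lift_gen: "\<phi> \<in> X \<rightarrow> carrier A \<Longrightarrow> x \<in> X \<Longrightarrow> free_lift A \<phi> (free_gen x) = \<phi> x"
  unfolding free_gen_def by (subst free_lift_single[of _ X]) (auto simp: Pi_iff)

end

text \<open>A homomorphism on the free algebra is determined by its values on letters, since words are products
of letters.\<close>
lemma alg_hom_free_single:
  fixes A :: "('k::field, 'b, 'z) module_scheme"
  assumes "alg_hom (free_alg X) A f" "kalg A" "w \<in> lists X"
  shows "f (Poly_Mapping.single w c) = c \<odot>\<^bsub>A\<^esub> kalg.word_prod A (\<lambda>x. f (free_gen x)) w"
proof -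
  interpret A: kalg A by fact
  let ?F = "free_alg X"
  have *: "f (Poly_Mapping.single w 1) = A.word_prod (\<lambda>x. f (free_gen x)) w"
    using assms(3)
  proof (induction w)
    case Nil
    then show ?case using alg_homD(2)[OF assms(1)] by (simp add: free_alg_simps)
  next
    case (Cons x w)
    have "Poly_Mapping.single (x # w) (1::'k) = free_gen x \<otimes>\<^bsub>?F\<^esub> Poly_Mapping.single w 1"
      by (simp add: free_gen_def free_alg_simps)
    moreover have "f (free_gen x \<otimes>\<^bsub>?F\<^esub> Poly_Mapping.single w (1::'k)) =
        f (free_gen x) \<otimes>\<^bsub>A\<^esub> f (Poly_Mapping.single w 1)"
      by (rule alg_homD(3)[OF assms(1)]) (use Cons in \<open>auto simp: free_alg_carrier free_gen_def\<close>)
    ultimately show ?case using Cons by simp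
  qed
  have "f (c \<odot>\<^bsub>?F\<^esub> Poly_Mapping.single w 1) = c \<odot>\<^bsub>A\<^esub> f (Poly_Mapping.single w 1)"
    by (rule lin_mapD(3)[OF alg_homD(1)[OF assms(1)]]) (use assms(3) in \<open>auto simp: free_alg_carrier\<close>)
  then show ?thesis using * by (simp add: free_alg_simps)
qed

lemma lin_map_eq_on_words:
  fixes A :: "('k::field, 'b, 'z) module_scheme"
  assumes "lin_map (free_alg X) A f" "lin_map (free_alg X) A g" "kalg A"
    and "\<And>w. w \<in> lists X \<Longrightarrow> f (Poly_Mapping.single w 1) = g (Poly_Mapping.single w 1)"
    and "p \<in> carrier (free_alg X)"
  shows "f p = g p"
proof -
  interpret A: kalg A by fact
  have c: "f (Poly_Mapping.single w c) = g (Poly_Mapping.single w c)" if w: "w \<in> lists X" for w c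
  proof -
    have "Poly_Mapping.single w (1::'k) \<in> carrier (free_alg X)" using w by (auto simp: free_alg_carrier)
    then show ?thesis
      using assms(4)[OF w] lin_mapD(3)[OF assms(1), of "Poly_Mapping.single w 1" c]
        lin_mapD(3)[OF assms(2), of "Poly_Mapping.single w 1" c] by (simp add: free_alg_simps(4))
  qed
  have "Poly_Mapping.keys p \<subseteq> lists X" using assms(5) by (simp add: free_alg_carrier)
  then show ?thesis
  proof (induction p rule: pm_induct)
    case zero
    then show ?case
      using lin_map_zero[OF assms(1) kalg_free_alg assms(3)] lin_map_zero[OF assms(2) kalg_free_alg assms(3)]
      by (simp add: free_alg_simps)
  next
    case (add p q)
    then show ?case
      using lin_mapD(2)[OF assms(1), of p q] lin_mapD(2)[OF assms(2), of p q]
      by (simp add: free_alg_simps free_alg_carrier)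
  qed (use c in auto)
qed

lemma alg_hom_free_unique:
  assumes "alg_hom (free_alg X) A f" "alg_hom (free_alg X) A g" "kalg A"
    and "\<And>x. x \<in> X \<Longrightarrow> f (free_gen x) = g (free_gen x)" and "p \<in> carrier (free_alg X)"
  shows "f p = g p"
proof (rule lin_map_eq_on_words[OF alg_homD(1)[OF assms(1)] alg_homD(1)[OF assms(2)] assms(3) _ assms(5)])
  interpret A: kalg A by fact
  fix w assume w: "w \<in> lists X"
  then have "A.word_prod (\<lambda>x. f (free_gen x)) w = A.word_prod (\<lambda>x. g (free_gen x)) w"
    by (induction w) (use assms(4) in auto)
  then show "f (Poly_Mapping.single w 1) = g (Poly_Mapping.single w 1)"
    using w by (simp add: alg_hom_free_single[OF assms(1,3)] alg_hom_free_single[OF assms(2,3)])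
qed

section \<open>Matrices over an algebra\<close>

definition amat :: "('b, 'z) ring_scheme \<Rightarrow> nat \<Rightarrow> nat \<Rightarrow> 'b mat \<Rightarrow> bool" where
  "amat A n m P \<longleftrightarrow> P \<in> carrier_mat n m \<and> (\<forall>i<n. \<forall>j<m. P $$ (i, j) \<in> carrier A)"

lemma amatD:
  "amat A n m P \<Longrightarrow> dim_row P = n" "amat A n m P \<Longrightarrow> dim_col P = m"
  "amat A n m P \<Longrightarrow> i < n \<Longrightarrow> j < m \<Longrightarrow> P $$ (i, j) \<in> carrier A"
  by (auto simp: amat_def)

lemma amat_transpose: "amat A n m P \<Longrightarrow> amat A m n (transpose_mat P)"
  by (auto simp: amat_def)

lemma amat_mat: "(\<And>i j. i < n \<Longrightarrow> j < m \<Longrightarrow> f (i, j) \<in> carrier A) \<Longrightarrow> amat A n m (mat n m f)"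
  by (auto simp: amat_def)

lemma amat_eqI:
  assumes "amat A n m P" "amat A n m Q" "\<And>i j. i < n \<Longrightarrow> j < m \<Longrightarrow> P $$ (i, j) = Q $$ (i, j)"
  shows "P = Q"
  using assms by (intro eq_matI) (auto simp: amat_def)

lemma amat_mult_index:
  "amat A n m P \<Longrightarrow> amat A m r Q \<Longrightarrow> i < n \<Longrightarrow> j < r \<Longrightarrow>
    amat_mult A P Q $$ (i, j) = (\<Oplus>\<^bsub>A\<^esub>l\<in>{..<m}. P $$ (i, l) \<otimes>\<^bsub>A\<^esub> Q $$ (l, j))"
  by (simp add: amat_mult_def amatD)

lemma alg_hom_amat:
  assumes "alg_hom A B f" "amat A n m P"
  shows "amat B n m (map_mat f P)"
  using assms by (auto simp: amat_def alg_homD)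

context kalg begin

lemma amat_mult_amat:
  assumes "amat A n m P" "amat A m r Q"
  shows "amat A n r (amat_mult A P Q)"
  unfolding amat_mult_def using amatD[OF assms(1)] amatD[OF assms(2)]
  by (simp, intro amat_mat) (auto intro!: finsum_closed)

lemma amat_mult_assoc:
  assumes P: "amat A n m P" and Q: "amat A m r Q" and R: "amat A r s R"
  shows "amat_mult A (amat_mult A P Q) R = amat_mult A P (amat_mult A Q R)"
proof (rule amat_eqI[of A n s])
  fix i j assume ij: "i < n" "j < s"
  have c: "\<And>l k. l < m \<Longrightarrow> k < r \<Longrightarrow> P $$ (i, l) \<in> carrier A \<and> Q $$ (l, k) \<in> carrier A \<and> R $$ (k, j) \<in> carrier A"
    using amatD(3)[OF P] amatD(3)[OF Q] amatD(3)[OF R] ij by auto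
  have P0: "P $$ (i, l) \<in> carrier A" if "l < m" for l using amatD(3)[OF P] ij that by auto
  have R0: "R $$ (k, j) \<in> carrier A" if "k < r" for k using amatD(3)[OF R] ij that by auto
  have Q0: "Q $$ (l, k) \<in> carrier A" if "l < m" "k < r" for l k using amatD(3)[OF Q] that by auto
  have "amat_mult A (amat_mult A P Q) R $$ (i, j) =
      (\<Oplus>k\<in>{..<r}. (\<Oplus>l\<in>{..<m}. P $$ (i, l) \<otimes> Q $$ (l, k)) \<otimes> R $$ (k, j))"
    unfolding amat_mult_index[OF amat_mult_amat[OF P Q] R ij]
    by (intro finsum_cong') (use ij P0 Q0 R0 in \<open>auto simp: amat_mult_index[OF P Q] intro!: finsum_closed\<close>)
  also have "\<dots> = (\<Oplus>k\<in>{..<r}. \<Oplus>l\<in>{..<m}. P $$ (i, l) \<otimes> Q $$ (l, k) \<otimes> R $$ (k, j))"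
    by (intro finsum_cong') (use P0 Q0 R0 in \<open>auto intro!: finsum_closed finsum_ldistr\<close>)
  also have "\<dots> = (\<Oplus>l\<in>{..<m}. \<Oplus>k\<in>{..<r}. P $$ (i, l) \<otimes> Q $$ (l, k) \<otimes> R $$ (k, j))"
    by (rule finsum_swap) (use P0 Q0 R0 in auto)
  also have "\<dots> = (\<Oplus>l\<in>{..<m}. \<Oplus>k\<in>{..<r}. P $$ (i, l) \<otimes> (Q $$ (l, k) \<otimes> R $$ (k, j)))"
    by (intro finsum_cong') (use P0 Q0 R0 in \<open>auto simp: m_assoc intro!: finsum_closed finsum_cong'\<close>)
  also have "\<dots> = (\<Oplus>l\<in>{..<m}. P $$ (i, l) \<otimes> (\<Oplus>k\<in>{..<r}. Q $$ (l, k) \<otimes> R $$ (k, j)))"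
    by (intro finsum_cong') (use P0 Q0 R0 in \<open>auto intro!: finsum_closed finsum_rdistr[symmetric]\<close>)
  also have "\<dots> = amat_mult A P (amat_mult A Q R) $$ (i, j)"
    unfolding amat_mult_index[OF P amat_mult_amat[OF Q R] ij]
    by (intro finsum_cong') (use ij P0 Q0 R0 in \<open>auto simp: amat_mult_index[OF Q R] intro!: finsum_closed\<close>)
  finally show "amat_mult A (amat_mult A P Q) R $$ (i, j) = amat_mult A P (amat_mult A Q R) $$ (i, j)" .
qed (use assms in \<open>auto intro!: amat_mult_amat\<close>)

lemma scalar_amat: "E \<in> carrier_mat n m \<Longrightarrow> amat A n m (scalar_mat A E)"
  by (auto simp: amat_def scalar_mat_def)

lemma scalar_index:
  "E \<in> carrier_mat n m \<Longrightarrow> i < n \<Longrightarrow> j < m \<Longrightarrow> scalar_mat A E $$ (i, j) = E $$ (i, j) \<odot> \<one>"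
  by (simp add: scalar_mat_def)

lemma finsum_smult_const: "x \<in> carrier A \<Longrightarrow> (\<Oplus>i\<in>S. f i \<odot> x) = (\<Sum>i\<in>S. f i) \<odot> x"
  by (induction S rule: infinite_finite_induct) (auto simp: smult_l_distr)

lemma scalar_mult_index_l:
  assumes "E \<in> carrier_mat n m" "amat A m r Q" "i < n" "j < r"
  shows "amat_mult A (scalar_mat A E) Q $$ (i, j) = (\<Oplus>l\<in>{..<m}. E $$ (i, l) \<odot> Q $$ (l, j))"
  unfolding amat_mult_index[OF scalar_amat[OF assms(1)] assms(2-4)]
  using assms amatD(3)[OF assms(2)] by (intro finsum_cong') (auto simp: scalar_index[of E n m] smult_mult_l)

lemma scalar_mult_index_r:
  assumes "E \<in> carrier_mat m r" "amat A n m Q" "i < n" "j < r"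
  shows "amat_mult A Q (scalar_mat A E) $$ (i, j) = (\<Oplus>l\<in>{..<m}. E $$ (l, j) \<odot> Q $$ (i, l))"
  unfolding amat_mult_index[OF assms(2) scalar_amat[OF assms(1)] assms(3,4)]
  using assms amatD(3)[OF assms(2)] by (intro finsum_cong') (auto simp: scalar_index[of E m r] smult_mult_r)

lemma scalar_mult:
  assumes "E \<in> carrier_mat n m" "F \<in> carrier_mat m r"
  shows "amat_mult A (scalar_mat A E) (scalar_mat A F) = scalar_mat A (E * F)"
proof (rule amat_eqI[of A n r])
  fix i j assume ij: "i < n" "j < r"
  have "amat_mult A (scalar_mat A E) (scalar_mat A F) $$ (i, j) =
      (\<Oplus>l\<in>{..<m}. E $$ (i, l) \<odot> scalar_mat A F $$ (l, j))"
    by (rule scalar_mult_index_l[OF assms(1) scalar_amat[OF assms(2)] ij])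
  also have "\<dots> = (\<Oplus>l\<in>{..<m}. (E $$ (i, l) * F $$ (l, j)) \<odot> \<one>)"
    using ij assms by (intro finsum_cong') (auto simp: scalar_index[OF assms(2)] smult_assoc)
  also have "\<dots> = scalar_mat A (E * F) $$ (i, j)"
    using ij assms
    by (simp add: finsum_smult_const scalar_index[of _ n r] scalar_prod_def atLeast0LessThan)
  finally show "amat_mult A (scalar_mat A E) (scalar_mat A F) $$ (i, j) = scalar_mat A (E * F) $$ (i, j)" .
qed (use assms in \<open>auto intro!: amat_mult_amat scalar_amat\<close>)

lemma scalar_one_l: "amat A n m P \<Longrightarrow> amat_mult A (scalar_mat A (1\<^sub>m n)) P = P"
proof (rule amat_eqI[of A n m])
  fix i j assume P: "amat A n m P" and ij: "i < n" "j < m"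
  show "amat_mult A (scalar_mat A (1\<^sub>m n)) P $$ (i, j) = P $$ (i, j)"
    unfolding scalar_mult_index_l[OF one_carrier_mat P ij]
    using ij amatD(3)[OF P] by (subst finsum_single[of _ i]) auto
qed (auto intro!: amat_mult_amat scalar_amat)

lemma scalar_one_r: "amat A n m P \<Longrightarrow> amat_mult A P (scalar_mat A (1\<^sub>m m)) = P"
proof (rule amat_eqI[of A n m])
  fix i j assume P: "amat A n m P" and ij: "i < n" "j < m"
  show "amat_mult A P (scalar_mat A (1\<^sub>m m)) $$ (i, j) = P $$ (i, j)"
    unfolding scalar_mult_index_r[OF one_carrier_mat P ij]
    using ij amatD(3)[OF P] by (subst finsum_single[of _ j]) auto
qed (auto intro!: amat_mult_amat scalar_amat)

lemma transpose_scalar: "transpose_mat (scalar_mat A E) = scalar_mat A (transpose_mat E)"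
  by (auto simp: scalar_mat_def)

text \<open>Transposition reverses a product only up to the order of the factors inside each entry, whence the
commutation hypothesis. It holds when one factor is a scalar matrix.\<close>
lemma transpose_amat_mult:
  assumes P: "amat A n m P" and Q: "amat A m r Q"
    and comm: "\<And>i l j. i < n \<Longrightarrow> l < m \<Longrightarrow> j < r \<Longrightarrow>
      P $$ (i, l) \<otimes> Q $$ (l, j) = Q $$ (l, j) \<otimes> P $$ (i, l)"
  shows "transpose_mat (amat_mult A P Q) = amat_mult A (transpose_mat Q) (transpose_mat P)"
proof (rule amat_eqI[of A r n])
  fix i j assume ij: "i < r" "j < n"
  note Qt = amat_transpose[OF Q] and Pt = amat_transpose[OF P]
  have "transpose_mat (amat_mult A P Q) $$ (i, j) = amat_mult A P Q $$ (j, i)"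
    using ij amat_mult_amat[OF P Q] by (auto simp: amat_def)
  also have "\<dots> = (\<Oplus>l\<in>{..<m}. P $$ (j, l) \<otimes> Q $$ (l, i))"
    by (rule amat_mult_index[OF P Q ij(2,1)])
  also have "\<dots> = (\<Oplus>l\<in>{..<m}. transpose_mat Q $$ (i, l) \<otimes> transpose_mat P $$ (l, j))"
    using ij comm amatD[OF P] amatD[OF Q] by (intro finsum_cong') auto
  also have "\<dots> = amat_mult A (transpose_mat Q) (transpose_mat P) $$ (i, j)"
    by (rule amat_mult_index[OF Qt Pt ij, symmetric])
  finally show "transpose_mat (amat_mult A P Q) $$ (i, j) =
      amat_mult A (transpose_mat Q) (transpose_mat P) $$ (i, j)" .
qed (use assms in \<open>auto intro!: amat_mult_amat amat_transpose\<close>)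

lemma transpose_scalar_mult_l:
  assumes "E \<in> carrier_mat n m" "amat A m r Q"
  shows "transpose_mat (amat_mult A (scalar_mat A E) Q) =
    amat_mult A (transpose_mat Q) (scalar_mat A (transpose_mat E))"
  using transpose_amat_mult[OF scalar_amat[OF assms(1)] assms(2)] assms amatD(3)[OF assms(2)]
  by (simp add: transpose_scalar scalar_index[OF assms(1)] smult_mult_l smult_mult_r)

lemma transpose_scalar_mult_r:
  assumes "amat A n m Q" "E \<in> carrier_mat m r"
  shows "transpose_mat (amat_mult A Q (scalar_mat A E)) =
    amat_mult A (scalar_mat A (transpose_mat E)) (transpose_mat Q)"
  using transpose_amat_mult[OF assms(1) scalar_amat[OF assms(2)]] assms amatD(3)[OF assms(1)]
  by (simp add: transpose_scalar scalar_index[OF assms(2)] smult_mult_l smult_mult_r)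

end

lemma alg_hom_amat_mult:
  assumes "alg_hom A B f" "kalg A" "kalg B" "amat A n m P" "amat A m r Q"
  shows "map_mat f (amat_mult A P Q) = amat_mult B (map_mat f P) (map_mat f Q)"
proof (rule amat_eqI[of B n r])
  interpret A: kalg A by fact
  interpret B: kalg B by fact
  note fP = alg_hom_amat[OF assms(1,4)] and fQ = alg_hom_amat[OF assms(1,5)]
  show "amat B n r (map_mat f (amat_mult A P Q))"
    by (rule alg_hom_amat[OF assms(1) A.amat_mult_amat[OF assms(4,5)]])
  show "amat B n r (amat_mult B (map_mat f P) (map_mat f Q))"
    by (rule B.amat_mult_amat[OF fP fQ])
  fix i j assume ij: "i < n" "j < r"
  have "map_mat f (amat_mult A P Q) $$ (i, j) = f (amat_mult A P Q $$ (i, j))"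
    using ij A.amat_mult_amat[OF assms(4,5)] by (auto simp: amat_def)
  also have "\<dots> = (\<Oplus>\<^bsub>B\<^esub>l\<in>{..<m}. f (P $$ (i, l) \<otimes>\<^bsub>A\<^esub> Q $$ (l, j)))"
    unfolding amat_mult_index[OF assms(4,5) ij] using ij
    by (intro lin_map_finsum[OF alg_homD(1)[OF assms(1)] assms(2,3)])
      (auto intro!: A.m_closed simp: amatD(3)[OF assms(4)] amatD(3)[OF assms(5)])
  also have "\<dots> = (\<Oplus>\<^bsub>B\<^esub>l\<in>{..<m}. map_mat f P $$ (i, l) \<otimes>\<^bsub>B\<^esub> map_mat f Q $$ (l, j))"
    using ij alg_homD(3,4)[OF assms(1)] amatD[OF assms(4)] amatD[OF assms(5)]
    by (intro B.finsum_cong') auto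
  also have "\<dots> = amat_mult B (map_mat f P) (map_mat f Q) $$ (i, j)"
    by (rule amat_mult_index[OF fP fQ ij, symmetric])
  finally show "map_mat f (amat_mult A P Q) $$ (i, j) = amat_mult B (map_mat f P) (map_mat f Q) $$ (i, j)" .
qed

lemma alg_hom_scalar_mat:
  assumes "alg_hom A B f" "kalg A"
  shows "map_mat f (scalar_mat A E) = scalar_mat B E"
proof -
  interpret A: kalg A by fact
  show ?thesis
    using alg_homD(2)[OF assms(1)] lin_mapD(3)[OF alg_homD(1)[OF assms(1)]]
    by (auto simp: scalar_mat_def)
qed

section \<open>Tensor products\<close>

definition bilin ::
  "('k, 'a, 'z) module_scheme \<Rightarrow> ('k, 'b, 'w) module_scheme \<Rightarrow> ('k, 'c, 'v) module_scheme
    \<Rightarrow> ('a \<Rightarrow> 'b \<Rightarrow> 'c) \<Rightarrow> bool" where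
  "bilin A B C \<beta> \<longleftrightarrow> (\<forall>x\<in>carrier A. lin_map B C (\<beta> x)) \<and> (\<forall>y\<in>carrier B. lin_map A C (\<lambda>x. \<beta> x y))"

text \<open>The map on the tensor product induced by a bilinear map, evaluated on representatives.\<close>
definition tensor_lift :: "('k::field, 'c, 'v) module_scheme \<Rightarrow> ('a \<Rightarrow> 'b \<Rightarrow> 'c) \<Rightarrow> (('a \<times> 'b) \<Rightarrow>\<^sub>0 'k) set \<Rightarrow> 'c" where
  "tensor_lift C \<beta> X = the_elem (lin_ext C (\<lambda>(x, y). \<beta> x y) ` X)"

locale kalg_pair = A: kalg A + B: kalg B
  for A :: "('k::field, 'a, 'z) module_scheme" and B :: "('k, 'b, 'w) module_scheme"
begin

lemma pair_monoid: "Group.monoid (A \<times>\<times> B)"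
  by (rule DirProd_monoid[OF A.monoid_axioms B.monoid_axioms])

lemma kalg_pre: "kalg (tensor_pre A B)"
  unfolding tensor_pre_def by (rule kalg_monoid_alg[OF pair_monoid])

lemma pre_simps:
  "carrier (tensor_pre A B) = {p. Poly_Mapping.keys p \<subseteq> carrier A \<times> carrier B}"
  "\<one>\<^bsub>tensor_pre A B\<^esub> = Poly_Mapping.single (\<one>\<^bsub>A\<^esub>, \<one>\<^bsub>B\<^esub>) 1" "\<zero>\<^bsub>tensor_pre A B\<^esub> = 0"
  "p \<oplus>\<^bsub>tensor_pre A B\<^esub> q = p + q" "c \<odot>\<^bsub>tensor_pre A B\<^esub> p = pm_scale c p"
  by (simp_all add: tensor_pre_def monoid_alg_simps)

lemma pre_mult:
  "Poly_Mapping.single (x, y) c \<otimes>\<^bsub>tensor_pre A B\<^esub> Poly_Mapping.single (x', y') d =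
    Poly_Mapping.single (x \<otimes>\<^bsub>A\<^esub> x', y \<otimes>\<^bsub>B\<^esub> y') (c * d)"
  "(p + p') \<otimes>\<^bsub>tensor_pre A B\<^esub> q = p \<otimes>\<^bsub>tensor_pre A B\<^esub> q + p' \<otimes>\<^bsub>tensor_pre A B\<^esub> q"
  "p \<otimes>\<^bsub>tensor_pre A B\<^esub> (q + q') = p \<otimes>\<^bsub>tensor_pre A B\<^esub> q + p \<otimes>\<^bsub>tensor_pre A B\<^esub> q'"
  "pm_scale c p \<otimes>\<^bsub>tensor_pre A B\<^esub> q = pm_scale c (p \<otimes>\<^bsub>tensor_pre A B\<^esub> q)"
  "p \<otimes>\<^bsub>tensor_pre A B\<^esub> pm_scale c q = pm_scale c (p \<otimes>\<^bsub>tensor_pre A B\<^esub> q)"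
  by (simp_all add: tensor_pre_def monoid_alg_l_distr monoid_alg_r_distr monoid_alg_scale_l monoid_alg_scale_r)

sublocale pm: vector_space "pm_scale :: 'k \<Rightarrow> ('x \<Rightarrow>\<^sub>0 'k) \<Rightarrow> ('x \<Rightarrow>\<^sub>0 'k)"
  by (rule vector_space_pm_scale)

lemma pre_minus_mult:
  "(p - p') \<otimes>\<^bsub>tensor_pre A B\<^esub> q = p \<otimes>\<^bsub>tensor_pre A B\<^esub> q - p' \<otimes>\<^bsub>tensor_pre A B\<^esub> q"
  "p \<otimes>\<^bsub>tensor_pre A B\<^esub> (q - q') = p \<otimes>\<^bsub>tensor_pre A B\<^esub> q - p \<otimes>\<^bsub>tensor_pre A B\<^esub> q'"
  using pre_mult(2)[of "p - p'" p' q] pre_mult(3)[of p "q - q'" q'] by (simp_all add: algebra_simps)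

lemma rels_carrier: "tensor_rels A B \<subseteq> carrier (tensor_pre A B)"
proof -
  have s: "Poly_Mapping.single (x, y) c \<in> carrier (tensor_pre A B)"
    if "x \<in> carrier A" "y \<in> carrier B" for x y c
    using that by (auto simp: pre_simps)
  have d: "p - q \<in> carrier (tensor_pre A B)" "p + q \<in> carrier (tensor_pre A B)"
    if "p \<in> carrier (tensor_pre A B)" "q \<in> carrier (tensor_pre A B)" for p q
    using that keys_diff[of p q] keys_add[of p q] by (auto simp: pre_simps)
  show ?thesis unfolding tensor_rels_def by (auto intro!: s d)
qed

lemma null_carrier: "tensor_null A B \<subseteq> carrier (tensor_pre A B)"
proof
  fix p assume "p \<in> tensor_null A B"
  then show "p \<in> carrier (tensor_pre A B)"
    unfolding tensor_null_def
  proof (induction p rule: pm.span_induct_alt)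
    case base
    then show ?case by (auto simp: pre_simps)
  next
    case (step c x y)
    interpret P: kalg "tensor_pre A B" by (rule kalg_pre)
    have "c \<odot>\<^bsub>tensor_pre A B\<^esub> x \<oplus>\<^bsub>tensor_pre A B\<^esub> y \<in> carrier (tensor_pre A B)"
      using step rels_carrier by (intro P.a_closed P.smult_closed) auto
    then show ?case by (simp add: pre_simps)
  qed
qed

lemma rels_intros:
  "x \<in> carrier A \<Longrightarrow> x' \<in> carrier A \<Longrightarrow> y \<in> carrier B \<Longrightarrow>
    Poly_Mapping.single (x \<oplus>\<^bsub>A\<^esub> x', y) 1
       - (Poly_Mapping.single (x, y) 1 + Poly_Mapping.single (x', y) 1) \<in> tensor_rels A B"
  "x \<in> carrier A \<Longrightarrow> y \<in> carrier B \<Longrightarrow> y' \<in> carrier B \<Longrightarrow>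
    Poly_Mapping.single (x, y \<oplus>\<^bsub>B\<^esub> y') 1
       - (Poly_Mapping.single (x, y) 1 + Poly_Mapping.single (x, y') 1) \<in> tensor_rels A B"
  "x \<in> carrier A \<Longrightarrow> y \<in> carrier B \<Longrightarrow>
    Poly_Mapping.single (d \<odot>\<^bsub>A\<^esub> x, y) 1 - Poly_Mapping.single (x, y) d \<in> tensor_rels A B"
  "x \<in> carrier A \<Longrightarrow> y \<in> carrier B \<Longrightarrow>
    Poly_Mapping.single (x, d \<odot>\<^bsub>B\<^esub> y) 1 - Poly_Mapping.single (x, y) d \<in> tensor_rels A B"
  unfolding tensor_rels_def by blast+

text \<open>Multiplying a bilinearity relation by a pure tensor gives the same relation for the multiplied
entries. Hence the span of the relations is an ideal.\<close>
lemma rels_mult: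
  assumes "r \<in> tensor_rels A B" "u \<in> carrier A" "v \<in> carrier B"
  shows "Poly_Mapping.single (u, v) 1 \<otimes>\<^bsub>tensor_pre A B\<^esub> r \<in> tensor_rels A B \<and>
    r \<otimes>\<^bsub>tensor_pre A B\<^esub> Poly_Mapping.single (u, v) 1 \<in> tensor_rels A B"
  using assms(1) unfolding tensor_rels_def[of A B] Un_iff
proof (elim disjE CollectE exE conjE, goal_cases)
  case (1 x x' y)
  then show ?case
    using assms(2,3) rels_intros(1)[of "u \<otimes>\<^bsub>A\<^esub> x" "u \<otimes>\<^bsub>A\<^esub> x'" "v \<otimes>\<^bsub>B\<^esub> y"]
      rels_intros(1)[of "x \<otimes>\<^bsub>A\<^esub> u" "x' \<otimes>\<^bsub>A\<^esub> u" "y \<otimes>\<^bsub>B\<^esub> v"]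
    by (simp add: pre_mult pre_minus_mult A.r_distr A.l_distr tensor_rels_def)
next
  case (2 x y y')
  then show ?case
    using assms(2,3) rels_intros(2)[of "u \<otimes>\<^bsub>A\<^esub> x" "v \<otimes>\<^bsub>B\<^esub> y" "v \<otimes>\<^bsub>B\<^esub> y'"]
      rels_intros(2)[of "x \<otimes>\<^bsub>A\<^esub> u" "y \<otimes>\<^bsub>B\<^esub> v" "y' \<otimes>\<^bsub>B\<^esub> v"]
    by (simp add: pre_mult pre_minus_mult B.r_distr B.l_distr tensor_rels_def)
next
  case (3 d x y)
  then show ?case
    using assms(2,3) rels_intros(3)[of "u \<otimes>\<^bsub>A\<^esub> x" "v \<otimes>\<^bsub>B\<^esub> y" d]
      rels_intros(3)[of "x \<otimes>\<^bsub>A\<^esub> u" "y \<otimes>\<^bsub>B\<^esub> v" d]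
    by (simp add: pre_mult pre_minus_mult A.smult_mult_r A.smult_mult_l tensor_rels_def)
next
  case (4 d x y)
  then show ?case
    using assms(2,3) rels_intros(4)[of "u \<otimes>\<^bsub>A\<^esub> x" "v \<otimes>\<^bsub>B\<^esub> y" d]
      rels_intros(4)[of "x \<otimes>\<^bsub>A\<^esub> u" "y \<otimes>\<^bsub>B\<^esub> v" d]
    by (simp add: pre_mult pre_minus_mult B.smult_mult_r B.smult_mult_l tensor_rels_def)
qed

lemma null_mult:
  assumes "n \<in> tensor_null A B" "p \<in> carrier (tensor_pre A B)"
  shows "p \<otimes>\<^bsub>tensor_pre A B\<^esub> n \<in> tensor_null A B \<and> n \<otimes>\<^bsub>tensor_pre A B\<^esub> p \<in> tensor_null A B"
proof -
  have z: "0 \<otimes>\<^bsub>tensor_pre A B\<^esub> q = 0" "q \<otimes>\<^bsub>tensor_pre A B\<^esub> 0 = 0" for q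
    by (simp_all add: tensor_pre_def)
  have *: "Poly_Mapping.single (u, v) 1 \<otimes>\<^bsub>tensor_pre A B\<^esub> n \<in> tensor_null A B \<and>
      n \<otimes>\<^bsub>tensor_pre A B\<^esub> Poly_Mapping.single (u, v) 1 \<in> tensor_null A B"
    if "u \<in> carrier A" "v \<in> carrier B" for u v
    using assms(1) unfolding tensor_null_def
  proof (induction n rule: pm.span_induct_alt)
    case base
    then show ?case by (simp add: z pm.span_zero)
  next
    case (step c x y)
    have "pm_scale c (Poly_Mapping.single (u, v) 1 \<otimes>\<^bsub>tensor_pre A B\<^esub> x) \<in> pm.span (tensor_rels A B)"
      "pm_scale c (x \<otimes>\<^bsub>tensor_pre A B\<^esub> Poly_Mapping.single (u, v) 1) \<in> pm.span (tensor_rels A B)"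
      using rels_mult[OF step(1) that] by (auto intro: pm.span_scale pm.span_base)
    then show ?case using step(2) by (simp add: pre_mult pm.span_add)
  qed
  have "Poly_Mapping.keys p \<subseteq> carrier A \<times> carrier B" using assms(2) by (simp add: pre_simps)
  then show ?thesis
  proof (induction p rule: pm_induct)
    case zero
    then show ?case by (simp add: z tensor_null_def pm.span_zero)
  next
    case (single x c)
    obtain u v where x: "x = (u, v)" "u \<in> carrier A" "v \<in> carrier B" using single by auto
    have s: "Poly_Mapping.single x c = pm_scale c (Poly_Mapping.single (u, v) 1)" by (simp add: x)
    show ?case using *[OF x(2,3)] unfolding s pre_mult tensor_null_def
      by (auto intro: pm.span_scale)
  next
    case (add p q)
    then show ?case unfolding pre_mult tensor_null_def by (auto intro: pm.span_add)
  qed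
qed

lemma null_ideal: "ideal (tensor_null A B) (tensor_pre A B)"
proof -
  interpret P: kalg "tensor_pre A B" by (rule kalg_pre)
  show ?thesis
  proof (rule idealI[OF P.ring_axioms])
    show "subgroup (tensor_null A B) (add_monoid (tensor_pre A B))"
    proof (rule P.add.subgroupI)
      show "tensor_null A B \<subseteq> carrier (tensor_pre A B)" by (rule null_carrier)
      show "tensor_null A B \<noteq> {}" unfolding tensor_null_def using pm.span_zero by blast
      fix a b assume a: "a \<in> tensor_null A B" and b: "b \<in> tensor_null A B"
      show "a \<oplus>\<^bsub>tensor_pre A B\<^esub> b \<in> tensor_null A B"
        using a b by (simp add: pre_simps tensor_null_def pm.span_add)
      have "\<ominus>\<^bsub>tensor_pre A B\<^esub> a = pm_scale (-1) a"
        using a null_carrier P.smult_minus_one[of a] by (auto simp: pre_simps)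
      then show "\<ominus>\<^bsub>tensor_pre A B\<^esub> a \<in> tensor_null A B"
        using a by (simp add: tensor_null_def pm.span_neg)
    qed
  qed (use null_mult in auto)
qed

sublocale T: kalg_ideal "tensor_pre A B" "tensor_null A B"
  by (intro kalg_ideal.intro kalg_pre null_ideal)

lemma kalg_tensor: "kalg (tensor_alg A B)"
  unfolding tensor_alg_def by (rule T.quot_kalg)

lemma single_pre_carrier [simp]:
  "x \<in> carrier A \<Longrightarrow> y \<in> carrier B \<Longrightarrow> Poly_Mapping.single (x, y) c \<in> carrier (tensor_pre A B)"
  by (auto simp: pre_simps)

lemma pure_closed: "x \<in> carrier A \<Longrightarrow> y \<in> carrier B \<Longrightarrow> pure_tensor A B x y \<in> carrier (tensor_alg A B)"
  by (auto simp: pure_tensor_def tensor_alg_def T.quot_carrier)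

lemma pure_one: "pure_tensor A B \<one>\<^bsub>A\<^esub> \<one>\<^bsub>B\<^esub> = \<one>\<^bsub>tensor_alg A B\<^esub>"
  by (simp add: pure_tensor_def tensor_alg_def T.quot_ops pre_simps)

lemma pure_mult:
  "x \<in> carrier A \<Longrightarrow> y \<in> carrier B \<Longrightarrow> x' \<in> carrier A \<Longrightarrow> y' \<in> carrier B \<Longrightarrow>
    pure_tensor A B x y \<otimes>\<^bsub>tensor_alg A B\<^esub> pure_tensor A B x' y' =
    pure_tensor A B (x \<otimes>\<^bsub>A\<^esub> x') (y \<otimes>\<^bsub>B\<^esub> y')"
  by (simp add: pure_tensor_def tensor_alg_def T.quot_ops pre_mult)

lemma pre_minus:
  "p \<in> carrier (tensor_pre A B) \<Longrightarrow> q \<in> carrier (tensor_pre A B) \<Longrightarrow> p \<ominus>\<^bsub>tensor_pre A B\<^esub> q = p - q"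
  using T.smult_minus_one[of q]
  by (auto simp: a_minus_def pre_simps intro!: poly_mapping_eqI simp: lookup_add lookup_minus)

lemma coset_rel_eq:
  assumes "p - q \<in> tensor_rels A B" "p \<in> carrier (tensor_pre A B)" "q \<in> carrier (tensor_pre A B)"
  shows "tensor_null A B +>\<^bsub>tensor_pre A B\<^esub> p = tensor_null A B +>\<^bsub>tensor_pre A B\<^esub> q"
proof -
  have "p - q \<in> tensor_null A B" using assms(1) by (simp add: tensor_null_def pm.span_base)
  then show ?thesis using assms(2,3) by (simp add: T.coset_eq_iff pre_minus)
qed

lemma pure_bilin: "bilin A B (tensor_alg A B) (pure_tensor A B)"
  unfolding bilin_def
proof (intro conjI ballI lin_mapI)
  fix x y and c :: 'k
  assume c: "x \<in> carrier A" "y \<in> carrier B"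
  show "pure_tensor A B x y \<in> carrier (tensor_alg A B)" by (rule pure_closed[OF c])
  then show "pure_tensor A B x y \<in> carrier (tensor_alg A B)" .
  have e: "Poly_Mapping.single (x, y) c = pm_scale c (Poly_Mapping.single (x, y) 1)" by simp
  show "pure_tensor A B x (c \<odot>\<^bsub>B\<^esub> y) = c \<odot>\<^bsub>tensor_alg A B\<^esub> pure_tensor A B x y"
    unfolding pure_tensor_def tensor_alg_def using c
    by (simp add: T.quot_smult pre_simps coset_rel_eq rels_intros)
  show "pure_tensor A B (c \<odot>\<^bsub>A\<^esub> x) y = c \<odot>\<^bsub>tensor_alg A B\<^esub> pure_tensor A B x y"
    unfolding pure_tensor_def tensor_alg_def using c
    by (simp add: T.quot_smult pre_simps coset_rel_eq rels_intros)
next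
  fix x y y' assume c: "x \<in> carrier A" "y \<in> carrier B" "y' \<in> carrier B"
  have "Poly_Mapping.single (x, y) 1 + Poly_Mapping.single (x, y') 1 \<in> carrier (tensor_pre A B)"
    using c T.add.m_closed[of "Poly_Mapping.single (x, y) 1" "Poly_Mapping.single (x, y') 1"]
    by (simp add: pre_simps(4))
  then show "pure_tensor A B x (y \<oplus>\<^bsub>B\<^esub> y') =
      pure_tensor A B x y \<oplus>\<^bsub>tensor_alg A B\<^esub> pure_tensor A B x y'"
    unfolding pure_tensor_def tensor_alg_def using c
    by (simp add: T.quot_ops pre_simps(4) coset_rel_eq rels_intros)
next
  fix x x' y assume c: "y \<in> carrier B" "x \<in> carrier A" "x' \<in> carrier A"
  have "Poly_Mapping.single (x, y) 1 + Poly_Mapping.single (x', y) 1 \<in> carrier (tensor_pre A B)"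
    using c T.add.m_closed[of "Poly_Mapping.single (x, y) 1" "Poly_Mapping.single (x', y) 1"]
    by (simp add: pre_simps(4))
  then show "pure_tensor A B (x \<oplus>\<^bsub>A\<^esub> x') y =
      pure_tensor A B x y \<oplus>\<^bsub>tensor_alg A B\<^esub> pure_tensor A B x' y"
    unfolding pure_tensor_def tensor_alg_def using c
    by (simp add: T.quot_ops pre_simps(4) coset_rel_eq rels_intros)
qed

lemma tensor_lin_eq:
  assumes "lin_map (tensor_alg A B) C f" "lin_map (tensor_alg A B) C g" "kalg C"
    and "\<And>x y. x \<in> carrier A \<Longrightarrow> y \<in> carrier B \<Longrightarrow> f (pure_tensor A B x y) = g (pure_tensor A B x y)"
    and "X \<in> carrier (tensor_alg A B)"
  shows "f X = g X"
proof -
  interpret C: kalg C by fact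
  let ?q = "\<lambda>p. tensor_null A B +>\<^bsub>tensor_pre A B\<^esub> p"
  have q: "lin_map (tensor_pre A B) (tensor_alg A B) ?q"
    unfolding tensor_alg_def using T.quot_hom by (rule alg_homD(1))
  note f = lin_map_comp[OF q assms(1)] and g = lin_map_comp[OF q assms(2)]
  obtain p where p: "X = ?q p" "p \<in> carrier (tensor_pre A B)"
    using assms(5) by (auto simp: tensor_alg_def T.quot_carrier)
  from p(2) have "Poly_Mapping.keys p \<subseteq> carrier A \<times> carrier B" by (simp add: pre_simps)
  then have "f (?q p) = g (?q p)"
  proof (induction p rule: pm_induct)
    case zero
    then show ?case
      using lin_map_zero[OF f kalg_pre assms(3)] lin_map_zero[OF g kalg_pre assms(3)]
      by (simp add: pre_simps)
  next
    case (single x c)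
    obtain u v where x: "x = (u, v)" "u \<in> carrier A" "v \<in> carrier B" using single by auto
    have s: "Poly_Mapping.single x c = c \<odot>\<^bsub>tensor_pre A B\<^esub> Poly_Mapping.single (u, v) 1"
      by (simp add: x pre_simps)
    show ?case unfolding s
      using lin_mapD(3)[OF f, of "Poly_Mapping.single (u, v) 1" c]
        lin_mapD(3)[OF g, of "Poly_Mapping.single (u, v) 1" c] assms(4)[OF x(2,3)] x
      by (simp add: pure_tensor_def)
  next
    case (add p q)
    then show ?case
      using lin_mapD(2)[OF f, of p q] lin_mapD(2)[OF g, of p q] by (simp add: pre_simps)
  qed
  then show ?thesis using p by simp
qed

lemma tensor_lift:
  assumes "kalg C" "bilin A B C \<beta>"
  shows "lin_map (tensor_alg A B) C (tensor_lift C \<beta>)"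
    and "x \<in> carrier A \<Longrightarrow> y \<in> carrier B \<Longrightarrow> tensor_lift C \<beta> (pure_tensor A B x y) = \<beta> x y"
proof -
  interpret C: kalg C by fact
  let ?b = "\<lambda>(x, y). \<beta> x y"
  have b1: "lin_map B C (\<beta> x)" if "x \<in> carrier A" for x using assms(2) that by (simp add: bilin_def)
  have b2: "lin_map A C (\<lambda>x. \<beta> x y)" if "y \<in> carrier B" for y using assms(2) that by (simp add: bilin_def)
  have bc: "?b \<in> carrier (A \<times>\<times> B) \<rightarrow> carrier C" using lin_mapD(1)[OF b1] by auto
  have lin: "lin_map (tensor_pre A B) C (lin_ext C ?b)"
    unfolding tensor_pre_def by (rule C.lin_ext_lin_map[OF bc])
  have bcl: "\<beta> x y \<in> carrier C" if "x \<in> carrier A" "y \<in> carrier B" for x y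
    using lin_mapD(1)[OF b1] that by auto
  have s: "lin_ext C ?b (Poly_Mapping.single (x, y) c) = c \<odot>\<^bsub>C\<^esub> \<beta> x y"
    if "x \<in> carrier A" "y \<in> carrier B" for x y c using bcl[OF that] by simp
  have mi: "lin_ext C ?b (p - q) = \<zero>\<^bsub>C\<^esub>" if "p \<in> carrier (tensor_pre A B)" "q \<in> carrier (tensor_pre A B)"
    "lin_ext C ?b p = lin_ext C ?b q" for p q
    using lin_map_minus[OF lin kalg_pre assms(1) that(1,2)] that(3) lin_mapD(1)[OF lin that(2)]
    unfolding pre_minus[OF that(1,2)] by (simp add: a_minus_def C.r_neg)
  have ad: "p + q \<in> carrier (tensor_pre A B) \<and> lin_ext C ?b (p + q) = lin_ext C ?b p \<oplus>\<^bsub>C\<^esub> lin_ext C ?b q"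
    if "p \<in> carrier (tensor_pre A B)" "q \<in> carrier (tensor_pre A B)" for p q
    using lin_mapD(2)[OF lin that] T.add.m_closed[OF that] by (simp add: pre_simps(4))
  have rel: "lin_ext C ?b r = \<zero>\<^bsub>C\<^esub>" if "r \<in> tensor_rels A B" for r
    using that unfolding tensor_rels_def
    by (elim UnE CollectE exE conjE; simp only:; intro mi)
      (auto simp: ad s bcl lin_mapD[OF b1] lin_mapD[OF b2] simp del: split_paired_All)
  have null: "lin_ext C ?b r = \<zero>\<^bsub>C\<^esub>" if "r \<in> tensor_null A B" for r
  proof -
    have "r \<in> carrier (tensor_pre A B) \<and> lin_ext C ?b r = \<zero>\<^bsub>C\<^esub>"
      using that unfolding tensor_null_def
    proof (induction r rule: pm.span_induct_alt)
      case base
      then show ?case by (auto simp: pre_simps)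
    next
      case (step c x y)
      then have x: "x \<in> carrier (tensor_pre A B)" using rels_carrier by auto
      have cx: "pm_scale c x \<in> carrier (tensor_pre A B)" "lin_ext C ?b (pm_scale c x) = \<zero>\<^bsub>C\<^esub>"
        using T.smult_closed[OF x, of c] lin_mapD(3)[OF lin x, of c] rel[OF step(1)]
        by (simp_all add: pre_simps(5))
      show ?case using ad[OF cx(1), of y] step cx by simp
    qed
    then show ?thesis ..
  qed
  note L = T.quot_lift_lin[OF assms(1) lin null]
  show "lin_map (tensor_alg A B) C (tensor_lift C \<beta>)"
    unfolding tensor_alg_def tensor_lift_def[abs_def] by (rule L(2))
  show "tensor_lift C \<beta> (pure_tensor A B x y) = \<beta> x y" if "x \<in> carrier A" "y \<in> carrier B"
    unfolding tensor_lift_def pure_tensor_def using L(1) s[OF that, of 1] bcl[OF that] that by simp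
qed

text \<open>Multiplicativity is bilinear in both arguments, so it suffices to check it on pure tensors.\<close>
lemma tensor_lift_hom:
  assumes "kalg C" "bilin A B C \<beta>" "\<beta> \<one>\<^bsub>A\<^esub> \<one>\<^bsub>B\<^esub> = \<one>\<^bsub>C\<^esub>"
    and m: "\<And>x y x' y'. x \<in> carrier A \<Longrightarrow> y \<in> carrier B \<Longrightarrow> x' \<in> carrier A \<Longrightarrow> y' \<in> carrier B \<Longrightarrow>
      \<beta> (x \<otimes>\<^bsub>A\<^esub> x') (y \<otimes>\<^bsub>B\<^esub> y') = \<beta> x y \<otimes>\<^bsub>C\<^esub> \<beta> x' y'"
  shows "alg_hom (tensor_alg A B) C (tensor_lift C \<beta>)"
proof -
  interpret C: kalg C by fact
  interpret TT: kalg "tensor_alg A B" by (rule kalg_tensor)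
  let ?h = "tensor_lift C \<beta>"
  note L = tensor_lift[OF assms(1,2)]
  have one: "?h \<one>\<^bsub>tensor_alg A B\<^esub> = \<one>\<^bsub>C\<^esub>"
    using L(2)[of "\<one>\<^bsub>A\<^esub>" "\<one>\<^bsub>B\<^esub>"] assms(3) by (simp add: pure_one)
  have ml: "lin_map (tensor_alg A B) (tensor_alg A B) (\<lambda>Y. X \<otimes>\<^bsub>tensor_alg A B\<^esub> Y)"
    "lin_map (tensor_alg A B) (tensor_alg A B) (\<lambda>Y. Y \<otimes>\<^bsub>tensor_alg A B\<^esub> X)"
    if "X \<in> carrier (tensor_alg A B)" for X
    using that by (auto simp: lin_map_def TT.r_distr TT.l_distr TT.smult_mult_r TT.smult_mult_l)
  have cl: "lin_map C C (\<lambda>Y. X \<otimes>\<^bsub>C\<^esub> Y)" "lin_map C C (\<lambda>Y. Y \<otimes>\<^bsub>C\<^esub> X)" if "X \<in> carrier C" for X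
    using that by (auto simp: lin_map_def C.r_distr C.l_distr C.smult_mult_r C.smult_mult_l)
  have 1: "?h (pure_tensor A B x y \<otimes>\<^bsub>tensor_alg A B\<^esub> Y) = ?h (pure_tensor A B x y) \<otimes>\<^bsub>C\<^esub> ?h Y"
    if "x \<in> carrier A" "y \<in> carrier B" "Y \<in> carrier (tensor_alg A B)" for x y Y
    using _ _ assms(1) _ that(3)
  proof (rule tensor_lin_eq)
    show "lin_map (tensor_alg A B) C (\<lambda>Y. ?h (pure_tensor A B x y \<otimes>\<^bsub>tensor_alg A B\<^esub> Y))"
      by (rule lin_map_comp[OF ml(1) L(1)]) (rule pure_closed[OF that(1,2)])
    show "lin_map (tensor_alg A B) C (\<lambda>Y. ?h (pure_tensor A B x y) \<otimes>\<^bsub>C\<^esub> ?h Y)"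
      by (rule lin_map_comp[OF L(1) cl(1)]) (rule lin_mapD(1)[OF L(1) pure_closed[OF that(1,2)]])
  qed (use that in \<open>simp add: pure_mult L(2) m\<close>)
  have 2: "?h (X \<otimes>\<^bsub>tensor_alg A B\<^esub> Y) = ?h X \<otimes>\<^bsub>C\<^esub> ?h Y"
    if "X \<in> carrier (tensor_alg A B)" "Y \<in> carrier (tensor_alg A B)" for X Y
    using _ _ assms(1) _ that(1)
  proof (rule tensor_lin_eq)
    show "lin_map (tensor_alg A B) C (\<lambda>X. ?h (X \<otimes>\<^bsub>tensor_alg A B\<^esub> Y))"
      by (rule lin_map_comp[OF ml(2)[OF that(2)] L(1)])
    show "lin_map (tensor_alg A B) C (\<lambda>X. ?h X \<otimes>\<^bsub>C\<^esub> ?h Y)"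
      by (rule lin_map_comp[OF L(1) cl(2)]) (rule lin_mapD(1)[OF L(1) that(2)])
  qed (use 1 that in simp)
  show ?thesis unfolding alg_hom_def using L(1) one 2 by auto
qed

end

lemma tensor_map_bilin:
  assumes "lin_map A A' f" "lin_map B B' g" "kalg_pair A B" "kalg_pair A' B'"
  shows "bilin A B (tensor_alg A' B') (\<lambda>x y. pure_tensor A' B' (f x) (g y))"
proof -
  interpret P: kalg_pair A B by fact
  interpret Q: kalg_pair A' B' by fact
  have "lin_map B' (tensor_alg A' B') (pure_tensor A' B' (f x))" if "x \<in> carrier A" for x
    using Q.pure_bilin lin_mapD(1)[OF assms(1) that] by (simp add: bilin_def)
  moreover have "lin_map A' (tensor_alg A' B') (\<lambda>x. pure_tensor A' B' x (g y))" if "y \<in> carrier B" for y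
    using Q.pure_bilin lin_mapD(1)[OF assms(2) that] by (simp add: bilin_def)
  ultimately show ?thesis
    unfolding bilin_def by (auto intro: lin_map_comp[OF assms(2)] lin_map_comp[OF assms(1)])
qed

lemma tensor_map_eq:
  "tensor_map A' B' f g = tensor_lift (tensor_alg A' B') (\<lambda>x y. pure_tensor A' B' (f x) (g y))"
  by (rule ext) (simp add: tensor_map_def tensor_lift_def)

section \<open>Inverse matrices\<close>

definition minv :: "'k::field mat \<Rightarrow> 'k mat" where
  "minv E = the (mat_inverse E)"

lemma minv:
  assumes "E \<in> carrier_mat m m" "invertible_mat E"
  shows "minv E \<in> carrier_mat m m" "E * minv E = 1\<^sub>m m" "minv E * E = 1\<^sub>m m"
proof -
  obtain B where B: "inverts_mat E B" "inverts_mat B E"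
    using assms(2) by (auto simp: invertible_mat_def)
  have EB: "E * B = 1\<^sub>m m" using B(1) assms(1) by (simp add: inverts_mat_def)
  have BE: "B * E = 1\<^sub>m (dim_row B)" using B(2) by (simp add: inverts_mat_def)
  have "dim_col B = m" using EB by (metis index_mult_mat(3) index_one_mat(3))
  moreover have "dim_row B = m" using BE assms(1) by (metis index_mult_mat(3) index_one_mat(3) carrier_matD(2))
  ultimately have Bc: "B \<in> carrier_mat m m" by auto
  have "mat_inverse E \<noteq> None"
  proof
    assume "mat_inverse E = None"
    from mat_inverse(1)[OF assms(1) this, of "()"] show False
      using Bc EB BE assms(1) by (auto simp: Units_def ring_mat_simps)
  qed
  then obtain C where "mat_inverse E = Some C" by auto
  then show "minv E \<in> carrier_mat m m" "E * minv E = 1\<^sub>m m" "minv E * E = 1\<^sub>m m"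
    using mat_inverse(2)[OF assms(1)] by (auto simp: minv_def)
qed

lemma bil_conj_minv: "bil_conj A E a = amat_mult A (scalar_mat A (minv E)) (amat_mult A (transpose_mat a) (scalar_mat A E))"
  by (simp add: bil_conj_def minv_def)

section \<open>Generic matrices between two forms\<close>

text \<open>If \<open>u\<close> satisfies \<open>u^T E u = F\<close> and is invertible, then its inverse is \<open>F^-1 u^T E\<close>.\<close>
definition link_inv :: "('k::field, 'b, 'z) module_scheme \<Rightarrow> 'k mat \<Rightarrow> 'k mat \<Rightarrow> 'b mat \<Rightarrow> 'b mat" where
  "link_inv A E F u = amat_mult A (scalar_mat A (minv F)) (amat_mult A (transpose_mat u) (scalar_mat A E))"

text \<open>The rectangular version of the defining relations: for \<open>E = F\<close> these are the relations of the
generators of the algebra of \<open>E\<close>. Such matrices compose like morphisms from \<open>E\<close> to \<open>F\<close>. Among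
them are the generic matrix itself, scalar matrices that realise a congruence, and the matrices
that define the comultiplication, the counit and the antipode.\<close>
definition link :: "('k::field, 'b, 'z) module_scheme \<Rightarrow> 'k mat \<Rightarrow> 'k mat \<Rightarrow> 'b mat \<Rightarrow> bool" where
  "link A E F u \<longleftrightarrow> amat A (dim_row E) (dim_row F) u \<and>
    amat_mult A (link_inv A E F u) u = scalar_mat A (1\<^sub>m (dim_row F)) \<and>
    amat_mult A u (link_inv A E F u) = scalar_mat A (1\<^sub>m (dim_row E))"

lemma bil_conj_link_inv: "bil_conj A E u = link_inv A E E u"
  by (simp add: bil_conj_minv link_inv_def)

context kalg begin

lemma link_inv_amat:
  assumes "E \<in> carrier_mat m m" "F \<in> carrier_mat n n" "invertible_mat F" "amat A m n u"
  shows "amat A n m (link_inv A E F u)"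
  unfolding link_inv_def
  by (intro amat_mult_amat scalar_amat amat_transpose) (use assms minv(1)[OF assms(2,3)] in auto)

text \<open>As \<open>(u v)^T = v^T u^T\<close> for commuting entries, the inverses multiply in reverse order.\<close>
lemma link_comp:
  assumes E: "E \<in> carrier_mat m m" "invertible_mat E" and F: "F \<in> carrier_mat n n" "invertible_mat F"
    and G: "G \<in> carrier_mat r r" "invertible_mat G"
    and u: "link A E F u" and v: "link A F G v"
    and comm: "\<And>i j k. i < m \<Longrightarrow> j < n \<Longrightarrow> k < r \<Longrightarrow> u $$ (i, j) \<otimes> v $$ (j, k) = v $$ (j, k) \<otimes> u $$ (i, j)"
  shows "link A E G (amat_mult A u v)" and "link_inv A E G (amat_mult A u v) = amat_mult A (link_inv A F G v) (link_inv A E F u)"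
proof -
  have ua: "amat A m n u" and va: "amat A n r v"
    using u v E F G by (auto simp: link_def)
  let ?s = "scalar_mat A"
  note ut = amat_transpose[OF ua] and vt = amat_transpose[OF va]
  have s: "amat A m m (?s E)" "amat A n n (?s F)" "amat A n n (?s (minv F))" "amat A r r (?s (minv G))"
    using E F G minv(1) by (auto intro: scalar_amat)
  have FF: "amat_mult A (?s F) (?s (minv F)) = ?s (1\<^sub>m n)"
    using scalar_mult[OF F(1) minv(1)[OF F]] minv(2)[OF F] by simp
  have uE: "amat A n m (amat_mult A (transpose_mat u) (?s E))" by (rule amat_mult_amat[OF ut s(1)])
  have "link_inv A E G (amat_mult A u v) =
      amat_mult A (?s (minv G)) (amat_mult A (amat_mult A (transpose_mat v) (transpose_mat u)) (?s E))"
    unfolding link_inv_def using transpose_amat_mult[OF ua va comm] by simp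
  also have "\<dots> = amat_mult A (?s (minv G)) (amat_mult A (transpose_mat v) (amat_mult A (transpose_mat u) (?s E)))"
    by (simp add: amat_mult_assoc[OF vt ut s(1)])
  also have "amat_mult A (transpose_mat u) (?s E) =
      amat_mult A (?s F) (amat_mult A (?s (minv F)) (amat_mult A (transpose_mat u) (?s E)))"
    using amat_mult_assoc[OF s(2,3) uE] FF scalar_one_l[OF uE] by simp
  also have "amat_mult A (transpose_mat v) (amat_mult A (?s F) (amat_mult A (?s (minv F)) (amat_mult A (transpose_mat u) (?s E))))
      = amat_mult A (amat_mult A (transpose_mat v) (?s F)) (link_inv A E F u)"
    unfolding link_inv_def
    by (rule amat_mult_assoc[OF vt s(2) amat_mult_amat[OF s(3) uE], symmetric])
  also have "amat_mult A (?s (minv G)) (amat_mult A (amat_mult A (transpose_mat v) (?s F)) (link_inv A E F u))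
      = amat_mult A (link_inv A F G v) (link_inv A E F u)"
    unfolding link_inv_def
    by (rule amat_mult_assoc[OF s(4) amat_mult_amat[OF vt s(2)] amat_mult_amat[OF s(3) uE], symmetric])
  finally show eq: "link_inv A E G (amat_mult A u v) = amat_mult A (link_inv A F G v) (link_inv A E F u)" .
  have iu: "amat A n m (link_inv A E F u)" by (rule link_inv_amat[OF E(1) F ua])
  have iv: "amat A r n (link_inv A F G v)" by (rule link_inv_amat[OF F(1) G va])
  have uv: "amat A m r (amat_mult A u v)" by (rule amat_mult_amat[OF ua va])
  have "amat_mult A (amat_mult A (link_inv A F G v) (link_inv A E F u)) (amat_mult A u v)
     = amat_mult A (link_inv A F G v) (amat_mult A (amat_mult A (link_inv A E F u) u) v)"
    using amat_mult_assoc[OF iv iu uv] amat_mult_assoc[OF iu ua va] by simp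
  also have "\<dots> = ?s (1\<^sub>m r)"
    using u v scalar_one_l[OF va] F G by (auto simp: link_def)
  finally have 1: "amat_mult A (amat_mult A (link_inv A F G v) (link_inv A E F u)) (amat_mult A u v) = ?s (1\<^sub>m r)" .
  have "amat_mult A (amat_mult A u v) (amat_mult A (link_inv A F G v) (link_inv A E F u))
     = amat_mult A u (amat_mult A (amat_mult A v (link_inv A F G v)) (link_inv A E F u))"
    using amat_mult_assoc[OF ua va amat_mult_amat[OF iv iu]] amat_mult_assoc[OF va iv iu] by simp
  also have "\<dots> = ?s (1\<^sub>m m)"
    using u v scalar_one_l[OF iu] E F by (auto simp: link_def)
  finally have 2: "amat_mult A (amat_mult A u v) (amat_mult A (link_inv A F G v) (link_inv A E F u)) = ?s (1\<^sub>m m)" .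
  show "link A E G (amat_mult A u v)" unfolding link_def eq using 1 2 uv E G by auto
qed

lemma scalar_link_inv:
  assumes "E \<in> carrier_mat m m" "F \<in> carrier_mat n n" "invertible_mat F" "M \<in> carrier_mat m n"
  shows "link_inv A E F (scalar_mat A M) = scalar_mat A (minv F * (transpose_mat M * E))"
  unfolding link_inv_def transpose_scalar
  using scalar_mult[of "transpose_mat M" n m E m] scalar_mult[of "minv F" n n "transpose_mat M * E" m] assms minv(1)
  by auto

lemma scalar_link:
  assumes "E \<in> carrier_mat m m" "F \<in> carrier_mat n n" "invertible_mat F" "M \<in> carrier_mat m n"
    and "minv F * (transpose_mat M * E) * M = 1\<^sub>m n" "M * (minv F * (transpose_mat M * E)) = 1\<^sub>m m"
  shows "link A E F (scalar_mat A M)"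
proof -
  have "minv F * (transpose_mat M * E) \<in> carrier_mat n m" using assms minv(1) by (intro mult_carrier_mat) auto
  then show ?thesis
    unfolding link_def scalar_link_inv[OF assms(1-4)]
    using scalar_amat[OF assms(4)] assms scalar_mult[of _ n m M n] scalar_mult[of M m n _ m] by simp
qed

end

lemma alg_hom_transpose_mat: "map_mat f (transpose_mat P) = transpose_mat (map_mat f P)"
  by auto

lemma alg_hom_link_inv:
  assumes "alg_hom A B f" "kalg A" "kalg B"
    and "E \<in> carrier_mat m m" "F \<in> carrier_mat n n" "invertible_mat F" "amat A m n u"
  shows "map_mat f (link_inv A E F u) = link_inv B E F (map_mat f u)"
proof -
  interpret A: kalg A by fact
  have s: "amat A m m (scalar_mat A E)" "amat A n n (scalar_mat A (minv F))"
    using assms minv(1) by (auto intro: A.scalar_amat)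
  note ut = amat_transpose[OF assms(7)]
  show ?thesis unfolding link_inv_def
    by (simp add: alg_hom_amat_mult[OF assms(1-3) s(2) A.amat_mult_amat[OF ut s(1)]]
      alg_hom_amat_mult[OF assms(1-3) ut s(1)] alg_hom_scalar_mat[OF assms(1,2)] alg_hom_transpose_mat)
qed

lemma alg_hom_link:
  assumes "alg_hom A B f" "kalg A" "kalg B"
    and "E \<in> carrier_mat m m" "F \<in> carrier_mat n n" "invertible_mat F" "link A E F u"
  shows "link B E F (map_mat f u)"
proof -
  interpret A: kalg A by fact
  have u: "amat A m n u" using assms by (auto simp: link_def)
  have iu: "amat A n m (link_inv A E F u)" by (rule A.link_inv_amat[OF assms(4-6) u])
  show ?thesis
    unfolding link_def alg_hom_link_inv[OF assms(1-6) u, symmetric]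
      alg_hom_amat_mult[OF assms(1-3) u iu, symmetric] alg_hom_amat_mult[OF assms(1-3) iu u, symmetric]
    using assms(7) alg_hom_amat[OF assms(1) u] assms(4,5)
    by (simp add: link_def alg_hom_scalar_mat[OF assms(1,2)])
qed

section \<open>Opposite algebras\<close>

lemma op_alg_simps [simp]:
  "carrier (op_alg A) = carrier A" "x \<otimes>\<^bsub>op_alg A\<^esub> y = y \<otimes>\<^bsub>A\<^esub> x" "\<one>\<^bsub>op_alg A\<^esub> = \<one>\<^bsub>A\<^esub>"
  "\<zero>\<^bsub>op_alg A\<^esub> = \<zero>\<^bsub>A\<^esub>" "add (op_alg A) = add A" "smult (op_alg A) = smult A"
  by (simp_all add: op_alg_def)

lemma kalg_op:
  assumes "kalg A"
  shows "kalg (op_alg A)"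
proof -
  interpret A: kalg A by fact
  show ?thesis
  proof (intro kalg.intro kalg_axioms.intro)
    show "ring (op_alg A)"
    proof (rule ringI)
      show "abelian_group (op_alg A)"
      proof (rule abelian_groupI)
        fix x assume "x \<in> carrier (op_alg A)"
        then show "\<exists>y\<in>carrier (op_alg A). y \<oplus>\<^bsub>op_alg A\<^esub> x = \<zero>\<^bsub>op_alg A\<^esub>"
          using A.l_neg A.a_inv_closed by fastforce
      qed (simp_all add: A.a_ac)
      show "Group.monoid (op_alg A)" by (rule monoidI) (simp_all add: A.m_assoc)
    qed (simp_all add: A.l_distr A.r_distr)
  qed (simp_all add: A.smult_l_distr A.smult_r_distr A.smult_assoc A.smult_mult_l A.smult_mult_r)
qed

lemma finsum_op: "finsum (op_alg A) f S = finsum A f S"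
  by (simp add: finsum_def)

lemma scalar_mat_op [simp]: "scalar_mat (op_alg A) E = scalar_mat A E"
  by (simp add: scalar_mat_def)

lemma amat_op [simp]: "amat (op_alg A) n m P = amat A n m P"
  by (simp add: amat_def)

text \<open>In the opposite algebra the factors inside each entry are exchanged, which transposition on both
sides undoes.\<close>
lemma amat_mult_op:
  assumes "kalg A" "amat A n m P" "amat A m r Q"
  shows "amat_mult (op_alg A) P Q = transpose_mat (amat_mult A (transpose_mat Q) (transpose_mat P))"
proof (rule amat_eqI[of A n r])
  interpret A: kalg A by fact
  interpret O: kalg "op_alg A" by (rule kalg_op[OF assms(1)])
  note Pt = amat_transpose[OF assms(2)] and Qt = amat_transpose[OF assms(3)]
  show "amat A n r (amat_mult (op_alg A) P Q)" using O.amat_mult_amat[of n m P r Q] assms(2,3) by simp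
  show "amat A n r (transpose_mat (amat_mult A (transpose_mat Q) (transpose_mat P)))"
    by (rule amat_transpose[OF A.amat_mult_amat[OF Qt Pt]])
  fix i j assume ij: "i < n" "j < r"
  have "amat_mult (op_alg A) P Q $$ (i, j) = (\<Oplus>\<^bsub>A\<^esub>l\<in>{..<m}. Q $$ (l, j) \<otimes>\<^bsub>A\<^esub> P $$ (i, l))"
    using amat_mult_index[of "op_alg A" n m P r Q i j] assms(2,3) ij by (simp add: finsum_op)
  also have "\<dots> = (\<Oplus>\<^bsub>A\<^esub>l\<in>{..<m}. transpose_mat Q $$ (j, l) \<otimes>\<^bsub>A\<^esub> transpose_mat P $$ (l, i))"
    using ij amatD[OF assms(2)] amatD[OF assms(3)] by (intro A.finsum_cong') auto
  also have "\<dots> = amat_mult A (transpose_mat Q) (transpose_mat P) $$ (j, i)"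
    by (rule amat_mult_index[OF Qt Pt ij(2,1), symmetric])
  finally show "amat_mult (op_alg A) P Q $$ (i, j) =
      transpose_mat (amat_mult A (transpose_mat Q) (transpose_mat P)) $$ (i, j)"
    using ij A.amat_mult_amat[OF Qt Pt] by (auto simp: amat_def)
qed

lemma alg_hom_op: "alg_hom A B f \<Longrightarrow> alg_hom (op_alg A) (op_alg B) f"
  by (auto simp: alg_hom_def lin_map_def)

section \<open>The algebra of a nondegenerate form\<close>

text \<open>The homomorphism out of the algebra of a form with prescribed images of the generators.\<close>
definition bil_lift :: "('k::field, 'b, 'z) module_scheme \<Rightarrow> (nat \<times> nat \<Rightarrow> 'b) \<Rightarrow> ((nat \<times> nat) list \<Rightarrow>\<^sub>0 'k) set \<Rightarrow> 'b" where
  "bil_lift C \<phi> X = the_elem (free_lift C \<phi> ` X)"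

locale bil_form =
  fixes E :: "'k::field mat" and m :: nat
  assumes E: "E \<in> carrier_mat m m" and invE: "invertible_mat E"
begin

abbreviation "G \<equiv> {..<m} \<times> {..<m}"
abbreviation "Fr \<equiv> bil_free E"
abbreviation "B \<equiv> bil_alg E"
abbreviation "a \<equiv> bil_mat E"
abbreviation "q p \<equiv> bil_ideal E +>\<^bsub>Fr\<^esub> p"

lemma Fr_eq: "Fr = free_alg G"
  using E by (simp add: bil_free_def)

lemma Fr_kalg: "kalg Fr" by (simp add: Fr_eq kalg_free_alg)

sublocale Fr: kalg "bil_free E" by (rule Fr_kalg)

lemma free_mat_amat: "amat Fr m m (bil_free_mat E)"
  unfolding bil_free_mat_def using E free_gen_closed[of _ G] by (auto simp: Fr_eq intro!: amat_mat)

text \<open>The defining relations say exactly that the generic matrix links \<open>E\<close> to itself.\<close>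
lemma rels_eq: "bil_rels E =
  {amat_mult Fr (link_inv Fr E E (bil_free_mat E)) (bil_free_mat E) $$ (i, j) \<ominus>\<^bsub>Fr\<^esub> scalar_mat Fr (1\<^sub>m m) $$ (i, j) | i j. i < m \<and> j < m}
        \<union> {amat_mult Fr (bil_free_mat E) (link_inv Fr E E (bil_free_mat E)) $$ (i, j) \<ominus>\<^bsub>Fr\<^esub> scalar_mat Fr (1\<^sub>m m) $$ (i, j) | i j. i < m \<and> j < m}"
  using E by (simp add: bil_rels_def Let_def bil_conj_link_inv)

lemma free_inv_amat: "amat Fr m m (link_inv Fr E E (bil_free_mat E))"
  by (rule Fr.link_inv_amat[OF E E invE free_mat_amat])

lemma rels_carrier: "bil_rels E \<subseteq> carrier Fr"
proof -
  note 1 = amatD(3)[OF Fr.amat_mult_amat[OF free_inv_amat free_mat_amat]]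
  note 2 = amatD(3)[OF Fr.amat_mult_amat[OF free_mat_amat free_inv_amat]]
  note 3 = amatD(3)[OF Fr.scalar_amat[of "1\<^sub>m m" m m]]
  show ?thesis unfolding rels_eq using 1 2 3 by (auto intro!: Fr.minus_closed)
qed

lemma ideal_B: "ideal (bil_ideal E) Fr"
  unfolding bil_ideal_def by (rule Fr.genideal_ideal[OF rels_carrier])

sublocale I: kalg_ideal "bil_free E" "bil_ideal E"
  by (intro kalg_ideal.intro Fr_kalg ideal_B)

lemma kalg_B: "kalg B"
  unfolding bil_alg_def by (rule I.quot_kalg)

sublocale B: kalg "bil_alg E" by (rule kalg_B)

lemma q_hom: "alg_hom Fr B q"
  unfolding bil_alg_def by (rule I.quot_hom)

lemma B_carrier: "carrier B = q ` carrier Fr"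
  unfolding bil_alg_def by (rule I.quot_carrier)

lemma a_eq: "a = map_mat q (bil_free_mat E)"
  by (simp add: bil_mat_def)

lemma a_amat: "amat B m m a"
  unfolding a_eq by (rule alg_hom_amat[OF q_hom free_mat_amat])

lemma a_index: "i < m \<Longrightarrow> j < m \<Longrightarrow> a $$ (i, j) = q (free_gen (i, j))"
  using E by (simp add: bil_mat_def bil_free_mat_def)

lemma ideal_zero: "r \<in> bil_ideal E \<Longrightarrow> q r = \<zero>\<^bsub>B\<^esub>"
  using I.a_rcos_const by (simp add: bil_alg_def quot_alg_simps FactRing_def)

lemma rels_in_ideal: "bil_rels E \<subseteq> bil_ideal E"
  unfolding bil_ideal_def by (rule Fr.genideal_self[OF rels_carrier])

lemma a_link: "link B E E a"
proof -
  let ?f = "bil_free_mat E" and ?g = "link_inv Fr E E (bil_free_mat E)"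
  have g: "map_mat q ?g = link_inv B E E a"
    unfolding a_eq by (rule alg_hom_link_inv[OF q_hom Fr_kalg kalg_B E E invE free_mat_amat])
  have key: "map_mat q X = scalar_mat B (1\<^sub>m m)"
    if X: "amat Fr m m X" "\<And>i j. i < m \<Longrightarrow> j < m \<Longrightarrow> X $$ (i, j) \<ominus>\<^bsub>Fr\<^esub> scalar_mat Fr (1\<^sub>m m) $$ (i, j) \<in> bil_rels E" for X
  proof (rule amat_eqI[of B m m])
    show "amat B m m (map_mat q X)" by (rule alg_hom_amat[OF q_hom X(1)])
    show "amat B m m (scalar_mat B (1\<^sub>m m))" by (rule B.scalar_amat) simp
    fix i j assume ij: "i < m" "j < m"
    note s = amatD(3)[OF Fr.scalar_amat[of "1\<^sub>m m" m m] ij]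
    have "q (X $$ (i, j)) = q (scalar_mat Fr (1\<^sub>m m) $$ (i, j))"
      using X(2)[OF ij] rels_in_ideal amatD(3)[OF X(1) ij] s
      by (subst I.coset_eq_iff) auto
    also have "\<dots> = scalar_mat B (1\<^sub>m m) $$ (i, j)"
      using ij by (subst alg_hom_scalar_mat[OF q_hom Fr_kalg, symmetric]) (simp add: scalar_mat_def)
    finally show "map_mat q X $$ (i, j) = scalar_mat B (1\<^sub>m m) $$ (i, j)"
      using ij X(1) by (auto simp: amat_def)
  qed
  have "amat_mult B (link_inv B E E a) a = map_mat q (amat_mult Fr ?g ?f)"
    unfolding alg_hom_amat_mult[OF q_hom Fr_kalg kalg_B free_inv_amat free_mat_amat] g a_eq[symmetric] ..
  also have "\<dots> = scalar_mat B (1\<^sub>m m)"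
    by (rule key[OF Fr.amat_mult_amat[OF free_inv_amat free_mat_amat]]) (auto simp: rels_eq)
  finally have 1: "amat_mult B (link_inv B E E a) a = scalar_mat B (1\<^sub>m m)" .
  have "amat_mult B a (link_inv B E E a) = map_mat q (amat_mult Fr ?f ?g)"
    unfolding alg_hom_amat_mult[OF q_hom Fr_kalg kalg_B free_mat_amat free_inv_amat] g a_eq[symmetric] ..
  also have "\<dots> = scalar_mat B (1\<^sub>m m)"
    by (rule key[OF Fr.amat_mult_amat[OF free_mat_amat free_inv_amat]]) (auto simp: rels_eq)
  finally have 2: "amat_mult B a (link_inv B E E a) = scalar_mat B (1\<^sub>m m)" .
  show ?thesis unfolding link_def using a_amat 1 2 E by simp
qed

text \<open>Universal property of the algebra of \<open>E\<close>: it maps to every algebra that contains a matrix linking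
\<open>E\<close> to itself.\<close>
lemma bil_lift:
  assumes "kalg C" "link C E E (mat m m \<phi>)"
  shows "alg_hom B C (bil_lift C \<phi>)" and "map_mat (bil_lift C \<phi>) a = mat m m \<phi>"
    and "p \<in> carrier Fr \<Longrightarrow> bil_lift C \<phi> (q p) = free_lift C \<phi> p"
proof -
  interpret C: kalg C by fact
  let ?u = "mat m m \<phi>" and ?h = "free_lift C \<phi>"
  have u: "amat C m m ?u" using assms(2) E by (auto simp: link_def)
  have \<phi>: "\<phi> \<in> G \<rightarrow> carrier C" using amatD(3)[OF u] by auto
  have h: "alg_hom Fr C ?h" unfolding Fr_eq by (rule C.free_lift_hom[OF \<phi>])
  have hm: "map_mat ?h (bil_free_mat E) = ?u"
    using E C.free_lift_gen[OF \<phi>] by (auto simp: bil_free_mat_def)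
  have lf: "map_mat ?h (link_inv Fr E E (bil_free_mat E)) = link_inv C E E ?u"
    using alg_hom_link_inv[OF h Fr_kalg assms(1) E E invE free_mat_amat] hm by simp
  have key: "?h (X $$ (i, j) \<ominus>\<^bsub>Fr\<^esub> scalar_mat Fr (1\<^sub>m m) $$ (i, j)) = \<zero>\<^bsub>C\<^esub>"
    if X: "amat Fr m m X" "map_mat ?h X = scalar_mat C (1\<^sub>m m)" and ij: "i < m" "j < m" for X i j
  proof -
    note s = amatD(3)[OF Fr.scalar_amat[of "1\<^sub>m m" m m] ij]
    note x = amatD(3)[OF X(1) ij]
    have "?h (X $$ (i, j)) = map_mat ?h X $$ (i, j)" using X(1) ij by (auto simp: amat_def)
    also have "\<dots> = map_mat ?h (scalar_mat Fr (1\<^sub>m m)) $$ (i, j)"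
      unfolding X(2) alg_hom_scalar_mat[OF h Fr_kalg] ..
    also have "\<dots> = ?h (scalar_mat Fr (1\<^sub>m m) $$ (i, j))" using ij by (simp add: scalar_mat_def)
    finally have e: "?h (X $$ (i, j)) = ?h (scalar_mat Fr (1\<^sub>m m) $$ (i, j))" .
    show ?thesis
      using lin_map_minus[OF alg_homD(1)[OF h] Fr_kalg assms(1) x s] s e alg_homD(4)[OF h]
      by (simp add: a_minus_def C.r_neg)
  qed
  have 1: "map_mat ?h (amat_mult Fr (link_inv Fr E E (bil_free_mat E)) (bil_free_mat E)) = scalar_mat C (1\<^sub>m m)"
    using alg_hom_amat_mult[OF h Fr_kalg assms(1) free_inv_amat free_mat_amat] lf hm assms(2) E
    by (simp add: link_def)
  have 2: "map_mat ?h (amat_mult Fr (bil_free_mat E) (link_inv Fr E E (bil_free_mat E))) = scalar_mat C (1\<^sub>m m)"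
    using alg_hom_amat_mult[OF h Fr_kalg assms(1) free_mat_amat free_inv_amat] lf hm assms(2) E
    by (simp add: link_def)
  have "bil_rels E \<subseteq> {p \<in> carrier Fr. ?h p = \<zero>\<^bsub>C\<^esub>}"
    using rels_carrier key[OF Fr.amat_mult_amat[OF free_inv_amat free_mat_amat] 1]
      key[OF Fr.amat_mult_amat[OF free_mat_amat free_inv_amat] 2]
    unfolding rels_eq by blast
  moreover have "ideal {p \<in> carrier Fr. ?h p = \<zero>\<^bsub>C\<^esub>} Fr"
  proof -
    have "?h \<in> Ring.ring_hom Fr C"
      using h by (auto simp: Ring.ring_hom_def alg_hom_def lin_map_def)
    from ring_hom_ring.kernel_is_ideal[OF ring_hom_ringI2[OF Fr.ring_axioms C.ring_axioms this]]
    show ?thesis by (simp only: a_kernel_def')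
  qed
  ultimately have "bil_ideal E \<subseteq> {p \<in> carrier Fr. ?h p = \<zero>\<^bsub>C\<^esub>}"
    unfolding bil_ideal_def by (intro Fr.genideal_minimal)
  then have z: "?h p = \<zero>\<^bsub>C\<^esub>" if "p \<in> bil_ideal E" for p using that by auto
  show hom: "alg_hom B C (bil_lift C \<phi>)"
    unfolding bil_alg_def bil_lift_def[abs_def] by (rule I.quot_lift_hom[OF assms(1) h z])
  show val: "bil_lift C \<phi> (q p) = ?h p" if "p \<in> carrier Fr" for p
    unfolding bil_lift_def by (rule I.quot_lift_lin(1)[OF assms(1) alg_homD(1)[OF h] z that])
  show "map_mat (bil_lift C \<phi>) a = mat m m \<phi>"
  proof (rule eq_matI)
    fix i j assume "i < dim_row (mat m m \<phi>)" "j < dim_col (mat m m \<phi>)"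
    then have ij: "i < m" "j < m" by auto
    have "bil_lift C \<phi> (a $$ (i, j)) = ?h (free_gen (i, j))"
      unfolding a_index[OF ij] by (rule val) (use ij in \<open>auto simp: Fr_eq free_gen_closed\<close>)
    also have "\<dots> = \<phi> (i, j)" by (rule C.free_lift_gen[OF \<phi>]) (use ij in auto)
    finally show "map_mat (bil_lift C \<phi>) a $$ (i, j) = mat m m \<phi> $$ (i, j)"
      using ij a_amat by (auto simp: amat_def)
  qed (use a_amat in \<open>auto simp: amat_def\<close>)
qed

lemma B_hom_unique:
  assumes "alg_hom B C f" "alg_hom B C g" "kalg C" "map_mat f a = map_mat g a" "X \<in> carrier B"
  shows "f X = g X"
proof -
  obtain p where p: "X = q p" "p \<in> carrier Fr" using assms(5) B_carrier by auto
  have f: "alg_hom (free_alg G) C (\<lambda>p. f (q p))" using alg_hom_comp[OF q_hom assms(1)] by (simp only: Fr_eq)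
  have g: "alg_hom (free_alg G) C (\<lambda>p. g (q p))" using alg_hom_comp[OF q_hom assms(2)] by (simp only: Fr_eq)
  have gen: "f (q (free_gen x)) = g (q (free_gen x))" if xG: "x \<in> G" for x
  proof -
    obtain i j where x: "x = (i, j)" "i < m" "j < m" using xG by auto
    have "map_mat f a $$ (i, j) = map_mat g a $$ (i, j)" using assms(4) by simp
    then show ?thesis using x a_amat a_index[OF x(2,3)] by (auto simp: amat_def)
  qed
  show ?thesis unfolding p(1)
    by (rule alg_hom_free_unique[OF f g assms(3) gen p(2)[unfolded Fr_eq]])
qed

section \<open>Comultiplication, counit and antipode\<close>

sublocale BB: kalg_pair "bil_alg E" "bil_alg E"
  by (intro kalg_pair.intro kalg_B)

abbreviation "T \<equiv> tensor_alg B B"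

lemma kalg_T: "kalg T" by (rule BB.kalg_tensor)

end

lemma (in kalg_pair) pure_left_hom: "alg_hom A (tensor_alg A B) (\<lambda>x. pure_tensor A B x \<one>\<^bsub>B\<^esub>)"
  using pure_bilin by (auto simp: alg_hom_def bilin_def pure_one pure_mult)

lemma (in kalg_pair) pure_right_hom: "alg_hom B (tensor_alg A B) (\<lambda>y. pure_tensor A B \<one>\<^bsub>A\<^esub> y)"
  using pure_bilin by (auto simp: alg_hom_def bilin_def pure_one pure_mult)

context bil_form begin

abbreviation "a1 \<equiv> map_mat (\<lambda>x. pure_tensor B B x \<one>\<^bsub>B\<^esub>) a"
abbreviation "a2 \<equiv> map_mat (\<lambda>x. pure_tensor B B \<one>\<^bsub>B\<^esub> x) a"

definition comult_fun where
  "comult_fun = (\<lambda>(i, j). \<Oplus>\<^bsub>T\<^esub>l\<in>{..<dim_row E}. pure_tensor B B (a $$ (i, l)) (a $$ (l, j)))"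

lemma a1_amat: "amat T m m a1" by (rule alg_hom_amat[OF BB.pure_left_hom a_amat])
lemma a2_amat: "amat T m m a2" by (rule alg_hom_amat[OF BB.pure_right_hom a_amat])

text \<open>The entries of the two copies of the generic matrix in the tensor product commute, so their product
is a composition of links.\<close>
lemma comult_mat: "mat m m comult_fun = amat_mult T a1 a2"
proof (rule amat_eqI[of T m m])
  interpret T: kalg T by (rule kalg_T)
  have c: "pure_tensor B B (a $$ (i, l)) (a $$ (l, j)) \<in> carrier T" if "i < m" "j < m" "l < m" for i j l
    using that a_amat by (auto simp: amat_def intro!: BB.pure_closed)
  show "amat T m m (mat m m comult_fun)"
    using E by (intro amat_mat) (auto simp: comult_fun_def intro!: T.finsum_closed c)
  show "amat T m m (amat_mult T a1 a2)" by (rule T.amat_mult_amat[OF a1_amat a2_amat])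
  fix i j assume ij: "i < m" "j < m"
  have "mat m m comult_fun $$ (i, j) = (\<Oplus>\<^bsub>T\<^esub>l\<in>{..<m}. pure_tensor B B (a $$ (i, l)) (a $$ (l, j)))"
    using ij E by (simp add: comult_fun_def)
  also have "\<dots> = (\<Oplus>\<^bsub>T\<^esub>l\<in>{..<m}. a1 $$ (i, l) \<otimes>\<^bsub>T\<^esub> a2 $$ (l, j))"
  proof (rule T.finsum_cong'[OF refl])
    fix l assume "l \<in> {..<m}"
    then show "pure_tensor B B (a $$ (i, l)) (a $$ (l, j)) = a1 $$ (i, l) \<otimes>\<^bsub>T\<^esub> a2 $$ (l, j)"
      using ij amatD[OF a_amat] by (simp add: BB.pure_mult)
  qed (use ij amatD(3)[OF a1_amat] amatD(3)[OF a2_amat] in auto)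
  finally show "mat m m comult_fun $$ (i, j) = amat_mult T a1 a2 $$ (i, j)"
    unfolding amat_mult_index[OF a1_amat a2_amat ij] .
qed

lemma comult_link: "link T E E (mat m m comult_fun)"
proof -
  interpret T: kalg T by (rule kalg_T)
  have 1: "link T E E a1" by (rule alg_hom_link[OF BB.pure_left_hom kalg_B kalg_T E E invE a_link])
  have 2: "link T E E a2" by (rule alg_hom_link[OF BB.pure_right_hom kalg_B kalg_T E E invE a_link])
  show ?thesis unfolding comult_mat
    by (rule T.link_comp(1)[OF E invE E invE E invE 1 2]) (use a_amat in \<open>auto simp: amat_def BB.pure_mult\<close>)
qed

lemma comult_eq: "bil_comult E = bil_lift T comult_fun"
  by (rule ext) (simp add: bil_comult_def bil_lift_def comult_fun_def Let_def)

lemma comult_hom: "alg_hom B T (bil_comult E)" "map_mat (bil_comult E) a = amat_mult T a1 a2"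
  using bil_lift[OF kalg_T comult_link] by (simp_all add: comult_eq comult_mat)

lemma counit_link: "link base_alg E E (mat m m (\<lambda>(i, j). if i = j then 1 else 0))"
proof -
  interpret K: kalg "base_alg :: ('k, 'k) module" by (rule kalg_base)
  have e: "mat m m (\<lambda>(i, j). if i = j then 1 else 0) = scalar_mat base_alg (1\<^sub>m m :: 'k mat)"
    by (auto simp: scalar_mat_def)
  show ?thesis unfolding e
    by (rule K.scalar_link[OF E E invE]) (use E minv[OF E invE] in \<open>auto simp: assoc_mult_mat[of _ m m _ m _ m]\<close>)
qed

lemma counit_eq: "bil_counit E = bil_lift base_alg (\<lambda>(i, j). if i = j then 1 else 0)"
  by (rule ext) (simp add: bil_counit_def bil_lift_def)

lemma counit_hom: "alg_hom B base_alg (bil_counit E)"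
  "map_mat (bil_counit E) a = scalar_mat base_alg (1\<^sub>m m)"
  using bil_lift[OF kalg_base counit_link] by (auto simp: counit_eq scalar_mat_def)

abbreviation "antipode_mat \<equiv> link_inv B E E a"

lemma s_amat: "amat B m m antipode_mat"
  by (rule B.link_inv_amat[OF E E invE a_amat])

text \<open>In the opposite algebra a product of matrices becomes the transpose of the product of the transposes.
The matrix \<open>antipode_mat^T = E^T a E^-T\<close> is conjugate to \<open>a\<close>, and this turns the two relations
for the antipode into \<open>a antipode_mat = 1\<close> and \<open>antipode_mat a = 1\<close>.\<close>
lemma antipode_link: "link (op_alg B) E E antipode_mat"
proof -
  let ?S = "scalar_mat B" and ?E' = "minv E" and ?m = "amat_mult B" and ?o = "amat_mult (op_alg B)"
  let ?Et = "transpose_mat E" and ?Et' = "transpose_mat (minv E)"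
  have Ei: "?E' \<in> carrier_mat m m" using minv(1)[OF E invE] .
  have sE: "amat B m m (?S E)" "amat B m m (?S ?E')" "amat B m m (?S ?Et)" "amat B m m (?S ?Et')"
    using E Ei by (auto intro!: B.scalar_amat)
  have EE: "?Et * ?Et' = 1\<^sub>m m" "?Et' * ?Et = 1\<^sub>m m"
    unfolding transpose_mult[OF Ei E, symmetric] transpose_mult[OF E Ei, symmetric] minv(2,3)[OF E invE] by simp_all
  note st = amat_transpose[OF s_amat] and at = amat_transpose[OF a_amat]
  note mm = B.amat_mult_amat
  have s_eq: "antipode_mat = ?m (?S ?E') (?m (transpose_mat a) (?S E))" by (simp add: link_inv_def)
  have st_eq: "transpose_mat antipode_mat = ?m (?S ?Et) (?m a (?S ?Et'))"
  proof -
    have "transpose_mat antipode_mat = ?m (transpose_mat (?m (transpose_mat a) (?S E))) (?S ?Et')"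
      unfolding s_eq by (rule B.transpose_scalar_mult_l[OF Ei mm[OF at sE(1)]])
    also have "transpose_mat (?m (transpose_mat a) (?S E)) = ?m (?S ?Et) a"
      using B.transpose_scalar_mult_r[OF at E] by simp
    also have "?m (?m (?S ?Et) a) (?S ?Et') = ?m (?S ?Et) (?m a (?S ?Et'))"
      by (rule B.amat_mult_assoc[OF sE(3) a_amat sE(4)])
    finally show ?thesis .
  qed
  let ?r = "link_inv (op_alg B) E E antipode_mat"
  have ra: "amat B m m ?r"
    using kalg.link_inv_amat[OF kalg_op[OF kalg_B] E E invE, of antipode_mat] s_amat by simp
  have r_eq: "?r = transpose_mat (?m (?m (?S ?Et) antipode_mat) (?S ?Et'))"
  proof -
    have 1: "?o (transpose_mat antipode_mat) (?S E) = transpose_mat (?m (?S ?Et) antipode_mat)"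
      using amat_mult_op[OF kalg_B st sE(1)] by (simp add: B.transpose_scalar)
    have 2: "amat B m m (transpose_mat (?m (?S ?Et) antipode_mat))" by (rule amat_transpose[OF mm[OF sE(3) s_amat]])
    have "?r = ?o (?S ?E') (?o (transpose_mat antipode_mat) (?S E))"
      by (simp only: link_inv_def[of "op_alg B" E E antipode_mat] scalar_mat_op)
    then show ?thesis unfolding 1
      using amat_mult_op[OF kalg_B sE(2) 2] by (simp add: B.transpose_scalar)
  qed
  have sym: "transpose_mat (?S (1\<^sub>m m)) = ?S (1\<^sub>m m)" by (simp add: B.transpose_scalar)
  have one: "?m (?S ?Et) (?S ?Et') = ?S (1\<^sub>m m)" "?m (?S ?Et') (?S ?Et) = ?S (1\<^sub>m m)"
    using EE E Ei B.scalar_mult[of ?Et m m ?Et' m] B.scalar_mult[of ?Et' m m ?Et m] by simp_all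
  have as: "?m a antipode_mat = ?S (1\<^sub>m m)" "?m antipode_mat a = ?S (1\<^sub>m m)" using a_link E by (simp_all add: link_def)
  have Ets: "amat B m m (?m (?S ?Et) antipode_mat)" "amat B m m (?m antipode_mat (?S ?Et'))" "amat B m m (?m a (?S ?Et'))"
    "amat B m m (?m (?S ?Et) a)"
    using mm sE s_amat a_amat by blast+
  have "?o ?r antipode_mat = transpose_mat (?m (transpose_mat antipode_mat) (?m (?m (?S ?Et) antipode_mat) (?S ?Et')))"
    using amat_mult_op[OF kalg_B ra s_amat] by (simp add: r_eq)
  also have "?m (transpose_mat antipode_mat) (?m (?m (?S ?Et) antipode_mat) (?S ?Et')) = ?S (1\<^sub>m m)"
  proof -
    have "?m (transpose_mat antipode_mat) (?m (?m (?S ?Et) antipode_mat) (?S ?Et')) =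
      ?m (?S ?Et) (?m (?m a (?S ?Et')) (?m (?S ?Et) (?m antipode_mat (?S ?Et'))))"
      unfolding st_eq B.amat_mult_assoc[OF sE(3) s_amat sE(4)]
      by (rule B.amat_mult_assoc[OF sE(3) Ets(3) mm[OF sE(3) Ets(2)]])
    also have "?m (?m a (?S ?Et')) (?m (?S ?Et) (?m antipode_mat (?S ?Et'))) =
        ?m a (?m (?m (?S ?Et') (?S ?Et)) (?m antipode_mat (?S ?Et')))"
      using B.amat_mult_assoc[OF a_amat sE(4) mm[OF sE(3) Ets(2)]] B.amat_mult_assoc[OF sE(4,3) Ets(2)] by simp
    also have "\<dots> = ?m (?m a antipode_mat) (?S ?Et')"
      unfolding one B.scalar_one_l[OF Ets(2)] by (rule B.amat_mult_assoc[OF a_amat s_amat sE(4), symmetric])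
    also have "\<dots> = ?S ?Et'" unfolding as by (rule B.scalar_one_l[OF sE(4)])
    finally show ?thesis using one by simp
  qed
  finally have 1: "?o ?r antipode_mat = ?S (1\<^sub>m m)" using sym by simp
  have "?o antipode_mat ?r = transpose_mat (?m (?m (?m (?S ?Et) antipode_mat) (?S ?Et')) (transpose_mat antipode_mat))"
    using amat_mult_op[OF kalg_B s_amat ra] by (simp add: r_eq)
  also have "?m (?m (?m (?S ?Et) antipode_mat) (?S ?Et')) (transpose_mat antipode_mat) = ?S (1\<^sub>m m)"
  proof -
    have "?m (?m (?m (?S ?Et) antipode_mat) (?S ?Et')) (transpose_mat antipode_mat) =
       ?m (?m (?S ?Et) antipode_mat) (?m (?S ?Et') (?m (?S ?Et) (?m a (?S ?Et'))))"
      unfolding st_eq by (rule B.amat_mult_assoc[OF Ets(1) sE(4) mm[OF sE(3) Ets(3)]])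
    also have "?m (?S ?Et') (?m (?S ?Et) (?m a (?S ?Et'))) = ?m a (?S ?Et')"
      using B.amat_mult_assoc[OF sE(4,3) Ets(3)] one B.scalar_one_l[OF Ets(3)] by simp
    also have "?m (?m (?S ?Et) antipode_mat) (?m a (?S ?Et')) = ?m (?S ?Et) (?m (?m antipode_mat a) (?S ?Et'))"
      using B.amat_mult_assoc[OF sE(3) s_amat Ets(3)] B.amat_mult_assoc[OF s_amat a_amat sE(4)] by simp
    also have "\<dots> = ?S (1\<^sub>m m)" unfolding as B.scalar_one_l[OF sE(4)] by (rule one)
    finally show ?thesis .
  qed
  finally have 2: "?o antipode_mat ?r = ?S (1\<^sub>m m)" using sym by simp
  show ?thesis unfolding link_def using s_amat 1 2 E by simp
qed

lemma mat_index_fun: "X \<in> carrier_mat n r \<Longrightarrow> mat n r (\<lambda>ij. X $$ ij) = X"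
  by (auto simp: mat_eq_iff)

lemma antipode_eq: "bil_antipode E = bil_lift (op_alg B) (\<lambda>ij. antipode_mat $$ ij)"
  by (rule ext) (simp add: bil_antipode_def bil_lift_def Let_def bil_conj_link_inv)

lemma antipode_hom: "alg_hom B (op_alg B) (bil_antipode E)" "map_mat (bil_antipode E) a = antipode_mat"
  using bil_lift[OF kalg_op[OF kalg_B], of "\<lambda>ij. antipode_mat $$ ij"] antipode_link s_amat
  by (simp_all add: antipode_eq mat_index_fun amat_def)

lemma hopf_simps:
  "carrier (bil_hopf E) = carrier B" "mult (bil_hopf E) = mult B" "one (bil_hopf E) = one B"
  "zero (bil_hopf E) = zero B" "add (bil_hopf E) = add B" "smult (bil_hopf E) = smult B"
  "comult (bil_hopf E) = bil_comult E" "counit (bil_hopf E) = bil_counit E"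
  "antipode (bil_hopf E) = bil_antipode E"
  by (simp_all add: bil_hopf_def module.extend_def hopf.fields_def)

text \<open>The Hopf algebra and the underlying algebra are different records with the same operations; the
tensor product depends on the operations only.\<close>
lemma tensor_map_hopf: "tensor_map (bil_hopf E) (bil_hopf E) f g = tensor_map B B f g"
proof -
  have "bil_hopf E \<times>\<times> bil_hopf E = B \<times>\<times> B" by (simp add: DirProd_def hopf_simps)
  then have 1: "tensor_pre (bil_hopf E) (bil_hopf E) = tensor_pre B B" by (simp add: tensor_pre_def)
  have 2: "tensor_rels (bil_hopf E) (bil_hopf E) = tensor_rels B B"
    by (simp add: tensor_rels_def hopf_simps)
  show ?thesis
    by (rule ext) (simp add: tensor_map_def tensor_alg_def pure_tensor_def tensor_null_def 1 2)
qed

end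

section \<open>Congruent forms\<close>

lemma map_mat_comp2: "map_mat (\<lambda>x. g (f x)) X = map_mat g (map_mat f X)"
  by auto

lemma (in kalg) amat_mult_op_scalar_l:
  "E \<in> carrier_mat n m \<Longrightarrow> amat A m r Q \<Longrightarrow>
    transpose_mat (amat_mult A (transpose_mat Q) (transpose_mat (scalar_mat A E))) = amat_mult A (scalar_mat A E) Q"
  using transpose_scalar_mult_r[of r m "transpose_mat Q" "transpose_mat E" n] amat_transpose[of A m r Q]
  by (simp add: transpose_scalar)

lemma (in kalg) amat_mult_op_scalar_r:
  "E \<in> carrier_mat m r \<Longrightarrow> amat A n m Q \<Longrightarrow>
    transpose_mat (amat_mult A (transpose_mat (scalar_mat A E)) (transpose_mat Q)) = amat_mult A Q (scalar_mat A E)"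
  using transpose_scalar_mult_l[of "transpose_mat E" r m n "transpose_mat Q"] amat_transpose[of A n m Q]
  by (simp add: transpose_scalar)

locale bil_congruence = E: bil_form E m + F: bil_form F m
  for E F :: "'k::field mat" and m :: nat +
  fixes M N :: "'k mat"
  assumes M: "M \<in> carrier_mat m m" and N: "N \<in> carrier_mat m m"
    and MN: "M * N = 1\<^sub>m m" and NM: "N * M = 1\<^sub>m m" and FM: "F = transpose_mat M * E * M"
begin

lemma FN: "F * N = transpose_mat M * E"
proof -
  have "F * N = transpose_mat M * E * (M * N)"
    unfolding FM by (rule assoc_mult_mat[of _ m m _ m _ m]) (use M N E.E in auto)
  then show ?thesis using MN M E.E by simp
qed

lemma NtF: "transpose_mat N * F = E * M"
proof -
  have t: "transpose_mat N * transpose_mat M = 1\<^sub>m m"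
    using transpose_mult[OF M N] MN by simp
  have "transpose_mat N * F = transpose_mat N * (transpose_mat M * (E * M))"
    unfolding FM using M E.E by (simp add: assoc_mult_mat[of _ m m _ m _ m])
  also have "\<dots> = transpose_mat N * transpose_mat M * (E * M)"
    by (rule assoc_mult_mat[symmetric, of _ m m _ m _ m]) (use M N E.E in auto)
  finally show ?thesis using t M E.E by simp
qed

lemma sym: "bil_congruence F E m N M"
proof (unfold_locales; (rule M N MN NM)?)
  have "transpose_mat N * F * N = E * M * N" using NtF by simp
  also have "\<dots> = E * (M * N)" by (rule assoc_mult_mat[of _ m m _ m _ m]) (use M N E.E in auto)
  finally show "E = transpose_mat N * F * N" using MN E.E by simp
qed

lemma minv_F: "minv F * (transpose_mat M * E) = N"
proof -
  have "minv F * (F * N) = minv F * F * N"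
    by (rule assoc_mult_mat[symmetric, of _ m m _ m _ m]) (use minv(1)[OF F.E F.invE] F.E N in auto)
  then show ?thesis using FN minv(3)[OF F.E F.invE] N by simp
qed

abbreviation "SM \<equiv> scalar_mat F.B M"
abbreviation "SN \<equiv> scalar_mat F.B N"

text \<open>The image of the generic matrix of \<open>E\<close>: the generic matrix of \<open>F\<close>, conjugated by \<open>M\<close>.\<close>
definition "u = amat_mult F.B SM (amat_mult F.B F.a SN)"

lemma scalars: "amat F.B m m SM" "amat F.B m m SN"
  using M N by (auto intro: F.B.scalar_amat)

lemma link_M: "link F.B E F SM" and link_inv_M: "link_inv F.B E F SM = SN"
proof -
  show "link F.B E F SM"
    by (rule F.B.scalar_link[OF E.E F.E F.invE M]) (simp_all add: minv_F MN NM)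
  show "link_inv F.B E F SM = SN"
    unfolding F.B.scalar_link_inv[OF E.E F.E F.invE M] minv_F ..
qed

lemma link_N: "link F.B F E SN" and link_inv_N: "link_inv F.B F E SN = SM"
proof -
  interpret S: bil_congruence F E m N M by (rule sym)
  show "link F.B F E SN"
    by (rule F.B.scalar_link[OF F.E E.E E.invE N]) (simp_all add: S.minv_F MN NM)
  show "link_inv F.B F E SN = SM"
    unfolding F.B.scalar_link_inv[OF F.E E.E E.invE N] S.minv_F ..
qed

lemma aN: "amat F.B m m (amat_mult F.B F.a SN)"
  by (rule F.B.amat_mult_amat[OF F.a_amat scalars(2)])

lemma u_amat: "amat F.B m m u"
  unfolding u_def by (rule F.B.amat_mult_amat[OF scalars(1) aN])

text \<open>A composition of three links, from \<open>E\<close> to \<open>F\<close>, from \<open>F\<close> to \<open>F\<close> and back.\<close>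
lemma u_link: "link F.B E E u" "link_inv F.B E E u = amat_mult F.B SM (amat_mult F.B F.antipode_mat SN)"
proof -
  have c1: "F.a $$ (i, j) \<otimes>\<^bsub>F.B\<^esub> SN $$ (j, k) = SN $$ (j, k) \<otimes>\<^bsub>F.B\<^esub> F.a $$ (i, j)"
    if "i < m" "j < m" "k < m" for i j k
    using that amatD(3)[OF F.a_amat] by (simp add: F.B.scalar_index[OF N] F.B.smult_mult_l F.B.smult_mult_r)
  have c2: "SM $$ (i, j) \<otimes>\<^bsub>F.B\<^esub> amat_mult F.B F.a SN $$ (j, k) = amat_mult F.B F.a SN $$ (j, k) \<otimes>\<^bsub>F.B\<^esub> SM $$ (i, j)"
    if "i < m" "j < m" "k < m" for i j k
    using that amatD(3)[OF aN] by (simp add: F.B.scalar_index[OF M] F.B.smult_mult_l F.B.smult_mult_r)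
  note l1 = F.B.link_comp[OF F.E F.invE F.E F.invE E.E E.invE F.a_link link_N]
  have 1: "link F.B F E (amat_mult F.B F.a SN)" by (rule l1(1)) (rule c1)
  have li1: "link_inv F.B F E (amat_mult F.B F.a SN) = amat_mult F.B SM F.antipode_mat"
    unfolding link_inv_N[symmetric] by (rule l1(2)) (rule c1)
  note l2 = F.B.link_comp[OF E.E E.invE F.E F.invE E.E E.invE link_M 1]
  show "link F.B E E u" unfolding u_def by (rule l2(1)) (rule c2)
  have "link_inv F.B E E u = amat_mult F.B (link_inv F.B F E (amat_mult F.B F.a SN)) (link_inv F.B E F SM)"
    unfolding u_def by (rule l2(2)) (rule c2)
  also have "\<dots> = amat_mult F.B SM (amat_mult F.B F.antipode_mat SN)"
    unfolding li1 link_inv_M by (rule F.B.amat_mult_assoc[OF scalars(1) F.s_amat scalars(2)])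
  finally show "link_inv F.B E E u = amat_mult F.B SM (amat_mult F.B F.antipode_mat SN)" .
qed

definition "bil_iso = bil_lift F.B (\<lambda>ij. u $$ ij)"

lemma bil_iso_hom: "alg_hom E.B F.B bil_iso" "map_mat bil_iso E.a = u"
proof -
  have "mat m m (\<lambda>ij. u $$ ij) = u" by (rule E.mat_index_fun) (use u_amat in \<open>simp add: amat_def\<close>)
  then show "alg_hom E.B F.B bil_iso" "map_mat bil_iso E.a = u"
    using E.bil_lift[OF F.kalg_B, of "\<lambda>ij. u $$ ij"] u_link(1) by (simp_all add: bil_iso_def)
qed

text \<open>Every structure map applied to the conjugated generic matrix conjugates the image of the generic
matrix; all compatibilities below reduce to this.\<close>
lemma map_u:
  assumes "alg_hom F.B C h" "kalg C"
  shows "map_mat h u = amat_mult C (scalar_mat C M) (amat_mult C (map_mat h F.a) (scalar_mat C N))"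
  unfolding u_def alg_hom_amat_mult[OF assms(1) F.kalg_B assms(2) scalars(1) aN]
    alg_hom_amat_mult[OF assms(1) F.kalg_B assms(2) F.a_amat scalars(2)]
    alg_hom_scalar_mat[OF assms(1) F.kalg_B] ..

end

lemma (in kalg) conj_conj:
  assumes "M \<in> carrier_mat m m" "N \<in> carrier_mat m m" "N * M = 1\<^sub>m m" "amat A m m X" "amat A m m Y"
  shows "amat_mult A (amat_mult A (scalar_mat A M) (amat_mult A X (scalar_mat A N)))
      (amat_mult A (scalar_mat A M) (amat_mult A Y (scalar_mat A N))) =
    amat_mult A (scalar_mat A M) (amat_mult A (amat_mult A X Y) (scalar_mat A N))"
proof -
  let ?m = "amat_mult A" and ?M = "scalar_mat A M" and ?N = "scalar_mat A N"
  have s: "amat A m m ?M" "amat A m m ?N" using assms by (auto intro: scalar_amat)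
  have NM: "?m ?N ?M = scalar_mat A (1\<^sub>m m)" using scalar_mult[OF assms(2,1)] assms(3) by simp
  note XN = amat_mult_amat[OF assms(4) s(2)] and YN = amat_mult_amat[OF assms(5) s(2)]
  have "?m (?m ?M (?m X ?N)) (?m ?M (?m Y ?N)) = ?m ?M (?m X (?m ?N (?m ?M (?m Y ?N))))"
    unfolding amat_mult_assoc[OF s(1) XN amat_mult_amat[OF s(1) YN]]
      amat_mult_assoc[OF assms(4) s(2) amat_mult_amat[OF s(1) YN]] ..
  also have "?m ?N (?m ?M (?m Y ?N)) = ?m Y ?N"
    unfolding amat_mult_assoc[OF s(2,1) YN, symmetric] NM by (rule scalar_one_l[OF YN])
  also have "?m X (?m Y ?N) = ?m (?m X Y) ?N" by (rule amat_mult_assoc[OF assms(4,5) s(2), symmetric])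
  finally show ?thesis .
qed

lemma (in kalg) conj_inverse:
  assumes "M \<in> carrier_mat m m" "N \<in> carrier_mat m m" "M * N = 1\<^sub>m m" "amat A m m X"
  shows "amat_mult A (scalar_mat A M)
      (amat_mult A (amat_mult A (scalar_mat A N) (amat_mult A X (scalar_mat A M))) (scalar_mat A N)) = X"
proof -
  let ?m = "amat_mult A" and ?M = "scalar_mat A M" and ?N = "scalar_mat A N"
  have s: "amat A m m ?M" "amat A m m ?N" using assms by (auto intro: scalar_amat)
  have MN: "?m ?M ?N = scalar_mat A (1\<^sub>m m)" using scalar_mult[OF assms(1,2)] assms(3) by simp
  note XM = amat_mult_amat[OF assms(4) s(1)]
  have XMN: "?m (?m X ?M) ?N = X"
    unfolding amat_mult_assoc[OF assms(4) s(1,2)] MN by (rule scalar_one_r[OF assms(4)])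
  show ?thesis
    unfolding amat_mult_assoc[OF s(2) XM s(2)] XMN amat_mult_assoc[OF s(1,2) assms(4), symmetric] MN
    by (rule scalar_one_l[OF assms(4)])
qed

lemma tensor_map_hom:
  assumes "kalg_pair A A" "kalg_pair B B" "alg_hom A B f"
  shows "alg_hom (tensor_alg A A) (tensor_alg B B) (tensor_map B B f f)"
    and "x \<in> carrier A \<Longrightarrow> y \<in> carrier A \<Longrightarrow>
      tensor_map B B f f (pure_tensor A A x y) = pure_tensor B B (f x) (f y)"
proof -
  interpret A: kalg_pair A A by fact
  interpret B: kalg_pair B B by fact
  note b = tensor_map_bilin[OF alg_homD(1)[OF assms(3)] alg_homD(1)[OF assms(3)] assms(1,2)]
  show "alg_hom (tensor_alg A A) (tensor_alg B B) (tensor_map B B f f)"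
    unfolding tensor_map_eq
    by (rule A.tensor_lift_hom[OF B.kalg_tensor b])
      (use alg_homD[OF assms(3)] in \<open>simp_all add: B.pure_one B.pure_mult\<close>)
  show "tensor_map B B f f (pure_tensor A A x y) = pure_tensor B B (f x) (f y)"
    if "x \<in> carrier A" "y \<in> carrier A"
    unfolding tensor_map_eq by (rule A.tensor_lift(2)[OF B.kalg_tensor b that])
qed

context bil_congruence begin

lemma bil_iso_inverse:
  assumes "X \<in> carrier F.B"
  shows "bil_iso (bil_congruence.bil_iso E N M X) = X"
proof -
  interpret S: bil_congruence F E m N M by (rule sym)
  note h = alg_hom_comp[OF S.bil_iso_hom(1) bil_iso_hom(1)]
  have id: "alg_hom F.B F.B (\<lambda>x. x)" by (auto simp: alg_hom_def lin_map_def)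
  have "map_mat (\<lambda>x. bil_iso (S.bil_iso x)) F.a = map_mat bil_iso S.u"
    by (simp add: map_mat_comp2 S.bil_iso_hom(2))
  also have "\<dots> = amat_mult F.B SN (amat_mult F.B u SM)"
    by (simp add: S.map_u[OF bil_iso_hom(1) F.kalg_B] bil_iso_hom(2))
  also have "\<dots> = F.a"
    unfolding u_def by (rule F.B.conj_inverse[OF N M NM F.a_amat])
  also have "\<dots> = map_mat (\<lambda>x. x) F.a" by auto
  finally show ?thesis by (rule F.B_hom_unique[OF h id F.kalg_B _ assms])
qed

lemma bil_iso_comult:
  assumes "X \<in> carrier E.B"
  shows "bil_comult F (bil_iso X) = tensor_map F.B F.B bil_iso bil_iso (bil_comult E X)"
proof -
  interpret TF: kalg F.T by (rule F.kalg_T)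
  let ?t = "tensor_map F.B F.B bil_iso bil_iso"
  note t = tensor_map_hom[OF E.BB.kalg_pair_axioms F.BB.kalg_pair_axioms bil_iso_hom(1)]
  note 1 = alg_hom_comp[OF bil_iso_hom(1) F.comult_hom(1)]
  note 2 = alg_hom_comp[OF E.comult_hom(1) t(1)]
  let ?M = "scalar_mat F.T M" and ?N = "scalar_mat F.T N" and ?m = "amat_mult F.T"
  have "map_mat (\<lambda>x. bil_comult F (bil_iso x)) E.a = map_mat (bil_comult F) u"
    unfolding map_mat_comp2 bil_iso_hom(2) ..
  also have "\<dots> = ?m ?M (?m (?m F.a1 F.a2) ?N)"
    unfolding map_u[OF F.comult_hom(1) F.kalg_T] F.comult_hom(2) ..
  also have "\<dots> = ?m (?m ?M (?m F.a1 ?N)) (?m ?M (?m F.a2 ?N))"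
    by (rule TF.conj_conj[OF M N NM F.a1_amat F.a2_amat, symmetric])
  also have "?m ?M (?m F.a1 ?N) = map_mat (\<lambda>x. pure_tensor F.B F.B x \<one>\<^bsub>F.B\<^esub>) u"
    by (rule map_u[OF F.BB.pure_left_hom F.kalg_T, symmetric])
  also have "\<dots> = map_mat ?t E.a1"
    unfolding bil_iso_hom(2)[symmetric] map_mat_comp2[symmetric]
    by (rule eq_matI)
      (use amatD[OF E.a_amat] alg_homD(2)[OF bil_iso_hom(1)] in \<open>auto simp: t(2)\<close>)
  also have "?m ?M (?m F.a2 ?N) = map_mat (\<lambda>x. pure_tensor F.B F.B \<one>\<^bsub>F.B\<^esub> x) u"
    by (rule map_u[OF F.BB.pure_right_hom F.kalg_T, symmetric])
  also have "\<dots> = map_mat ?t E.a2"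
    unfolding bil_iso_hom(2)[symmetric] map_mat_comp2[symmetric]
    by (rule eq_matI)
      (use amatD[OF E.a_amat] alg_homD(2)[OF bil_iso_hom(1)] in \<open>auto simp: t(2)\<close>)
  also have "?m (map_mat ?t E.a1) (map_mat ?t E.a2) = map_mat ?t (amat_mult E.T E.a1 E.a2)"
    by (rule alg_hom_amat_mult[OF t(1) E.kalg_T F.kalg_T E.a1_amat E.a2_amat, symmetric])
  also have "\<dots> = map_mat (\<lambda>x. ?t (bil_comult E x)) E.a"
    unfolding map_mat_comp2 E.comult_hom(2) ..
  finally show ?thesis by (rule E.B_hom_unique[OF 1 2 F.kalg_T _ assms])
qed

lemma bil_iso_counit:
  assumes "X \<in> carrier E.B"
  shows "bil_counit F (bil_iso X) = bil_counit E X"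
proof -
  interpret K: kalg "base_alg :: ('k, 'k) module" by (rule kalg_base)
  note 1 = alg_hom_comp[OF bil_iso_hom(1) F.counit_hom(1)]
  have "map_mat (\<lambda>x. bil_counit F (bil_iso x)) E.a = map_mat (bil_counit F) u"
    unfolding map_mat_comp2 bil_iso_hom(2) ..
  also have "\<dots> = amat_mult base_alg (scalar_mat base_alg M) (amat_mult base_alg (scalar_mat base_alg (1\<^sub>m m)) (scalar_mat base_alg N))"
    unfolding map_u[OF F.counit_hom(1) kalg_base] F.counit_hom(2) ..
  also have "\<dots> = scalar_mat base_alg (1\<^sub>m m)"
    using K.scalar_one_l[OF K.scalar_amat[OF N]] K.scalar_mult[OF M N] MN by simp
  also have "\<dots> = map_mat (bil_counit E) E.a" by (rule E.counit_hom(2)[symmetric])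
  finally show ?thesis by (rule E.B_hom_unique[OF 1 E.counit_hom(1) kalg_base _ assms])
qed

lemma bil_iso_antipode:
  assumes "X \<in> carrier E.B"
  shows "bil_antipode F (bil_iso X) = bil_iso (bil_antipode E X)"
proof -
  let ?o = "amat_mult (op_alg F.B)" and ?m = "amat_mult F.B"
  note ko = kalg_op[OF F.kalg_B]
  note 1 = alg_hom_comp[OF bil_iso_hom(1) F.antipode_hom(1)]
  note 2 = alg_hom_comp[OF E.antipode_hom(1) alg_hom_op[OF bil_iso_hom(1)]]
  have sN: "amat F.B m m (?m F.antipode_mat SN)" by (rule F.B.amat_mult_amat[OF F.s_amat scalars(2)])
  have "map_mat (\<lambda>x. bil_antipode F (bil_iso x)) E.a = map_mat (bil_antipode F) u"
    unfolding map_mat_comp2 bil_iso_hom(2) ..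
  also have "\<dots> = ?o SM (?o F.antipode_mat SN)"
    unfolding map_u[OF F.antipode_hom(1) ko] F.antipode_hom(2) scalar_mat_op ..
  also have "?o F.antipode_mat SN = ?m F.antipode_mat SN"
    unfolding amat_mult_op[OF F.kalg_B F.s_amat scalars(2)] by (rule F.B.amat_mult_op_scalar_r[OF N F.s_amat])
  also have "?o SM (?m F.antipode_mat SN) = ?m SM (?m F.antipode_mat SN)"
    unfolding amat_mult_op[OF F.kalg_B scalars(1) sN] by (rule F.B.amat_mult_op_scalar_l[OF M sN])
  also have "\<dots> = link_inv F.B E E (map_mat bil_iso E.a)"
    unfolding bil_iso_hom(2) u_link(2) ..
  also have "\<dots> = map_mat (\<lambda>x. bil_iso (bil_antipode E x)) E.a"
    unfolding map_mat_comp2 E.antipode_hom(2)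
    by (rule alg_hom_link_inv[OF bil_iso_hom(1) E.kalg_B F.kalg_B E.E E.E E.invE E.a_amat, symmetric])
  finally show ?thesis by (rule E.B_hom_unique[OF 1 2 ko _ assms])
qed

lemma hopf_isomorphic: "hopf_isomorphic (bil_hopf E) (bil_hopf F)"
proof -
  interpret S: bil_congruence F E m N M by (rule sym)
  have inv: "S.bil_iso (bil_iso X) = X" if "X \<in> carrier E.B" for X by (rule S.bil_iso_inverse[OF that])
  have "bij_betw bil_iso (carrier E.B) (carrier F.B)"
    by (rule bij_betw_byWitness[where f' = S.bil_iso])
      (use inv bil_iso_inverse alg_homD(4)[OF bil_iso_hom(1)] alg_homD(4)[OF S.bil_iso_hom(1)] in auto)
  then have "bil_iso \<in> ring_iso (bil_hopf E) (bil_hopf F)"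
    using bil_iso_hom(1)
    by (auto simp: ring_iso_def Ring.ring_hom_def E.hopf_simps F.hopf_simps alg_hom_def lin_map_def)
  then have "bil_iso \<in> hopf_iso (bil_hopf E) (bil_hopf F)"
    using bil_iso_comult bil_iso_counit bil_iso_antipode lin_mapD(3)[OF alg_homD(1)[OF bil_iso_hom(1)]]
    by (simp add: hopf_iso_def E.hopf_simps F.hopf_simps F.tensor_map_hopf)
  then show ?thesis by (auto simp: hopf_isomorphic_def)
qed

end

section \<open>Functions on words annihilated by a form\<close>

locale form =
  fixes m :: nat and e :: "nat \<Rightarrow> nat \<Rightarrow> 'k::field"
begin

abbreviation "W \<equiv> lists {..<m}"

text \<open>Such functions are the linear forms on the component of degree \<open>n\<close> of the quadratic algebra with
generators \<open>x_i\<close> and the single relation \<open>\<Sum> e i j x_i x_j = 0\<close>.\<close>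
definition traceless :: "nat \<Rightarrow> (nat list \<Rightarrow> 'k) \<Rightarrow> bool" where
  "traceless n s \<longleftrightarrow> (\<forall>u\<in>W. \<forall>v\<in>W. length u + length v + 2 = n \<longrightarrow>
     (\<Sum>i<m. \<Sum>j<m. e i j * s (u @ i # j # v)) = 0)"

lemma tracelessD:
  "traceless n s \<Longrightarrow> u \<in> W \<Longrightarrow> v \<in> W \<Longrightarrow> length u + length v + 2 = n \<Longrightarrow>
    (\<Sum>i<m. \<Sum>j<m. e i j * s (u @ i # j # v)) = 0"
  by (auto simp: traceless_def)

end

locale form_inv = form m e for m and e :: "nat \<Rightarrow> nat \<Rightarrow> 'k::field" +
  fixes e' :: "nat \<Rightarrow> nat \<Rightarrow> 'k"
  assumes inv_r: "i < m \<Longrightarrow> k < m \<Longrightarrow> (\<Sum>j<m. e i j * e' j k) = (if i = k then 1 else 0)"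
    and inv_l: "i < m \<Longrightarrow> k < m \<Longrightarrow> (\<Sum>j<m. e' i j * e j k) = (if i = k then 1 else 0)"

context form_inv
begin

lemma e_inverse_apply: "i < m \<Longrightarrow> (\<Sum>j<m. e' i j * (\<Sum>k<m. e j k * f k)) = f i"
proof -
  assume i: "i < m"
  have "(\<Sum>j<m. e' i j * (\<Sum>k<m. e j k * f k)) = (\<Sum>j<m. \<Sum>k<m. e' i j * e j k * f k)"
    by (simp add: sum_distrib_left mult_ac)
  also have "\<dots> = (\<Sum>k<m. (\<Sum>j<m. e' i j * e j k) * f k)"
    by (subst sum.swap) (simp add: sum_distrib_right)
  also have "\<dots> = (\<Sum>k<m. if i = k then f k else 0)"
    by (intro sum.cong) (use i in \<open>auto simp: inv_l\<close>)
  finally show ?thesis using i by simp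
qed

end

text \<open>The equation for \<open>q\<close> is \<open>q + 1/q = - \<Sum> e i j * e' i j\<close>. It makes the form \<open>e\<close> comparable with the
form on a plane with matrix \<open>((0, 1), (-1/q, 0))\<close>; the isotropic vector starts the
recursion for the second family of operators.\<close>
locale form_isotropic = form_inv m e e' for m and e e' :: "nat \<Rightarrow> nat \<Rightarrow> 'k::field" +
  fixes c :: "nat \<Rightarrow> 'k" and q :: 'k
  assumes isotropic: "(\<Sum>i<m. \<Sum>j<m. e i j * c i * c j) = 0"
    and c_nz: "\<exists>i<m. c i \<noteq> 0"
    and q_nz: "q \<noteq> 0"
    and q_root: "q * q + q * (\<Sum>i<m. \<Sum>j<m. e i j * e' i j) + 1 = 0"
begin

definition \<l> :: "nat \<Rightarrow> 'k" where "\<l> i = (\<Sum>j<m. e i j * c j)"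

lemma c_l: "(\<Sum>i<m. \<l> i * c i) = 0"
  using isotropic by (simp add: \<l>_def sum_distrib_left mult_ac)

lemma e'_l: "i < m \<Longrightarrow> (\<Sum>j<m. e' i j * \<l> j) = c i"
  unfolding \<l>_def by (rule e_inverse_apply)

text \<open>A function on words of all lengths, annihilated by \<open>e\<close> at neighbouring letters, in which each value
is determined by the values one letter further: this couples the different lengths, so that operators
that change the length can act.\<close>
definition admissible :: "(nat list \<Rightarrow> 'k) \<Rightarrow> bool" where
  "admissible \<sigma> \<longleftrightarrow> (\<forall>u\<in>W. \<forall>v\<in>W. (\<Sum>i<m. \<Sum>j<m. e i j * \<sigma> (u @ i # j # v)) = 0) \<and>
    (\<forall>u\<in>W. (\<Sum>j<m. \<l> j * \<sigma> (u @ [j])) = \<sigma> u)"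

subsection \<open>Extension to words of all lengths\<close>

text \<open>One step from length \<open>n\<close> to \<open>n + 1\<close>. The ansatz \<open>w j \<mapsto> \<beta>_j s(w) + c_j r(w)\<close> has the contraction
\<open>s\<close> with \<open>\<l>\<close> at the last letter, because \<open>\<l> \<cdot> \<beta> = 1\<close> and \<open>\<l> \<cdot> c = 0\<close>. The form
annihilates it at the last two letters if the contraction of \<open>r\<close> with \<open>\<l>\<close> is
\<open>u \<mapsto> - \<Sum> (e \<beta>)_i s(u i)\<close>, so \<open>r\<close> is an extension of a function on shorter words.\<close>
primrec extend :: "(nat \<Rightarrow> 'k) \<Rightarrow> nat \<Rightarrow> (nat list \<Rightarrow> 'k) \<Rightarrow> nat list \<Rightarrow> 'k" where
  "extend \<beta> 0 s = (\<lambda>w. \<beta> (last w) * s (butlast w))"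
| "extend \<beta> (Suc n) s = (\<lambda>w. \<beta> (last w) * s (butlast w) +
     c (last w) * extend \<beta> n (\<lambda>u. - (\<Sum>i<m. (\<Sum>j<m. e i j * \<beta> j) * s (u @ [i]))) (butlast w))"

lemma extend_contract:
  assumes "(\<Sum>j<m. \<l> j * \<beta> j) = 1"
  shows "(\<Sum>j<m. \<l> j * extend \<beta> n s (w @ [j])) = s w"
proof (cases n)
  case 0
  then show ?thesis using assms by (simp add: sum_distrib_right[symmetric] mult.assoc[symmetric])
next
  case (Suc k)
  define r where "r = extend \<beta> k (\<lambda>u. - (\<Sum>i<m. (\<Sum>j<m. e i j * \<beta> j) * s (u @ [i])))"
  have "(\<Sum>j<m. \<l> j * extend \<beta> n s (w @ [j])) = (\<Sum>j<m. \<l> j * (\<beta> j * s w + c j * r w))"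
    by (simp add: Suc r_def)
  also have "\<dots> = (\<Sum>j<m. \<l> j * \<beta> j) * s w + (\<Sum>j<m. \<l> j * c j) * r w"
    by (simp only: sum_distrib_left sum_distrib_right sum.distrib distrib_left mult_ac)
  finally have "(\<Sum>j<m. \<l> j * extend \<beta> n s (w @ [j])) = (\<Sum>j<m. \<l> j * \<beta> j) * s w + (\<Sum>j<m. \<l> j * c j) * r w" .
  then show ?thesis using assms c_l by simp
qed

text \<open>At the last two letters the two summands of the recursion cancel; at all other places the form
annihilates both of them separately.\<close>
lemma extend_traceless:
  assumes "(\<Sum>j<m. \<l> j * \<beta> j) = 1"
  shows "traceless n s \<Longrightarrow> traceless (Suc n) (extend \<beta> n s)"
proof (induction n arbitrary: s)
  case 0
  then show ?case by (simp add: traceless_def)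
next
  case (Suc n)
  define b where "b = (\<lambda>i. \<Sum>j<m. e i j * \<beta> j)"
  define s' where "s' = (\<lambda>u. - (\<Sum>i<m. b i * s (u @ [i])))"
  let ?r = "extend \<beta> n s'"
  have ext: "extend \<beta> (Suc n) s = (\<lambda>w. \<beta> (last w) * s (butlast w) + c (last w) * ?r (butlast w))"
    by (simp add: s'_def b_def)
  have s': "traceless n s'"
    unfolding traceless_def
  proof (intro ballI impI)
    fix u v assume uv: "u \<in> W" "v \<in> W" "length u + length v + 2 = n"
    have "(\<Sum>i<m. \<Sum>j<m. e i j * s' (u @ i # j # v)) =
        - (\<Sum>i<m. \<Sum>j<m. \<Sum>k<m. b k * (e i j * s (u @ i # j # (v @ [k]))))"
      by (simp add: s'_def sum_distrib_left sum_negf mult_ac)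
    also have "\<dots> = - (\<Sum>i<m. \<Sum>k<m. \<Sum>j<m. b k * (e i j * s (u @ i # j # (v @ [k]))))"
      by (subst (2) sum.swap) (rule refl)
    also have "\<dots> = - (\<Sum>k<m. \<Sum>i<m. \<Sum>j<m. b k * (e i j * s (u @ i # j # (v @ [k]))))"
      by (subst sum.swap) (rule refl)
    also have "\<dots> = - (\<Sum>k<m. b k * (\<Sum>i<m. \<Sum>j<m. e i j * s (u @ i # j # (v @ [k]))))"
      by (simp only: sum_distrib_left)
    also have "\<dots> = - (\<Sum>k<m. b k * 0)"
      by (intro arg_cong[where f = uminus] sum.cong refl arg_cong2[where f = "(*)"] tracelessD[OF Suc.prems])
        (use uv in auto)
    finally show "(\<Sum>i<m. \<Sum>j<m. e i j * s' (u @ i # j # v)) = 0" by simp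
  qed
  have r: "traceless (Suc n) ?r" by (rule Suc.IH[OF s'])
  show ?case
    unfolding traceless_def
  proof (intro ballI impI)
    fix u v assume uv: "u \<in> W" "v \<in> W" "length u + length v + 2 = Suc (Suc n)"
    show "(\<Sum>i<m. \<Sum>j<m. e i j * extend \<beta> (Suc n) s (u @ i # j # v)) = 0"
    proof (cases v rule: rev_cases)
      case Nil
      have "(\<Sum>i<m. \<Sum>j<m. e i j * extend \<beta> (Suc n) s (u @ i # j # v)) =
         (\<Sum>i<m. \<Sum>j<m. e i j * \<beta> j * s (u @ [i]) + e i j * c j * ?r (u @ [i]))"
        unfolding ext Nil by (simp add: butlast_append algebra_simps)
      also have "\<dots> = (\<Sum>i<m. b i * s (u @ [i])) + (\<Sum>i<m. \<l> i * ?r (u @ [i]))"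
        by (simp add: sum.distrib sum_distrib_right \<l>_def b_def)
      also have "(\<Sum>i<m. \<l> i * ?r (u @ [i])) = s' u" by (rule extend_contract[OF assms])
      finally show ?thesis by (simp add: s'_def)
    next
      case (snoc v' x)
      then have v': "v' \<in> W" "length u + length v' + 2 = Suc n" using uv by auto
      have "(\<Sum>i<m. \<Sum>j<m. e i j * extend \<beta> (Suc n) s (u @ i # j # v)) =
         (\<Sum>i<m. \<Sum>j<m. \<beta> x * (e i j * s (u @ i # j # v')) + c x * (e i j * ?r (u @ i # j # v')))"
        unfolding ext snoc by (simp add: butlast_append algebra_simps)
      also have "\<dots> = \<beta> x * (\<Sum>i<m. \<Sum>j<m. e i j * s (u @ i # j # v')) +
          c x * (\<Sum>i<m. \<Sum>j<m. e i j * ?r (u @ i # j # v'))"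
        by (simp add: sum.distrib sum_distrib_left)
      finally show ?thesis
        using tracelessD[OF Suc.prems uv(1) v'] tracelessD[OF r uv(1) v'] by simp
    qed
  qed
qed

primrec up :: "(nat \<Rightarrow> 'k) \<Rightarrow> nat \<Rightarrow> (nat list \<Rightarrow> 'k) \<Rightarrow> nat \<Rightarrow> nat list \<Rightarrow> 'k" where
  "up \<beta> n s 0 = s"
| "up \<beta> n s (Suc k) = extend \<beta> (n + k) (up \<beta> n s k)"

primrec down :: "(nat list \<Rightarrow> 'k) \<Rightarrow> nat \<Rightarrow> nat list \<Rightarrow> 'k" where
  "down s 0 = s"
| "down s (Suc d) = (\<lambda>w. \<Sum>j<m. \<l> j * down s d (w @ [j]))"

lemma up_traceless:
  "(\<Sum>j<m. \<l> j * \<beta> j) = 1 \<Longrightarrow> traceless n s \<Longrightarrow> traceless (n + k) (up \<beta> n s k)"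
  by (induction k) (auto intro: extend_traceless)

lemma down_traceless:
  "traceless n s \<Longrightarrow> u \<in> W \<Longrightarrow> v \<in> W \<Longrightarrow> length u + length v + 2 + d = n \<Longrightarrow>
    (\<Sum>i<m. \<Sum>j<m. e i j * down s d (u @ i # j # v)) = 0"
proof (induction d arbitrary: v)
  case 0
  then show ?case using tracelessD[of n s u v] by simp
next
  case (Suc d)
  have "(\<Sum>i<m. \<Sum>j<m. e i j * down s (Suc d) (u @ i # j # v)) =
      (\<Sum>i<m. \<Sum>j<m. \<Sum>k<m. \<l> k * (e i j * down s d (u @ i # j # (v @ [k]))))"
    by (simp add: sum_distrib_left mult_ac)
  also have "\<dots> = (\<Sum>i<m. \<Sum>k<m. \<Sum>j<m. \<l> k * (e i j * down s d (u @ i # j # (v @ [k]))))"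
    by (subst (2) sum.swap) (rule refl)
  also have "\<dots> = (\<Sum>k<m. \<Sum>i<m. \<Sum>j<m. \<l> k * (e i j * down s d (u @ i # j # (v @ [k]))))"
    by (subst sum.swap) (rule refl)
  also have "\<dots> = (\<Sum>k<m. \<l> k * (\<Sum>i<m. \<Sum>j<m. e i j * down s d (u @ i # j # (v @ [k]))))"
    by (simp only: sum_distrib_left)
  also have "\<dots> = (\<Sum>k<m. \<l> k * 0)"
    by (intro sum.cong refl arg_cong2[where f = "(*)"] Suc.IH) (use Suc.prems in auto)
  finally show ?case by simp
qed

lemma beta_exists: "\<exists>\<beta>. (\<Sum>j<m. \<l> j * \<beta> j) = 1"
proof -
  obtain z where z: "z < m" "\<l> z \<noteq> 0"
  proof (rule ccontr)
    assume "\<not> thesis"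
    with that have "\<And>z. z < m \<Longrightarrow> \<l> z = 0" by blast
    then have "c i = 0" if "i < m" for i using e'_l[OF that] by simp
    with c_nz show False by blast
  qed
  have "(\<Sum>j<m. \<l> j * (if z = j then 1 / \<l> z else 0)) = (\<Sum>j<m. if z = j then 1 else 0)"
    by (intro sum.cong) (use z in auto)
  then show ?thesis using z by (intro exI[of _ "\<lambda>j. if z = j then 1 / \<l> z else 0"]) simp
qed

text \<open>Words shorter than \<open>n\<close> are reached by contracting with \<open>\<l>\<close> at the end, longer words by repeated
extension.\<close>
lemma admissible_extension:
  assumes "traceless n s"
  obtains \<sigma> where "admissible \<sigma>" "\<And>w. length w = n \<Longrightarrow> \<sigma> w = s w"
proof -
  obtain \<beta> where \<beta>: "(\<Sum>j<m. \<l> j * \<beta> j) = 1" using beta_exists by blast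
  define \<sigma> where "\<sigma> = (\<lambda>w. if length w < n then down s (n - length w) w else up \<beta> n s (length w - n) w)"
  have "admissible \<sigma>"
    unfolding admissible_def
  proof (intro conjI ballI)
    fix u v assume uv: "u \<in> W" "v \<in> W"
    let ?L = "length u + length v + 2"
    show "(\<Sum>i<m. \<Sum>j<m. e i j * \<sigma> (u @ i # j # v)) = 0"
    proof (cases "?L < n")
      case True
      then show ?thesis using down_traceless[OF assms uv, of "n - ?L"] by (simp add: \<sigma>_def)
    next
      case False
      then show ?thesis using tracelessD[OF up_traceless[OF \<beta> assms, of "?L - n"] uv]
        by (simp add: \<sigma>_def)
    qed
  next
    fix u assume u: "u \<in> W"
    show "(\<Sum>j<m. \<l> j * \<sigma> (u @ [j])) = \<sigma> u"
    proof (cases "length u < n")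
      case True
      then obtain d where d: "n - length u = Suc d" by (metis Suc_diff_Suc)
      have "\<sigma> (u @ [j]) = down s d (u @ [j])" for j
      proof (cases "d = 0")
        case False
        then show ?thesis using True d by (simp add: \<sigma>_def) (metis Suc_diff_Suc diff_Suc_1' diff_is_0_eq' not_less_eq not_le)
      qed (use True d in \<open>auto simp: \<sigma>_def\<close>)
      then show ?thesis using True by (simp add: \<sigma>_def d)
    next
      case False
      then have "\<sigma> (u @ [j]) = extend \<beta> (length u) (up \<beta> n s (length u - n)) (u @ [j])" for j
        by (simp add: \<sigma>_def Suc_diff_le)
      then show ?thesis using False extend_contract[OF \<beta>] by (simp add: \<sigma>_def)
    qed
  qed
  moreover have "\<sigma> w = s w" if "length w = n" for w using that by (simp add: \<sigma>_def)
  ultimately show ?thesis using that by blast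
qed

subsection \<open>Operators on admissible functions\<close>

text \<open>The second family of operators, the first being \<open>X\<close> below. The operators act from the right: \<open>X i\<close>
removes the first letter \<open>i\<close>. The recursion is the commutation rule
\<open>x'_i x_j = q x_i x'_j + e' i j\<close>, which reduces \<open>x'_i\<close> to its value on the empty word.\<close>
fun Xp :: "nat \<Rightarrow> (nat list \<Rightarrow> 'k) \<Rightarrow> nat list \<Rightarrow> 'k" where
  "Xp i \<sigma> [] = c i * \<sigma> []"
| "Xp i \<sigma> (j # w) = q * Xp j (\<lambda>v. \<sigma> (i # v)) w + e' i j * \<sigma> w"

abbreviation X :: "nat \<Rightarrow> (nat list \<Rightarrow> 'k) \<Rightarrow> nat list \<Rightarrow> 'k" where
  "X i \<sigma> \<equiv> (\<lambda>w. \<sigma> (i # w))"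

lemma Xp_cong: "(\<And>v. v \<in> W \<Longrightarrow> \<sigma> v = \<tau> v) \<Longrightarrow> i < m \<Longrightarrow> w \<in> W \<Longrightarrow> Xp i \<sigma> w = Xp i \<tau> w"
proof (induction w arbitrary: i \<sigma> \<tau>)
  case (Cons j w)
  have "Xp j (X i \<sigma>) w = Xp j (X i \<tau>) w" by (rule Cons.IH) (use Cons.prems in auto)
  then show ?case using Cons.prems by simp
qed simp

lemma Xp_lin: "Xp i (\<lambda>v. \<Sum>x\<in>S. a x * \<sigma> x v) w = (\<Sum>x\<in>S. a x * Xp i (\<sigma> x) w)"
proof (induction w arbitrary: i \<sigma>)
  case (Cons j w)
  show ?case
    unfolding Xp.simps(2) Cons.IH by (simp only: sum_distrib_left distrib_left sum.distrib mult_ac)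
qed (simp add: sum_distrib_left mult_ac)

lemma Xp_zero: "Xp i (\<lambda>v. 0) w = 0"
  by (induction w arbitrary: i) auto

lemma Xp_lin2: "Xp i (\<lambda>v. \<Sum>x\<in>S. \<Sum>y\<in>R. a x y * \<sigma> x y v) w = (\<Sum>x\<in>S. \<Sum>y\<in>R. a x y * Xp i (\<sigma> x y) w)"
  using Xp_lin[where S = "S \<times> R" and a = "\<lambda>z. a (fst z) (snd z)" and \<sigma> = "\<lambda>z. \<sigma> (fst z) (snd z)"]
  by (simp add: sum.cartesian_product case_prod_unfold)

lemma admissible_quad: "admissible \<sigma> \<Longrightarrow> u \<in> W \<Longrightarrow> v \<in> W \<Longrightarrow> (\<Sum>i<m. \<Sum>j<m. e i j * \<sigma> (u @ i # j # v)) = 0"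
  by (simp add: admissible_def)

lemma admissible_ell: "admissible \<sigma> \<Longrightarrow> u \<in> W \<Longrightarrow> (\<Sum>j<m. \<l> j * \<sigma> (u @ [j])) = \<sigma> u"
  by (simp add: admissible_def)

lemma X_admissible:
  assumes "admissible \<sigma>" "i < m"
  shows "admissible (X i \<sigma>)"
  unfolding admissible_def
proof (intro conjI ballI)
  fix u v assume "u \<in> W" "v \<in> W"
  then show "(\<Sum>ia<m. \<Sum>j<m. e ia j * \<sigma> (i # u @ ia # j # v)) = 0"
    using admissible_quad[OF assms(1), of "i # u" v] assms(2) by simp
next
  fix u assume "u \<in> W"
  then show "(\<Sum>j<m. \<l> j * \<sigma> (i # u @ [j])) = \<sigma> (i # u)"
    using admissible_ell[OF assms(1), of "i # u"] assms(2) by simp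
qed

lemma e_e'_contract:
  "h < m \<Longrightarrow> (\<Sum>j<m. \<Sum>k<m. e j k * e' k h * f j) = f h"
  "i < m \<Longrightarrow> (\<Sum>j<m. \<Sum>k<m. e' i j * e j k * f k) = f i"
proof -
  assume h: "h < m"
  have "(\<Sum>j<m. \<Sum>k<m. e j k * e' k h * f j) = (\<Sum>j<m. if j = h then f j else 0)"
    by (intro sum.cong) (use h in \<open>auto simp: sum_distrib_right[symmetric] inv_r\<close>)
  then show "(\<Sum>j<m. \<Sum>k<m. e j k * e' k h * f j) = f h" using h by simp
next
  assume i: "i < m"
  have "(\<Sum>j<m. \<Sum>k<m. e' i j * e j k * f k) = (\<Sum>k<m. if i = k then f k else 0)"
    by (subst sum.swap, intro sum.cong) (use i in \<open>auto simp: sum_distrib_right[symmetric] inv_l\<close>)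
  then show "(\<Sum>j<m. \<Sum>k<m. e' i j * e j k * f k) = f i" using i by simp
qed

text \<open>This lemma and the next ones say that the two columns \<open>x, x'\<close> satisfy
\<open>(x, x')^T e (x, x') = ((0, 1), (-1/q, 0))\<close> on admissible functions.\<close>
lemma rel_XX: "admissible \<sigma> \<Longrightarrow> w \<in> W \<Longrightarrow> (\<Sum>j<m. \<Sum>k<m. e j k * X k (X j \<sigma>) w) = 0"
  using admissible_quad[of \<sigma> "[]" w] by simp

lemma rel_XXp: "admissible \<sigma> \<Longrightarrow> w \<in> W \<Longrightarrow> (\<Sum>j<m. \<Sum>k<m. e j k * Xp k (X j \<sigma>) w) = \<sigma> w"
proof (cases w)
  case Nil
  assume "admissible \<sigma>"
  from admissible_ell[OF this, of "[]"] show ?thesis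
    by (simp add: Nil \<l>_def sum_distrib_left mult_ac)
next
  case (Cons h w')
  assume a: "admissible \<sigma>" "w \<in> W"
  then have h: "h < m" "w' \<in> W" using Cons by auto
  have z: "(\<Sum>j<m. \<Sum>k<m. e j k * Xp h (X k (X j \<sigma>)) w') = 0"
  proof -
    have "(\<Sum>j<m. \<Sum>k<m. e j k * Xp h (X k (X j \<sigma>)) w') = Xp h (\<lambda>v. \<Sum>j<m. \<Sum>k<m. e j k * X k (X j \<sigma>) v) w'"
      by (rule Xp_lin2[symmetric])
    also have "\<dots> = Xp h (\<lambda>v. 0) w'" by (rule Xp_cong) (use rel_XX[OF a(1)] h in auto)
    finally show ?thesis by (simp add: Xp_zero)
  qed
  have "(\<Sum>j<m. \<Sum>k<m. e j k * Xp k (X j \<sigma>) w) =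
      q * (\<Sum>j<m. \<Sum>k<m. e j k * Xp h (X k (X j \<sigma>)) w') + (\<Sum>j<m. \<Sum>k<m. e j k * e' k h * \<sigma> (j # w'))"
    unfolding Cons Xp.simps(2)[of _ "X _ \<sigma>"]
    by (simp only: sum_distrib_left distrib_left sum.distrib mult_ac)
  then show ?thesis unfolding z using e_e'_contract(1)[OF h(1)] Cons by simp
qed

text \<open>By the commutation rule the left-hand side is \<open>q + \<Sum> e j k * e' j k\<close>; here the equation for \<open>q\<close>
enters.\<close>
lemma rel_XpX: "admissible \<sigma> \<Longrightarrow> w \<in> W \<Longrightarrow> (\<Sum>j<m. \<Sum>k<m. e j k * X k (Xp j \<sigma>) w) = - inverse q * \<sigma> w"
proof -
  assume a: "admissible \<sigma>" "w \<in> W"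
  let ?t = "\<Sum>j<m. \<Sum>k<m. e j k * e' j k"
  have "(\<Sum>j<m. \<Sum>k<m. e j k * X k (Xp j \<sigma>) w) = q * (\<Sum>j<m. \<Sum>k<m. e j k * Xp k (X j \<sigma>) w) + ?t * \<sigma> w"
    by (simp only: Xp.simps(2)[of _ \<sigma>] sum_distrib_left sum_distrib_right distrib_left sum.distrib mult_ac)
  also have "\<dots> = (q + ?t) * \<sigma> w" unfolding rel_XXp[OF a] by (simp add: algebra_simps)
  also have "q + ?t = - inverse q"
    using q_root q_nz by (simp add: field_simps eq_neg_iff_add_eq_0)
  finally show ?thesis .
qed

text \<open>Move \<open>x'_i\<close> past the common prefix with the commutation rule. At the end of the prefix remain
the relation for \<open>x' x\<close>, and for the last letter \<open>\<l> \<cdot> c = 0\<close> and \<open>e' \<l> = c\<close>.\<close>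
lemma Xp_admissible: "admissible \<sigma> \<Longrightarrow> i < m \<Longrightarrow> admissible (Xp i \<sigma>)"
proof -
  have 1: "(\<Sum>j<m. \<Sum>k<m. e j k * Xp i \<sigma> (u @ j # k # v)) = 0"
    if "admissible \<sigma>" "i < m" "u \<in> W" "v \<in> W" for \<sigma> i u v
    using that
  proof (induction u arbitrary: i \<sigma>)
    case Nil
    have "(\<Sum>j<m. \<Sum>k<m. e j k * Xp i \<sigma> ([] @ j # k # v)) =
       q * (\<Sum>j<m. \<Sum>k<m. e j k * X k (Xp j (X i \<sigma>)) v) + (\<Sum>j<m. \<Sum>k<m. e' i j * e j k * \<sigma> (k # v))"
      unfolding append_Nil Xp.simps(2)[of i \<sigma>]
      by (simp only: sum_distrib_left distrib_left sum.distrib mult_ac)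
    also have "\<dots> = 0"
      unfolding rel_XpX[OF X_admissible[OF Nil(1,2)] Nil(4)] e_e'_contract(2)[OF Nil(2)] using q_nz by simp
    finally show ?case .
  next
    case (Cons h u)
    have IH: "(\<Sum>j<m. \<Sum>k<m. e j k * Xp h (X i \<sigma>) (u @ j # k # v)) = 0"
      by (rule Cons.IH) (use Cons.prems in \<open>auto intro: X_admissible\<close>)
    have "(\<Sum>j<m. \<Sum>k<m. e j k * Xp i \<sigma> ((h # u) @ j # k # v)) =
       q * (\<Sum>j<m. \<Sum>k<m. e j k * Xp h (X i \<sigma>) (u @ j # k # v)) +
       e' i h * (\<Sum>j<m. \<Sum>k<m. e j k * \<sigma> (u @ j # k # v))"
      unfolding append_Cons Xp.simps(2)[of i \<sigma>]
      by (simp only: sum_distrib_left distrib_left sum.distrib mult_ac)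
    then show ?case unfolding IH using admissible_quad[OF Cons.prems(1), of u v] Cons.prems by simp
  qed
  have 2: "(\<Sum>j<m. \<l> j * Xp i \<sigma> (u @ [j])) = Xp i \<sigma> u"
    if "admissible \<sigma>" "i < m" "u \<in> W" for \<sigma> i u
    using that
  proof (induction u arbitrary: i \<sigma>)
    case Nil
    have "(\<Sum>j<m. \<l> j * Xp i \<sigma> ([] @ [j])) = q * \<sigma> [i] * (\<Sum>j<m. \<l> j * c j) + (\<Sum>j<m. e' i j * \<l> j) * \<sigma> []"
      unfolding append_Nil Xp.simps(2)[of i \<sigma>] Xp.simps(1)
      by (simp only: sum_distrib_left sum_distrib_right distrib_left sum.distrib mult_ac)
    then show ?case unfolding c_l e'_l[OF Nil(2)] by simp
  next
    case (Cons h u)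
    have IH: "(\<Sum>j<m. \<l> j * Xp h (X i \<sigma>) (u @ [j])) = Xp h (X i \<sigma>) u"
      by (rule Cons.IH) (use Cons.prems in \<open>auto intro: X_admissible\<close>)
    have "(\<Sum>j<m. \<l> j * Xp i \<sigma> ((h # u) @ [j])) =
       q * (\<Sum>j<m. \<l> j * Xp h (X i \<sigma>) (u @ [j])) + e' i h * (\<Sum>j<m. \<l> j * \<sigma> (u @ [j]))"
      unfolding append_Cons Xp.simps(2)[of i \<sigma>]
      by (simp only: sum_distrib_left distrib_left sum.distrib mult_ac)
    then show ?case unfolding IH using admissible_ell[OF Cons.prems(1), of u] Cons.prems by simp
  qed
  show "admissible \<sigma> \<Longrightarrow> i < m \<Longrightarrow> admissible (Xp i \<sigma>)" unfolding admissible_def[of "Xp i \<sigma>"] using 1 2 by blast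
qed

lemma rel_XpXp: "admissible \<sigma> \<Longrightarrow> w \<in> W \<Longrightarrow> (\<Sum>j<m. \<Sum>k<m. e j k * Xp k (Xp j \<sigma>) w) = 0"
proof (cases w)
  case Nil
  have "(\<Sum>j<m. \<Sum>k<m. e j k * Xp k (Xp j \<sigma>) []) = (\<Sum>j<m. \<Sum>k<m. e j k * c j * c k) * \<sigma> []"
    by (simp add: sum_distrib_left mult_ac)
  then show ?thesis by (simp add: Nil isotropic)
next
  case (Cons h w')
  assume a: "admissible \<sigma>" "w \<in> W"
  then have h: "h < m" "w' \<in> W" using Cons by auto
  have z: "(\<Sum>j<m. \<Sum>k<m. e j k * Xp h (X k (Xp j \<sigma>)) w') = - inverse q * Xp h \<sigma> w'"
  proof -
    have "(\<Sum>j<m. \<Sum>k<m. e j k * Xp h (X k (Xp j \<sigma>)) w') = Xp h (\<lambda>v. \<Sum>j<m. \<Sum>k<m. e j k * X k (Xp j \<sigma>) v) w'"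
      by (rule Xp_lin2[symmetric])
    also have "\<dots> = Xp h (\<lambda>v. \<Sum>x\<in>{()}. - inverse q * \<sigma> v) w'"
      by (rule Xp_cong) (use rel_XpX[OF a(1)] h in auto)
    also have "\<dots> = - inverse q * Xp h \<sigma> w'"
      using Xp_lin[where S = "{()}" and a = "\<lambda>_. - inverse q" and \<sigma> = "\<lambda>_. \<sigma>"] by simp
    finally show ?thesis .
  qed
  have "(\<Sum>j<m. \<Sum>k<m. e j k * Xp k (Xp j \<sigma>) w) =
      q * (\<Sum>j<m. \<Sum>k<m. e j k * Xp h (X k (Xp j \<sigma>)) w') + (\<Sum>j<m. \<Sum>k<m. e j k * e' k h * Xp j \<sigma> w')"
    unfolding Cons Xp.simps(2)[of _ "Xp _ \<sigma>"]
    by (simp only: sum_distrib_left sum.distrib distrib_left mult_ac)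
  then show ?thesis unfolding z e_e'_contract(1)[OF h(1)] using q_nz by simp
qed

end

section \<open>Functionals of prescribed leading part\<close>

locale form_pair = P: form_isotropic m e e' c q + Q: form_isotropic m e' e d q
  for m and e e' :: "nat \<Rightarrow> nat \<Rightarrow> 'k::field" and c d q
begin

abbreviation "W \<equiv> lists {..<m}"
abbreviation "WW \<equiv> lists ({..<m} \<times> {..<m})"

text \<open>The coefficient of \<open>z^k\<close> in the product over the letters \<open>(i, j)\<close> of
\<open>x_i y_j z - q x'_i y'_j z^-1\<close>, applied to \<open>\<sigma>\<close> and \<open>\<tau>\<close> and evaluated at the empty word.\<close>
fun psi :: "int \<Rightarrow> (nat list \<Rightarrow> 'k) \<Rightarrow> (nat list \<Rightarrow> 'k) \<Rightarrow> (nat \<times> nat) list \<Rightarrow> 'k" where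
  "psi k \<sigma> \<tau> [] = (if k = 0 then \<sigma> [] * \<tau> [] else 0)"
| "psi k \<sigma> \<tau> ((i, j) # w) = psi (k - 1) (P.X i \<sigma>) (Q.X j \<tau>) w
     - q * psi (k + 1) (P.Xp i \<sigma>) (Q.Xp j \<tau>) w"

lemma psi_cong:
  "(\<And>v. v \<in> W \<Longrightarrow> \<sigma> v = \<sigma>' v) \<Longrightarrow> (\<And>v. v \<in> W \<Longrightarrow> \<tau> v = \<tau>' v) \<Longrightarrow> w \<in> WW \<Longrightarrow>
    psi k \<sigma> \<tau> w = psi k \<sigma>' \<tau>' w"
proof (induction w arbitrary: k \<sigma> \<tau> \<sigma>' \<tau>')
  case (Cons x w)
  obtain i j where x: "x = (i, j)" "i < m" "j < m" using Cons.prems(3) by (cases x) auto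
  have w: "w \<in> WW" using Cons.prems(3) by auto
  have 1: "psi (k - 1) (P.X i \<sigma>) (Q.X j \<tau>) w = psi (k - 1) (P.X i \<sigma>') (Q.X j \<tau>') w"
    by (rule Cons.IH[OF _ _ w]) (use Cons.prems x in auto)
  have 2: "psi (k + 1) (P.Xp i \<sigma>) (Q.Xp j \<tau>) w = psi (k + 1) (P.Xp i \<sigma>') (Q.Xp j \<tau>') w"
    by (rule Cons.IH[OF _ _ w]) (use Cons.prems x in \<open>auto intro!: P.Xp_cong Q.Xp_cong\<close>)
  show ?case unfolding x psi.simps 1 2 ..
qed simp

lemma psi_lin_l: "psi k (\<lambda>v. \<Sum>x\<in>S. a x * \<sigma> x v) \<tau> w = (\<Sum>x\<in>S. a x * psi k (\<sigma> x) \<tau> w)"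
proof (induction w arbitrary: k \<sigma> \<tau>)
  case (Cons z w)
  obtain i j where z: "z = (i, j)" by (cases z) auto
  have *: "P.Xp i (\<lambda>v. \<Sum>x\<in>S. a x * \<sigma> x v) = (\<lambda>v. \<Sum>x\<in>S. a x * P.Xp i (\<sigma> x) v)"
    by (rule ext) (rule P.Xp_lin)
  show ?case
    by (simp add: z Cons.IH * sum_distrib_left sum_subtractf right_diff_distrib mult_ac)
qed (simp add: sum_distrib_left mult_ac)

lemma psi_lin_r: "psi k \<sigma> (\<lambda>v. \<Sum>x\<in>S. a x * \<tau> x v) w = (\<Sum>x\<in>S. a x * psi k \<sigma> (\<tau> x) w)"
proof (induction w arbitrary: k \<sigma> \<tau>)
  case (Cons z w)
  obtain i j where z: "z = (i, j)" by (cases z) auto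
  have *: "Q.Xp j (\<lambda>v. \<Sum>x\<in>S. a x * \<tau> x v) = (\<lambda>v. \<Sum>x\<in>S. a x * Q.Xp j (\<tau> x) v)"
    by (rule ext) (rule Q.Xp_lin)
  show ?case
    by (simp add: z Cons.IH * sum_distrib_left sum_subtractf right_diff_distrib mult_ac)
qed (simp add: sum_distrib_left mult_ac)

lemma psi_lin2_l: "psi k (\<lambda>v. \<Sum>x\<in>S. \<Sum>y\<in>R. a x y * \<sigma> x y v) \<tau> w = (\<Sum>x\<in>S. \<Sum>y\<in>R. a x y * psi k (\<sigma> x y) \<tau> w)"
  using psi_lin_l[where S = "S \<times> R" and a = "\<lambda>z. a (fst z) (snd z)" and \<sigma> = "\<lambda>z. \<sigma> (fst z) (snd z)"]
  by (simp add: sum.cartesian_product case_prod_unfold)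

lemma psi_scale:
  "psi k (\<lambda>v. a * \<sigma> v) \<tau> w = a * psi k \<sigma> \<tau> w" "psi k \<sigma> (\<lambda>v. a * \<tau> v) w = a * psi k \<sigma> \<tau> w"
  using psi_lin_l[where S = "{()}" and a = "\<lambda>_. a" and \<sigma> = "\<lambda>_. \<sigma>"]
    psi_lin_r[where S = "{()}" and a = "\<lambda>_. a" and \<tau> = "\<lambda>_. \<tau>"] by simp_all

lemma psi_add:
  "psi k \<sigma> (\<lambda>v. a * \<tau> v + b * \<tau>' v) w = a * psi k \<sigma> \<tau> w + b * psi k \<sigma> \<tau>' w"
  "psi k (\<lambda>v. a * \<tau> v + b * \<tau>' v) \<sigma> w = a * psi k \<tau> \<sigma> w + b * psi k \<tau>' \<sigma> w"
  using psi_lin_r[where S = "{True, False}" and a = "\<lambda>x. if x then a else b" and \<tau> = "\<lambda>x. if x then \<tau> else \<tau>'"]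
    psi_lin_l[where S = "{True, False}" and a = "\<lambda>x. if x then a else b" and \<sigma> = "\<lambda>x. if x then \<tau> else \<tau>'"]
  by simp_all

lemma psi_two: "psi k \<sigma> \<tau> ((i, j) # (l, r) # v) =
    psi (k - 2) (P.X l (P.X i \<sigma>)) (Q.X r (Q.X j \<tau>)) v
    - q * psi k (P.Xp l (P.X i \<sigma>)) (Q.Xp r (Q.X j \<tau>)) v
    - q * psi k (P.X l (P.Xp i \<sigma>)) (Q.X r (Q.Xp j \<tau>)) v
    + q * q * psi (k + 2) (P.Xp l (P.Xp i \<sigma>)) (Q.Xp r (Q.Xp j \<tau>)) v"
  by (simp add: algebra_simps)

lemma psi_zero: "psi k (\<lambda>v. 0) \<tau> w = 0" "psi k \<sigma> (\<lambda>v. 0) w = 0"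
  using psi_scale(1)[where a = 0] psi_scale(2)[where a = 0] by simp_all

text \<open>The product of two letters has four terms. Contracted with \<open>e\<close> in the row indices, the terms with
\<open>x x\<close> and \<open>x' x'\<close> vanish and the other two give \<open>- q y_j y'_r + y'_j y_r\<close>, which is \<open>e j r\<close> by
the commutation rule for \<open>y\<close>.\<close>
lemma psi_rel_left:
  assumes "P.admissible \<sigma>" "Q.admissible \<tau>" "u \<in> WW" "v \<in> WW" "j < m" "r < m"
  shows "(\<Sum>i<m. \<Sum>l<m. e i l * psi k \<sigma> \<tau> (u @ (i, j) # (l, r) # v)) = e j r * psi k \<sigma> \<tau> (u @ v)"
  using assms(1-3)
proof (induction u arbitrary: k \<sigma> \<tau>)
  case Nil
  have p1: "(\<Sum>i<m. \<Sum>l<m. e i l * psi k' (P.X l (P.X i \<sigma>)) \<tau>' v) = 0" for k' \<tau>'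
    unfolding psi_lin2_l[symmetric] using psi_cong[of _ "\<lambda>v. 0" \<tau>' \<tau>' v k'] P.rel_XX[OF Nil(1)] assms(4) psi_zero by simp
  have p2: "(\<Sum>i<m. \<Sum>l<m. e i l * psi k' (P.Xp l (P.X i \<sigma>)) \<tau>' v) = psi k' \<sigma> \<tau>' v" for k' \<tau>'
    unfolding psi_lin2_l[symmetric] by (rule psi_cong) (use P.rel_XXp[OF Nil(1)] assms(4) in auto)
  have p3: "(\<Sum>i<m. \<Sum>l<m. e i l * psi k' (P.X l (P.Xp i \<sigma>)) \<tau>' v) = - inverse q * psi k' \<sigma> \<tau>' v" for k' \<tau>'
  proof -
    have "(\<Sum>i<m. \<Sum>l<m. e i l * psi k' (P.X l (P.Xp i \<sigma>)) \<tau>' v) = psi k' (\<lambda>v. - inverse q * \<sigma> v) \<tau>' v"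
      unfolding psi_lin2_l[symmetric] by (rule psi_cong) (use P.rel_XpX[OF Nil(1)] assms(4) in auto)
    then show ?thesis unfolding psi_scale .
  qed
  have p4: "(\<Sum>i<m. \<Sum>l<m. e i l * psi k' (P.Xp l (P.Xp i \<sigma>)) \<tau>' v) = 0" for k' \<tau>'
    unfolding psi_lin2_l[symmetric] using psi_cong[of _ "\<lambda>v. 0" \<tau>' \<tau>' v k'] P.rel_XpXp[OF Nil(1)] assms(4) psi_zero by simp
  have "(\<Sum>i<m. \<Sum>l<m. e i l * psi k \<sigma> \<tau> ([] @ (i, j) # (l, r) # v)) =
      (\<Sum>i<m. \<Sum>l<m. e i l * psi (k - 2) (P.X l (P.X i \<sigma>)) (Q.X r (Q.X j \<tau>)) v)
    - q * (\<Sum>i<m. \<Sum>l<m. e i l * psi k (P.Xp l (P.X i \<sigma>)) (Q.Xp r (Q.X j \<tau>)) v)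
    - q * (\<Sum>i<m. \<Sum>l<m. e i l * psi k (P.X l (P.Xp i \<sigma>)) (Q.X r (Q.Xp j \<tau>)) v)
    + q * q * (\<Sum>i<m. \<Sum>l<m. e i l * psi (k + 2) (P.Xp l (P.Xp i \<sigma>)) (Q.Xp r (Q.Xp j \<tau>)) v)"
    unfolding append_Nil psi_two
    by (simp only: sum_distrib_left sum.distrib sum_subtractf distrib_left right_diff_distrib mult_ac)
  also have "\<dots> = - q * psi k \<sigma> (Q.Xp r (Q.X j \<tau>)) v + 1 * psi k \<sigma> (Q.X r (Q.Xp j \<tau>)) v"
    unfolding p1 p2 p3 p4 using P.q_nz by simp
  also have "\<dots> = psi k \<sigma> (\<lambda>w. - q * Q.Xp r (Q.X j \<tau>) w + 1 * Q.X r (Q.Xp j \<tau>) w) v"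
    by (rule psi_add(1)[symmetric])
  also have "(\<lambda>w. - q * Q.Xp r (Q.X j \<tau>) w + 1 * Q.X r (Q.Xp j \<tau>) w) = (\<lambda>w. e j r * \<tau> w)"
    by (rule ext) simp
  finally show ?case by (simp add: psi_scale)
next
  case (Cons z u)
  obtain x y where z: "z = (x, y)" "x < m" "y < m" using Cons.prems(3) by (cases z) auto
  have u: "u \<in> WW" using Cons.prems(3) by auto
  note IH1 = Cons.IH[OF P.X_admissible[OF Cons.prems(1) z(2)] Q.X_admissible[OF Cons.prems(2) z(3)] u, of "k - 1"]
  note IH2 = Cons.IH[OF P.Xp_admissible[OF Cons.prems(1) z(2)] Q.Xp_admissible[OF Cons.prems(2) z(3)] u, of "k + 1"]
  have "(\<Sum>i<m. \<Sum>l<m. e i l * psi k \<sigma> \<tau> ((z # u) @ (i, j) # (l, r) # v)) =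
     (\<Sum>i<m. \<Sum>l<m. e i l * psi (k - 1) (P.X x \<sigma>) (Q.X y \<tau>) (u @ (i, j) # (l, r) # v))
     - q * (\<Sum>i<m. \<Sum>l<m. e i l * psi (k + 1) (P.Xp x \<sigma>) (Q.Xp y \<tau>) (u @ (i, j) # (l, r) # v))"
    unfolding z append_Cons psi.simps
    by (simp only: sum_distrib_left sum_subtractf right_diff_distrib mult_ac)
  then show ?case unfolding IH1 IH2 by (simp add: z algebra_simps)
qed

text \<open>Exchanging rows and columns exchanges the two forms.\<close>
lemma psi_rel_right:
  assumes "P.admissible \<sigma>" "Q.admissible \<tau>" "u \<in> WW" "v \<in> WW" "i < m" "l < m"
  shows "(\<Sum>j<m. \<Sum>r<m. e' j r * psi k \<sigma> \<tau> (u @ (i, j) # (l, r) # v)) = e' i l * psi k \<sigma> \<tau> (u @ v)"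
proof -
  interpret S: form_pair m e' e d c q by unfold_locales
  have swap: "S.psi k \<tau> \<sigma> (map prod.swap w) = psi k \<sigma> \<tau> w" for k \<sigma> \<tau> w
    by (induction k \<sigma> \<tau> w rule: psi.induct) (simp_all add: mult.commute)
  have uv: "map prod.swap u \<in> WW" "map prod.swap v \<in> WW" using assms(3,4) by (auto simp: in_lists_conv_set)
  show ?thesis
    using S.psi_rel_left[OF assms(2,1) uv assms(5,6), of k] swap[of k \<tau> \<sigma> "u @ v"]
      swap[of k \<tau> \<sigma> "u @ (i, j) # (l, r) # v" for j r] by simp
qed

lemma psi_low: "int (length w) < k \<Longrightarrow> psi k \<sigma> \<tau> w = 0"
  by (induction k \<sigma> \<tau> w rule: psi.induct) auto

lemma psi_odd: "odd (int (length w) + k) \<Longrightarrow> psi k \<sigma> \<tau> w = 0"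
  by (induction k \<sigma> \<tau> w rule: psi.induct) auto

text \<open>Only the choice of \<open>x_i y_j z\<close> at every letter reaches the power \<open>z^k\<close>.\<close>
lemma psi_top: "int (length w) = k \<Longrightarrow> psi k \<sigma> \<tau> w = \<sigma> (map fst w) * \<tau> (map snd w)"
  by (induction k \<sigma> \<tau> w rule: psi.induct) (auto simp: psi_low)

lemma top_functional:
  assumes "P.traceless n s" "Q.traceless n t"
  obtains \<Phi> where
    "\<And>u v j r. u \<in> WW \<Longrightarrow> v \<in> WW \<Longrightarrow> j < m \<Longrightarrow> r < m \<Longrightarrow>
      (\<Sum>i<m. \<Sum>l<m. e i l * \<Phi> (u @ (i, j) # (l, r) # v)) = e j r * \<Phi> (u @ v)"
    "\<And>u v i l. u \<in> WW \<Longrightarrow> v \<in> WW \<Longrightarrow> i < m \<Longrightarrow> l < m \<Longrightarrow>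
      (\<Sum>j<m. \<Sum>r<m. e' j r * \<Phi> (u @ (i, j) # (l, r) # v)) = e' i l * \<Phi> (u @ v)"
    "\<And>w. length w < n \<Longrightarrow> \<Phi> w = 0" "\<And>w. length w = Suc n \<Longrightarrow> \<Phi> w = 0"
    "\<And>w. length w = n \<Longrightarrow> \<Phi> w = s (map fst w) * t (map snd w)"
proof -
  obtain \<sigma> where \<sigma>: "P.admissible \<sigma>" "\<And>w. length w = n \<Longrightarrow> \<sigma> w = s w" using P.admissible_extension[OF assms(1)] by blast
  obtain \<tau> where \<tau>: "Q.admissible \<tau>" "\<And>w. length w = n \<Longrightarrow> \<tau> w = t w" using Q.admissible_extension[OF assms(2)] by blast
  show ?thesis
    by (rule that[of "psi (int n) \<sigma> \<tau>"])
      (use psi_rel_left[OF \<sigma>(1) \<tau>(1)] psi_rel_right[OF \<sigma>(1) \<tau>(1)] \<sigma>(2) \<tau>(2) in \<open>auto simp: psi_low psi_top psi_odd\<close>)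
qed

end

section \<open>Words of a fixed length\<close>

definition words :: "nat \<Rightarrow> nat \<Rightarrow> nat list set" where
  "words m n = {w \<in> lists {..<m}. length w = n}"

lemma words_0 [simp]: "words m 0 = {[]}"
  by (auto simp: words_def)

lemma words_Suc: "words m (Suc n) = (\<lambda>(x, w). x # w) ` ({..<m} \<times> words m n)"
  by (auto simp: words_def length_Suc_conv image_iff)

lemma finite_words [simp]: "finite (words m n)"
  by (induction n) (auto simp: words_Suc)

lemma sum_words_Suc: "(\<Sum>w\<in>words m (Suc n). g w) = (\<Sum>x<m. \<Sum>w\<in>words m n. g (x # w))"
proof -
  have "inj_on (\<lambda>(x, w). x # w) ({..<m} \<times> words m n)" by (auto simp: inj_on_def)
  then show ?thesis
    by (simp add: words_Suc sum.reindex sum.cartesian_product case_prod_unfold)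
qed

section \<open>Finite rank decompositions\<close>

text \<open>Gaussian elimination: subtracting from \<open>T\<close> the rank one function through a nonzero entry clears
the row of this entry, and keeps the columns in \<open>S\<close> and the rows in \<open>R\<close>.\<close>
lemma rank_decomposition:
  fixes T :: "'a \<Rightarrow> 'a \<Rightarrow> 'k::field"
  assumes "finite A"
    and S: "\<And>f g k. S f \<Longrightarrow> S g \<Longrightarrow> S (\<lambda>x. f x - k * g x)"
    and R: "\<And>f g k. R f \<Longrightarrow> R g \<Longrightarrow> R (\<lambda>x. f x - k * g x)" "\<And>f k. R f \<Longrightarrow> R (\<lambda>x. k * f x)"
    and "\<And>J. J \<in> A \<Longrightarrow> S (\<lambda>I. T I J)" "\<And>I. I \<in> A \<Longrightarrow> R (\<lambda>J. T I J)"
  shows "\<exists>N s t. (\<forall>r<N. S (s r) \<and> R (t r)) \<and> (\<forall>I\<in>A. \<forall>J\<in>A. T I J = (\<Sum>r<(N::nat). s r I * t r J))"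
  using assms(5,6)
proof (induction "card {I \<in> A. \<exists>J\<in>A. T I J \<noteq> 0}" arbitrary: T rule: less_induct)
  case less
  show ?case
  proof (cases "\<exists>I\<in>A. \<exists>J\<in>A. T I J \<noteq> 0")
    case False
    then show ?thesis by (intro exI[of _ 0]) auto
  next
    case True
    then obtain I0 J0 where IJ: "I0 \<in> A" "J0 \<in> A" "T I0 J0 \<noteq> 0" by blast
    define T' where "T' = (\<lambda>I J. T I J - T I J0 * (T I0 J / T I0 J0))"
    have "{I \<in> A. \<exists>J\<in>A. T' I J \<noteq> 0} \<subset> {I \<in> A. \<exists>J\<in>A. T I J \<noteq> 0}"
    proof
      show "{I \<in> A. \<exists>J\<in>A. T' I J \<noteq> 0} \<subseteq> {I \<in> A. \<exists>J\<in>A. T I J \<noteq> 0}"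
      proof clarify
        fix I J assume "I \<in> A" "J \<in> A" "T' I J \<noteq> 0"
        then show "\<exists>J\<in>A. T I J \<noteq> 0" using IJ(2) by (cases "T I J0 = 0") (auto simp: T'_def)
      qed
      have "I0 \<notin> {I \<in> A. \<exists>J\<in>A. T' I J \<noteq> 0}" using IJ(3) by (auto simp: T'_def)
      then show "{I \<in> A. \<exists>J\<in>A. T' I J \<noteq> 0} \<noteq> {I \<in> A. \<exists>J\<in>A. T I J \<noteq> 0}" using IJ by blast
    qed
    then have "card {I \<in> A. \<exists>J\<in>A. T' I J \<noteq> 0} < card {I \<in> A. \<exists>J\<in>A. T I J \<noteq> 0}"
      using assms(1) by (intro psubset_card_mono) auto
    moreover have "S (\<lambda>I. T' I J)" if "J \<in> A" for J
      using S[OF less.prems(1)[OF that] less.prems(1)[OF IJ(2)], of "T I0 J / T I0 J0"]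
      by (simp add: T'_def mult.commute)
    moreover have "R (\<lambda>J. T' I J)" if "I \<in> A" for I
      using R(1)[OF less.prems(2)[OF that] less.prems(2)[OF IJ(1)], of "T I J0 / T I0 J0"]
      by (simp add: T'_def)
    ultimately obtain N s t where st: "\<forall>r<(N::nat). S (s r) \<and> R (t r)"
      "\<forall>I\<in>A. \<forall>J\<in>A. T' I J = (\<Sum>r<N. s r I * t r J)"
      using less.hyps[of T'] by blast
    let ?s = "s(N := (\<lambda>I. T I J0))" and ?t = "t(N := (\<lambda>J. (1 / T I0 J0) * T I0 J))"
    have "\<forall>r<Suc N. S (?s r) \<and> R (?t r)"
      using st(1) less.prems(1)[OF IJ(2)] R(2)[OF less.prems(2)[OF IJ(1)], of "1 / T I0 J0"]
      by (auto simp: less_Suc_eq)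
    moreover have "\<forall>I\<in>A. \<forall>J\<in>A. T I J = (\<Sum>r<Suc N. ?s r I * ?t r J)"
    proof (intro ballI)
      fix I J assume "I \<in> A" "J \<in> A"
      then have "T' I J = (\<Sum>r<N. s r I * t r J)" using st(2) by blast
      then have "T I J = (\<Sum>r<N. s r I * t r J) + T I J0 * (T I0 J / T I0 J0)"
        by (simp add: T'_def algebra_simps)
      also have "\<dots> = (\<Sum>r<Suc N. ?s r I * ?t r J)" by simp
      finally show "T I J = (\<Sum>r<Suc N. ?s r I * ?t r J)" .
    qed
    ultimately show ?thesis by blast
  qed
qed

section \<open>Solving quadratic equations\<close>

text \<open>The form restricted to the span of the first two basis vectors is a polynomial of degree at most 2.\<close>
lemma isotropic_exists:
  fixes e :: "nat \<Rightarrow> nat \<Rightarrow> 'k::alg_closed_field"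
  assumes "m \<ge> 2"
  obtains c where "(\<Sum>i<m. \<Sum>j<m. e i j * c i * c j) = 0" "\<exists>i<m. c i \<noteq> 0"
proof -
  have sum2: "(\<Sum>i<m. \<Sum>j<m. e i j * c i * c j) =
      e 0 0 * c 0 * c 0 + (e 0 1 + e 1 0) * c 0 * c 1 + e 1 1 * c 1 * c 1"
    if "\<And>i. i \<ge> 2 \<Longrightarrow> c i = 0" for c :: "nat \<Rightarrow> 'k"
  proof -
    have inner: "(\<Sum>j<m. e i j * c i * c j) = (\<Sum>j\<in>{0,1}. e i j * c i * c j)" for i
      by (rule sum.mono_neutral_right) (use assms that in auto)
    have "(\<Sum>i<m. \<Sum>j<m. e i j * c i * c j) = (\<Sum>i\<in>{0,1}. \<Sum>j\<in>{0,1}. e i j * c i * c j)"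
      unfolding inner by (rule sum.mono_neutral_right) (use assms that in auto)
    then show ?thesis by (simp add: algebra_simps)
  qed
  show ?thesis
  proof (cases "e 1 1 = 0")
    case True
    then show ?thesis
      by (intro that[of "\<lambda>i. if i = 1 then 1 else 0"])
        (use assms in \<open>auto simp: sum2 intro: exI[of _ 1]\<close>)
  next
    case False
    let ?p = "[:e 0 0, e 0 1 + e 1 0, e 1 1:]"
    have "degree ?p > 0" using False by simp
    then obtain x where "poly ?p x = 0" using alg_closed_imp_poly_has_root[of ?p] by blast
    then have x: "e 0 0 + (e 0 1 + e 1 0) * x + e 1 1 * x * x = 0" by (simp add: algebra_simps)
    show ?thesis
      by (intro that[of "\<lambda>i. if i = 0 then 1 else if i = 1 then x else 0"])
        (use assms x in \<open>auto simp: sum2 intro: exI[of _ 0]\<close>)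
  qed
qed

lemma quadratic_parameter_exists:
  fixes t :: "'k::alg_closed_field"
  obtains q where "q \<noteq> 0" "q * q + q * t + 1 = 0"
proof -
  let ?p = "[:1, t, 1:] :: 'k poly"
  obtain q where "poly ?p q = 0" using alg_closed_imp_poly_has_root[of ?p] by auto
  then have "q * q + q * t + 1 = 0" by (simp add: algebra_simps)
  moreover from this have "q \<noteq> 0" by auto
  ultimately show ?thesis using that by blast
qed

section \<open>Annihilated functions with nonzero pairing\<close>

text \<open>The coordinates of the pure tensor \<open>c_p \<otimes> c_(p+1) \<otimes> ...\<close> .\<close>
primrec pure_word :: "(nat \<Rightarrow> nat \<Rightarrow> 'k::field) \<Rightarrow> nat \<Rightarrow> nat list \<Rightarrow> 'k" where
  "pure_word c p [] = 1"
| "pure_word c p (x # w) = c p x * pure_word c (Suc p) w"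

lemma pure_word_two:
  "pure_word c p (u @ i # j # v) =
    pure_word c p u * (c (p + length u) i * c (Suc (p + length u)) j) * pure_word c (Suc (Suc (p + length u))) v"
  by (induction u arbitrary: p) auto

lemma sum_pure_word:
  "(\<Sum>w\<in>words m n. pure_word c p w * pure_word d p w) = (\<Prod>r<n. \<Sum>i<m. c (p + r) i * d (p + r) i)"
proof (induction n arbitrary: p)
  case (Suc n)
  have "(\<Sum>w\<in>words m (Suc n). pure_word c p w * pure_word d p w) =
      (\<Sum>x<m. \<Sum>w\<in>words m n. (c p x * d p x) * (pure_word c (Suc p) w * pure_word d (Suc p) w))"
    by (simp add: sum_words_Suc mult_ac)
  also have "\<dots> = (\<Sum>x<m. c p x * d p x) * (\<Prod>r<n. \<Sum>i<m. c (Suc p + r) i * d (Suc p + r) i)"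
    by (simp add: sum_distrib_left[symmetric] sum_distrib_right Suc)
  finally show ?case by (simp add: prod.lessThan_Suc_shift del: prod.lessThan_Suc)
qed simp

context form_inv
begin

definition bform :: "(nat \<Rightarrow> 'k) \<Rightarrow> (nat \<Rightarrow> 'k) \<Rightarrow> 'k" where
  "bform x y = (\<Sum>i<m. \<Sum>j<m. e i j * x i * y j)"

text \<open>Take \<open>s = c_0 \<otimes> ... \<otimes> c_(n-1)\<close> and \<open>t = e f_0 \<otimes> ... \<otimes> e f_(n-1)\<close>. The form annihilates these
tensors because successive vectors are orthogonal, and their pairing is the product of the numbers
\<open>bform (c p) (f p)\<close>.\<close>
lemma pairing_from_chain:
  assumes "\<And>p. Suc p < n \<Longrightarrow> bform (c p) (c (Suc p)) = 0"
    and "\<And>p. Suc p < n \<Longrightarrow> bform (f (Suc p)) (f p) = 0"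
    and "\<And>p. p < n \<Longrightarrow> bform (c p) (f p) \<noteq> 0"
  shows "\<exists>s t. traceless n s \<and> form.traceless m e' n t \<and> (\<Sum>w\<in>words m n. s w * t w) \<noteq> 0"
proof -
  define d where "d = (\<lambda>p i. \<Sum>j<m. e i j * f p j)"
  have d0: "(\<Sum>i<m. \<Sum>j<m. e' i j * d p i * d (Suc p) j) = 0" if "Suc p < n" for p
  proof -
    have "(\<Sum>i<m. \<Sum>j<m. e' i j * d p i * d (Suc p) j) = (\<Sum>i<m. d p i * (\<Sum>j<m. e' i j * d (Suc p) j))"
      by (simp add: sum_distrib_left mult_ac)
    also have "\<dots> = (\<Sum>i<m. d p i * f (Suc p) i)"
    proof (intro sum.cong refl arg_cong2[where f = "(*)"])
      fix i assume i: "i \<in> {..<m}"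
      show "(\<Sum>j<m. e' i j * d (Suc p) j) = f (Suc p) i" using e_inverse_apply[of i "f (Suc p)"] i by (simp add: d_def)
    qed
    also have "\<dots> = bform (f (Suc p)) (f p)" by (simp add: bform_def d_def sum_distrib_left sum_distrib_right mult_ac)
    finally show ?thesis using assms(2)[OF that] by simp
  qed
  have 1: "traceless n (pure_word c 0)"
    unfolding traceless_def
  proof (intro ballI impI)
    fix u v :: "nat list" assume l: "length u + length v + 2 = n"
    have "(\<Sum>i<m. \<Sum>j<m. e i j * pure_word c 0 (u @ i # j # v)) =
      pure_word c 0 u * bform (c (length u)) (c (Suc (length u))) * pure_word c (Suc (Suc (length u))) v"
      by (simp add: pure_word_two bform_def sum_distrib_left sum_distrib_right mult_ac)
    then show "(\<Sum>i<m. \<Sum>j<m. e i j * pure_word c 0 (u @ i # j # v)) = 0"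
      using assms(1)[of "length u"] l by simp
  qed
  have 2: "form.traceless m e' n (pure_word d 0)"
    unfolding form.traceless_def
  proof (intro ballI impI)
    fix u v :: "nat list" assume l: "length u + length v + 2 = n"
    have "(\<Sum>i<m. \<Sum>j<m. e' i j * pure_word d 0 (u @ i # j # v)) =
      pure_word d 0 u * (\<Sum>i<m. \<Sum>j<m. e' i j * d (length u) i * d (Suc (length u)) j) * pure_word d (Suc (Suc (length u))) v"
      by (simp add: pure_word_two sum_distrib_left sum_distrib_right mult_ac)
    then show "(\<Sum>i<m. \<Sum>j<m. e' i j * pure_word d 0 (u @ i # j # v)) = 0"
      using d0[of "length u"] l by simp
  qed
  have "(\<Sum>i<m. c r i * d r i) = bform (c r) (f r)" for r
    by (simp add: bform_def d_def sum_distrib_left mult_ac)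
  then have "(\<Sum>w\<in>words m n. pure_word c 0 w * pure_word d 0 w) \<noteq> 0"
    using assms(3) by (simp add: sum_pure_word)
  with 1 2 show ?thesis by blast
qed

lemma orthogonal_vector:
  fixes u w :: "nat \<Rightarrow> 'k"
  assumes "\<And>l. \<exists>i<m. w i \<noteq> l * u i"
  shows "\<exists>c. (\<Sum>i<m. c i * u i) = 0 \<and> (\<Sum>i<m. c i * w i) \<noteq> 0"
proof (cases "\<exists>i<m. u i \<noteq> 0")
  case False
  obtain j where "j < m" "w j \<noteq> 0" using assms[of 0] by auto
  then show ?thesis
    by (intro exI[of _ "\<lambda>i. if i = j then 1 else 0"]) (use False in \<open>auto simp: if_distrib if_distribR cong: if_cong\<close>)
next
  case True
  then obtain i where i: "i < m" "u i \<noteq> 0" by blast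
  obtain j where j: "j < m" "w j \<noteq> (w i / u i) * u j" using assms by blast
  then have ij: "i \<noteq> j" using i by auto
  let ?c = "\<lambda>k. if k = j then u i else if k = i then - u j else 0"
  have c: "(\<Sum>k<m. ?c k * g k) = u i * g j - u j * g i" for g
  proof -
    have "(\<Sum>k<m. ?c k * g k) = (\<Sum>k\<in>{i, j}. ?c k * g k)"
      by (rule sum.mono_neutral_right) (use i j in auto)
    then show ?thesis using ij by (simp add: algebra_simps)
  qed
  show ?thesis using i j by (intro exI[of _ ?c] conjI) (unfold c, auto simp: field_simps)
qed

text \<open>The vectors orthogonal to \<open>v\<close> form a space of dimension at least 2, which no line contains.\<close>
lemma nonproportional_orthogonal:
  fixes g v :: "nat \<Rightarrow> 'k"
  assumes "m \<ge> 3"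
  shows "\<exists>f. (\<Sum>i<m. f i * v i) = 0 \<and> (\<forall>l. \<exists>i<m. f i \<noteq> l * g i)"
proof -
  obtain i j k where ijk: "i < m" "j < m" "k < m" "i \<noteq> j" "i \<noteq> k" "j \<noteq> k" "v i \<noteq> 0 \<or> (\<forall>r<m. v r = 0)"
  proof (cases "\<exists>i<m. v i \<noteq> 0")
    case True
    then obtain i where i: "i < m" "v i \<noteq> 0" by blast
    show ?thesis
      by (rule that[of i "if i = 0 then 1 else 0" "if i = 2 then 1 else 2"]) (use i assms in auto)
  next
    case False
    then show ?thesis using that[of 0 1 2] assms by auto
  qed
  define a where "a = (if v i \<noteq> 0 then v i else 1)"
  define f where "f = (\<lambda>x y. if y = x then a else if y = i then - v x else 0)"
  have o: "(\<Sum>y<m. f x y * v y) = 0" if "x < m" "x \<noteq> i" for x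
  proof -
    have "(\<Sum>y<m. f x y * v y) = (\<Sum>y\<in>{i, x}. f x y * v y)"
      by (rule sum.mono_neutral_right) (use ijk that in \<open>auto simp: f_def\<close>)
    then show ?thesis using that ijk by (auto simp: f_def a_def)
  qed
  have a: "a \<noteq> 0" by (simp add: a_def)
  show ?thesis
  proof (rule ccontr)
    assume "\<not> ?thesis"
    then have "\<exists>l. \<forall>y<m. f x y = l * g y" if "x < m" "x \<noteq> i" for x using o[OF that] by blast
    then obtain l l' where "\<forall>y<m. f j y = l * g y" "\<forall>y<m. f k y = l' * g y" using ijk by metis
    then have "f j j = l * g j" "f j k = l * g k" "f k k = l' * g k" using ijk by blast+
    then show False using a ijk by (auto simp: f_def)
  qed
qed

text \<open>Choose \<open>f'\<close> orthogonal to \<open>f\<close> such that the linear forms \<open>bform c _\<close> and \<open>bform _ f'\<close> are not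
proportional; then some \<open>c'\<close> lies in the kernel of the first only.\<close>
lemma chain_step:
  assumes "m \<ge> 3"
  shows "\<exists>c' f'. bform c c' = 0 \<and> bform f' f = 0 \<and> bform c' f' \<noteq> 0"
proof -
  let ?u = "\<lambda>j. \<Sum>i<m. e i j * c i" and ?v = "\<lambda>i. \<Sum>j<m. e i j * f j"
  obtain f' where f': "(\<Sum>i<m. f' i * ?v i) = 0" "\<And>l. \<exists>i<m. f' i \<noteq> l * (\<Sum>j<m. e' i j * ?u j)"
    using nonproportional_orthogonal[OF assms, of ?v "\<lambda>i. \<Sum>j<m. e' i j * ?u j"] by blast
  let ?w = "\<lambda>i. \<Sum>j<m. e i j * f' j"
  have "\<exists>i<m. ?w i \<noteq> l * ?u i" for l
  proof (rule ccontr)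
    assume "\<not> ?thesis"
    then have w: "?w i = l * ?u i" if "i < m" for i using that by blast
    have "f' i = l * (\<Sum>j<m. e' i j * ?u j)" if "i < m" for i
    proof -
      have "f' i = (\<Sum>j<m. e' i j * ?w j)" using e_inverse_apply[OF that] by simp
      also have "\<dots> = (\<Sum>j<m. e' i j * (l * ?u j))" by (intro sum.cong) (auto simp: w)
      also have "\<dots> = l * (\<Sum>j<m. e' i j * ?u j)" by (simp only: sum_distrib_left mult_ac)
      finally show ?thesis .
    qed
    with f'(2)[of l] show False by blast
  qed
  then obtain c' where c': "(\<Sum>i<m. c' i * ?u i) = 0" "(\<Sum>i<m. c' i * ?w i) \<noteq> 0"
    using orthogonal_vector[of ?w ?u] by blast
  have "bform c c' = (\<Sum>i<m. c' i * ?u i)"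
    unfolding bform_def by (subst sum.swap) (simp only: sum_distrib_left mult_ac)
  moreover have "bform f' f = (\<Sum>i<m. f' i * ?v i)" "bform c' f' = (\<Sum>i<m. c' i * ?w i)"
    unfolding bform_def by (simp_all only: sum_distrib_left mult_ac)
  ultimately show ?thesis using c' f' by (intro exI[of _ c'] exI[of _ f']) auto
qed

lemma chain_big:
  assumes "m \<ge> 3"
  shows "\<exists>c f. \<forall>p. bform (c p) (c (Suc p)) = 0 \<and> bform (f (Suc p)) (f p) = 0 \<and> bform (c p) (f p) \<noteq> 0"
proof -
  define nxt where "nxt = (\<lambda>z. SOME z'. bform (fst z) (fst z') = 0 \<and> bform (snd z') (snd z) = 0 \<and> bform (fst z') (snd z') \<noteq> 0)"
  have nxt: "bform (fst z) (fst (nxt z)) = 0 \<and> bform (snd (nxt z)) (snd z) = 0 \<and> bform (fst (nxt z)) (snd (nxt z)) \<noteq> 0" for z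
  proof -
    obtain c' f' where "bform (fst z) c' = 0 \<and> bform f' (snd z) = 0 \<and> bform c' f' \<noteq> 0"
      using chain_step[OF assms, of "fst z" "snd z"] by (elim exE)
    then show ?thesis unfolding nxt_def
      by (intro someI[of "\<lambda>z'. bform (fst z) (fst z') = 0 \<and> bform (snd z') (snd z) = 0 \<and> bform (fst z') (snd z') \<noteq> 0" "(c', f')"]) simp
  qed
  define s where "s = (\<lambda>p. (nxt ^^ Suc p) (\<lambda>_. 0, \<lambda>_. 0))"
  have s: "s (Suc p) = nxt (s p)" for p by (simp add: s_def)
  have "bform (fst (s p)) (snd (s p)) \<noteq> 0" for p
    unfolding s_def funpow.simps comp_def using nxt by blast
  then have "\<forall>p. bform (fst (s p)) (fst (s (Suc p))) = 0 \<and> bform (snd (s (Suc p))) (snd (s p)) = 0 \<and>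
     bform (fst (s p)) (snd (s p)) \<noteq> 0"
    using nxt by (simp add: s)
  then show ?thesis by (intro exI[of _ "\<lambda>p. fst (s p)"] exI[of _ "\<lambda>p. snd (s p)"])
qed

end

text \<open>In the plane each vector determines the next one up to a factor. The initial vector \<open>f\<close> depends on a
parameter \<open>l\<close>, and each \<open>bform (c p) (f p)\<close> is a nonzero polynomial of degree at most 1 in \<open>l\<close>;
in an infinite field all but finitely many values of \<open>l\<close> work.\<close>
lemma (in form_inv) chain_two:
  assumes m: "m = 2" and inf: "infinite (UNIV :: 'k set)"
  shows "\<exists>c f. (\<forall>p. bform (c p) (c (Suc p)) = 0 \<and> bform (f (Suc p)) (f p) = 0) \<and> (\<forall>p<n. bform (c p) (f p) \<noteq> 0)"
proof -
  have S: "(\<Sum>i<m. g i) = g 0 + g 1" for g :: "nat \<Rightarrow> 'k" unfolding m by (simp add: numeral_2_eq_2)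
  have bform: "bform x y = e 0 0 * x 0 * y 0 + e 0 1 * x 0 * y 1 + e 1 0 * x 1 * y 0 + e 1 1 * x 1 * y 1" for x y
    unfolding bform_def S by simp
  have det: "e 0 0 * e 1 1 - e 0 1 * e 1 0 \<noteq> 0"
  proof
    assume d: "e 0 0 * e 1 1 - e 0 1 * e 1 0 = 0"
    have i: "e 0 0 * e' 0 0 + e 0 1 * e' 1 0 = 1" "e 1 0 * e' 0 0 + e 1 1 * e' 1 0 = 0"
       "e 0 0 * e' 0 1 + e 0 1 * e' 1 1 = 0" "e 1 0 * e' 0 1 + e 1 1 * e' 1 1 = 1"
      using inv_r[of 0 0] inv_r[of 1 0] inv_r[of 0 1] inv_r[of 1 1] unfolding S by (simp_all add: m)
    have "1 = (e 0 0 * e' 0 0 + e 0 1 * e' 1 0) * (e 1 0 * e' 0 1 + e 1 1 * e' 1 1) -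
       (e 1 0 * e' 0 0 + e 1 1 * e' 1 0) * (e 0 0 * e' 0 1 + e 0 1 * e' 1 1)" unfolding i by simp
    also have "\<dots> = (e 0 0 * e 1 1 - e 0 1 * e 1 0) * (e' 0 0 * e' 1 1 - e' 0 1 * e' 1 0)"
      by (simp add: algebra_simps)
    finally show False using d by simp
  qed
  have nz': "x = 0 \<and> y = 0" if "e 0 0 * x + e 1 0 * y = 0" "e 0 1 * x + e 1 1 * y = 0" for x y
  proof -
    have "(e 0 0 * e 1 1 - e 0 1 * e 1 0) * x = e 1 1 * (e 0 0 * x + e 1 0 * y) - e 1 0 * (e 0 1 * x + e 1 1 * y)"
      "(e 0 0 * e 1 1 - e 0 1 * e 1 0) * y = e 0 0 * (e 0 1 * x + e 1 1 * y) - e 0 1 * (e 0 0 * x + e 1 0 * y)"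
      by (simp_all add: algebra_simps)
    then have "(e 0 0 * e 1 1 - e 0 1 * e 1 0) * x = 0" "(e 0 0 * e 1 1 - e 0 1 * e 1 0) * y = 0"
      by (simp_all only: that mult_zero_right diff_self)
    then show ?thesis using det by simp
  qed
  \<comment> \<open>The vectors orthogonal to \<open>c\<close> on the right, and to \<open>f\<close> on the left, each span a line; these generate it.\<close>
  define gC where "gC = (\<lambda>c (i::nat). if i = 0 then - (e 0 1 * c 0 + e 1 1 * c (1::nat)) else e 0 0 * c (0::nat) + e 1 0 * c 1)"
  define gF where "gF = (\<lambda>f (i::nat). if i = 0 then - (e 1 0 * f 0 + e 1 1 * f (1::nat)) else e 0 0 * f (0::nat) + e 0 1 * f 1)"
  define c where "c = (\<lambda>p. (gC ^^ p) (\<lambda>i::nat. 1 :: 'k))"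
  define f where "f = (\<lambda>l p. (gF ^^ p) (\<lambda>i::nat. if i = 0 then 1 else l :: 'k))"
  have cS: "c (Suc p) = gC (c p)" for p by (simp add: c_def)
  have fS: "f l (Suc p) = gF (f l p)" for l p by (simp add: f_def)
  have c1: "bform (c p) (c (Suc p)) = 0" for p unfolding cS bform gC_def by (simp add: algebra_simps)
  have f1: "bform (f l (Suc p)) (f l p) = 0" for l p unfolding fS bform gF_def by (simp add: algebra_simps)
  have cn: "\<not> (c p 0 = 0 \<and> c p 1 = 0)" for p
  proof (induction p)
    case (Suc p)
    show ?case
    proof
      assume "c (Suc p) 0 = 0 \<and> c (Suc p) 1 = 0"
      then have "e 0 0 * c p 0 + e 1 0 * c p 1 = 0" "e 0 1 * c p 0 + e 1 1 * c p 1 = 0"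
        unfolding cS gC_def by (auto simp: neg_eq_iff_add_eq_0)
      then show False using nz' Suc by blast
    qed
  qed (simp add: c_def)
  \<comment> \<open>\<open>r \<cdot> f\<^sub>p\<close> is a nonzero polynomial of degree at most 1 in the parameter\<close>
  have lin: "\<exists>x y. (x \<noteq> 0 \<or> y \<noteq> 0) \<and> (\<forall>l. r0 * f l p 0 + r1 * f l p 1 = x + y * l)"
    if "r0 \<noteq> 0 \<or> r1 \<noteq> 0" for r0 r1 p
    using that
  proof (induction p arbitrary: r0 r1)
    case 0
    then show ?case by (intro exI[of _ r0] exI[of _ r1]) (simp add: f_def)
  next
    case (Suc p)
    let ?s0 = "r1 * e 0 0 - r0 * e 1 0" and ?s1 = "r1 * e 0 1 - r0 * e 1 1"
    have "?s0 \<noteq> 0 \<or> ?s1 \<noteq> 0"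
    proof (rule ccontr)
      assume "\<not> ?thesis"
      then have "e 0 0 * r1 + e 1 0 * (- r0) = 0" "e 0 1 * r1 + e 1 1 * (- r0) = 0" by (simp_all add: algebra_simps)
      from nz'[OF this] Suc.prems show False by simp
    qed
    from Suc.IH[OF this] obtain x y where "x \<noteq> 0 \<or> y \<noteq> 0" "\<forall>l. ?s0 * f l p 0 + ?s1 * f l p 1 = x + y * l"
      by blast
    moreover have "r0 * f l (Suc p) 0 + r1 * f l (Suc p) 1 = ?s0 * f l p 0 + ?s1 * f l p 1" for l
      unfolding fS gF_def by (simp add: algebra_simps)
    ultimately show ?case by auto
  qed
  have fin: "finite {l. bform (c p) (f l p) = 0}" for p
  proof -
    let ?r0 = "e 0 0 * c p 0 + e 1 0 * c p 1" and ?r1 = "e 0 1 * c p 0 + e 1 1 * c p 1"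
    have "?r0 \<noteq> 0 \<or> ?r1 \<noteq> 0" using nz' cn by blast
    from lin[OF this] obtain x y where xy: "x \<noteq> 0 \<or> y \<noteq> 0" "\<forall>l. ?r0 * f l p 0 + ?r1 * f l p 1 = x + y * l"
      by blast
    have "bform (c p) (f l p) = ?r0 * f l p 0 + ?r1 * f l p 1" for l unfolding bform by (simp add: algebra_simps)
    then have "{l. bform (c p) (f l p) = 0} = {l. x + y * l = 0}" using xy(2) by simp
    also have "\<dots> \<subseteq> {- x / y}"
    proof clarify
      fix l assume l: "x + y * l = 0"
      then have "y \<noteq> 0" using xy(1) by auto
      moreover have "l * y = - x" using l by (simp add: eq_neg_iff_add_eq_0 algebra_simps)
      ultimately show "l = - x / y" by (metis nonzero_eq_divide_eq)
    qed
    finally show ?thesis by (rule finite_subset) simp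
  qed
  have "finite (\<Union>p<n. {l. bform (c p) (f l p) = 0})" using fin by auto
  then obtain l where "l \<notin> (\<Union>p<n. {l. bform (c p) (f l p) = 0})" using inf ex_new_if_finite by blast
  then show ?thesis using c1 f1 by (intro exI[of _ c] exI[of _ "f l"]) auto
qed

lemma (in form_inv) pairing_nonzero:
  assumes "m \<ge> 2" "infinite (UNIV :: 'k set)"
  shows "\<exists>s t. traceless n s \<and> form.traceless m e' n t \<and> (\<Sum>w\<in>words m n. s w * t w) \<noteq> 0"
proof (cases "m = 2")
  case True
  from chain_two[OF this assms(2), of n] obtain c f where
    "\<forall>p. bform (c p) (c (Suc p)) = 0 \<and> bform (f (Suc p)) (f p) = 0" "\<forall>p<n. bform (c p) (f p) \<noteq> 0" by blast
  then show ?thesis using pairing_from_chain[of n c f] by simp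
next
  case False
  then have "m \<ge> 3" using assms by auto
  from chain_big[OF this] obtain c f where
    "\<forall>p. bform (c p) (c (Suc p)) = 0 \<and> bform (f (Suc p)) (f p) = 0 \<and> bform (c p) (f p) \<noteq> 0" by blast
  then show ?thesis using pairing_from_chain[of n c f] by simp
qed

section \<open>The defining relations in quadratic form\<close>

lemma lin_map_mult:
  assumes "kalg A" "lin_map A B \<phi>" "x \<in> carrier A"
  shows "lin_map A B (\<lambda>y. \<phi> (x \<otimes>\<^bsub>A\<^esub> y))" "lin_map A B (\<lambda>y. \<phi> (y \<otimes>\<^bsub>A\<^esub> x))"
proof -
  interpret A: kalg A by fact
  show "lin_map A B (\<lambda>y. \<phi> (x \<otimes>\<^bsub>A\<^esub> y))" "lin_map A B (\<lambda>y. \<phi> (y \<otimes>\<^bsub>A\<^esub> x))"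
    using assms(3) by (auto intro!: lin_mapI simp: A.r_distr A.l_distr A.smult_mult_r A.smult_mult_l
      lin_mapD[OF assms(2)])
qed

lemma (in kalg) quadratic_entry:
  assumes "amat A n m u" "E \<in> carrier_mat n n" "lin_map A base_alg L" "j < m" "r < m"
  shows "L (amat_mult A (transpose_mat u) (amat_mult A (scalar_mat A E) u) $$ (j, r)) =
    (\<Sum>i<n. \<Sum>l<n. E $$ (i, l) * L (u $$ (i, j) \<otimes> u $$ (l, r)))"
proof -
  note ut = amat_transpose[OF assms(1)] and Eu = amat_mult_amat[OF scalar_amat[OF assms(2)] assms(1)]
  have u: "u $$ (i, k) \<in> carrier A" if "i < n" "k < m" for i k using amatD(3)[OF assms(1) that] .
  have "L (amat_mult A (transpose_mat u) (amat_mult A (scalar_mat A E) u) $$ (j, r)) =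
     (\<Sum>i<n. L (transpose_mat u $$ (j, i) \<otimes> amat_mult A (scalar_mat A E) u $$ (i, r)))"
    unfolding amat_mult_index[OF ut Eu assms(4,5)]
    by (subst lin_map_finsum[OF assms(3) kalg_axioms kalg_base])
      (use assms amatD(3)[OF ut] amatD(3)[OF Eu] in auto)
  also have "\<dots> = (\<Sum>i<n. \<Sum>l<n. E $$ (i, l) * L (u $$ (i, j) \<otimes> u $$ (l, r)))"
  proof (rule sum.cong[OF refl])
    fix i assume "i \<in> {..<n}"
    then have i: "i < n" by simp
    note Li = lin_map_mult(1)[OF kalg_axioms assms(3) u[OF i assms(4)]]
    have "L (transpose_mat u $$ (j, i) \<otimes> amat_mult A (scalar_mat A E) u $$ (i, r)) =
       L (u $$ (i, j) \<otimes> (\<Oplus>l\<in>{..<n}. E $$ (i, l) \<odot> u $$ (l, r)))"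
      unfolding scalar_mult_index_l[OF assms(2,1) i assms(5)] using i assms amatD[OF assms(1)] by simp
    also have "\<dots> = (\<Sum>l<n. L (u $$ (i, j) \<otimes> (E $$ (i, l) \<odot> u $$ (l, r))))"
      by (subst lin_map_finsum[OF Li kalg_axioms kalg_base]) (use u assms in auto)
    also have "\<dots> = (\<Sum>l<n. E $$ (i, l) * L (u $$ (i, j) \<otimes> u $$ (l, r)))"
      by (intro sum.cong refl) (use lin_mapD(3)[OF Li] u assms in auto)
    finally show "L (transpose_mat u $$ (j, i) \<otimes> amat_mult A (scalar_mat A E) u $$ (i, r)) =
      (\<Sum>l<n. E $$ (i, l) * L (u $$ (i, j) \<otimes> u $$ (l, r)))" .
  qed
  finally show ?thesis .
qed

text \<open>Multiply the two relations for \<open>link_inv\<close> by \<open>E\<close>, respectively by \<open>E^-1\<close>. In this form the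
relations are expressions of degree 2 in the entries, which functionals can test.\<close>
lemma (in kalg) link_iff_quadratic:
  assumes E: "E \<in> carrier_mat m m" "invertible_mat E" and u: "amat A m m u"
  shows "link A E E u \<longleftrightarrow>
    amat_mult A (transpose_mat u) (amat_mult A (scalar_mat A E) u) = scalar_mat A E \<and>
    amat_mult A u (amat_mult A (scalar_mat A (minv E)) (transpose_mat u)) = scalar_mat A (minv E)"
proof -
  let ?m = "amat_mult A" and ?E = "scalar_mat A E" and ?E' = "scalar_mat A (minv E)" and ?t = "transpose_mat u"
  note t = amat_transpose[OF u]
  have s: "amat A m m ?E" "amat A m m ?E'" using E minv(1)[OF E] by (auto intro: scalar_amat)
  have EE: "?m ?E ?E' = scalar_mat A (1\<^sub>m m)" "?m ?E' ?E = scalar_mat A (1\<^sub>m m)"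
    using scalar_mult[OF E(1) minv(1)[OF E]] scalar_mult[OF minv(1)[OF E] E(1)] minv(2,3)[OF E] by simp_all
  note mm = amat_mult_amat
  let ?p = "?m ?t (?m ?E u)" and ?r = "?m u (?m ?E' ?t)"
  have p: "amat A m m ?p" and r: "amat A m m ?r" using mm s u t by blast+
  have 1: "?m (link_inv A E E u) u = ?m ?E' ?p"
    unfolding link_inv_def amat_mult_assoc[OF s(2) mm[OF t s(1)] u] amat_mult_assoc[OF t s(1) u] ..
  have 2: "?m u (link_inv A E E u) = ?m ?r ?E"
    unfolding link_inv_def amat_mult_assoc[OF s(2) t s(1), symmetric]
    by (rule amat_mult_assoc[OF u mm[OF s(2) t] s(1), symmetric])
  have 3: "?m ?E (?m ?E' ?p) = ?p"
    unfolding amat_mult_assoc[OF s p, symmetric] EE by (rule scalar_one_l[OF p])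
  have 4: "?m (?m ?r ?E) ?E' = ?r"
    unfolding amat_mult_assoc[OF r s] EE by (rule scalar_one_r[OF r])
  show ?thesis
  proof
    assume l: "link A E E u"
    then have "?m ?E' ?p = scalar_mat A (1\<^sub>m m)" "?m ?r ?E = scalar_mat A (1\<^sub>m m)"
      using 1 2 E by (simp_all add: link_def)
    then show "?p = ?E \<and> ?r = ?E'"
      using 3 4 scalar_one_r[OF s(1)] scalar_one_l[OF s(2)] by metis
  next
    assume "?p = ?E \<and> ?r = ?E'"
    then show "link A E E u" unfolding link_def 1 2 using EE u E by simp
  qed
qed

text \<open>Extend a basis of the subspace \<open>S\<close> by \<open>p\<close> and define the functional on the basis.\<close>
lemma separating_functional:
  fixes S :: "('x \<Rightarrow>\<^sub>0 'k::field) set"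
  assumes "0 \<in> S" "\<And>x y. x \<in> S \<Longrightarrow> y \<in> S \<Longrightarrow> x + y \<in> S" "\<And>c x. x \<in> S \<Longrightarrow> pm_scale c x \<in> S" "p \<notin> S"
  shows "\<exists>g :: ('x \<Rightarrow>\<^sub>0 'k) \<Rightarrow> 'k. (\<forall>x y. g (x + y) = g x + g y) \<and> (\<forall>c x. g (pm_scale c x) = c * g x) \<and>
    (\<forall>x\<in>S. g x = 0) \<and> g p = 1"
proof -
  interpret vp: vector_space_pair "pm_scale :: 'k \<Rightarrow> ('x \<Rightarrow>\<^sub>0 'k) \<Rightarrow> _" "(*) :: 'k \<Rightarrow> 'k \<Rightarrow> 'k"
    by (intro vector_space_pair.intro vector_space_pm_scale) (unfold_locales, auto simp: algebra_simps)
  have "vp.vs1.subspace S" using assms unfolding vp.vs1.subspace_def by blast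
  then have spS: "vp.vs1.span S = S" by (simp add: vp.vs1.span_eq_iff)
  obtain Bs where Bs: "Bs \<subseteq> S" "vp.vs1.independent Bs" "S \<subseteq> vp.vs1.span Bs"
    using vp.vs1.maximal_independent_subset[of S] by blast
  have "vp.vs1.span Bs \<subseteq> S" using vp.vs1.span_mono[OF Bs(1)] spS by simp
  then have "p \<notin> vp.vs1.span Bs" using assms(4) by blast
  then have ind: "vp.vs1.independent (insert p Bs)" using Bs(2) by (rule vp.vs1.independent_insertI)
  have pB: "p \<notin> Bs" using assms(4) Bs(1) by blast
  obtain g where g: "Vector_Spaces.linear pm_scale (*) g" "\<And>y. y \<in> insert p Bs \<Longrightarrow> g y = (if y = p then 1 else 0)"
    using vp.linear_independent_extend[OF ind, of "\<lambda>y. if y = p then 1 else 0"] by blast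
  interpret g: Vector_Spaces.linear pm_scale "(*)" g by (rule g(1))
  have "g y = 0" if "y \<in> S" for y
  proof -
    have "y \<in> vp.vs1.span Bs" using that Bs(3) by blast
    then show ?thesis
    proof (induction rule: vp.vs1.span_induct_alt)
      case (step c x y)
      have "g x = 0" using g(2)[of x] step pB by auto
      then show ?case using step by (simp add: g.add g.scale)
    qed (simp add: g.zero)
  qed
  then show ?thesis using g.add g.scale g(2)[of p] by auto
qed

section \<open>Functionals on the algebra of a form\<close>

context bil_form begin

abbreviation "WW \<equiv> lists ({..<m} \<times> {..<m})"
abbreviation "word w \<equiv> q (Poly_Mapping.single w 1)"

sublocale FI: form_inv m "\<lambda>i j. E $$ (i, j)" "\<lambda>i j. minv E $$ (i, j)"
proof
  fix i k assume ik: "i < m" "k < m"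
  have "(E * minv E) $$ (i, k) = (\<Sum>j<m. E $$ (i, j) * minv E $$ (j, k))"
    "(minv E * E) $$ (i, k) = (\<Sum>j<m. minv E $$ (i, j) * E $$ (j, k))"
    using ik E minv(1)[OF E invE] by (auto simp: scalar_prod_def atLeast0LessThan)
  then show "(\<Sum>j<m. E $$ (i, j) * minv E $$ (j, k)) = (if i = k then 1 else 0)"
    "(\<Sum>j<m. minv E $$ (i, j) * E $$ (j, k)) = (if i = k then 1 else 0)"
    using minv(2,3)[OF E invE] ik by simp_all
qed

lemma single_carrier [simp]: "w \<in> WW \<Longrightarrow> Poly_Mapping.single w c \<in> carrier Fr"
  by (auto simp: Fr_eq free_alg_carrier)

lemma word_closed [simp]: "w \<in> WW \<Longrightarrow> word w \<in> carrier B"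
  using B_carrier by auto

lemma single_mult [simp]:
  "Poly_Mapping.single u c \<otimes>\<^bsub>Fr\<^esub> Poly_Mapping.single v d = Poly_Mapping.single (u @ v) (c * d)"
  by (simp add: Fr_eq free_alg_simps)

lemma word_append: "u \<in> WW \<Longrightarrow> v \<in> WW \<Longrightarrow> word (u @ v) = word u \<otimes>\<^bsub>B\<^esub> word v"
  using alg_homD(3)[OF q_hom, of "Poly_Mapping.single u 1" "Poly_Mapping.single v 1"] by simp

lemma word_Nil: "word [] = \<one>\<^bsub>B\<^esub>"
proof -
  have "\<one>\<^bsub>Fr\<^esub> = Poly_Mapping.single [] 1" by (simp add: Fr_eq free_alg_simps)
  then show ?thesis using alg_homD(2)[OF q_hom] by simp
qed

lemma word_single: "i < m \<Longrightarrow> j < m \<Longrightarrow> word [(i, j)] = a $$ (i, j)"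
  by (simp add: a_index free_gen_def)

lemma a_closed [simp]: "i < m \<Longrightarrow> j < m \<Longrightarrow> a $$ (i, j) \<in> carrier B"
  using amatD(3)[OF a_amat] .

lemma word_Cons: "i < m \<Longrightarrow> j < m \<Longrightarrow> w \<in> WW \<Longrightarrow> word ((i, j) # w) = a $$ (i, j) \<otimes>\<^bsub>B\<^esub> word w"
  using word_append[of "[(i, j)]" w] by (simp add: word_single)

abbreviation "functional \<phi> \<equiv> lin_map B base_alg \<phi>"

lemma functional_a: "functional \<phi> \<Longrightarrow> i < m \<Longrightarrow> j < m \<Longrightarrow> functional (\<lambda>y. \<phi> (a $$ (i, j) \<otimes>\<^bsub>B\<^esub> y))"
  by (rule lin_map_mult(1)[OF kalg_B _ a_closed])

lemma zip_in_WW: "I \<in> lists {..<m} \<Longrightarrow> J \<in> lists {..<m} \<Longrightarrow> zip I J \<in> WW"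
  by (induction I J rule: list_induct2') auto

lemma map_fst_snd_in: "w \<in> WW \<Longrightarrow> map fst w \<in> lists {..<m}" "w \<in> WW \<Longrightarrow> map snd w \<in> lists {..<m}"
  by (induction w) auto

lemma functional_q:
  assumes "functional \<phi>" "p \<in> carrier Fr"
  shows "\<phi> (q p) = (\<Sum>w\<in>Poly_Mapping.keys p. Poly_Mapping.lookup p w * \<phi> (word w))"
proof -
  interpret K: kalg "base_alg :: ('k, 'k) module" by (rule kalg_base)
  have 1: "lin_map (free_alg G) base_alg (\<lambda>p. \<phi> (q p))"
    using lin_map_comp[OF alg_homD(1)[OF q_hom] assms(1)] by (simp only: Fr_eq)
  have 2: "lin_map (free_alg G) base_alg (lin_ext base_alg (\<lambda>w. \<phi> (word w)))"
    unfolding free_alg_def by (rule K.lin_ext_lin_map) simp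
  have "\<phi> (q p) = lin_ext base_alg (\<lambda>w. \<phi> (word w)) p"
    by (rule lin_map_eq_on_words[OF 1 2 kalg_base]) (use assms(2) in \<open>auto simp: Fr_eq\<close>)
  then show ?thesis by (simp add: lin_ext_def)
qed

lemma a_quadratic:
  "amat_mult B (transpose_mat a) (amat_mult B (scalar_mat B E) a) = scalar_mat B E"
  "amat_mult B a (amat_mult B (scalar_mat B (minv E)) (transpose_mat a)) = scalar_mat B (minv E)"
  using a_link B.link_iff_quadratic[OF E invE a_amat] by simp_all

text \<open>The defining relation, with words multiplied on both sides.\<close>
lemma functional_rel:
  assumes "functional \<phi>" "u \<in> WW" "v \<in> WW"
  shows "j < m \<Longrightarrow> r < m \<Longrightarrow>
      (\<Sum>i<m. \<Sum>l<m. E $$ (i, l) * \<phi> (word (u @ (i, j) # (l, r) # v))) = E $$ (j, r) * \<phi> (word (u @ v))"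
    and "i < m \<Longrightarrow> l < m \<Longrightarrow>
      (\<Sum>j<m. \<Sum>r<m. minv E $$ (j, r) * \<phi> (word (u @ (i, j) # (l, r) # v))) = minv E $$ (i, l) * \<phi> (word (u @ v))"
proof -
  let ?L = "\<lambda>x. \<phi> (word u \<otimes>\<^bsub>B\<^esub> (x \<otimes>\<^bsub>B\<^esub> word v))"
  have L: "functional ?L"
    using lin_map_mult(2)[OF kalg_B lin_map_mult(1)[OF kalg_B assms(1)], of "word u" "word v"] assms by simp
  have m2: "word (u @ (i, j) # (l, r) # v) = word u \<otimes>\<^bsub>B\<^esub> (a $$ (i, j) \<otimes>\<^bsub>B\<^esub> a $$ (l, r) \<otimes>\<^bsub>B\<^esub> word v)"
    if "i < m" "j < m" "l < m" "r < m" for i j l r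
    using that assms by (simp add: word_append word_Cons B.m_assoc)
  have L1: "?L (c \<odot>\<^bsub>B\<^esub> \<one>\<^bsub>B\<^esub>) = c * \<phi> (word (u @ v))" for c
    using lin_mapD(3)[OF L, of "\<one>\<^bsub>B\<^esub>" c] assms by (simp add: word_append)
  show "(\<Sum>i<m. \<Sum>l<m. E $$ (i, l) * \<phi> (word (u @ (i, j) # (l, r) # v))) = E $$ (j, r) * \<phi> (word (u @ v))"
    if jr: "j < m" "r < m"
  proof -
    have "(\<Sum>i<m. \<Sum>l<m. E $$ (i, l) * \<phi> (word (u @ (i, j) # (l, r) # v))) =
       (\<Sum>i<m. \<Sum>l<m. E $$ (i, l) * ?L (a $$ (i, j) \<otimes>\<^bsub>B\<^esub> a $$ (l, r)))"
      by (intro sum.cong refl) (use m2 jr in auto)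
    also have "\<dots> = ?L (scalar_mat B E $$ (j, r))"
      using B.quadratic_entry[OF a_amat E L jr] unfolding a_quadratic by simp
    finally show ?thesis using jr L1 E by (simp add: B.scalar_index[OF E])
  qed
  show "(\<Sum>j<m. \<Sum>r<m. minv E $$ (j, r) * \<phi> (word (u @ (i, j) # (l, r) # v))) = minv E $$ (i, l) * \<phi> (word (u @ v))"
    if il: "i < m" "l < m"
  proof -
    note t = amat_transpose[OF a_amat]
    have "(\<Sum>j<m. \<Sum>r<m. minv E $$ (j, r) * \<phi> (word (u @ (i, j) # (l, r) # v))) =
       (\<Sum>j<m. \<Sum>r<m. minv E $$ (j, r) * ?L (transpose_mat a $$ (j, i) \<otimes>\<^bsub>B\<^esub> transpose_mat a $$ (r, l)))"
      by (intro sum.cong refl) (use m2 il amatD[OF a_amat] in auto)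
    also have "\<dots> = ?L (scalar_mat B (minv E) $$ (i, l))"
      using B.quadratic_entry[OF t minv(1)[OF E invE] L il] a_quadratic(2) by simp
    finally show ?thesis using il L1 by (simp add: B.scalar_index[OF minv(1)[OF E invE]])
  qed
qed

text \<open>Extend \<open>\<Phi>\<close> linearly to the free algebra and let \<open>J\<close> be the largest ideal on which it vanishes. By
hypothesis the generic matrix satisfies the quadratic relations modulo \<open>J\<close>, so the
universal property maps the algebra of \<open>E\<close> to the quotient by \<open>J\<close>. Hence \<open>J\<close> contains
the ideal of relations, and \<open>\<Phi>\<close> descends.\<close>
lemma functional_of_words:
  assumes "\<And>u v j r. u \<in> WW \<Longrightarrow> v \<in> WW \<Longrightarrow> j < m \<Longrightarrow> r < m \<Longrightarrow>
      (\<Sum>i<m. \<Sum>l<m. E $$ (i, l) * \<Phi> (u @ (i, j) # (l, r) # v)) = E $$ (j, r) * \<Phi> (u @ v)"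
    and "\<And>u v i l. u \<in> WW \<Longrightarrow> v \<in> WW \<Longrightarrow> i < m \<Longrightarrow> l < m \<Longrightarrow>
      (\<Sum>j<m. \<Sum>r<m. minv E $$ (j, r) * \<Phi> (u @ (i, j) # (l, r) # v)) = minv E $$ (i, l) * \<Phi> (u @ v)"
  obtains \<phi> where "functional \<phi>" "\<And>w. w \<in> WW \<Longrightarrow> \<phi> (word w) = \<Phi> w"
proof -
  interpret K: kalg "base_alg :: ('k, 'k) module" by (rule kalg_base)
  define \<Lambda> where "\<Lambda> = lin_ext base_alg \<Phi>"
  have \<Lambda>: "lin_map Fr base_alg \<Lambda>"
    unfolding \<Lambda>_def Fr_eq free_alg_def by (rule K.lin_ext_lin_map) simp
  have \<Lambda>1: "\<Lambda> (Poly_Mapping.single w c) = c * \<Phi> w" for w c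
    unfolding \<Lambda>_def by simp
  define J where "J = {p \<in> carrier Fr. \<forall>x\<in>carrier Fr. \<forall>y\<in>carrier Fr. \<Lambda> (x \<otimes>\<^bsub>Fr\<^esub> (p \<otimes>\<^bsub>Fr\<^esub> y)) = 0}"
  have JI: "p \<in> J" if p: "p \<in> carrier Fr"
    "\<And>u v. u \<in> WW \<Longrightarrow> v \<in> WW \<Longrightarrow> \<Lambda> (Poly_Mapping.single u 1 \<otimes>\<^bsub>Fr\<^esub> (p \<otimes>\<^bsub>Fr\<^esub> Poly_Mapping.single v 1)) = 0" for p
  proof -
    have z: "lin_map Fr base_alg (\<lambda>_. 0)" by (auto intro: lin_mapI)
    have 1: "\<Lambda> (Poly_Mapping.single u 1 \<otimes>\<^bsub>Fr\<^esub> (p \<otimes>\<^bsub>Fr\<^esub> y)) = 0" if "u \<in> WW" "y \<in> carrier Fr" for u y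
    proof -
      have "lin_map Fr base_alg (\<lambda>y. \<Lambda> (Poly_Mapping.single u 1 \<otimes>\<^bsub>Fr\<^esub> (p \<otimes>\<^bsub>Fr\<^esub> y)))"
        using lin_map_mult(1)[OF Fr_kalg lin_map_mult(1)[OF Fr_kalg \<Lambda>, of "Poly_Mapping.single u 1"] p(1)] that by simp
      from lin_map_eq_on_words[OF this[unfolded Fr_eq] z[unfolded Fr_eq] kalg_base _ that(2)[unfolded Fr_eq]] p(2) that(1)
      show ?thesis by (simp add: Fr_eq)
    qed
    have 2: "\<Lambda> (x \<otimes>\<^bsub>Fr\<^esub> (p \<otimes>\<^bsub>Fr\<^esub> y)) = 0" if "x \<in> carrier Fr" "y \<in> carrier Fr" for x y
    proof -
      have "lin_map Fr base_alg (\<lambda>x. \<Lambda> (x \<otimes>\<^bsub>Fr\<^esub> (p \<otimes>\<^bsub>Fr\<^esub> y)))"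
        by (rule lin_map_mult(2)[OF Fr_kalg \<Lambda>]) (use p(1) that in simp)
      from lin_map_eq_on_words[OF this[unfolded Fr_eq] z[unfolded Fr_eq] kalg_base _ that(1)[unfolded Fr_eq]] 1 that(2)
      show ?thesis by (simp add: Fr_eq)
    qed
    show ?thesis using p(1) 2 by (simp add: J_def)
  qed
  have J: "ideal J Fr"
  proof (rule idealI[OF Fr.ring_axioms])
    show "subgroup J (add_monoid Fr)"
    proof (rule Fr.add.subgroupI)
      show "J \<subseteq> carrier Fr" by (auto simp: J_def)
      have "\<zero>\<^bsub>Fr\<^esub> \<in> J" using lin_map_zero[OF \<Lambda> Fr_kalg kalg_base] by (simp add: J_def)
      then show "J \<noteq> {}" by blast
      fix p p' assume p: "p \<in> J" and p': "p' \<in> J"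
      show "p \<oplus>\<^bsub>Fr\<^esub> p' \<in> J"
        using p p' by (simp add: J_def Fr.l_distr Fr.r_distr lin_mapD(2)[OF \<Lambda>])
      have "(-1) \<odot>\<^bsub>Fr\<^esub> p \<in> J"
        using p by (simp add: J_def Fr.smult_mult_l Fr.smult_mult_r lin_mapD(3)[OF \<Lambda>])
      then show "\<ominus>\<^bsub>Fr\<^esub> p \<in> J" using p by (simp add: J_def Fr.smult_minus_one)
    qed
    fix p x assume "p \<in> J" "x \<in> carrier Fr"
    then have p: "p \<in> carrier Fr" "\<And>x y. x \<in> carrier Fr \<Longrightarrow> y \<in> carrier Fr \<Longrightarrow> \<Lambda> (x \<otimes>\<^bsub>Fr\<^esub> (p \<otimes>\<^bsub>Fr\<^esub> y)) = 0"
      and x: "x \<in> carrier Fr" by (auto simp: J_def)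
    show "x \<otimes>\<^bsub>Fr\<^esub> p \<in> J"
      unfolding J_def
    proof (intro CollectI conjI ballI)
      fix z y assume zy: "z \<in> carrier Fr" "y \<in> carrier Fr"
      have "\<Lambda> ((z \<otimes>\<^bsub>Fr\<^esub> x) \<otimes>\<^bsub>Fr\<^esub> (p \<otimes>\<^bsub>Fr\<^esub> y)) = 0" by (rule p(2)) (use zy x in auto)
      then show "\<Lambda> (z \<otimes>\<^bsub>Fr\<^esub> (x \<otimes>\<^bsub>Fr\<^esub> p \<otimes>\<^bsub>Fr\<^esub> y)) = 0" using zy p(1) x by (simp add: Fr.m_assoc)
    qed (use p x in simp)
    show "p \<otimes>\<^bsub>Fr\<^esub> x \<in> J"
      unfolding J_def using p x by (simp add: Fr.m_assoc)
  qed
  interpret J: kalg_ideal "bil_free E" J by (intro kalg_ideal.intro Fr_kalg J)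
  let ?C = "quot_alg Fr J" and ?qJ = "\<lambda>p. J +>\<^bsub>Fr\<^esub> p" and ?f = "bil_free_mat E"
  have C: "kalg ?C" by (rule J.quot_kalg)
  interpret C: kalg ?C by (rule C)
  have qJ: "alg_hom Fr ?C ?qJ" by (rule J.quot_hom)
  let ?u = "map_mat ?qJ ?f"
  have u: "amat ?C m m ?u" by (rule alg_hom_amat[OF qJ free_mat_amat])
  have fi: "?f $$ (i, j) = Poly_Mapping.single [(i, j)] 1" if "i < m" "j < m" for i j
    using that E by (simp add: bil_free_mat_def free_gen_def)
  have key: "map_mat ?qJ Y = scalar_mat ?C H"
    if Y: "amat Fr m m Y" and H: "H \<in> carrier_mat m m"
      and YH: "\<And>L j r u v. j < m \<Longrightarrow> r < m \<Longrightarrow> u \<in> WW \<Longrightarrow> v \<in> WW \<Longrightarrow>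
        \<Lambda> (Poly_Mapping.single u 1 \<otimes>\<^bsub>Fr\<^esub> (Y $$ (j, r) \<otimes>\<^bsub>Fr\<^esub> Poly_Mapping.single v 1)) = H $$ (j, r) * \<Phi> (u @ v)"
    for Y H
  proof (rule amat_eqI[of ?C m m])
    show "amat ?C m m (map_mat ?qJ Y)" by (rule alg_hom_amat[OF qJ Y])
    show "amat ?C m m (scalar_mat ?C H)" by (rule C.scalar_amat[OF H])
    fix j r assume jr: "j < m" "r < m"
    have Yc: "Y $$ (j, r) \<in> carrier Fr" by (rule amatD(3)[OF Y jr])
    have Hc: "H $$ (j, r) \<odot>\<^bsub>Fr\<^esub> \<one>\<^bsub>Fr\<^esub> \<in> carrier Fr" by simp
    have "Y $$ (j, r) \<ominus>\<^bsub>Fr\<^esub> H $$ (j, r) \<odot>\<^bsub>Fr\<^esub> \<one>\<^bsub>Fr\<^esub> \<in> J"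
    proof (rule JI)
      fix u v assume uv: "u \<in> WW" "v \<in> WW"
      let ?L = "\<lambda>p. \<Lambda> (Poly_Mapping.single u 1 \<otimes>\<^bsub>Fr\<^esub> (p \<otimes>\<^bsub>Fr\<^esub> Poly_Mapping.single v 1))"
      have L: "lin_map Fr base_alg ?L"
        using lin_map_mult(2)[OF Fr_kalg lin_map_mult(1)[OF Fr_kalg \<Lambda>, of "Poly_Mapping.single u 1"],
            of "Poly_Mapping.single v 1"] uv by simp
      have "?L (H $$ (j, r) \<odot>\<^bsub>Fr\<^esub> \<one>\<^bsub>Fr\<^esub>) = H $$ (j, r) * \<Phi> (u @ v)"
        using lin_mapD(3)[OF L, of "\<one>\<^bsub>Fr\<^esub>" "H $$ (j, r)"] uv \<Lambda>1[of "u @ v" 1] by simp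
      then show "?L (Y $$ (j, r) \<ominus>\<^bsub>Fr\<^esub> H $$ (j, r) \<odot>\<^bsub>Fr\<^esub> \<one>\<^bsub>Fr\<^esub>) = 0"
        using lin_map_minus[OF L Fr_kalg kalg_base Yc Hc] YH[OF jr uv]
          K.r_neg[of "H $$ (j, r) * \<Phi> (u @ v)"] by (simp add: a_minus_def)
    qed (use Yc Hc in simp)
    then have "?qJ (Y $$ (j, r)) = ?qJ (H $$ (j, r) \<odot>\<^bsub>Fr\<^esub> \<one>\<^bsub>Fr\<^esub>)"
      using J.coset_eq_iff[OF Yc Hc] by simp
    also have "\<dots> = scalar_mat ?C H $$ (j, r)"
      using lin_mapD(3)[OF alg_homD(1)[OF qJ], of "\<one>\<^bsub>Fr\<^esub>"] alg_homD(2)[OF qJ]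
      by (simp add: C.scalar_index[OF H jr])
    finally show "map_mat ?qJ Y $$ (j, r) = scalar_mat ?C H $$ (j, r)"
      using jr amatD[OF Y] by simp
  qed
  have L: "lin_map Fr base_alg (\<lambda>p. \<Lambda> (Poly_Mapping.single u 1 \<otimes>\<^bsub>Fr\<^esub> (p \<otimes>\<^bsub>Fr\<^esub> Poly_Mapping.single v 1)))"
    if "u \<in> WW" "v \<in> WW" for u v
    using lin_map_mult(2)[OF Fr_kalg lin_map_mult(1)[OF Fr_kalg \<Lambda>, of "Poly_Mapping.single u 1"],
        of "Poly_Mapping.single v 1"] that by simp
  have Lf: "\<Lambda> (Poly_Mapping.single u 1 \<otimes>\<^bsub>Fr\<^esub> (?f $$ (i, j) \<otimes>\<^bsub>Fr\<^esub> ?f $$ (l, r) \<otimes>\<^bsub>Fr\<^esub> Poly_Mapping.single v 1)) =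
      \<Phi> (u @ (i, j) # (l, r) # v)" if "i < m" "j < m" "l < m" "r < m" for u v i j l r
    using that \<Lambda>1[of "u @ (i, j) # (l, r) # v" 1] by (simp add: fi)
  note ft = amat_transpose[OF free_mat_amat]
  have sE: "amat Fr m m (scalar_mat Fr E)" "amat Fr m m (scalar_mat Fr (minv E))"
    using E minv(1)[OF E invE] by (auto intro: Fr.scalar_amat)
  note Ef = Fr.amat_mult_amat[OF sE(1) free_mat_amat] and Eft = Fr.amat_mult_amat[OF sE(2) ft]
  have 1: "amat_mult ?C (transpose_mat ?u) (amat_mult ?C (scalar_mat ?C E) ?u) = scalar_mat ?C E"
  proof -
    have "amat_mult ?C (transpose_mat ?u) (amat_mult ?C (scalar_mat ?C E) ?u) =
       map_mat ?qJ (amat_mult Fr (transpose_mat ?f) (amat_mult Fr (scalar_mat Fr E) ?f))"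
      by (simp add: alg_hom_amat_mult[OF qJ Fr_kalg C ft Ef] alg_hom_amat_mult[OF qJ Fr_kalg C sE(1) free_mat_amat]
        alg_hom_scalar_mat[OF qJ Fr_kalg] alg_hom_transpose_mat)
    also have "\<dots> = scalar_mat ?C E"
    proof (rule key[OF Fr.amat_mult_amat[OF ft Ef] E])
      fix j r u v assume h: "j < m" "r < m" "u \<in> WW" "v \<in> WW"
      show "\<Lambda> (Poly_Mapping.single u 1 \<otimes>\<^bsub>Fr\<^esub> (amat_mult Fr (transpose_mat ?f) (amat_mult Fr (scalar_mat Fr E) ?f) $$ (j, r)
          \<otimes>\<^bsub>Fr\<^esub> Poly_Mapping.single v 1)) = E $$ (j, r) * \<Phi> (u @ v)"
        unfolding Fr.quadratic_entry[OF free_mat_amat E L[OF h(3,4)] h(1,2)] assms(1)[OF h(3,4,1,2), symmetric]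
        by (intro sum.cong refl) (use Lf h in auto)
    qed
    finally show ?thesis .
  qed
  have 2: "amat_mult ?C ?u (amat_mult ?C (scalar_mat ?C (minv E)) (transpose_mat ?u)) = scalar_mat ?C (minv E)"
  proof -
    have "amat_mult ?C ?u (amat_mult ?C (scalar_mat ?C (minv E)) (transpose_mat ?u)) =
       map_mat ?qJ (amat_mult Fr ?f (amat_mult Fr (scalar_mat Fr (minv E)) (transpose_mat ?f)))"
      by (simp add: alg_hom_amat_mult[OF qJ Fr_kalg C free_mat_amat Eft] alg_hom_amat_mult[OF qJ Fr_kalg C sE(2) ft]
        alg_hom_scalar_mat[OF qJ Fr_kalg] alg_hom_transpose_mat)
    also have "\<dots> = scalar_mat ?C (minv E)"
    proof (rule key[OF Fr.amat_mult_amat[OF free_mat_amat Eft] minv(1)[OF E invE]])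
      fix i l u v assume h: "i < m" "l < m" "u \<in> WW" "v \<in> WW"
      show "\<Lambda> (Poly_Mapping.single u 1 \<otimes>\<^bsub>Fr\<^esub> (amat_mult Fr ?f (amat_mult Fr (scalar_mat Fr (minv E)) (transpose_mat ?f)) $$ (i, l)
          \<otimes>\<^bsub>Fr\<^esub> Poly_Mapping.single v 1)) = minv E $$ (i, l) * \<Phi> (u @ v)"
        unfolding Fr.quadratic_entry[OF ft minv(1)[OF E invE] L[OF h(3,4)] h(1,2), unfolded transpose_transpose]
          assms(2)[OF h(3,4,1,2), symmetric]
        by (intro sum.cong refl) (use Lf h amatD[OF free_mat_amat] in auto)
    qed
    finally show ?thesis .
  qed
  have lnk: "link ?C E E ?u" using C.link_iff_quadratic[OF E invE u] 1 2 by simp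
  have me: "mat m m (\<lambda>ij. ?u $$ ij) = ?u" by (rule mat_index_fun) (use u in \<open>simp add: amat_def\<close>)
  note bl = bil_lift[OF C, of "\<lambda>ij. ?u $$ ij", unfolded me, OF lnk]
  let ?h = "bil_lift ?C (\<lambda>ij. ?u $$ ij)"
  have h: "?h (q p) = ?qJ p" if "p \<in> carrier Fr" for p
  proof -
    have gen: "?h (q (free_gen x)) = ?qJ (free_gen x)" if xG: "x \<in> G" for x
    proof -
      obtain i j where x: "x = (i, j)" "i < m" "j < m" using xG by auto
      have "?h (a $$ (i, j)) = map_mat ?h a $$ (i, j)" using x amatD[OF a_amat] by simp
      then show ?thesis unfolding bl(2) using x E amatD[OF a_amat]
        by (simp add: a_index bil_free_mat_def)
    qed
    have 1: "alg_hom (free_alg G) ?C (\<lambda>p. ?h (q p))"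
      using alg_hom_comp[OF q_hom bl(1)] by (simp only: Fr_eq)
    have 2: "alg_hom (free_alg G) ?C ?qJ" using qJ by (simp only: Fr_eq)
    show ?thesis by (rule alg_hom_free_unique[OF 1 2 C gen that[unfolded Fr_eq]])
  qed
  have sub: "r \<in> J" if r: "r \<in> bil_ideal E" for r
  proof -
    have rc: "r \<in> carrier Fr" using r I.a_subset by auto
    have "q r = q \<zero>\<^bsub>Fr\<^esub>" using r rc I.coset_eq_iff[OF rc Fr.zero_closed] by (simp add: a_minus_def)
    then have "?qJ r = ?qJ \<zero>\<^bsub>Fr\<^esub>" using h[OF rc] h[OF Fr.zero_closed] by simp
    then show ?thesis using J.coset_eq_iff[OF rc Fr.zero_closed] rc by (simp add: a_minus_def)
  qed
  have \<Lambda>0: "\<Lambda> r = \<zero>\<^bsub>base_alg\<^esub>" if "r \<in> bil_ideal E" for r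
  proof -
    from sub[OF that] have r: "r \<in> carrier Fr"
      "\<forall>x\<in>carrier Fr. \<forall>y\<in>carrier Fr. \<Lambda> (x \<otimes>\<^bsub>Fr\<^esub> (r \<otimes>\<^bsub>Fr\<^esub> y)) = 0"
      unfolding J_def by blast+
    have "\<Lambda> (\<one>\<^bsub>Fr\<^esub> \<otimes>\<^bsub>Fr\<^esub> (r \<otimes>\<^bsub>Fr\<^esub> \<one>\<^bsub>Fr\<^esub>)) = 0"
      using bspec[OF bspec[OF r(2) Fr.one_closed] Fr.one_closed] .
    then show ?thesis unfolding Fr.r_one[OF r(1)] Fr.l_one[OF r(1)] by simp
  qed
  have ql: "the_elem (\<Lambda> ` q p) = \<Lambda> p" if "p \<in> carrier Fr" for p
    by (rule I.quot_lift_lin(1)[OF kalg_base \<Lambda> \<Lambda>0 that])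
  show ?thesis
  proof (rule that[of "\<lambda>X. the_elem (\<Lambda> ` X)"])
    show "functional (\<lambda>X. the_elem (\<Lambda> ` X))" unfolding bil_alg_def by (rule I.quot_lift_lin(2)[OF kalg_base \<Lambda> \<Lambda>0])
    fix w assume "w \<in> WW"
    then show "the_elem (\<Lambda> ` word w) = \<Phi> w" using ql[of "Poly_Mapping.single w 1"] \<Lambda>1[of w 1] by simp
  qed
qed

section \<open>Separation by functionals\<close>

definition below :: "nat \<Rightarrow> ((nat \<times> nat) list \<Rightarrow>\<^sub>0 'k) set set" where
  "below n = {q p | p. p \<in> carrier Fr \<and> (\<forall>w\<in>Poly_Mapping.keys p. length w < n)}"

text \<open>Separate a representative of \<open>x\<close> from the sum of the ideal of relations and the span of short
words.\<close>
lemma separation: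
  assumes x: "x \<in> carrier B" "x \<notin> below n"
  shows "\<exists>\<phi>. functional \<phi> \<and> (\<forall>w\<in>WW. length w < n \<longrightarrow> \<phi> (word w) = 0) \<and> \<phi> x \<noteq> 0"
proof -
  obtain p where p: "x = q p" "p \<in> carrier Fr" using x(1) B_carrier by auto
  let ?L = "{p \<in> carrier Fr. \<forall>w\<in>Poly_Mapping.keys p. length w < n}"
  define S where "S = {r + l | r l. r \<in> bil_ideal E \<and> l \<in> ?L}"
  have fs: "r + l = r \<oplus>\<^bsub>Fr\<^esub> l" "pm_scale c r = c \<odot>\<^bsub>Fr\<^esub> r" for r l c by (simp_all add: Fr_eq free_alg_simps)
  have z0: "\<zero>\<^bsub>Fr\<^esub> = 0" by (simp add: Fr_eq free_alg_simps)
  have z: "0 \<in> bil_ideal E" "0 \<in> ?L"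
    using additive_subgroup.zero_closed[OF ideal.axioms(1)[OF ideal_B]] Fr.zero_closed by (simp_all add: z0)
  have addL: "l + l' \<in> ?L" if "l \<in> ?L" "l' \<in> ?L" for l l'
    using that keys_add[of l l'] Fr.a_closed[of l l'] by (auto simp: fs(1)[symmetric])
  have sc: "pm_scale c l \<in> ?L" if "l \<in> ?L" for l c
    using that keys_pm_scale[of c l] Fr.smult_closed[of l c] by (auto simp: fs(2)[symmetric])
  have S0: "0 \<in> S" using z unfolding S_def by (intro CollectI exI[of _ 0]) simp
  have Sa: "y + y' \<in> S" if yS: "y \<in> S" "y' \<in> S" for y y'
  proof -
    obtain r l r' l' where y: "y = r + l" "r \<in> bil_ideal E" "l \<in> ?L" "y' = r' + l'" "r' \<in> bil_ideal E" "l' \<in> ?L"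
      using yS unfolding S_def by blast
    have "y + y' = (r + r') + (l + l')" using y by simp
    moreover have "r + r' \<in> bil_ideal E" using y I.a_closed by (simp add: fs)
    ultimately show "y + y' \<in> S" using addL y unfolding S_def by blast
  qed
  have Ss: "pm_scale c y \<in> S" if yS: "y \<in> S" for c y
  proof -
    obtain r l where y: "y = r + l" "r \<in> bil_ideal E" "l \<in> ?L" using yS unfolding S_def by blast
    have "pm_scale c y = pm_scale c r + pm_scale c l" using y by (simp add: pm_scale_add)
    moreover have "pm_scale c r \<in> bil_ideal E" using I.smult_ideal[OF y(2), of c] by (simp add: fs)
    ultimately show "pm_scale c y \<in> S" using sc y unfolding S_def by blast
  qed
  have "p \<notin> S"
  proof
    assume "p \<in> S"
    then obtain r l where y: "p = r + l" "r \<in> bil_ideal E" "l \<in> ?L" unfolding S_def by blast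
    have rc: "r \<in> carrier Fr" using y(2) I.a_subset by auto
    have "p \<ominus>\<^bsub>Fr\<^esub> l = r" using y rc by (simp add: a_minus_def fs Fr.a_assoc Fr.r_neg)
    then have "q p = q l" using I.coset_eq_iff[OF p(2), of l] y by simp
    then show False using x(2) p(1) y(3) unfolding below_def by blast
  qed
  from separating_functional[OF S0 Sa Ss this] obtain g where
    g: "\<And>y z. g (y + z) = g y + g z" "\<And>c y. g (pm_scale c y) = c * g y" "\<And>y. y \<in> S \<Longrightarrow> g y = 0" "g p = 1"
    by blast
  have gl: "lin_map Fr base_alg g"
    by (rule lin_mapI) (simp_all add: g fs[symmetric])
  have g0: "g r = \<zero>\<^bsub>base_alg\<^esub>" if "r \<in> bil_ideal E" for r
  proof -
    have "r + 0 \<in> S" unfolding S_def using that z by blast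
    then show ?thesis using g(3) by simp
  qed
  have ql: "the_elem (g ` q p) = g p" if "p \<in> carrier Fr" for p
    by (rule I.quot_lift_lin(1)[OF kalg_base gl g0 that])
  show ?thesis
  proof (intro exI[of _ "\<lambda>X. the_elem (g ` X)"] conjI ballI impI)
    show "functional (\<lambda>X. the_elem (g ` X))" unfolding bil_alg_def by (rule I.quot_lift_lin(2)[OF kalg_base gl g0])
    show "the_elem (g ` x) \<noteq> 0" unfolding p(1) using ql[OF p(2)] g(4) by simp
    fix w assume w: "w \<in> WW" "length w < n"
    have "0 + Poly_Mapping.single w 1 \<in> S"
      unfolding S_def using w z by (intro CollectI exI[of _ 0] exI[of _ "Poly_Mapping.single w 1"]) auto
    then show "the_elem (g ` word w) = 0" using ql[of "Poly_Mapping.single w 1"] w g(3) by simp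
  qed
qed

lemma below_0: "below 0 = {\<zero>\<^bsub>B\<^esub>}"
proof -
  have z: "q 0 = \<zero>\<^bsub>B\<^esub>" using ideal_zero[of 0] I.zero_closed by (simp add: Fr_eq free_alg_simps)
  have "p = 0" if "\<forall>w\<in>Poly_Mapping.keys p. length w < 0" for p :: "(nat \<times> nat) list \<Rightarrow>\<^sub>0 'k"
    using that by (auto intro!: poly_mapping_eqI simp: in_keys_iff)
  moreover have "0 \<in> carrier Fr" using Fr.zero_closed by (simp add: Fr_eq free_alg_simps)
  ultimately show ?thesis unfolding below_def z[symmetric] by (auto intro!: exI[of _ 0])
qed

lemma eq_by_functionals:
  assumes "x \<in> carrier B" "y \<in> carrier B" "\<And>\<phi>. functional \<phi> \<Longrightarrow> \<phi> x = \<phi> y"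
  shows "x = y"
proof (rule ccontr)
  assume "x \<noteq> y"
  then have "x \<ominus>\<^bsub>B\<^esub> y \<noteq> \<zero>\<^bsub>B\<^esub>" using B.minus_zero_eq assms by blast
  then have "x \<ominus>\<^bsub>B\<^esub> y \<notin> below 0" by (simp add: below_0)
  from separation[OF _ this] assms obtain \<phi> where \<phi>: "functional \<phi>" "\<phi> (x \<ominus>\<^bsub>B\<^esub> y) \<noteq> 0" by auto
  interpret K: kalg "base_alg :: ('k, 'k) module" by (rule kalg_base)
  have "\<phi> (x \<ominus>\<^bsub>B\<^esub> y) = 0"
    using lin_map_minus[OF \<phi>(1) kalg_B kalg_base assms(1,2)] assms(3)[OF \<phi>(1)] K.r_neg[of "\<phi> y"]
    by (simp add: a_minus_def)
  then show False using \<phi>(2) by simp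
qed

section \<open>Convolution\<close>

definition tensor_fun :: "(((nat \<times> nat) list \<Rightarrow>\<^sub>0 'k) set \<Rightarrow> 'k) \<Rightarrow> (((nat \<times> nat) list \<Rightarrow>\<^sub>0 'k) set \<Rightarrow> 'k) \<Rightarrow> _ \<Rightarrow> 'k" where
  "tensor_fun \<phi> \<psi> = tensor_lift base_alg (\<lambda>x y. \<phi> x * \<psi> y)"

definition conv where "conv \<phi> \<psi> x = tensor_fun \<phi> \<psi> (bil_comult E x)"

lemma tensor_fun_bilin: "functional \<phi> \<Longrightarrow> functional \<psi> \<Longrightarrow> bilin B B base_alg (\<lambda>x y. \<phi> x * \<psi> y)"
  by (auto simp: bilin_def lin_map_def algebra_simps)

lemma tensor_fun_lin: "functional \<phi> \<Longrightarrow> functional \<psi> \<Longrightarrow> lin_map T base_alg (tensor_fun \<phi> \<psi>)"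
  unfolding tensor_fun_def by (rule BB.tensor_lift(1)[OF kalg_base tensor_fun_bilin])

lemma tensor_fun_pure: "functional \<phi> \<Longrightarrow> functional \<psi> \<Longrightarrow> x \<in> carrier B \<Longrightarrow> y \<in> carrier B \<Longrightarrow>
    tensor_fun \<phi> \<psi> (pure_tensor B B x y) = \<phi> x * \<psi> y"
  unfolding tensor_fun_def by (rule BB.tensor_lift(2)[OF kalg_base tensor_fun_bilin])

lemma conv_lin: "functional \<phi> \<Longrightarrow> functional \<psi> \<Longrightarrow> functional (conv \<phi> \<psi>)"
  unfolding conv_def[abs_def] by (rule lin_map_comp[OF alg_homD(1)[OF comult_hom(1)] tensor_fun_lin])

text \<open>The comultiplication is multiplicative and maps \<open>a_ij\<close> to \<open>\<Sum> a_il \<otimes> a_lj\<close>.\<close>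
lemma conv_a_mult:
  assumes \<phi>: "functional \<phi>" and \<psi>: "functional \<psi>" and ij: "i < m" "j < m" and x: "x \<in> carrier B"
  shows "conv \<phi> \<psi> (a $$ (i, j) \<otimes>\<^bsub>B\<^esub> x) =
    (\<Sum>l<m. conv (\<lambda>y. \<phi> (a $$ (i, l) \<otimes>\<^bsub>B\<^esub> y)) (\<lambda>y. \<psi> (a $$ (l, j) \<otimes>\<^bsub>B\<^esub> y)) x)"
proof -
  interpret T: kalg T by (rule kalg_T)
  have Z: "bil_comult E x \<in> carrier T" by (rule alg_homD(4)[OF comult_hom(1) x])
  have c: "pure_tensor B B (a $$ (i, l)) (a $$ (l, j)) \<in> carrier T" if "l < m" for l
    using that ij by (intro BB.pure_closed) auto
  have "bil_comult E (a $$ (i, j)) = map_mat (bil_comult E) a $$ (i, j)" using ij amatD[OF a_amat] by simp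
  also have "\<dots> = mat m m comult_fun $$ (i, j)" unfolding comult_hom(2) comult_mat ..
  finally have D: "bil_comult E (a $$ (i, j)) = (\<Oplus>\<^bsub>T\<^esub>l\<in>{..<m}. pure_tensor B B (a $$ (i, l)) (a $$ (l, j)))"
    using ij E by (simp add: comult_fun_def)
  have "conv \<phi> \<psi> (a $$ (i, j) \<otimes>\<^bsub>B\<^esub> x) =
     tensor_fun \<phi> \<psi> ((\<Oplus>\<^bsub>T\<^esub>l\<in>{..<m}. pure_tensor B B (a $$ (i, l)) (a $$ (l, j))) \<otimes>\<^bsub>T\<^esub> bil_comult E x)"
    unfolding conv_def using alg_homD(3)[OF comult_hom(1)] ij x D by simp
  also have "\<dots> = (\<Sum>l<m. tensor_fun \<phi> \<psi> (pure_tensor B B (a $$ (i, l)) (a $$ (l, j)) \<otimes>\<^bsub>T\<^esub> bil_comult E x))"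
    by (subst lin_map_finsum[OF lin_map_mult(2)[OF kalg_T tensor_fun_lin[OF \<phi> \<psi>] Z] kalg_T kalg_base]) (use c in auto)
  also have "\<dots> = (\<Sum>l<m. conv (\<lambda>y. \<phi> (a $$ (i, l) \<otimes>\<^bsub>B\<^esub> y)) (\<lambda>y. \<psi> (a $$ (l, j) \<otimes>\<^bsub>B\<^esub> y)) x)"
  proof (rule sum.cong[OF refl])
    fix l assume "l \<in> {..<m}"
    then have l: "l < m" by simp
    have f: "functional (\<lambda>y. \<phi> (a $$ (i, l) \<otimes>\<^bsub>B\<^esub> y))" "functional (\<lambda>y. \<psi> (a $$ (l, j) \<otimes>\<^bsub>B\<^esub> y))"
      using functional_a \<phi> \<psi> l ij by blast+
    show "tensor_fun \<phi> \<psi> (pure_tensor B B (a $$ (i, l)) (a $$ (l, j)) \<otimes>\<^bsub>T\<^esub> bil_comult E x) =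
       conv (\<lambda>y. \<phi> (a $$ (i, l) \<otimes>\<^bsub>B\<^esub> y)) (\<lambda>y. \<psi> (a $$ (l, j) \<otimes>\<^bsub>B\<^esub> y)) x"
      unfolding conv_def
    proof (rule BB.tensor_lin_eq[OF _ tensor_fun_lin[OF f] kalg_base _ Z])
      show "lin_map T base_alg (\<lambda>Y. tensor_fun \<phi> \<psi> (pure_tensor B B (a $$ (i, l)) (a $$ (l, j)) \<otimes>\<^bsub>T\<^esub> Y))"
        by (rule lin_map_mult(1)[OF kalg_T tensor_fun_lin[OF \<phi> \<psi>] c[OF l]])
    qed (use l ij in \<open>simp add: BB.pure_mult tensor_fun_pure[OF \<phi> \<psi>] tensor_fun_pure[OF f]\<close>)
  qed
  finally show ?thesis .
qed

lemma conv_one: "functional \<phi> \<Longrightarrow> functional \<psi> \<Longrightarrow> conv \<phi> \<psi> \<one>\<^bsub>B\<^esub> = \<phi> \<one>\<^bsub>B\<^esub> * \<psi> \<one>\<^bsub>B\<^esub>"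
  unfolding conv_def alg_homD(2)[OF comult_hom(1)] BB.pure_one[symmetric] by (rule tensor_fun_pure) auto

lemma conv_wd:
  assumes "functional \<phi>" "functional \<psi>" "w \<in> WW"
  shows "conv \<phi> \<psi> (word w) =
    (\<Sum>L\<in>words m (length w). \<phi> (word (zip (map fst w) L)) * \<psi> (word (zip L (map snd w))))"
  using assms
proof (induction w arbitrary: \<phi> \<psi>)
  case Nil
  then show ?case by (simp add: word_Nil conv_one)
next
  case (Cons x w)
  obtain i j where x: "x = (i, j)" "i < m" "j < m" using Cons.prems(3) by (cases x) auto
  have w: "w \<in> WW" using Cons.prems(3) by auto
  have zc: "zip (map fst w) L \<in> WW" "zip L (map snd w) \<in> WW" if "L \<in> words m (length w)" for L
  proof -
    have L: "L \<in> lists {..<m}" using that by (simp add: words_def)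
    show "zip (map fst w) L \<in> WW" "zip L (map snd w) \<in> WW"
      using zip_in_WW[OF map_fst_snd_in(1)[OF w] L] zip_in_WW[OF L map_fst_snd_in(2)[OF w]] .
  qed
  have "conv \<phi> \<psi> (word (x # w)) =
    (\<Sum>l<m. conv (\<lambda>y. \<phi> (a $$ (i, l) \<otimes>\<^bsub>B\<^esub> y)) (\<lambda>y. \<psi> (a $$ (l, j) \<otimes>\<^bsub>B\<^esub> y)) (word w))"
    using conv_a_mult[OF Cons.prems(1,2) x(2,3), of "word w"] w x by (simp add: word_Cons)
  also have "\<dots> = (\<Sum>l<m. \<Sum>L\<in>words m (length w).
      \<phi> (a $$ (i, l) \<otimes>\<^bsub>B\<^esub> word (zip (map fst w) L)) * \<psi> (a $$ (l, j) \<otimes>\<^bsub>B\<^esub> word (zip L (map snd w))))"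
    by (intro sum.cong refl Cons.IH w functional_a Cons.prems) (use x in auto)
  also have "\<dots> = (\<Sum>l<m. \<Sum>L\<in>words m (length w).
      \<phi> (word (zip (map fst (x # w)) (l # L))) * \<psi> (word (zip (l # L) (map snd (x # w)))))"
    by (intro sum.cong refl) (use zc x in \<open>simp add: word_Cons\<close>)
  finally show ?case by (simp add: sum_words_Suc)
qed

lemma conv_a:
  assumes "functional \<phi>" "functional \<psi>" "i < m" "j < m"
  shows "conv \<phi> \<psi> (a $$ (i, j)) = (\<Sum>l<m. \<phi> (a $$ (i, l)) * \<psi> (a $$ (l, j)))"
proof -
  have "conv \<phi> \<psi> (a $$ (i, j)) = (\<Sum>l<m. conv (\<lambda>y. \<phi> (a $$ (i, l) \<otimes>\<^bsub>B\<^esub> y)) (\<lambda>y. \<psi> (a $$ (l, j) \<otimes>\<^bsub>B\<^esub> y)) \<one>\<^bsub>B\<^esub>)"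
    using conv_a_mult[OF assms, of "\<one>\<^bsub>B\<^esub>"] assms by simp
  also have "\<dots> = (\<Sum>l<m. \<phi> (a $$ (i, l)) * \<psi> (a $$ (l, j)))"
    using assms by (intro sum.cong refl) (simp add: conv_one functional_a)
  finally show ?thesis .
qed

end

section \<open>Polynomials evaluated at an element\<close>

context kalg begin

definition evalp :: "'k poly \<Rightarrow> 'b \<Rightarrow> 'b" where
  "evalp P y = fold_coeffs (\<lambda>c r. c \<odot> \<one> \<oplus> y \<otimes> r) P \<zero>"

lemma evalp_0 [simp]: "evalp 0 y = \<zero>"
  by (simp add: evalp_def)

lemma evalp_pCons [simp]: "y \<in> carrier A \<Longrightarrow> evalp (pCons c P) y = c \<odot> \<one> \<oplus> y \<otimes> evalp P y"
  by (cases "P = 0 \<and> c = 0") (auto simp: evalp_def)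

lemma evalp_closed [simp]: "y \<in> carrier A \<Longrightarrow> evalp P y \<in> carrier A"
  by (induction P) auto

lemma evalp_add: "y \<in> carrier A \<Longrightarrow> evalp (P + Q) y = evalp P y \<oplus> evalp Q y"
proof (induction P Q rule: poly_induct2)
  case (pCons a p b q)
  then show ?case by (simp add: smult_l_distr r_distr a_ac)
qed simp

lemma evalp_smult: "y \<in> carrier A \<Longrightarrow> evalp (Polynomial.smult c P) y = c \<odot> evalp P y"
  by (induction P) (auto simp: smult_r_distr smult_assoc smult_mult_r)

lemma evalp_mult: "y \<in> carrier A \<Longrightarrow> evalp (P * Q) y = evalp P y \<otimes> evalp Q y"
proof (induction P)
  case (pCons c P)
  then show ?case by (simp add: evalp_add evalp_smult l_distr smult_mult_l m_assoc)
qed simp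

lemma evalp_pcompose: "y \<in> carrier A \<Longrightarrow> evalp (pcompose P Q) y = evalp P (evalp Q y)"
proof (induction P)
  case (pCons c P)
  then show ?case by (simp add: pcompose_pCons evalp_add evalp_mult)
qed simp

lemma evalp_monom: "y \<in> carrier A \<Longrightarrow> evalp (Polynomial.monom c n) y = c \<odot> (y [^] n)"
proof (induction n)
  case 0
  then show ?case by (simp add: monom_0)
next
  case (Suc n)
  have "y [^] Suc n = y \<otimes> y [^] n" using nat_pow_Suc2[OF Suc.prems] .
  then show ?case using Suc by (simp add: monom_Suc smult_mult_r)
qed

lemma functional_evalp:
  assumes "lin_map A base_alg \<phi>" "y \<in> carrier A" "\<And>k. k \<ge> N \<Longrightarrow> poly.coeff P k = 0"
  shows "\<phi> (evalp P y) = (\<Sum>k<N. poly.coeff P k * \<phi> (y [^] k))"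
  using assms(1,3)
proof (induction P arbitrary: \<phi> N)
  case 0
  then show ?case using lin_map_zero[OF 0(1) kalg_axioms kalg_base] by simp
next
  case (pCons c P)
  note L = lin_map_mult(1)[OF kalg_axioms pCons.prems(1) assms(2)]
  obtain M where N: "N = Suc M"
  proof (cases N)
    case 0
    then have "poly.coeff (pCons c P) k = 0" for k using pCons.prems(2) by simp
    then have "pCons c P = 0" by (intro poly_eqI) simp
    with pCons.hyps show ?thesis by auto
  qed
  have "\<phi> (evalp (pCons c P) y) = c * \<phi> \<one> + \<phi> (y \<otimes> evalp P y)"
    using assms(2) by (simp add: lin_mapD[OF pCons.prems(1)])
  also have "\<phi> (y \<otimes> evalp P y) = (\<Sum>k<M. poly.coeff P k * \<phi> (y \<otimes> y [^] k))"
    by (rule pCons.IH[OF L]) (use pCons.prems(2)[of "Suc k" for k] N in simp)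
  also have "c * \<phi> \<one> + (\<Sum>k<M. poly.coeff P k * \<phi> (y \<otimes> y [^] k)) =
      (\<Sum>k<N. poly.coeff (pCons c P) k * \<phi> (y [^] k))"
    unfolding N sum.lessThan_Suc_shift using nat_pow_Suc2[OF assms(2)] by (simp del: nat_pow_Suc)
  finally show ?case .
qed

end

lemma alg_hom_evalp:
  assumes "alg_hom A B f" "kalg A" "kalg B" "y \<in> carrier A"
  shows "f (kalg.evalp A P y) = kalg.evalp B P (f y)"
proof -
  interpret A: kalg A by fact
  interpret B: kalg B by fact
  note lin = alg_homD(1)[OF assms(1)]
  show ?thesis
  proof (induction P)
    case 0
    then show ?case using lin_map_zero[OF lin assms(2,3)] by simp
  next
    case (pCons c P)
    then show ?case using assms(4) alg_homD(2-4)[OF assms(1)] by (simp add: lin_mapD[OF lin])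
  qed
qed

section \<open>Cocommutative elements\<close>

context bil_form begin

text \<open>The character of the comodule whose coefficient matrix is the generic matrix.\<close>
definition chi where "chi = (\<Oplus>\<^bsub>B\<^esub>i\<in>{..<m}. a $$ (i, i))"

lemma chi_closed [simp]: "chi \<in> carrier B"
  unfolding chi_def by (rule B.finsum_closed) auto

lemma zip_words: "I \<in> words m n \<Longrightarrow> J \<in> words m n \<Longrightarrow> zip I J \<in> WW \<and> length (zip I J) = n"
  by (simp add: words_def zip_in_WW)

lemma map_words: "w \<in> WW \<Longrightarrow> map fst w \<in> words m (length w) \<and> map snd w \<in> words m (length w)"
  unfolding words_def using map_fst_snd_in by simp

lemma functional_chi_mult:
  assumes "functional \<phi>" "x \<in> carrier B"
  shows "\<phi> (chi \<otimes>\<^bsub>B\<^esub> x) = (\<Sum>i<m. \<phi> (a $$ (i, i) \<otimes>\<^bsub>B\<^esub> x))"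
  unfolding chi_def
  by (subst lin_map_finsum[OF lin_map_mult(2)[OF kalg_B assms] kalg_B kalg_base]) auto

lemma functional_chi_pow:
  "functional \<phi> \<Longrightarrow> \<phi> (chi [^]\<^bsub>B\<^esub> n) = (\<Sum>I\<in>words m n. \<phi> (word (zip I I)))"
proof (induction n arbitrary: \<phi>)
  case 0
  then show ?case by (simp add: word_Nil)
next
  case (Suc n)
  have "\<phi> (chi [^]\<^bsub>B\<^esub> Suc n) = (\<Sum>i<m. \<phi> (a $$ (i, i) \<otimes>\<^bsub>B\<^esub> chi [^]\<^bsub>B\<^esub> n))"
    unfolding B.nat_pow_Suc2[OF chi_closed] by (rule functional_chi_mult[OF Suc.prems]) simp
  also have "\<dots> = (\<Sum>i<m. \<Sum>I\<in>words m n. \<phi> (a $$ (i, i) \<otimes>\<^bsub>B\<^esub> word (zip I I)))"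
    by (intro sum.cong refl Suc.IH functional_a Suc.prems) auto
  also have "\<dots> = (\<Sum>i<m. \<Sum>I\<in>words m n. \<phi> (word (zip (i # I) (i # I))))"
    by (intro sum.cong refl) (use zip_words in \<open>simp add: word_Cons\<close>)
  finally show ?case by (simp add: sum_words_Suc)
qed

text \<open>Invariance of the comultiplication under the flip, expressed through functionals, which separate the
elements of the tensor square.\<close>
definition cocommutative where
  "cocommutative x \<longleftrightarrow> x \<in> carrier B \<and> (\<forall>\<phi> \<psi>. functional \<phi> \<longrightarrow> functional \<psi> \<longrightarrow> conv \<phi> \<psi> x = conv \<psi> \<phi> x)"

text \<open>The comultiplication of \<open>chi^n\<close> is the sum of all \<open>a_IL \<otimes> a_LI\<close>.\<close>
lemma chi_pow_cocommutative: "cocommutative (chi [^]\<^bsub>B\<^esub> (n::nat))"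
  unfolding cocommutative_def
proof (intro conjI allI impI)
  fix \<phi> \<psi> assume f: "functional \<phi>" "functional \<psi>"
  have *: "conv \<phi> \<psi> (chi [^]\<^bsub>B\<^esub> n) = (\<Sum>I\<in>words m n. \<Sum>L\<in>words m n. \<phi> (word (zip I L)) * \<psi> (word (zip L I)))"
    if "functional \<phi>" "functional \<psi>" for \<phi> \<psi>
    unfolding functional_chi_pow[OF conv_lin[OF that]]
  proof (rule sum.cong[OF refl])
    fix I assume I: "I \<in> words m n"
    then have "length I = n" by (simp add: words_def)
    then show "conv \<phi> \<psi> (word (zip I I)) = (\<Sum>L\<in>words m n. \<phi> (word (zip I L)) * \<psi> (word (zip L I)))"
      using conv_wd[OF that, of "zip I I"] zip_words[OF I I] by simp
  qed
  show "conv \<phi> \<psi> (chi [^]\<^bsub>B\<^esub> n) = conv \<psi> \<phi> (chi [^]\<^bsub>B\<^esub> n)"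
    unfolding *[OF f] *[OF f(2,1)] by (subst sum.swap) (simp add: mult.commute)
qed simp

lemma cocommutative_diff:
  assumes "cocommutative x" "cocommutative y"
  shows "cocommutative (x \<ominus>\<^bsub>B\<^esub> c \<odot>\<^bsub>B\<^esub> y)"
  unfolding cocommutative_def
proof (intro conjI allI impI)
  have xy: "x \<in> carrier B" "y \<in> carrier B" using assms by (simp_all add: cocommutative_def)
  then show "x \<ominus>\<^bsub>B\<^esub> c \<odot>\<^bsub>B\<^esub> y \<in> carrier B" by simp
  fix \<phi> \<psi> assume f: "functional \<phi>" "functional \<psi>"
  have *: "conv \<phi> \<psi> (x \<ominus>\<^bsub>B\<^esub> c \<odot>\<^bsub>B\<^esub> y) = conv \<phi> \<psi> x \<ominus>\<^bsub>base_alg\<^esub> c * conv \<phi> \<psi> y"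
    if "functional \<phi>" "functional \<psi>" for \<phi> \<psi>
    using lin_map_minus[OF conv_lin[OF that] kalg_B kalg_base, of x "c \<odot>\<^bsub>B\<^esub> y"] lin_mapD(3)[OF conv_lin[OF that]] xy
    by simp
  show "conv \<phi> \<psi> (x \<ominus>\<^bsub>B\<^esub> c \<odot>\<^bsub>B\<^esub> y) = conv \<psi> \<phi> (x \<ominus>\<^bsub>B\<^esub> c \<odot>\<^bsub>B\<^esub> y)"
    unfolding *[OF f] *[OF f(2,1)] using assms f by (simp add: cocommutative_def)
qed

lemma in_below: "x \<in> carrier B \<Longrightarrow> \<exists>n. x \<in> below n"
proof -
  assume "x \<in> carrier B"
  then obtain p where p: "x = q p" "p \<in> carrier Fr" using B_carrier by auto
  have "\<forall>w\<in>Poly_Mapping.keys p. length w < Suc (Max (length ` Poly_Mapping.keys p))"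
    by (simp add: less_Suc_eq_le)
  then show ?thesis using p unfolding below_def by blast
qed

lemma word_split:
  assumes "J \<in> words m n" "length u + length v + 2 = n"
  obtains J1 j1 j2 J2 where "J = J1 @ j1 # j2 # J2" "length J1 = length u" "length J2 = length v"
    "J1 \<in> lists {..<m}" "J2 \<in> lists {..<m}" "j1 < m" "j2 < m"
proof -
  have J: "J = take (length u) J @ drop (length u) J" by simp
  have l: "length J = length u + Suc (Suc (length v))" using assms by (simp add: words_def)
  obtain j1 j2 J2 where d: "drop (length u) J = j1 # j2 # J2"
    using l by (metis length_drop diff_add_inverse length_Suc_conv)
  have e: "J = take (length u) J @ j1 # j2 # J2" using J d by simp
  have "set J \<subseteq> {..<m}" using assms(1) by (auto simp: words_def)
  then have "set (take (length u) J @ j1 # j2 # J2) \<subseteq> {..<m}" using e by simp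
  moreover have "length J2 = length v" using l arg_cong[OF d, of length] by simp
  ultimately show ?thesis using that[OF e] l by auto
qed

text \<open>By the defining relations the contraction at two neighbouring letters is a value at a word that is
shorter by two.\<close>
lemma functional_traceless:
  assumes \<phi>: "functional \<phi>" and low: "\<And>w. w \<in> WW \<Longrightarrow> length w < n \<Longrightarrow> \<phi> (word w) = 0" and J: "J \<in> words m n"
  shows "FI.traceless n (\<lambda>I. \<phi> (word (zip I J)))"
    and "form.traceless m (\<lambda>i j. minv E $$ (i, j)) n (\<lambda>I. \<phi> (word (zip J I)))"
proof -
  have key: "(\<Sum>i<m. \<Sum>j<m. E $$ (i, j) * \<phi> (word (zip (u @ i # j # v) J))) = 0 \<and>
      (\<Sum>i<m. \<Sum>j<m. minv E $$ (i, j) * \<phi> (word (zip J (u @ i # j # v)))) = 0"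
    if uv: "u \<in> lists {..<m}" "v \<in> lists {..<m}" "length u + length v + 2 = n" for u v
  proof -
    obtain J1 j1 j2 J2 where s: "J = J1 @ j1 # j2 # J2" "length J1 = length u" "length J2 = length v"
      "J1 \<in> lists {..<m}" "J2 \<in> lists {..<m}" "j1 < m" "j2 < m"
      using word_split[OF J uv(3)] .
    have z: "zip (u @ i # j # v) J = zip u J1 @ (i, j1) # (j, j2) # zip v J2"
      "zip J (u @ i # j # v) = zip J1 u @ (j1, i) # (j2, j) # zip J2 v" for i j
      using s by simp_all
    note in1 = zip_in_WW[OF uv(1) s(4)] zip_in_WW[OF uv(2) s(5)]
      and in2 = zip_in_WW[OF s(4) uv(1)] zip_in_WW[OF s(5) uv(2)]
    have "\<phi> (word (zip u J1 @ zip v J2)) = 0" "\<phi> (word (zip J1 u @ zip J2 v)) = 0"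
      by (rule low; use in1 in2 uv(3) s(2,3) in auto)+
    then show ?thesis
      unfolding z using functional_rel(1)[OF \<phi> in1 s(6,7)] functional_rel(2)[OF \<phi> in2 s(6,7)] by simp
  qed
  show "FI.traceless n (\<lambda>I. \<phi> (word (zip I J)))"
    unfolding FI.traceless_def using key by blast
  show "form.traceless m (\<lambda>i j. minv E $$ (i, j)) n (\<lambda>I. \<phi> (word (zip J I)))"
    unfolding form.traceless_def using key by blast
qed

end

lemma traceless_linear:
  fixes e :: "nat \<Rightarrow> nat \<Rightarrow> 'k::field"
  shows "form.traceless m e n s \<Longrightarrow> form.traceless m e n t \<Longrightarrow> form.traceless m e n (\<lambda>x. s x - k * t x)"
    and "form.traceless m e n s \<Longrightarrow> form.traceless m e n (\<lambda>x. k * s x)"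
proof -
  have 1: "(\<Sum>i<m. \<Sum>j<m. e i j * (s (u @ i # j # v) - k * t (u @ i # j # v))) =
     (\<Sum>i<m. \<Sum>j<m. e i j * s (u @ i # j # v)) - k * (\<Sum>i<m. \<Sum>j<m. e i j * t (u @ i # j # v))" for u v
    by (simp add: sum_distrib_left sum_subtractf right_diff_distrib mult_ac)
  have 2: "(\<Sum>i<m. \<Sum>j<m. e i j * (k * s (u @ i # j # v))) = k * (\<Sum>i<m. \<Sum>j<m. e i j * s (u @ i # j # v))" for u v
    by (simp add: sum_distrib_left mult_ac)
  show "form.traceless m e n s \<Longrightarrow> form.traceless m e n t \<Longrightarrow> form.traceless m e n (\<lambda>x. s x - k * t x)"
    "form.traceless m e n s \<Longrightarrow> form.traceless m e n (\<lambda>x. k * s x)"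
    unfolding form.traceless_def 1 2 by simp_all
qed

locale bil_form_big = bil_form E m for E :: "'k::{alg_closed_field, field_char_0} mat" and m +
  assumes m2: "m \<ge> 2"
begin

abbreviation "traceless1 \<equiv> FI.traceless"
abbreviation "traceless2 \<equiv> form.traceless m (\<lambda>i j. minv E $$ (i, j))"

text \<open>The functional vanishes on words shorter than \<open>n\<close>. Vanishing on words of length \<open>n + 1\<close> is a
consequence of the parity of the construction; it is used for \<open>n = 0\<close>, to separate 1 from the
generators.\<close>
definition top_fun where
  "top_fun n f g \<phi> \<longleftrightarrow> functional \<phi> \<and> (\<forall>w\<in>WW. (length w < n \<or> length w = Suc n \<longrightarrow> \<phi> (word w) = 0) \<and>
     (length w = n \<longrightarrow> \<phi> (word w) = f (map fst w) * g (map snd w)))"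

lemma top_fun_exists:
  assumes "traceless1 n f" "traceless2 n g"
  shows "\<exists>\<phi>. top_fun n f g \<phi>"
proof -
  let ?e = "\<lambda>i j. E $$ (i, j)" and ?e' = "\<lambda>i j. minv E $$ (i, j)"
  obtain c where c: "(\<Sum>i<m. \<Sum>j<m. ?e i j * c i * c j) = 0" "\<exists>i<m. c i \<noteq> 0"
    using isotropic_exists[OF m2] .
  obtain d where d: "(\<Sum>i<m. \<Sum>j<m. ?e' i j * d i * d j) = 0" "\<exists>i<m. d i \<noteq> 0"
    using isotropic_exists[OF m2] .
  obtain r where r: "r \<noteq> 0" "r * r + r * (\<Sum>i<m. \<Sum>j<m. ?e i j * ?e' i j) + 1 = 0"
    using quadratic_parameter_exists .
  interpret FP: form_pair m ?e ?e' c d r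
    by unfold_locales
      (use c d r FI.inv_l FI.inv_r in \<open>simp_all add: mult.commute[of "minv E $$ _" "E $$ _"]\<close>)
  obtain \<Phi> where \<Phi>:
    "\<And>u v j r. u \<in> WW \<Longrightarrow> v \<in> WW \<Longrightarrow> j < m \<Longrightarrow> r < m \<Longrightarrow>
      (\<Sum>i<m. \<Sum>l<m. ?e i l * \<Phi> (u @ (i, j) # (l, r) # v)) = ?e j r * \<Phi> (u @ v)"
    "\<And>u v i l. u \<in> WW \<Longrightarrow> v \<in> WW \<Longrightarrow> i < m \<Longrightarrow> l < m \<Longrightarrow>
      (\<Sum>j<m. \<Sum>r<m. ?e' j r * \<Phi> (u @ (i, j) # (l, r) # v)) = ?e' i l * \<Phi> (u @ v)"
    "\<And>w. length w < n \<Longrightarrow> \<Phi> w = 0" "\<And>w. length w = Suc n \<Longrightarrow> \<Phi> w = 0"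
    "\<And>w. length w = n \<Longrightarrow> \<Phi> w = f (map fst w) * g (map snd w)"
    using FP.top_functional[OF assms] by blast
  obtain \<phi> where "functional \<phi>" "\<And>w. w \<in> WW \<Longrightarrow> \<phi> (word w) = \<Phi> w"
    using functional_of_words[OF \<Phi>(1,2)] by blast
  then have "top_fun n f g \<phi>" using \<Phi>(3-5) by (simp add: top_fun_def)
  then show ?thesis by (intro exI[of "top_fun n f g" \<phi>])
qed

lemma pairing: "\<exists>s t. traceless1 n s \<and> traceless2 n t \<and> (\<Sum>w\<in>words m n. s w * t w) \<noteq> 0"
  by (rule FI.pairing_nonzero[OF m2 infinite_UNIV_char_0])

lemma top_fun_chi:
  assumes "top_fun n f g \<phi>"
  shows "\<phi> (chi [^]\<^bsub>B\<^esub> n) = (\<Sum>w\<in>words m n. f w * g w)" "k < n \<Longrightarrow> \<phi> (chi [^]\<^bsub>B\<^esub> (k::nat)) = 0"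
proof -
  have \<phi>: "functional \<phi>" using assms by (simp add: top_fun_def)
  have d: "zip I I \<in> WW" "length I = k" "map fst (zip I I) = I" "map snd (zip I I) = I"
    if "I \<in> words m k" for I k
    using zip_words[OF that that] that by (simp_all add: words_def)
  show "\<phi> (chi [^]\<^bsub>B\<^esub> n) = (\<Sum>w\<in>words m n. f w * g w)"
    unfolding functional_chi_pow[OF \<phi>]
    by (intro sum.cong refl) (use d assms in \<open>simp add: top_fun_def\<close>)
  show "\<phi> (chi [^]\<^bsub>B\<^esub> k) = 0" if "k < n"
    unfolding functional_chi_pow[OF \<phi>]
    by (intro sum.neutral ballI) (use d assms that in \<open>simp add: top_fun_def\<close>)
qed

text \<open>Test with a functional whose leading part has the degree of the polynomial and a nonzero pairing.\<close>
lemma chi_independent: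
  assumes "B.evalp P chi = \<zero>\<^bsub>B\<^esub>"
  shows "P = 0"
proof (rule ccontr)
  assume "P \<noteq> 0"
  let ?n = "Polynomial.degree P"
  obtain s t where st: "traceless1 ?n s" "traceless2 ?n t" "(\<Sum>w\<in>words m ?n. s w * t w) \<noteq> 0"
    using pairing by blast
  obtain \<phi> where \<phi>: "top_fun ?n s t \<phi>" using top_fun_exists[OF st(1,2)] by blast
  then have f: "functional \<phi>" by (simp add: top_fun_def)
  have "0 = \<phi> (B.evalp P chi)" using assms lin_map_zero[OF f kalg_B kalg_base] by simp
  also have "\<dots> = (\<Sum>k<Suc ?n. poly.coeff P k * \<phi> (chi [^]\<^bsub>B\<^esub> k))"
    by (rule B.functional_evalp[OF f chi_closed]) (simp add: coeff_eq_0)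
  also have "\<dots> = poly.coeff P ?n * (\<Sum>w\<in>words m ?n. s w * t w)"
    using top_fun_chi[OF \<phi>] by simp
  finally show False using st(3) \<open>P \<noteq> 0\<close> by simp
qed

text \<open>Functionals with leading part \<open>s \<otimes> t\<close> see only the part of \<open>x\<close> of length \<open>n\<close>, as a bilinear
expression \<open>X s t\<close>. The convolution of two of them has leading part \<open>s \<otimes> t'\<close> up to the factor
\<open>pr s' t\<close>, the pairing of the inner parts. Cocommutativity therefore gives
\<open>X s t' * pr s' t = X s' t * pr s t'\<close>, so \<open>X\<close> is a multiple \<open>\<kappa>\<close> of the pairing \<open>pr\<close>, as it is for
\<open>\<kappa> chi^n\<close>.\<close>
lemma cocommutative_step:
  assumes x: "cocommutative x" "x \<in> below (Suc n)"
  shows "\<exists>\<kappa>. x \<ominus>\<^bsub>B\<^esub> \<kappa> \<odot>\<^bsub>B\<^esub> chi [^]\<^bsub>B\<^esub> n \<in> below n"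
proof -
  obtain p where p: "x = q p" "p \<in> carrier Fr" "\<And>w. w \<in> Poly_Mapping.keys p \<Longrightarrow> length w < Suc n"
    using x(2) unfolding below_def by blast
  have pW: "w \<in> WW" if "w \<in> Poly_Mapping.keys p" for w using p(2) that by (auto simp: Fr_eq free_alg_carrier)
  have xc: "x \<in> carrier B" using x by (simp add: cocommutative_def)
  let ?K = "{w \<in> Poly_Mapping.keys p. length w = n}"
  define X where "X = (\<lambda>s t. \<Sum>w\<in>?K. Poly_Mapping.lookup p w * (s (map fst w) * t (map snd w)))"
  define pr where "pr = (\<lambda>s t. \<Sum>w\<in>words m n. s w * t w :: 'k)"
  have only_top: "\<phi> x = (\<Sum>w\<in>?K. Poly_Mapping.lookup p w * \<phi> (word w))"
    if "functional \<phi>" "\<And>w. w \<in> WW \<Longrightarrow> length w < n \<Longrightarrow> \<phi> (word w) = 0" for \<phi>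
    unfolding p(1) functional_q[OF that(1) p(2)]
  proof (rule sum.mono_neutral_right)
    show "\<forall>w\<in>Poly_Mapping.keys p - ?K. Poly_Mapping.lookup p w * \<phi> (word w) = 0"
      using that(2) pW p(3) by (auto simp: less_Suc_eq)
  qed auto
  have top_x: "\<phi> x = X s t" if "top_fun n s t \<phi>" for s t \<phi>
    using only_top[of \<phi>] that pW by (simp add: top_fun_def X_def)
  have conv_x: "conv \<phi> \<phi>' x = X s t' * pr s' t" if "top_fun n s t \<phi>" "top_fun n s' t' \<phi>'" for s t s' t' \<phi> \<phi>'
  proof -
    have f: "functional \<phi>" "functional \<phi>'" using that by (simp_all add: top_fun_def)
    have val: "conv \<phi> \<phi>' (word w) = (\<Sum>L\<in>words m (length w). \<phi> (word (zip (map fst w) L)) * \<phi>' (word (zip L (map snd w))))"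
      if "w \<in> WW" for w by (rule conv_wd[OF f that])
    have low: "conv \<phi> \<phi>' (word w) = 0" if w: "w \<in> WW" "length w < n" for w
      unfolding val[OF w(1)]
    proof (intro sum.neutral ballI)
      fix L assume "L \<in> words m (length w)"
      then have "zip (map fst w) L \<in> WW \<and> length (zip (map fst w) L) = length w" using zip_words map_words[OF w(1)] by blast
      then show "\<phi> (word (zip (map fst w) L)) * \<phi>' (word (zip L (map snd w))) = 0"
        using \<open>top_fun n s t \<phi>\<close> w(2) by (simp add: top_fun_def)
    qed
    have top: "conv \<phi> \<phi>' (word w) = s (map fst w) * t' (map snd w) * pr s' t" if w: "w \<in> WW" "length w = n" for w
    proof -
      have "conv \<phi> \<phi>' (word w) = (\<Sum>L\<in>words m n. s (map fst w) * t' (map snd w) * (s' L * t L))"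
        unfolding val[OF w(1)] w(2)
      proof (rule sum.cong[OF refl])
        fix L assume L: "L \<in> words m n"
        then have l: "length L = n" by (simp add: words_def)
        have "zip (map fst w) L \<in> WW" "zip L (map snd w) \<in> WW" using zip_words L map_words[OF w(1)] w(2) by blast+
        then show "\<phi> (word (zip (map fst w) L)) * \<phi>' (word (zip L (map snd w))) = s (map fst w) * t' (map snd w) * (s' L * t L)"
          using that \<open>top_fun n s t \<phi>\<close> \<open>top_fun n s' t' \<phi>'\<close> l w(2) by (simp add: top_fun_def)
      qed
      then show ?thesis by (simp add: pr_def sum_distrib_left)
    qed
    have "conv \<phi> \<phi>' x = (\<Sum>w\<in>?K. Poly_Mapping.lookup p w * conv \<phi> \<phi>' (word w))"
      by (rule only_top[OF conv_lin[OF f]]) (rule low)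
    also have "\<dots> = X s t' * pr s' t"
      unfolding X_def sum_distrib_right
      by (rule sum.cong[OF refl]) (use top pW in \<open>simp add: mult.assoc\<close>)
    finally show ?thesis .
  qed
  obtain s0 t0 where st0: "traceless1 n s0" "traceless2 n t0" "pr s0 t0 \<noteq> 0"
    using pairing unfolding pr_def by blast
  obtain \<phi>0 where \<phi>0: "top_fun n s0 t0 \<phi>0" using top_fun_exists[OF st0(1,2)] by blast
  define \<kappa> where "\<kappa> = X s0 t0 / pr s0 t0"
  have X: "X s t = \<kappa> * pr s t" if st: "traceless1 n s" "traceless2 n t" for s t
  proof -
    obtain \<phi> where \<phi>: "top_fun n s t0 \<phi>" using top_fun_exists[OF st(1) st0(2)] by blast
    obtain \<phi>' where \<phi>': "top_fun n s0 t \<phi>'" using top_fun_exists[OF st0(1) st(2)] by blast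
    have "conv \<phi> \<phi>' x = conv \<phi>' \<phi> x" using x(1) \<phi> \<phi>' by (simp add: cocommutative_def top_fun_def)
    then have "X s t * pr s0 t0 = X s0 t0 * pr s t" unfolding conv_x[OF \<phi> \<phi>'] conv_x[OF \<phi>' \<phi>] .
    then show ?thesis using st0(3) by (simp add: \<kappa>_def field_simps)
  qed
  have "x \<ominus>\<^bsub>B\<^esub> \<kappa> \<odot>\<^bsub>B\<^esub> chi [^]\<^bsub>B\<^esub> n \<in> below n"
  proof (rule ccontr)
    let ?y = "x \<ominus>\<^bsub>B\<^esub> \<kappa> \<odot>\<^bsub>B\<^esub> chi [^]\<^bsub>B\<^esub> n"
    assume y: "?y \<notin> below n"
    have "?y \<in> carrier B" using xc by simp
    from separation[OF this y] obtain \<phi> where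
      sep: "functional \<phi> \<and> (\<forall>w\<in>WW. length w < n \<longrightarrow> \<phi> (word w) = 0) \<and> \<phi> ?y \<noteq> 0" by (elim exE)
    have \<phi>: "functional \<phi>" "\<And>w. w \<in> WW \<Longrightarrow> length w < n \<Longrightarrow> \<phi> (word w) = 0" "\<phi> ?y \<noteq> 0"
      using sep by simp_all
    \<comment> \<open>Every functional that vanishes on shorter words is in length \<open>n\<close> a sum of leading parts \<open>s \<otimes> t\<close>, hence takes equal values at \<open>x\<close> and at \<open>\<kappa> chi^n\<close>.\<close>
    have "\<exists>N s t. (\<forall>r<N. traceless1 n (s r) \<and> traceless2 n (t r)) \<and>
        (\<forall>I\<in>words m n. \<forall>J\<in>words m n. \<phi> (word (zip I J)) = (\<Sum>r<(N::nat). s r I * t r J))"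
    proof (rule rank_decomposition[OF finite_words])
      show "\<And>f g k. traceless1 n f \<Longrightarrow> traceless1 n g \<Longrightarrow> traceless1 n (\<lambda>x. f x - k * g x)" by (rule traceless_linear(1))
      show "\<And>f g k. traceless2 n f \<Longrightarrow> traceless2 n g \<Longrightarrow> traceless2 n (\<lambda>x. f x - k * g x)" by (rule traceless_linear(1))
      show "\<And>f k. traceless2 n f \<Longrightarrow> traceless2 n (\<lambda>x. k * f x)" by (rule traceless_linear(2))
      show "\<And>J. J \<in> words m n \<Longrightarrow> traceless1 n (\<lambda>I. \<phi> (word (zip I J)))"
        by (rule functional_traceless(1)[OF \<phi>(1)]) (use \<phi>(2) in auto)
      show "\<And>I. I \<in> words m n \<Longrightarrow> traceless2 n (\<lambda>J. \<phi> (word (zip I J)))"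
        by (rule functional_traceless(2)[OF \<phi>(1)]) (use \<phi>(2) in auto)
    qed
    then obtain N s t where "(\<forall>r<N. traceless1 n (s r) \<and> traceless2 n (t r)) \<and>
        (\<forall>I\<in>words m n. \<forall>J\<in>words m n. \<phi> (word (zip I J)) = (\<Sum>r<(N::nat). s r I * t r J))" by (elim exE)
    then have st: "\<And>r. r < N \<Longrightarrow> traceless1 n (s r)" "\<And>r. r < N \<Longrightarrow> traceless2 n (t r)"
      "\<And>I J. I \<in> words m n \<Longrightarrow> J \<in> words m n \<Longrightarrow> \<phi> (word (zip I J)) = (\<Sum>r<N. s r I * t r J)" by simp_all
    have "\<phi> x = (\<Sum>w\<in>?K. Poly_Mapping.lookup p w * \<phi> (word w))"
      by (rule only_top[OF \<phi>(1)]) (rule \<phi>(2))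
    also have "\<dots> = (\<Sum>w\<in>?K. Poly_Mapping.lookup p w * (\<Sum>r<N. s r (map fst w) * t r (map snd w)))"
    proof (rule sum.cong[OF refl])
      fix w assume "w \<in> ?K"
      then have w: "w \<in> WW" "length w = n" using pW by auto
      have "\<phi> (word (zip (map fst w) (map snd w))) = (\<Sum>r<N. s r (map fst w) * t r (map snd w))"
        by (rule st(3)) (use map_words[OF w(1)] w(2) in simp_all)
      then show "Poly_Mapping.lookup p w * \<phi> (word w) = Poly_Mapping.lookup p w * (\<Sum>r<N. s r (map fst w) * t r (map snd w))"
        by (simp add: zip_map_fst_snd)
    qed
    also have "\<dots> = (\<Sum>r<N. X (s r) (t r))"
      unfolding X_def sum_distrib_left by (rule sum.swap)
    also have "\<dots> = (\<Sum>r<N. \<kappa> * pr (s r) (t r))" by (intro sum.cong refl X st) auto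
    also have "\<dots> = \<kappa> * (\<Sum>I\<in>words m n. \<Sum>r<N. s r I * t r I)"
      unfolding pr_def sum_distrib_left[symmetric] by (subst sum.swap) (rule refl)
    also have "(\<Sum>I\<in>words m n. \<Sum>r<N. s r I * t r I) = \<phi> (chi [^]\<^bsub>B\<^esub> n)"
      unfolding functional_chi_pow[OF \<phi>(1)] by (intro sum.cong refl) (simp add: st(3))
    finally have "\<phi> x = \<kappa> * \<phi> (chi [^]\<^bsub>B\<^esub> n)" .
    moreover have "\<phi> ?y = \<phi> x \<ominus>\<^bsub>base_alg\<^esub> \<kappa> * \<phi> (chi [^]\<^bsub>B\<^esub> n)"
      using lin_map_minus[OF \<phi>(1) kalg_B kalg_base xc, of "\<kappa> \<odot>\<^bsub>B\<^esub> chi [^]\<^bsub>B\<^esub> n"]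
        lin_mapD(3)[OF \<phi>(1), of "chi [^]\<^bsub>B\<^esub> n" \<kappa>] by simp
    moreover have "z \<ominus>\<^bsub>base_alg\<^esub> z = 0" for z :: 'k
    proof -
      interpret K: kalg "base_alg :: ('k, 'k) module" by (rule kalg_base)
      show ?thesis using K.r_neg[of z] by (simp add: a_minus_def)
    qed
    ultimately show False using \<phi>(3) by simp
  qed
  then show ?thesis by (rule exI)
qed

lemma cocommutative_polynomial:
  assumes "cocommutative x"
  shows "\<exists>P. x = B.evalp P chi"
proof -
  have "\<exists>P. x = B.evalp P chi" if "cocommutative x" "x \<in> below n" for x n
    using that
  proof (induction n arbitrary: x)
    case 0
    then show ?case by (intro exI[of _ 0]) (simp add: below_0)
  next
    case (Suc n)
    obtain \<kappa> where k: "x \<ominus>\<^bsub>B\<^esub> \<kappa> \<odot>\<^bsub>B\<^esub> chi [^]\<^bsub>B\<^esub> n \<in> below n"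
      using cocommutative_step[OF Suc.prems] by blast
    obtain P where P: "x \<ominus>\<^bsub>B\<^esub> \<kappa> \<odot>\<^bsub>B\<^esub> chi [^]\<^bsub>B\<^esub> n = B.evalp P chi"
      using Suc.IH[OF cocommutative_diff[OF Suc.prems(1) chi_pow_cocommutative] k] by blast
    have xc: "x \<in> carrier B" using Suc.prems by (simp add: cocommutative_def)
    have "B.evalp (P + Polynomial.monom \<kappa> n) chi = (x \<ominus>\<^bsub>B\<^esub> \<kappa> \<odot>\<^bsub>B\<^esub> chi [^]\<^bsub>B\<^esub> n) \<oplus>\<^bsub>B\<^esub> \<kappa> \<odot>\<^bsub>B\<^esub> chi [^]\<^bsub>B\<^esub> n"
      using P by (simp add: B.evalp_add B.evalp_monom)
    also have "\<dots> = x" using xc by (simp add: a_minus_def B.a_assoc B.l_neg)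
    finally show ?case by (intro exI[of _ "P + Polynomial.monom \<kappa> n"]) simp
  qed
  then show ?thesis using assms in_below[of x] by (auto simp: cocommutative_def)
qed

end

section \<open>Functionals dual to the generators\<close>

context bil_form begin

lemma conv_cong:
  assumes "functional \<phi>" "functional \<psi>" "functional \<phi>'" "functional \<psi>'"
    and "\<And>x. x \<in> carrier B \<Longrightarrow> \<phi> x = \<phi>' x" "\<And>x. x \<in> carrier B \<Longrightarrow> \<psi> x = \<psi>' x" "x \<in> carrier B"
  shows "conv \<phi> \<psi> x = conv \<phi>' \<psi>' x"
  unfolding conv_def
  by (rule BB.tensor_lin_eq[OF tensor_fun_lin[OF assms(1,2)] tensor_fun_lin[OF assms(3,4)] kalg_base])
    (use assms alg_homD(4)[OF comult_hom(1)] in \<open>simp_all add: tensor_fun_pure\<close>)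

lemma conv_chi:
  assumes "functional \<phi>" "functional \<psi>"
  shows "conv \<phi> \<psi> chi = (\<Sum>i<m. \<Sum>l<m. \<phi> (a $$ (i, l)) * \<psi> (a $$ (l, i)))"
proof -
  have "conv \<phi> \<psi> chi = (\<Sum>i<m. conv \<phi> \<psi> (a $$ (i, i)))"
    unfolding chi_def by (subst lin_map_finsum[OF conv_lin[OF assms] kalg_B kalg_base]) auto
  then show ?thesis by (simp add: conv_a[OF assms])
qed

lemma chi_cocommutative: "cocommutative chi"
  using chi_pow_cocommutative[of 1] by simp

end

context bil_form_big begin

lemma chi_inj: "B.evalp P chi = B.evalp Q chi \<Longrightarrow> P = Q"
proof -
  assume e: "B.evalp P chi = B.evalp Q chi"
  have "B.evalp (P + Polynomial.smult (-1) Q) chi = B.evalp Q chi \<oplus>\<^bsub>B\<^esub> (-1) \<odot>\<^bsub>B\<^esub> B.evalp Q chi"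
    unfolding B.evalp_add[OF chi_closed] B.evalp_smult[OF chi_closed] e ..
  also have "\<dots> = \<zero>\<^bsub>B\<^esub>" by (simp add: B.smult_minus_one B.r_neg del: B.evalp_pCons)
  finally show "P = Q" using chi_independent[of "P + Polynomial.smult (-1) Q"] by simp
qed

lemma unit_functional: "\<exists>\<phi>. functional \<phi> \<and> \<phi> \<one>\<^bsub>B\<^esub> = 1 \<and> (\<forall>k<m. \<forall>l<m. \<phi> (a $$ (k, l)) = 0)"
proof -
  have "traceless1 0 (\<lambda>_. 1)" "traceless2 0 (\<lambda>_. 1)" by (simp_all add: form.traceless_def)
  note ex = top_fun_exists[OF this]
  obtain \<phi> where \<phi>: "top_fun 0 (\<lambda>_. 1) (\<lambda>_. 1) \<phi>" using ex by (elim exE)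
  have h: "(length w = 1 \<longrightarrow> \<phi> (word w) = 0) \<and> (w = [] \<longrightarrow> \<phi> (word w) = 1)" if "w \<in> WW" for w
    using \<phi> that by (auto simp: top_fun_def)
  have w: "\<phi> (word []) = 1" "\<And>k l. k < m \<Longrightarrow> l < m \<Longrightarrow> \<phi> (word [(k, l)]) = 0"
    using h[of "[]"] h[of "[(k, l)]" for k l] by auto
  show ?thesis
    by (rule exI[of _ \<phi>]) (use \<phi> w in \<open>simp add: top_fun_def word_Nil word_single\<close>)
qed

lemma dual_functional:
  assumes "i < m" "j < m"
  shows "\<exists>\<phi>. functional \<phi> \<and> \<phi> \<one>\<^bsub>B\<^esub> = 0 \<and> (\<forall>k<m. \<forall>l<m. \<phi> (a $$ (k, l)) = (if k = i \<and> l = j then 1 else 0))"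
proof -
  let ?f = "\<lambda>w. if w = [i] then 1 else 0 :: 'k" and ?g = "\<lambda>w. if w = [j] then 1 else 0 :: 'k"
  have "traceless1 1 ?f" "traceless2 1 ?g" by (simp_all add: form.traceless_def)
  note ex = top_fun_exists[OF this]
  obtain \<phi> where \<phi>: "top_fun 1 ?f ?g \<phi>" using ex by (elim exE)
  have h: "(w = [] \<longrightarrow> \<phi> (word w) = 0) \<and> (length w = 1 \<longrightarrow> \<phi> (word w) = ?f (map fst w) * ?g (map snd w))"
    if "w \<in> WW" for w
    using \<phi> that by (auto simp: top_fun_def)
  have w: "\<phi> (word []) = 0" "\<And>k l. k < m \<Longrightarrow> l < m \<Longrightarrow> \<phi> (word [(k, l)]) = (if k = i \<and> l = j then 1 else 0)"
    using h[of "[]"] h[of "[(k, l)]" for k l] by auto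
  show ?thesis
    by (rule exI[of _ \<phi>]) (use \<phi> w in \<open>simp add: top_fun_def word_Nil word_single\<close>)
qed

definition unit_fun where "unit_fun = (SOME \<phi>. functional \<phi> \<and> \<phi> \<one>\<^bsub>B\<^esub> = 1 \<and> (\<forall>k<m. \<forall>l<m. \<phi> (a $$ (k, l)) = 0))"

definition dual_fun where "dual_fun i j = (SOME \<phi>. functional \<phi> \<and> \<phi> \<one>\<^bsub>B\<^esub> = 0 \<and>
  (\<forall>k<m. \<forall>l<m. \<phi> (a $$ (k, l)) = (if k = i \<and> l = j then 1 else 0)))"

lemma unit_fun: "functional unit_fun" "unit_fun \<one>\<^bsub>B\<^esub> = 1" "k < m \<Longrightarrow> l < m \<Longrightarrow> unit_fun (a $$ (k, l)) = 0"
  using someI_ex[OF unit_functional] unfolding unit_fun_def by blast+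

lemma dual_fun:
  assumes "i < m" "j < m"
  shows "functional (dual_fun i j)" "dual_fun i j \<one>\<^bsub>B\<^esub> = 0"
    "k < m \<Longrightarrow> l < m \<Longrightarrow> dual_fun i j (a $$ (k, l)) = (if k = i \<and> l = j then 1 else 0)"
  using someI_ex[OF dual_functional[OF assms]] unfolding dual_fun_def by blast+

end

section \<open>Forms of size one\<close>

text \<open>The single generator has square 1, so every element has the form \<open>\<alpha> + \<beta> a\<close> and satisfies
\<open>(y - \<alpha>)^2 = \<beta>^2\<close>.\<close>
lemma (in bil_form) quadratic_of_size_one:
  assumes m1: "m = 1" and y: "y \<in> carrier B"
  shows "\<exists>R. R \<noteq> 0 \<and> B.evalp R y = \<zero>\<^bsub>B\<^esub>"
proof -
  let ?a = "a $$ (0, 0)"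
  define lc where "lc = (\<lambda>\<alpha> \<beta>. \<alpha> \<odot>\<^bsub>B\<^esub> \<one>\<^bsub>B\<^esub> \<oplus>\<^bsub>B\<^esub> \<beta> \<odot>\<^bsub>B\<^esub> ?a)"
  have ac: "?a \<in> carrier B" using m1 by simp
  have lc: "lc \<alpha> \<beta> \<in> carrier B" for \<alpha> \<beta> unfolding lc_def using ac by simp
  have e0: "E $$ (0, 0) \<noteq> 0"
  proof
    assume "E $$ (0, 0) = 0"
    then have "(E * minv E) $$ (0, 0) = 0" using E minv(1)[OF E invE] m1 by (simp add: scalar_prod_def)
    then show False using minv(2)[OF E invE] m1 by simp
  qed
  have aa: "?a \<otimes>\<^bsub>B\<^esub> ?a = \<one>\<^bsub>B\<^esub>"
  proof (rule eq_by_functionals)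
    fix \<phi> assume \<phi>: "functional \<phi>"
    have z: "(0::nat) < m" using m1 by simp
    have "\<phi> (scalar_mat B E $$ (0, 0)) = E $$ (0, 0) * \<phi> (?a \<otimes>\<^bsub>B\<^esub> ?a)"
      using B.quadratic_entry[OF a_amat E \<phi> z z] unfolding a_quadratic(1) by (simp add: m1)
    moreover have "\<phi> (scalar_mat B E $$ (0, 0)) = E $$ (0, 0) * \<phi> \<one>\<^bsub>B\<^esub>"
      using B.scalar_index[OF E z z] lin_mapD(3)[OF \<phi>, of "\<one>\<^bsub>B\<^esub>"] by simp
    ultimately show "\<phi> (?a \<otimes>\<^bsub>B\<^esub> ?a) = \<phi> \<one>\<^bsub>B\<^esub>" using e0 by simp
  qed (use ac in auto)
  have add: "lc \<alpha> \<beta> \<oplus>\<^bsub>B\<^esub> lc \<gamma> \<delta> = lc (\<alpha> + \<gamma>) (\<beta> + \<delta>)" for \<alpha> \<beta> \<gamma> \<delta>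
    unfolding lc_def using ac by (simp add: B.smult_l_distr B.a_ac)
  have sm: "c \<odot>\<^bsub>B\<^esub> lc \<alpha> \<beta> = lc (c * \<alpha>) (c * \<beta>)" for c \<alpha> \<beta>
    unfolding lc_def using ac by (simp add: B.smult_r_distr B.smult_assoc)
  have mul: "lc \<alpha> \<beta> \<otimes>\<^bsub>B\<^esub> lc \<gamma> \<delta> = lc (\<alpha> * \<gamma> + \<beta> * \<delta>) (\<alpha> * \<delta> + \<beta> * \<gamma>)" for \<alpha> \<beta> \<gamma> \<delta>
    unfolding lc_def using ac aa
    by (simp add: B.l_distr B.r_distr B.smult_mult_l B.smult_mult_r B.smult_l_distr B.smult_r_distr B.smult_assoc[symmetric] B.a_ac mult.commute)
  have one: "\<one>\<^bsub>B\<^esub> = lc 1 0" unfolding lc_def using ac by simp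
  have al: "?a = lc 0 1" unfolding lc_def using ac by simp
  have zero: "\<zero>\<^bsub>B\<^esub> = lc 0 0" unfolding lc_def using ac by simp
  have w: "\<exists>\<alpha> \<beta>. word w = lc \<alpha> \<beta>" if "w \<in> WW" for w
    using that
  proof (induction w)
    case Nil
    have "word [] = lc 1 0" unfolding word_Nil by (rule one)
    then show ?case by (intro exI)
  next
    case (Cons x w)
    have xw: "x = (0, 0)" "w \<in> WW" using Cons.hyps m1 by (cases x, auto)+
    have "\<exists>\<alpha> \<beta>. word w = lc \<alpha> \<beta>" by (rule Cons.IH)
    then obtain \<alpha> \<beta> where "word w = lc \<alpha> \<beta>" by (elim exE)
    with xw have "word (x # w) = lc 0 1 \<otimes>\<^bsub>B\<^esub> lc \<alpha> \<beta>" using word_Cons[of 0 0 w] m1 al by simp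
    then have "word (x # w) = lc \<beta> \<alpha>" unfolding mul by simp
    then show ?case by (intro exI)
  qed
  obtain p where p: "y = q p" "p \<in> carrier Fr" using y B_carrier by auto
  have "\<exists>\<alpha> \<beta>. q p = lc \<alpha> \<beta>"
  proof -
    have "Poly_Mapping.keys p \<subseteq> WW" using p(2) by (simp add: Fr_eq free_alg_carrier)
    then show ?thesis
    proof (induction p rule: pm_induct)
      case zero
      have "q 0 = \<zero>\<^bsub>B\<^esub>" using ideal_zero additive_subgroup.zero_closed[OF ideal.axioms(1)[OF ideal_B]]
        by (simp add: Fr_eq free_alg_simps)
      then have "q 0 = lc 0 0" using \<open>\<zero>\<^bsub>B\<^esub> = lc 0 0\<close> by (rule trans)
      then show ?case by (intro exI)
    next
      case (single w c)
      obtain \<alpha> \<beta> where "word w = lc \<alpha> \<beta>" using w[OF single] by (elim exE)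
      moreover have "q (Poly_Mapping.single w c) = c \<odot>\<^bsub>B\<^esub> word w"
      proof -
        have "Poly_Mapping.single w c = c \<odot>\<^bsub>Fr\<^esub> Poly_Mapping.single w 1" by (simp add: Fr_eq free_alg_simps)
        then show ?thesis using lin_mapD(3)[OF alg_homD(1)[OF q_hom] single_carrier[OF single]] by simp
      qed
      ultimately have "q (Poly_Mapping.single w c) = lc (c * \<alpha>) (c * \<beta>)" using sm by simp
      then show ?case by (intro exI)
    next
      case (add p p')
      obtain \<alpha> \<beta> where h1: "q p = lc \<alpha> \<beta>" using add.IH(1) by (elim exE)
      obtain \<gamma> \<delta> where h2: "q p' = lc \<gamma> \<delta>" using add.IH(2) by (elim exE)
      have pc: "p \<in> carrier Fr" "p' \<in> carrier Fr" using add by (simp_all add: Fr_eq free_alg_carrier)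
      have "p + p' = p \<oplus>\<^bsub>Fr\<^esub> p'" by (simp add: Fr_eq free_alg_simps)
      then have "q (p + p') = q p \<oplus>\<^bsub>B\<^esub> q p'" using lin_mapD(2)[OF alg_homD(1)[OF q_hom] pc] by simp
      then have "q (p + p') = lc (\<alpha> + \<gamma>) (\<beta> + \<delta>)"
        unfolding h1 h2 \<open>\<And>\<alpha> \<beta> \<gamma> \<delta>. lc \<alpha> \<beta> \<oplus>\<^bsub>B\<^esub> lc \<gamma> \<delta> = lc (\<alpha> + \<gamma>) (\<beta> + \<delta>)\<close> .
      then show ?case by (intro exI)
    qed
  qed
  then obtain \<alpha> \<beta> where y': "y = lc \<alpha> \<beta>" unfolding p(1)[symmetric] by (elim exE)
  let ?R = "[:\<alpha> * \<alpha> - \<beta> * \<beta>, - (\<alpha> + \<alpha>), 1:]"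
  have "B.evalp ?R y = (\<alpha> * \<alpha> - \<beta> * \<beta>) \<odot>\<^bsub>B\<^esub> lc 1 0 \<oplus>\<^bsub>B\<^esub> y \<otimes>\<^bsub>B\<^esub> ((- (\<alpha> + \<alpha>)) \<odot>\<^bsub>B\<^esub> lc 1 0 \<oplus>\<^bsub>B\<^esub> y \<otimes>\<^bsub>B\<^esub> (1 \<odot>\<^bsub>B\<^esub> lc 1 0 \<oplus>\<^bsub>B\<^esub> y \<otimes>\<^bsub>B\<^esub> lc 0 0))"
    unfolding one[symmetric] zero[symmetric] using y by simp
  also have "\<dots> = lc 0 0" unfolding y' mul add sm by (simp add: algebra_simps)
  finally show ?thesis unfolding zero[symmetric] by (intro exI[of _ ?R]) simp
qed

section \<open>Isomorphisms preserving convolution\<close>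

text \<open>An isomorphism of coalgebras and algebras, with compatibility of the comultiplications expressed by
the convolution of functionals.\<close>
locale bil_coiso = E: bil_form E m + F: bil_form F n for E F :: "'k::field mat" and m n :: nat +
  fixes f g
  assumes f: "alg_hom E.B F.B f" and g: "alg_hom F.B E.B g"
    and gf: "x \<in> carrier E.B \<Longrightarrow> g (f x) = x" and fg: "y \<in> carrier F.B \<Longrightarrow> f (g y) = y"
    and conv_f: "F.functional \<phi> \<Longrightarrow> F.functional \<psi> \<Longrightarrow> x \<in> carrier E.B \<Longrightarrow>
      F.conv \<phi> \<psi> (f x) = E.conv (\<lambda>x. \<phi> (f x)) (\<lambda>x. \<psi> (f x)) x"
begin

lemma f_closed [simp]: "x \<in> carrier E.B \<Longrightarrow> f x \<in> carrier F.B" using alg_homD(4)[OF f] .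
lemma g_closed [simp]: "y \<in> carrier F.B \<Longrightarrow> g y \<in> carrier E.B" using alg_homD(4)[OF g] .

lemma functional_f: "F.functional \<phi> \<Longrightarrow> E.functional (\<lambda>x. \<phi> (f x))"
  by (rule lin_map_comp[OF alg_homD(1)[OF f]])

lemma functional_g: "E.functional \<phi> \<Longrightarrow> F.functional (\<lambda>x. \<phi> (g x))"
  by (rule lin_map_comp[OF alg_homD(1)[OF g]])

lemma sym: "bil_coiso F E n m g f"
proof unfold_locales
  fix \<phi> \<psi> y assume h: "E.functional \<phi>" "E.functional \<psi>" "y \<in> carrier F.B"
  have "F.conv (\<lambda>x. \<phi> (g x)) (\<lambda>x. \<psi> (g x)) (f (g y)) = E.conv (\<lambda>x. \<phi> (g (f x))) (\<lambda>x. \<psi> (g (f x))) (g y)"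
    by (rule conv_f[OF functional_g[OF h(1)] functional_g[OF h(2)]]) (use h in simp)
  also have "\<dots> = E.conv \<phi> \<psi> (g y)"
    by (rule E.conv_cong) (use h functional_f functional_g gf in \<open>auto\<close>)
  finally show "E.conv \<phi> \<psi> (g y) = F.conv (\<lambda>x. \<phi> (g x)) (\<lambda>x. \<psi> (g x)) y" using fg h(3) by simp
qed (use f g gf fg in auto)

lemma cocommutative_f: "E.cocommutative x \<Longrightarrow> F.cocommutative (f x)"
  unfolding E.cocommutative_def F.cocommutative_def using conv_f functional_f by simp

end

text \<open>If \<open>m < n\<close>, pad both matrices with zeros to square ones; the padded product in the other order has a
zero in the last diagonal place.\<close>
lemma right_inverse_dim:
  fixes A :: "'k::field mat"
  assumes A: "A \<in> carrier_mat n m" and B: "B \<in> carrier_mat m n" and AB: "A * B = 1\<^sub>m n"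
  shows "n \<le> m"
proof (rule ccontr)
  assume "\<not> n \<le> m"
  then have mn: "m < n" by simp
  define A' where "A' = mat n n (\<lambda>(i, j). if j < m then A $$ (i, j) else 0)"
  define B' where "B' = mat n n (\<lambda>(i, j). if i < m then B $$ (i, j) else 0)"
  have c: "A' \<in> carrier_mat n n" "B' \<in> carrier_mat n n" by (simp_all add: A'_def B'_def)
  have "A' * B' = 1\<^sub>m n"
  proof (rule eq_matI)
    fix i j assume ij: "i < dim_row (1\<^sub>m n :: 'k mat)" "j < dim_col (1\<^sub>m n :: 'k mat)"
    have "(A' * B') $$ (i, j) = (\<Sum>k<n. (if k < m then A $$ (i, k) else 0) * (if k < m then B $$ (k, j) else 0))"
      using ij by (simp add: A'_def B'_def scalar_prod_def atLeast0LessThan)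
    also have "\<dots> = (\<Sum>k<m. A $$ (i, k) * B $$ (k, j))"
      by (rule sum.mono_neutral_cong_right) (use mn in auto)
    also have "\<dots> = (A * B) $$ (i, j)" using A B ij by (simp add: scalar_prod_def atLeast0LessThan)
    finally show "(A' * B') $$ (i, j) = 1\<^sub>m n $$ (i, j)" unfolding AB .
  qed (use c in auto)
  then have "B' * A' = 1\<^sub>m n" by (rule mat_mult_left_right_inverse[OF c])
  then have "(B' * A') $$ (n - 1, n - 1) = 1" using mn by simp
  moreover have "(B' * A') $$ (n - 1, n - 1) = 0" using mn by (auto simp: A'_def B'_def scalar_prod_def intro!: sum.neutral)
  ultimately show False by simp
qed

locale bil_coiso_big = bil_coiso E F m n f g + E: bil_form_big E m + F: bil_form_big F n
  for E F :: "'k::{alg_closed_field, field_char_0} mat" and m n f g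
begin

lemma sym_big: "bil_coiso_big F E n m g f"
  by (intro bil_coiso_big.intro sym E.bil_form_big_axioms F.bil_form_big_axioms)

text \<open>Degrees multiply under composition of polynomials, and the composition here is the identity.\<close>
lemma f_chi: "\<exists>\<alpha> \<beta>. f E.chi = \<beta> \<odot>\<^bsub>F.B\<^esub> \<one>\<^bsub>F.B\<^esub> \<oplus>\<^bsub>F.B\<^esub> \<alpha> \<odot>\<^bsub>F.B\<^esub> F.chi"
proof -
  interpret S: bil_coiso F E n m g f by (rule sym)
  obtain P where P: "f E.chi = F.B.evalp P F.chi"
    using F.cocommutative_polynomial[OF cocommutative_f[OF E.chi_cocommutative]] by blast
  obtain Q where Q: "g F.chi = E.B.evalp Q E.chi"
    using E.cocommutative_polynomial[OF S.cocommutative_f[OF F.chi_cocommutative]] by blast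
  have "F.B.evalp (pcompose Q P) F.chi = F.B.evalp Q (f E.chi)"
    unfolding F.B.evalp_pcompose[OF F.chi_closed] P ..
  also have "\<dots> = f (g F.chi)" unfolding Q by (rule alg_hom_evalp[OF f E.kalg_B F.kalg_B E.chi_closed, symmetric])
  also have "\<dots> = F.B.evalp [:0, 1:] F.chi" using fg by simp
  finally have "pcompose Q P = [:0, 1:]" by (rule F.chi_inj)
  then have "Polynomial.degree Q * Polynomial.degree P = 1"
    using degree_pcompose[of Q P] by simp
  then have d: "Polynomial.degree P = 1" by simp
  have "P = [:poly.coeff P 0, poly.coeff P 1:]"
  proof (rule poly_eqI)
    fix k
    show "poly.coeff P k = poly.coeff [:poly.coeff P 0, poly.coeff P 1:] k"
    proof (cases "k \<le> 1")
      case True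
      then have "k = 0 \<or> k = 1" by auto
      then show ?thesis by auto
    next
      case False
      then show ?thesis using d by (simp add: coeff_eq_0)
    qed
  qed
  then obtain \<beta> \<alpha> where "P = [:\<beta>, \<alpha>:]" by blast
  then have "f E.chi = \<beta> \<odot>\<^bsub>F.B\<^esub> \<one>\<^bsub>F.B\<^esub> \<oplus>\<^bsub>F.B\<^esub> \<alpha> \<odot>\<^bsub>F.B\<^esub> F.chi"
    unfolding P by (simp add: F.B.smult_mult_r)
  then show ?thesis by blast
qed

text \<open>The coefficients in \<open>f(a_ij) = const_coeff i j + \<Sum> gen_coeff k l i j b_kl\<close>.\<close>
definition const_coeff where "const_coeff i j = F.unit_fun (f (E.a $$ (i, j)))"
definition gen_coeff where "gen_coeff k l i j = F.dual_fun k l (f (E.a $$ (i, j)))"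

text \<open>Convolving with a functional dual to \<open>a_ji\<close> isolates \<open>f(a_ij)\<close> in the comultiplication of
\<open>f(chi)\<close>. Since \<open>f(chi)\<close> is linear in the character of \<open>F\<close>, the result is a combination of 1 and
the \<open>b_kl\<close>.\<close>
lemma functional_f_a:
  assumes \<phi>: "F.functional \<phi>" and ij: "i < m" "j < m"
  shows "\<phi> (f (E.a $$ (i, j))) = const_coeff i j * \<phi> \<one>\<^bsub>F.B\<^esub> + (\<Sum>k<n. \<Sum>l<n. gen_coeff k l i j * \<phi> (F.a $$ (k, l)))"
proof -
  obtain \<alpha> \<beta> where fchi: "f E.chi = \<beta> \<odot>\<^bsub>F.B\<^esub> \<one>\<^bsub>F.B\<^esub> \<oplus>\<^bsub>F.B\<^esub> \<alpha> \<odot>\<^bsub>F.B\<^esub> F.chi" using f_chi by blast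
  define \<psi> where "\<psi> = (\<lambda>x. E.dual_fun j i (g x))"
  have \<psi>: "F.functional \<psi>" unfolding \<psi>_def by (rule functional_g[OF E.dual_fun(1)[OF ij(2,1)]])
  have gen: "\<phi> (f (E.a $$ (i, j))) = \<beta> * \<psi> \<one>\<^bsub>F.B\<^esub> * \<phi> \<one>\<^bsub>F.B\<^esub> + (\<Sum>k<n. \<Sum>l<n. \<alpha> * \<psi> (F.a $$ (l, k)) * \<phi> (F.a $$ (k, l)))"
    if \<phi>: "F.functional \<phi>" for \<phi>
  proof -
    have "F.conv \<phi> \<psi> (f E.chi) = (\<Sum>i'<m. \<Sum>l<m. \<phi> (f (E.a $$ (i', l))) * \<psi> (f (E.a $$ (l, i'))))"
      unfolding conv_f[OF \<phi> \<psi> E.chi_closed] by (rule E.conv_chi[OF functional_f[OF \<phi>] functional_f[OF \<psi>]])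
    also have "\<dots> = (\<Sum>i'<m. \<Sum>l<m. if l = j then (if i' = i then \<phi> (f (E.a $$ (i, j))) else 0) else 0)"
      by (intro sum.cong refl) (use ij in \<open>auto simp: \<psi>_def gf E.dual_fun(3)\<close>)
    also have "\<dots> = \<phi> (f (E.a $$ (i, j)))" using ij by simp
    finally have "\<phi> (f (E.a $$ (i, j))) = F.conv \<phi> \<psi> (f E.chi)" by simp
    also have "\<dots> = \<beta> * (\<phi> \<one>\<^bsub>F.B\<^esub> * \<psi> \<one>\<^bsub>F.B\<^esub>) + \<alpha> * (\<Sum>k<n. \<Sum>l<n. \<phi> (F.a $$ (k, l)) * \<psi> (F.a $$ (l, k)))"
      unfolding fchi using lin_mapD[OF F.conv_lin[OF \<phi> \<psi>]] F.conv_one[OF \<phi> \<psi>] F.conv_chi[OF \<phi> \<psi>] by simp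
    finally show ?thesis by (simp add: sum_distrib_left mult_ac)
  qed
  have b: "const_coeff i j = \<beta> * \<psi> \<one>\<^bsub>F.B\<^esub>"
    unfolding const_coeff_def gen[OF F.unit_fun(1)] using F.unit_fun(2,3) by simp
  have G: "gen_coeff k l i j = \<alpha> * \<psi> (F.a $$ (l, k))" if kl: "k < n" "l < n" for k l
  proof -
    have "gen_coeff k l i j = (\<Sum>k'<n. \<Sum>l'<n. if l' = l then (if k' = k then \<alpha> * \<psi> (F.a $$ (l, k)) else 0) else 0)"
      unfolding gen_coeff_def gen[OF F.dual_fun(1)[OF kl]] F.dual_fun(2)[OF kl]
      by (simp only: mult_zero_right add_0_left, intro sum.cong refl) (use F.dual_fun(3)[OF kl] in auto)
    then show ?thesis using kl by simp
  qed
  show ?thesis unfolding gen[OF \<phi>] b by (simp add: G)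
qed

text \<open>The comultiplication of \<open>f(a_ij)\<close>, computed once before and once after the expansion into 1 and
the \<open>b_kl\<close>.\<close>
lemma conv_f_a:
  assumes "F.functional \<phi>" "F.functional \<psi>" "i < m" "j < m"
  shows "(\<Sum>r<m. \<phi> (f (E.a $$ (i, r))) * \<psi> (f (E.a $$ (r, j)))) = const_coeff i j * (\<phi> \<one>\<^bsub>F.B\<^esub> * \<psi> \<one>\<^bsub>F.B\<^esub>) +
    (\<Sum>k<n. \<Sum>l<n. gen_coeff k l i j * (\<Sum>p<n. \<phi> (F.a $$ (k, p)) * \<psi> (F.a $$ (p, l))))"
proof -
  have "(\<Sum>r<m. \<phi> (f (E.a $$ (i, r))) * \<psi> (f (E.a $$ (r, j)))) = F.conv \<phi> \<psi> (f (E.a $$ (i, j)))"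
    using conv_f[OF assms(1,2)] E.conv_a[OF functional_f[OF assms(1)] functional_f[OF assms(2)] assms(3,4)] assms(3,4)
    by simp
  then show ?thesis
    unfolding functional_f_a[OF F.conv_lin[OF assms(1,2)] assms(3,4)] F.conv_one[OF assms(1,2)]
    using F.conv_a[OF assms(1,2)] by simp
qed

text \<open>Compare the coefficients of \<open>b_kp \<otimes> b_p'l\<close>: for fixed \<open>k\<close> and \<open>l\<close> let \<open>G_kl\<close> be the matrix with
entries \<open>gen_coeff k l i j\<close>; then \<open>G_kp G_p'l = \<delta>_pp' G_kl\<close>.\<close>
lemma gen_coeff_mult:
  assumes "k < n" "p < n" "p' < n" "l < n" "i < m" "j < m"
  shows "(\<Sum>r<m. gen_coeff k p i r * gen_coeff p' l r j) = (if p = p' then gen_coeff k l i j else 0)"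
proof -
  have inner: "(\<Sum>x<n. F.dual_fun k p (F.a $$ (k', x)) * F.dual_fun p' l (F.a $$ (x, l'))) =
      (if l' = l then (if k' = k then (if p = p' then 1 else 0) else 0) else 0)" if "k' < n" "l' < n" for k' l'
  proof -
    have "(\<Sum>x<n. F.dual_fun k p (F.a $$ (k', x)) * F.dual_fun p' l (F.a $$ (x, l'))) =
       (\<Sum>x<n. if x = p then (if l' = l then (if k' = k then (if p = p' then 1 else 0) else 0) else 0) else 0)"
      by (intro sum.cong refl) (use assms that F.dual_fun(3) in auto)
    then show ?thesis using assms by simp
  qed
  have "(\<Sum>r<m. gen_coeff k p i r * gen_coeff p' l r j) =
     (\<Sum>k'<n. \<Sum>l'<n. gen_coeff k' l' i j * (\<Sum>x<n. F.dual_fun k p (F.a $$ (k', x)) * F.dual_fun p' l (F.a $$ (x, l'))))"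
    unfolding gen_coeff_def[of k p] gen_coeff_def[of p' l]
    using conv_f_a[OF F.dual_fun(1)[OF assms(1,2)] F.dual_fun(1)[OF assms(3,4)] assms(5,6)] F.dual_fun(2) assms by simp
  also have "\<dots> = (\<Sum>k'<n. \<Sum>l'<n. if l' = l then (if k' = k then (if p = p' then gen_coeff k l i j else 0) else 0) else 0)"
    by (intro sum.cong refl) (auto simp: inner)
  also have "\<dots> = (if p = p' then gen_coeff k l i j else 0)" using assms by simp
  finally show ?thesis .
qed

text \<open>Compare the coefficients of \<open>1 \<otimes> b_kl\<close>.\<close>
lemma const_coeff_mult:
  assumes "k < n" "l < n" "i < m" "j < m"
  shows "(\<Sum>r<m. const_coeff i r * gen_coeff k l r j) = 0"
proof -
  have "(\<Sum>r<m. const_coeff i r * gen_coeff k l r j) = (\<Sum>k'<n. \<Sum>l'<n. gen_coeff k' l' i j * (\<Sum>p<n. F.unit_fun (F.a $$ (k', p)) * F.dual_fun k l (F.a $$ (p, l'))))"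
    unfolding const_coeff_def gen_coeff_def[of k l]
    using conv_f_a[OF F.unit_fun(1) F.dual_fun(1)[OF assms(1,2)] assms(3,4)] F.dual_fun(2)[OF assms(1,2)] by simp
  also have "\<dots> = 0" by (intro sum.neutral ballI) (simp add: F.unit_fun(3))
  finally show ?thesis .
qed

text \<open>Otherwise all \<open>G_kl = G_k0 G_00 G_0l\<close> vanish and \<open>f\<close> maps every generator to a scalar, against
injectivity.\<close>
lemma gen_coeff_nonzero: "\<exists>i<m. \<exists>r<m. gen_coeff 0 0 i r \<noteq> 0"
proof (rule ccontr)
  assume "\<not> ?thesis"
  then have 0: "gen_coeff 0 0 i r = 0" if "i < m" "r < m" for i r using that by blast
  have n0: "0 < n" and m0: "0 < m" using E.m2 F.m2 by simp_all
  have 1: "gen_coeff k 0 i r = 0" if "k < n" "i < m" "r < m" for k i r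
    using gen_coeff_mult[OF that(1) n0 n0 n0 that(2,3)] 0 that by simp
  have 2: "gen_coeff k l i j = 0" if "k < n" "l < n" "i < m" "j < m" for k l i j
    using gen_coeff_mult[OF that(1) n0 n0 that(2-4)] 1 that by simp
  have h: "F.functional (\<lambda>x. E.dual_fun 0 0 (g x))" by (rule functional_g[OF E.dual_fun(1)[OF m0 m0]])
  have "E.dual_fun 0 0 (g (f (E.a $$ (0, 0)))) = const_coeff 0 0 * E.dual_fun 0 0 (g \<one>\<^bsub>F.B\<^esub>)"
    using functional_f_a[OF h m0 m0] 2 m0 by simp
  then show False using E.dual_fun(2,3)[OF m0 m0] m0 gf alg_homD(2)[OF g] by simp
qed

text \<open>The columns of \<open>P\<close> are \<open>G_k0 v\<close> for a basis vector \<open>v\<close> with \<open>G_00 v \<noteq> 0\<close>. The relations of matrix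
units give \<open>f(a) P = P b\<close>, and one fixed row of each
\<open>G_0k\<close>, scaled, gives a left inverse of \<open>P\<close>.\<close>
lemma intertwiner:
  shows "\<exists>P L. P \<in> carrier_mat m n \<and> L \<in> carrier_mat n m \<and> L * P = 1\<^sub>m n \<and>
    amat_mult F.B (map_mat f E.a) (scalar_mat F.B P) = amat_mult F.B (scalar_mat F.B P) F.a"
proof -
  obtain i0 r0 where ir: "i0 < m" "r0 < m" "gen_coeff 0 0 i0 r0 \<noteq> 0" using gen_coeff_nonzero by blast
  have n0: "0 < n" using F.m2 by simp
  define P where "P = mat m n (\<lambda>(i, k). gen_coeff k 0 i r0)"
  define L where "L = mat n m (\<lambda>(k, i). gen_coeff 0 k i0 i / gen_coeff 0 0 i0 r0)"
  have P: "P \<in> carrier_mat m n" and L: "L \<in> carrier_mat n m" by (simp_all add: P_def L_def)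
  have LP: "L * P = 1\<^sub>m n"
  proof (rule eq_matI)
    fix k j assume "k < dim_row (1\<^sub>m n :: 'k mat)" "j < dim_col (1\<^sub>m n :: 'k mat)"
    then have kj: "k < n" "j < n" by simp_all
    have "(L * P) $$ (k, j) = (\<Sum>i<m. gen_coeff 0 k i0 i * gen_coeff j 0 i r0) / gen_coeff 0 0 i0 r0"
      using kj by (simp add: P_def L_def scalar_prod_def atLeast0LessThan sum_divide_distrib)
    then show "(L * P) $$ (k, j) = 1\<^sub>m n $$ (k, j)"
      using gen_coeff_mult[OF n0 kj n0 ir(1,2)] ir(3) kj by simp
  qed (use P L in auto)
  let ?u = "map_mat f E.a"
  have u: "amat F.B m m ?u" by (rule alg_hom_amat[OF f E.a_amat])
  have uP: "amat_mult F.B ?u (scalar_mat F.B P) = amat_mult F.B (scalar_mat F.B P) F.a"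
  proof (rule amat_eqI[of F.B m n])
    show 1: "amat F.B m n (amat_mult F.B ?u (scalar_mat F.B P))"
      by (rule F.B.amat_mult_amat[OF u F.B.scalar_amat[OF P]])
    show 2: "amat F.B m n (amat_mult F.B (scalar_mat F.B P) F.a)"
      by (rule F.B.amat_mult_amat[OF F.B.scalar_amat[OF P] F.a_amat])
    fix i j assume ij: "i < m" "j < n"
    show "amat_mult F.B ?u (scalar_mat F.B P) $$ (i, j) = amat_mult F.B (scalar_mat F.B P) F.a $$ (i, j)"
    proof (rule F.eq_by_functionals[OF amatD(3)[OF 1 ij] amatD(3)[OF 2 ij]])
      fix \<phi> assume \<phi>: "F.functional \<phi>"
      have uc: "?u $$ (i, r) = f (E.a $$ (i, r))" if "r < m" for r using that ij amatD[OF E.a_amat] by simp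
      have "\<phi> (amat_mult F.B ?u (scalar_mat F.B P) $$ (i, j)) = (\<Sum>r<m. P $$ (r, j) * \<phi> (f (E.a $$ (i, r))))"
        unfolding F.B.scalar_mult_index_r[OF P u ij]
        by (subst lin_map_finsum[OF \<phi> F.kalg_B kalg_base])
          (use ij uc amatD(3)[OF u] in \<open>auto simp: lin_mapD(3)[OF \<phi>] intro!: sum.cong\<close>)
      also have "\<dots> = (\<Sum>r<m. const_coeff i r * gen_coeff j 0 r r0 * \<phi> \<one>\<^bsub>F.B\<^esub> + (\<Sum>k<n. \<Sum>l<n. gen_coeff k l i r * gen_coeff j 0 r r0 * \<phi> (F.a $$ (k, l))))"
        by (intro sum.cong refl) (use ij in \<open>simp add: functional_f_a[OF \<phi>] P_def distrib_left sum_distrib_left mult_ac\<close>)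
      also have "\<dots> = (\<Sum>r<m. const_coeff i r * gen_coeff j 0 r r0) * \<phi> \<one>\<^bsub>F.B\<^esub> + (\<Sum>k<n. \<Sum>l<n. (\<Sum>r<m. gen_coeff k l i r * gen_coeff j 0 r r0) * \<phi> (F.a $$ (k, l)))"
      proof -
        have "(\<Sum>r<m. \<Sum>k<n. \<Sum>l<n. gen_coeff k l i r * gen_coeff j 0 r r0 * \<phi> (F.a $$ (k, l))) =
          (\<Sum>k<n. \<Sum>r<m. \<Sum>l<n. gen_coeff k l i r * gen_coeff j 0 r r0 * \<phi> (F.a $$ (k, l)))" by (rule sum.swap)
        also have "\<dots> = (\<Sum>k<n. \<Sum>l<n. \<Sum>r<m. gen_coeff k l i r * gen_coeff j 0 r r0 * \<phi> (F.a $$ (k, l)))"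
          by (intro sum.cong refl sum.swap)
        finally show ?thesis by (simp add: sum.distrib sum_distrib_right)
      qed
      also have "\<dots> = (\<Sum>k<n. \<Sum>l<n. if l = j then gen_coeff k 0 i r0 * \<phi> (F.a $$ (k, j)) else 0)"
        unfolding const_coeff_mult[OF ij(2) n0 ij(1) ir(2)]
        by (simp only: mult_zero_left add_0_left, intro sum.cong refl) (use ij ir n0 gen_coeff_mult in auto)
      also have "\<dots> = (\<Sum>k<n. P $$ (i, k) * \<phi> (F.a $$ (k, j)))" using ij by (simp add: P_def)
      also have "\<dots> = \<phi> (amat_mult F.B (scalar_mat F.B P) F.a $$ (i, j))"
        unfolding F.B.scalar_mult_index_l[OF P F.a_amat ij]
        by (subst lin_map_finsum[OF \<phi> F.kalg_B kalg_base]) (use ij in \<open>auto simp: lin_mapD(3)[OF \<phi>]\<close>)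
      finally show "\<phi> (amat_mult F.B ?u (scalar_mat F.B P) $$ (i, j)) =
        \<phi> (amat_mult F.B (scalar_mat F.B P) F.a $$ (i, j))" .
    qed
  qed
  show ?thesis using P L LP uP by blast
qed

lemma dim_le: "n \<le> m"
  using intertwiner right_inverse_dim by blast

lemma dim_eq: "m = n"
proof -
  interpret S: bil_coiso_big F E n m g f by (rule sym_big)
  show ?thesis using dim_le S.dim_le by simp
qed

end

text \<open>The generators are linearly independent, so coefficients may be compared in the first row.\<close>
lemma (in bil_form_big) scalar_commutant:
  assumes N: "N \<in> carrier_mat m m"
    and comm: "amat_mult B (transpose_mat a) (scalar_mat B N) = amat_mult B (scalar_mat B N) (transpose_mat a)"
  shows "N = N $$ (0, 0) \<cdot>\<^sub>m 1\<^sub>m m"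
proof -
  note t = amat_transpose[OF a_amat]
  have m0: "0 < m" using m2 by simp
  have key: "N $$ (r, j) = (if r = j then N $$ (0, 0) else 0)" if rj: "r < m" "j < m" for r j
  proof -
    have \<phi>: "functional (dual_fun r 0)" by (rule dual_fun(1)[OF rj(1) m0])
    have "dual_fun r 0 (amat_mult B (transpose_mat a) (scalar_mat B N) $$ (0, j)) = (\<Sum>k<m. N $$ (k, j) * dual_fun r 0 (a $$ (k, 0)))"
      unfolding B.scalar_mult_index_r[OF N t m0 rj(2)]
      by (subst lin_map_finsum[OF \<phi> kalg_B kalg_base])
        (use rj m0 amatD[OF a_amat] in \<open>auto simp: lin_mapD(3)[OF \<phi>]\<close>)
    also have "\<dots> = (\<Sum>k<m. if k = r then N $$ (r, j) else 0)"
      by (intro sum.cong refl) (use rj m0 dual_fun(3) in auto)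
    finally have 1: "dual_fun r 0 (amat_mult B (transpose_mat a) (scalar_mat B N) $$ (0, j)) = N $$ (r, j)" using rj by simp
    have "dual_fun r 0 (amat_mult B (scalar_mat B N) (transpose_mat a) $$ (0, j)) = (\<Sum>k<m. N $$ (0, k) * dual_fun r 0 (a $$ (j, k)))"
      unfolding B.scalar_mult_index_l[OF N t m0 rj(2)]
      by (subst lin_map_finsum[OF \<phi> kalg_B kalg_base])
        (use rj m0 amatD[OF a_amat] in \<open>auto simp: lin_mapD(3)[OF \<phi>]\<close>)
    also have "\<dots> = (\<Sum>k<m. if k = 0 then (if r = j then N $$ (0, 0) else 0) else 0)"
      by (intro sum.cong refl) (use rj m0 dual_fun(3) in auto)
    finally have 2: "dual_fun r 0 (amat_mult B (scalar_mat B N) (transpose_mat a) $$ (0, j)) = (if r = j then N $$ (0, 0) else 0)"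
      using m0 by simp
    show ?thesis using 1 2 comm by simp
  qed
  show ?thesis
  proof (rule eq_matI)
    fix i j assume "i < dim_row (N $$ (0, 0) \<cdot>\<^sub>m 1\<^sub>m m)" "j < dim_col (N $$ (0, 0) \<cdot>\<^sub>m 1\<^sub>m m)"
    then show "N $$ (i, j) = (N $$ (0, 0) \<cdot>\<^sub>m 1\<^sub>m m) $$ (i, j)" by (subst key) simp_all
  qed (use N in auto)
qed

text \<open>The form \<open>E' = P^T E P\<close> is preserved by \<open>P^-1 f(a) P = b\<close>. As \<open>b\<close> also preserves \<open>F\<close>, the matrix
\<open>E' F^-1\<close> commutes with \<open>b^T\<close> and is a scalar.\<close>
lemma congruent_of_coiso:
  assumes "bil_coiso_big E F m m f g"
  shows "\<exists>M \<in> carrier_mat m m. invertible_mat M \<and> F = transpose_mat M * E * M"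
proof -
  interpret bil_coiso_big E F m m f g by fact
  obtain P L where P: "P \<in> carrier_mat m m" and L: "L \<in> carrier_mat m m" and LP: "L * P = 1\<^sub>m m"
    and uP: "amat_mult F.B (map_mat f E.a) (scalar_mat F.B P) = amat_mult F.B (scalar_mat F.B P) F.a"
    using intertwiner by blast
  have PL: "P * L = 1\<^sub>m m" by (rule mat_mult_left_right_inverse[OF L P LP])
  define E' where "E' = transpose_mat P * E * P"
  have E'c: "E' \<in> carrier_mat m m" using P E.E by (simp add: E'_def)
  have PtLt: "transpose_mat P * transpose_mat L = 1\<^sub>m m" "transpose_mat L * transpose_mat P = 1\<^sub>m m"
    unfolding transpose_mult[OF L P, symmetric] transpose_mult[OF P L, symmetric] LP PL by simp_all
  have inv: "invertible_mat E'"
  proof -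
    let ?I = "L * (minv E * transpose_mat L)"
    have I: "?I \<in> carrier_mat m m" using L minv(1)[OF E.E E.invE] by simp
    have "E' * ?I = transpose_mat P * E * (P * L) * (minv E * transpose_mat L)"
      unfolding E'_def using P L E.E minv(1)[OF E.E E.invE] by (simp add: assoc_mult_mat[of _ m m _ m _ m])
    also have "\<dots> = transpose_mat P * (E * minv E) * transpose_mat L"
      unfolding PL using P L E.E minv(1)[OF E.E E.invE] by (simp add: assoc_mult_mat[of _ m m _ m _ m])
    also have "\<dots> = 1\<^sub>m m" unfolding minv(2)[OF E.E E.invE] using P PtLt by simp
    finally have "E' * ?I = 1\<^sub>m m" .
    moreover from mat_mult_left_right_inverse[OF E'c I this] have "?I * E' = 1\<^sub>m m" .
    ultimately show ?thesis using E'c I unfolding invertible_mat_def inverts_mat_def by (intro conjI exI[of _ ?I]) auto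
  qed
  interpret C: bil_congruence E E' m P L
    by unfold_locales (use E'c inv P L PL LP in \<open>auto simp: E'_def\<close>)
  interpret D: bil_congruence E' E m L P by (rule C.sym)
  let ?S = "scalar_mat F.B" and ?mm = "amat_mult F.B" and ?u = "map_mat f E.a"
  have lP: "link F.B E E' (?S P)"
    by (rule F.B.scalar_link[OF E.E E'c inv P]) (simp_all add: C.minv_F LP PL)
  have lL: "link F.B E' E (?S L)"
    by (rule F.B.scalar_link[OF E'c E.E E.invE L]) (simp_all add: D.minv_F LP PL)
  have lu: "link F.B E E ?u" by (rule alg_hom_link[OF f E.kalg_B F.kalg_B E.E E.E E.invE E.a_link])
  have u: "amat F.B m m ?u" by (rule alg_hom_amat[OF f E.a_amat])
  have sP: "amat F.B m m (?S P)" and sL: "amat F.B m m (?S L)" using P L by (auto intro: F.B.scalar_amat)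
  have comm: "?S H $$ (i, j) \<otimes>\<^bsub>F.B\<^esub> x = x \<otimes>\<^bsub>F.B\<^esub> ?S H $$ (i, j)"
    if "H \<in> carrier_mat m m" "i < m" "j < m" "x \<in> carrier F.B" for H i j x
    using that by (simp add: F.B.scalar_index F.B.smult_mult_l F.B.smult_mult_r)
  have Lu: "link F.B E' E (?mm (?S L) ?u)"
    by (rule F.B.link_comp(1)[OF E'c inv E.E E.invE E.E E.invE lL lu]) (use comm[OF L] amatD(3)[OF u] in blast)
  have Lua: "amat F.B m m (?mm (?S L) ?u)" by (rule F.B.amat_mult_amat[OF sL u])
  have "link F.B E' E' (?mm (?mm (?S L) ?u) (?S P))"
    by (rule F.B.link_comp(1)[OF E'c inv E.E E.invE E'c inv Lu lP]) (use comm[OF P] amatD(3)[OF Lua] in metis)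
  moreover have "?mm (?mm (?S L) ?u) (?S P) = F.a"
    unfolding F.B.amat_mult_assoc[OF sL u sP] uP F.B.amat_mult_assoc[OF sL sP F.a_amat, symmetric]
      F.B.scalar_mult[OF L P] LP by (rule F.B.scalar_one_l[OF F.a_amat])
  ultimately have lb: "link F.B E' E' F.a" by simp
  \<comment> \<open>From \<open>b^T E' b = E'\<close> and \<open>b F^-1 b^T = F^-1\<close> follows \<open>b^T E' F^-1 = b^T E' b F^-1 b^T = E' F^-1 b^T\<close>.\<close>
  have q1: "?mm (transpose_mat F.a) (?mm (?S E') F.a) = ?S E'"
    using lb F.B.link_iff_quadratic[OF E'c inv F.a_amat] by simp
  have q2: "?mm F.a (?mm (?S (minv F)) (transpose_mat F.a)) = ?S (minv F)" by (rule F.a_quadratic(2))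
  note t = amat_transpose[OF F.a_amat]
  have Fi: "minv F \<in> carrier_mat m m" by (rule minv(1)[OF F.E F.invE])
  have sE': "amat F.B m m (?S E')" and sFi: "amat F.B m m (?S (minv F))"
    using E'c Fi by (auto intro: F.B.scalar_amat)
  let ?N = "E' * minv F"
  have N: "?N \<in> carrier_mat m m" using E'c Fi by simp
  have Fit: "amat F.B m m (?mm (?S (minv F)) (transpose_mat F.a))" by (rule F.B.amat_mult_amat[OF sFi t])
  have "?mm (transpose_mat F.a) (?S ?N) = ?mm (transpose_mat F.a) (?mm (?S E') (?S (minv F)))"
    unfolding F.B.scalar_mult[OF E'c Fi] ..
  also have "\<dots> = ?mm (transpose_mat F.a) (?mm (?S E') (?mm F.a (?mm (?S (minv F)) (transpose_mat F.a))))"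
    unfolding q2 ..
  also have "\<dots> = ?mm (?mm (transpose_mat F.a) (?mm (?S E') F.a)) (?mm (?S (minv F)) (transpose_mat F.a))"
    unfolding F.B.amat_mult_assoc[OF t F.B.amat_mult_amat[OF sE' F.a_amat] Fit] F.B.amat_mult_assoc[OF sE' F.a_amat Fit] ..
  also have "\<dots> = ?mm (?S ?N) (transpose_mat F.a)"
    unfolding q1 F.B.amat_mult_assoc[OF sE' sFi t, symmetric] F.B.scalar_mult[OF E'c Fi] ..
  finally have "?N = ?N $$ (0, 0) \<cdot>\<^sub>m 1\<^sub>m m" by (rule F.scalar_commutant[OF N])
  then obtain l where l: "?N = l \<cdot>\<^sub>m 1\<^sub>m m" by blast
  have "E' = ?N * F" using E'c Fi F.E minv(3)[OF F.E F.invE] by (simp add: assoc_mult_mat[of _ m m _ m _ m])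
  then have E'F: "E' = l \<cdot>\<^sub>m F" unfolding l using F.E by (simp add: mult_smult_assoc_mat[of _ m m _ m])
  have "l \<noteq> 0"
  proof
    assume "l = 0"
    then have "E' $$ (0, k) = 0" if "k < m" for k unfolding E'F using that F.E by simp
    then have "(E' * minv E') $$ (0, 0) = 0"
      using E'c minv(1)[OF E'c inv] E.m2 by (simp add: scalar_prod_def)
    then show False unfolding minv(2)[OF E'c inv] using E.m2 by simp
  qed
  obtain \<mu> where \<mu>: "\<mu> ^ 2 = inverse l" using nth_root_exists[of 2 "inverse l"] by auto
  have \<mu>0: "\<mu> \<noteq> 0" using \<mu> \<open>l \<noteq> 0\<close> by auto
  let ?M = "\<mu> \<cdot>\<^sub>m P"
  have M: "?M \<in> carrier_mat m m" using P by simp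
  have "transpose_mat ?M * E * ?M = (\<mu> * \<mu>) \<cdot>\<^sub>m E'"
  proof -
    have "transpose_mat ?M = \<mu> \<cdot>\<^sub>m transpose_mat P" by (rule eq_matI) auto
    then have "transpose_mat ?M * E * ?M = (\<mu> \<cdot>\<^sub>m (transpose_mat P * E)) * (\<mu> \<cdot>\<^sub>m P)"
      using P E.E by (simp add: mult_smult_assoc_mat[of _ m m _ m])
    also have "\<dots> = \<mu> \<cdot>\<^sub>m (\<mu> \<cdot>\<^sub>m E')" unfolding E'_def using P E.E
      by (simp add: mult_smult_distrib[of _ m m _ m] mult_smult_assoc_mat[of _ m m _ m])
    also have "\<dots> = (\<mu> * \<mu>) \<cdot>\<^sub>m E'" by (rule eq_matI) (auto simp: mult.assoc)
    finally show ?thesis .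
  qed
  also have "\<dots> = F"
    unfolding E'F using \<mu> \<open>l \<noteq> 0\<close> F.E by (auto simp: power2_eq_square intro!: eq_matI)
  finally have "F = transpose_mat ?M * E * ?M" ..
  moreover have "invertible_mat ?M"
  proof -
    let ?I = "inverse \<mu> \<cdot>\<^sub>m L"
    have "?M * ?I = 1\<^sub>m m" "?I * ?M = 1\<^sub>m m"
      using P L PL LP \<mu>0 by (auto intro!: eq_matI simp: mult_smult_distrib[of _ m m _ m] mult_smult_assoc_mat[of _ m m _ m])
    then show ?thesis using M L P unfolding invertible_mat_def inverts_mat_def by (intro conjI exI[of _ ?I]) auto
  qed
  ultimately show ?thesis using M by blast
qed

section \<open>Classification\<close>

text \<open>The definition of a Hopf isomorphism speaks of the tensor square of \<open>f\<close>; evaluating tensors of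
functionals turns this into compatibility with convolution.\<close>
lemma coiso_of_hopf_iso:
  assumes "bil_form E m" "bil_form F n" "f \<in> hopf_iso (bil_hopf E) (bil_hopf F)"
  shows "\<exists>g. bil_coiso E F m n f g"
proof -
  interpret E: bil_form E m by fact
  interpret F: bil_form F n by fact
  have fr: "f \<in> Ring.ring_hom (bil_hopf E) (bil_hopf F)" and fb: "bij_betw f (carrier E.B) (carrier F.B)"
    and fs: "\<And>c x. x \<in> carrier E.B \<Longrightarrow> f (c \<odot>\<^bsub>E.B\<^esub> x) = c \<odot>\<^bsub>F.B\<^esub> f x"
    and fc: "\<And>x. x \<in> carrier E.B \<Longrightarrow> bil_comult F (f x) = tensor_map F.B F.B f f (bil_comult E x)"
    using assms(3) by (simp_all add: hopf_iso_def ring_iso_def E.hopf_simps F.hopf_simps F.tensor_map_hopf)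
  have f: "alg_hom E.B F.B f"
    using fr fs unfolding Ring.ring_hom_def alg_hom_def lin_map_def by (auto simp: E.hopf_simps F.hopf_simps)
  define g where "g = the_inv_into (carrier E.B) f"
  have inj: "inj_on f (carrier E.B)" and im: "f ` carrier E.B = carrier F.B"
    using fb by (simp_all add: bij_betw_def)
  have gf: "g (f x) = x" if "x \<in> carrier E.B" for x unfolding g_def by (rule the_inv_into_f_f[OF inj that])
  have gc: "g y \<in> carrier E.B" if "y \<in> carrier F.B" for y
    using the_inv_into_into[OF inj, of y] that im by (simp add: g_def)
  have fg: "f (g y) = y" if "y \<in> carrier F.B" for y
    using f_the_inv_into_f[OF inj, of y] that im by (simp add: g_def)
  note fh = lin_mapD[OF alg_homD(1)[OF f]] alg_homD[OF f]
  have g: "alg_hom F.B E.B g"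
    unfolding alg_hom_def lin_map_def
  proof (intro conjI ballI allI)
    fix y y' assume y: "y \<in> carrier F.B" "y' \<in> carrier F.B"
    show "g (y \<oplus>\<^bsub>F.B\<^esub> y') = g y \<oplus>\<^bsub>E.B\<^esub> g y'"
      using gf[of "g y \<oplus>\<^bsub>E.B\<^esub> g y'"] fh(2)[OF gc[OF y(1)] gc[OF y(2)]] gc y fg by simp
    show "g (y \<otimes>\<^bsub>F.B\<^esub> y') = g y \<otimes>\<^bsub>E.B\<^esub> g y'"
      using gf[of "g y \<otimes>\<^bsub>E.B\<^esub> g y'"] alg_homD(3)[OF f gc[OF y(1)] gc[OF y(2)]] gc y fg by simp
  next
    fix c y assume y: "y \<in> carrier F.B"
    show "g (c \<odot>\<^bsub>F.B\<^esub> y) = c \<odot>\<^bsub>E.B\<^esub> g y"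
      using gf[of "c \<odot>\<^bsub>E.B\<^esub> g y"] fs[OF gc[OF y]] gc[OF y] fg[OF y] by simp
  next
    show "g \<one>\<^bsub>F.B\<^esub> = \<one>\<^bsub>E.B\<^esub>" using gf[of "\<one>\<^bsub>E.B\<^esub>"] alg_homD(2)[OF f] by simp
  qed (use gc in auto)
  have conv: "F.conv \<phi> \<psi> (f x) = E.conv (\<lambda>x. \<phi> (f x)) (\<lambda>x. \<psi> (f x)) x"
    if h: "F.functional \<phi>" "F.functional \<psi>" "x \<in> carrier E.B" for \<phi> \<psi> x
  proof -
    have e: "E.functional (\<lambda>x. \<phi> (f x))" "E.functional (\<lambda>x. \<psi> (f x))"
      using lin_map_comp[OF alg_homD(1)[OF f]] h by blast+
    note t = tensor_map_hom[OF E.BB.kalg_pair_axioms F.BB.kalg_pair_axioms f]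
    show ?thesis unfolding F.conv_def E.conv_def fc[OF h(3)]
    proof (rule E.BB.tensor_lin_eq[OF _ E.tensor_fun_lin[OF e] kalg_base])
      show "lin_map E.T base_alg (\<lambda>X. F.tensor_fun \<phi> \<psi> (tensor_map F.B F.B f f X))"
        by (rule lin_map_comp[OF alg_homD(1)[OF t(1)] F.tensor_fun_lin[OF h(1,2)]])
      show "bil_comult E x \<in> carrier E.T" by (rule alg_homD(4)[OF E.comult_hom(1) h(3)])
    qed (use h e alg_homD(4)[OF f] in \<open>simp add: t(2) F.tensor_fun_pure E.tensor_fun_pure\<close>)
  qed
  have "bil_coiso E F m n f g" by unfold_locales (use f g gf fg conv in auto)
  then show ?thesis by (intro exI[of "bil_coiso E F m n f" g])
qed

text \<open>The preimage of the character of \<open>F\<close> is a root of a nonzero polynomial, but the character is not.\<close>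
lemma size_one_of_coiso:
  fixes E F :: "'k::{alg_closed_field, field_char_0} mat"
  assumes "bil_coiso E F m n f g" "m = 1"
  shows "\<not> n \<ge> 2"
proof
  assume n: "n \<ge> 2"
  interpret bil_coiso E F m n f g by fact
  interpret Fb: bil_form_big F n by unfold_locales (rule n)
  obtain R where R: "R \<noteq> 0" "E.B.evalp R (g F.chi) = \<zero>\<^bsub>E.B\<^esub>"
    using E.quadratic_of_size_one[OF assms(2), of "g F.chi"] by auto
  have "F.B.evalp R (f (g F.chi)) = f (E.B.evalp R (g F.chi))"
    by (rule alg_hom_evalp[OF f E.kalg_B F.kalg_B, symmetric]) simp
  also have "\<dots> = \<zero>\<^bsub>F.B\<^esub>" unfolding R(2) by (rule lin_map_zero[OF alg_homD(1)[OF f] E.kalg_B F.kalg_B])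
  finally have "F.B.evalp R F.chi = \<zero>\<^bsub>F.B\<^esub>" using fg by simp
  then show False using Fb.chi_independent R(1) by blast
qed

lemma congruent_size_one:
  fixes E F :: "'k::alg_closed_field mat"
  assumes "bil_form E 1" "bil_form F 1"
  shows "\<exists>M \<in> carrier_mat 1 1. invertible_mat M \<and> F = transpose_mat M * E * M"
proof -
  interpret E: bil_form E 1 by fact
  interpret F: bil_form F 1 by fact
  have nz: "H $$ (0, 0) \<noteq> 0" if "bil_form H 1" for H :: "'k mat"
  proof
    interpret H: bil_form H 1 by fact
    assume "H $$ (0, 0) = 0"
    then have "(H * minv H) $$ (0, 0) = 0" using H.E minv(1)[OF H.E H.invE] by (simp add: scalar_prod_def)
    then show False using minv(2)[OF H.E H.invE] by simp
  qed
  obtain x where x: "x ^ 2 = F $$ (0, 0) / E $$ (0, 0)" using nth_root_exists[of 2] by auto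
  have x0: "x \<noteq> 0" using x nz[OF assms(1)] nz[OF assms(2)] by auto
  let ?M = "mat 1 1 (\<lambda>_. x)" and ?I = "mat 1 1 (\<lambda>_. inverse x)"
  have "?M * ?I = 1\<^sub>m 1" "?I * ?M = 1\<^sub>m 1" using x0 by (auto simp: scalar_prod_def intro!: eq_matI)
  then have "invertible_mat ?M" unfolding invertible_mat_def inverts_mat_def by (intro conjI exI[of _ ?I]) auto
  moreover have "F = transpose_mat ?M * E * ?M"
  proof (rule eq_matI)
    fix i j assume "i < dim_row (transpose_mat ?M * E * ?M)" "j < dim_col (transpose_mat ?M * E * ?M)"
    then have "i = 0" "j = 0" by simp_all
    moreover have "x * E $$ (0, 0) * x = F $$ (0, 0)"
      using x nz[OF assms(1)] by (simp add: power2_eq_square field_simps)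
    ultimately show "F $$ (i, j) = (transpose_mat ?M * E * ?M) $$ (i, j)"
      using E.E by (simp add: scalar_prod_def)
  qed (use F.E in auto)
  ultimately show ?thesis by (intro bexI[of _ ?M]) auto
qed

theorem theorem5p3:
  fixes E F :: "'k::{alg_closed_field, field_char_0} mat"
    and m n :: nat
  assumes "m \<ge> 1" and "n \<ge> 1"
    and "E \<in> carrier_mat m m" and "invertible_mat E"
    and "F \<in> carrier_mat n n" and "invertible_mat F"
  shows "hopf_isomorphic (bil_hopf E) (bil_hopf F) \<longleftrightarrow>
    m = n \<and> (\<exists>M \<in> carrier_mat m m. invertible_mat M \<and> F = transpose_mat M * E * M)"
proof
  have E: "bil_form E m" and F: "bil_form F n" using assms by (auto intro: bil_form.intro)
  assume "hopf_isomorphic (bil_hopf E) (bil_hopf F)"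
  then obtain f where "f \<in> hopf_iso (bil_hopf E) (bil_hopf F)" by (auto simp: hopf_isomorphic_def)
  note ex = coiso_of_hopf_iso[OF E F this]
  obtain g where fg: "bil_coiso E F m n f g" using ex by (elim exE)
  note gf = bil_coiso.sym[OF fg]
  consider "m = 1" "n = 1" | "m \<ge> 2" "n \<ge> 2"
    using size_one_of_coiso[OF fg] size_one_of_coiso[OF gf] assms(1,2) by force
  then show "m = n \<and> (\<exists>M \<in> carrier_mat m m. invertible_mat M \<and> F = transpose_mat M * E * M)"
  proof cases
    case 1
    then show ?thesis using congruent_size_one[of E F] E F by simp
  next
    case 2
    then have big: "bil_coiso_big E F m n f g"
      using fg E F by (intro bil_coiso_big.intro bil_form_big.intro bil_form_big_axioms.intro)
    then have "m = n" by (rule bil_coiso_big.dim_eq)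
    then show ?thesis using congruent_of_coiso big by blast
  qed
next
  assume mn: "m = n \<and> (\<exists>M \<in> carrier_mat m m. invertible_mat M \<and> F = transpose_mat M * E * M)"
  then obtain M where M: "M \<in> carrier_mat m m" "invertible_mat M" "F = transpose_mat M * E * M" by blast
  have "bil_congruence E F m M (minv M)"
    using assms mn M minv[OF M(1,2)]
    by (intro bil_congruence.intro bil_form.intro bil_congruence_axioms.intro) auto
  then show "hopf_isomorphic (bil_hopf E) (bil_hopf F)" by (rule bil_congruence.hopf_isomorphic)
qed

end
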